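(* Let $\xi=\epsilon\delta_0+\sum_{j\ge1}(\delta_{a_j}+\delta_{-a_j})$ with $\epsilon\in\{0,1\}$, $0<a_1<a_2<\cdots$, and $a_j\sim(j/c)^{1/q}$ as $j\to\infty$ for some $c>0$ and $q\in(0,2)$. Let $\Xi_\xi$ be the determinantal process on $(0,\infty)$ with extended kernel $\mathfrak K_\xi$, and let $\mathfrak A_\xi$ be the analytic part of the kernel (see context). For all sufficiently large $T$ set $$n_T=\max\{n\ge1:a_n^2\le Tn\},\quad \sigma_T=\sqrt{T/n_T},\quad T_\tau=T+\sigma_T^2\tau,\quad u_q=\Bigl(\frac{q\pi}{\sin(\pi q/2)}\Bigr)^{1/(2-q)},\quad \rho_q=\frac{u_q}\pi .$$ Then, as $T\to\infty$, $$\sigma_T\,\mathfrak A_\xi\bigl((T_s,\sigma_TX),(T_t,\sigma_TY)\bigr)\longrightarrow\frac1{2\pi}\int_{-u_q}^{u_q}e^{k^2(t-s)/2+ik(Y-X)}\,dk$$ locally uniformly in $(s,t,X,Y)\in\mathbb R^4$. Consequently $$\sigma_T\,\mathfrak K_\xi\bigl((T_s,\sigma_TX),(T_t,\sigma_TY)\bigr)-\mathfrak K_{\mathsf{Sine},\rho_q}\bigl((s,X),(t,Y)\bigr)\longrightarrow0$$ locally uniformly in all four variables. The rescaled processes $\tau\mapsto(x\mapsto x/\sigma_T)_\#\,\Xi_\xi(T_\tau)$ converge in finite-dimensional distributions, for the vague topology on locally finite point measures, to the extended sine process of density $\rho_q$.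
   Context: A process of point configurations on $\mathbb R$ is determinantal with extended kernel $\mathfrak K$ if for every finite set of times $\{t_1,\dots,t_m\}$ the point process $\sum_j\delta_{t_j}\otimes\Xi(t_j)$ has correlation functions $\det[\mathfrak K((s_i,x_i),(s_j,x_j))]$ with respect to counting measure times Lebesgue measure. $F_\#$ denotes pushforward. **Kernel.** $\mathfrak E_\xi(z)=z^\epsilon\prod_{j\ge1}(1-z^2/a_j^2)$. $\Gamma=\{x\pm ix/\sqrt3:|x|\ge\sqrt3\}\cup\{x\pm i:|x|\le\sqrt3\}$, the component in the upper half-plane oriented from right to left, the one in the lower half-plane from left to right; $i\mathbb R$ is oriented upward; $\mathfrak h_s(x,z)=(2\pi s)^{-1/2}e^{-(x-z)^2/(2s)}$. For $S,U>0$ and $x,y\in\mathbb R$, $$\mathfrak A_\xi((S,x),(U,y))=\frac1{(2\pi i)^2\sqrt{SU}}\int_\Gamma dz\int_{i\mathbb R}dw\,\frac1{w-z}\exp\Bigl\{\frac{(w-y)^2}{2U}-\frac{(z-x)^2}{2S}\Bigr\}\frac{\mathfrak E_\xi(w)}{\mathfrak E_\xi(z)}+\int_{-1}^1\mathfrak h_S(x,iu)\,\mathfrak h_U(-iy,u)\,du$$ (the double integral is a joint two-dimensional integral; the singularity at $w=z$ is integrable), and $\mathfrak K_\xi((S,x),(U,y))=\mathfrak A_\xi((S,x),(U,y))-\mathbf 1_{\{S>U\}}\mathfrak h_{S-U}(x,y)$. (This is the extended kernel of a determinantal process $\Xi_\xi$ on $(0,\infty)$, the limit of finite $\beta=2$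 Dyson Brownian motions started from the truncations $\xi|_{[-N,N]}$.) **Extended sine process of density $\rho$:** the determinantal process with extended kernel $\mathfrak K_{\mathsf{Sine},\rho}((s,x),(t,y))=\frac1{2\pi}\int_{-\pi\rho}^{\pi\rho}e^{u^2(t-s)/2+iu(y-x)}du-\mathbf 1_{\{s>t\}}\mathfrak h_{s-t}(x,y)$. *)

theory Defs
  imports
    "HOL-Probability.Probability"
    "HOL-Complex_Analysis.Complex_Analysis"
    "HOL-Library.Landau_Symbols"
    "Jordan_Normal_Form.Determinant"
begin

section \<open>Point configurations and point processes\<close>

text \<open>Locally finite point measures on the real line: Borel measures taking a finite integer value
  on every bounded Borel set. Multiplicities are allowed. In \<^typ>\<open>ennreal\<close> the set \<open>\<nat>\<close> does not
  contain \<open>\<infinity>\<close>.\<close>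

definition point_measures :: "real measure set" where
  "point_measures =
     {\<mu>. sets \<mu> = sets borel \<and> (\<forall>B\<in>sets borel. bounded B \<longrightarrow> emeasure \<mu> B \<in> \<nat>)}"

text \<open>The coarsest topology on \<^const>\<open>point_measures\<close> making \<open>\<mu> \<mapsto> \<integral>f d\<mu>\<close> continuous for every
  continuous \<open>f\<close> with compact support.\<close>

definition vague_topology :: "real measure topology" where
  "vague_topology = topology_generated_by
     {{\<mu> \<in> point_measures. (\<integral>x. f x \<partial>\<mu>) \<in> U} | (f :: real \<Rightarrow> real) U.
        continuous_on UNIV f \<and> compact (closure {x. f x \<noteq> 0}) \<and> open U}"

lemma topspace_vague_topology: "topspace vague_topology = point_measures"
proof -
  let ?S = "{{\<mu> \<in> point_measures. (\<integral>x. f x \<partial>\<mu>) \<in> U} | (f :: real \<Rightarrow> real) U.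
        continuous_on UNIV f \<and> compact (closure {x. f x \<noteq> 0}) \<and> open U}"
  have "point_measures \<in> ?S"
    by (rule CollectI, rule exI[of _ "\<lambda>_. 0"], rule exI[of _ UNIV]) auto
  then have "\<Union>?S = point_measures"
    by auto
  then show ?thesis
    by (simp add: vague_topology_def topology_generated_by_topspace)
qed

text \<open>A family of random point configurations indexed by \<open>J\<close>; the \<open>\<sigma>\<close>-algebra on
  \<^const>\<open>point_measures\<close> is the one generated by the evaluations \<open>\<mu> \<mapsto> \<mu>(B)\<close>.\<close>

definition configuration_process :: "'w measure \<Rightarrow> 't set \<Rightarrow> ('t \<Rightarrow> 'w \<Rightarrow> real measure) \<Rightarrow> bool" where
  "configuration_process M J \<Xi> \<longleftrightarrow>
     prob_space M \<and>
     (\<forall>t\<in>J. (\<forall>\<omega>\<in>space M. \<Xi> t \<omega> \<in> point_measures) \<and>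
             (\<forall>B\<in>sets borel. (\<lambda>\<omega>. emeasure (\<Xi> t \<omega>) B) \<in> borel_measurable M))"

text \<open>For a point measure \<open>N = \<Sum>\<^sub>k \<delta>\<^bsub>x\<^sub>k\<^esub>\<close> this is the sum of \<open>f (x\<^bsub>k\<^sub>0\<^esub>, \<dots>, x\<^bsub>k\<^sub>n\<^sub>-\<^sub>1\<^esub>)\<close> over pairwise
  distinct indices. A tuple of locations \<open>p\<close> is realised by
  \<open>\<Prod>\<^sub>i (N{p\<^sub>i} - #{j < i. p\<^sub>j = p\<^sub>i})\<close> such tuples of indices.\<close>

definition factorial_sum :: "'s measure \<Rightarrow> nat \<Rightarrow> ((nat \<Rightarrow> 's) \<Rightarrow> ennreal) \<Rightarrow> ennreal" where
  "factorial_sum N n f =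
     (\<integral>\<^sup>+ p. f p * (\<Prod>i<n. emeasure N {p i} - of_nat (card {j. j < i \<and> p j = p i}))
        \<partial>count_space (PiE {..<n} (\<lambda>_. space N)))"

text \<open>\<open>\<rho>\<close> is the \<open>n\<close>-point correlation function, with respect to the reference measure \<open>L\<close>, of the
  point process \<open>N\<close>. Correlation functions are determined only almost everywhere, and \<open>\<rho>\<close> is
  complex-valued here because the kernels below are.\<close>

definition has_correlation_function ::
  "'w measure \<Rightarrow> ('w \<Rightarrow> 's measure) \<Rightarrow> 's measure \<Rightarrow> nat \<Rightarrow> ((nat \<Rightarrow> 's) \<Rightarrow> complex) \<Rightarrow> bool" where
  "has_correlation_function M N L n \<rho> \<longleftrightarrow>
     \<rho> \<in> borel_measurable (Pi\<^sub>M {..<n} (\<lambda>_. L)) \<and>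
     (AE p in Pi\<^sub>M {..<n} (\<lambda>_. L). \<rho> p \<in> \<real>\<^sub>\<ge>\<^sub>0) \<and>
     (\<forall>f\<in>borel_measurable (Pi\<^sub>M {..<n} (\<lambda>_. L)).
        (\<integral>\<^sup>+ \<omega>. factorial_sum (N \<omega>) n f \<partial>M) =
        (\<integral>\<^sup>+ p. f p * ennreal (Re (\<rho> p)) \<partial>Pi\<^sub>M {..<n} (\<lambda>_. L)))"

text \<open>\<open>\<Sum>\<^bsub>t \<in> I\<^esub> \<delta>\<^sub>t \<otimes> \<Xi>(t)\<close> as a measure on \<open>I \<times> \<real>\<close>, for finite \<open>I\<close>.\<close>

definition space_time_configuration ::
  "real set \<Rightarrow> (real \<Rightarrow> 'w \<Rightarrow> real measure) \<Rightarrow> 'w \<Rightarrow> (real \<times> real) measure" where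
  "space_time_configuration I \<Xi> \<omega> =
     measure_of (I \<times> UNIV) (sets (count_space I \<Otimes>\<^sub>M borel))
       (\<lambda>B. \<Sum>t\<in>I. emeasure (return (count_space I) t \<Otimes>\<^sub>M \<Xi> t \<omega>) B)"

definition determinantal_process ::
  "'w measure \<Rightarrow> real set \<Rightarrow> (real \<Rightarrow> 'w \<Rightarrow> real measure) \<Rightarrow>
     (real \<times> real \<Rightarrow> real \<times> real \<Rightarrow> complex) \<Rightarrow> bool" where
  "determinantal_process M J \<Xi> K \<longleftrightarrow>
     configuration_process M J \<Xi> \<and>
     (\<forall>I n. finite I \<and> I \<subseteq> J \<longrightarrow>
        has_correlation_function M (space_time_configuration I \<Xi>) (count_space I \<Otimes>\<^sub>M lborel) n
          (\<lambda>p. Determinant.det (Matrix.mat n n (\<lambda>(i, j). K (p i) (p j)))))"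

text \<open>Convergence in finite-dimensional distributions along the filter \<open>\<F>\<close>: joint convergence in
  law at every finite set of times, tested against the bounded functions that are continuous for
  the product of the vague topologies.\<close>

definition fdd_converges ::
  "'i filter \<Rightarrow> 'w measure \<Rightarrow> ('i \<Rightarrow> 't \<Rightarrow> 'w \<Rightarrow> real measure) \<Rightarrow>
     'v measure \<Rightarrow> ('t \<Rightarrow> 'v \<Rightarrow> real measure) \<Rightarrow> bool" where
  "fdd_converges \<F> M X M' Z \<longleftrightarrow>
     (\<forall>I (F :: ('t \<Rightarrow> real measure) \<Rightarrow> real).
        finite I \<and>
        continuous_map (product_topology (\<lambda>_. vague_topology) I) euclideanreal F \<and>
        bounded (F ` topspace (product_topology (\<lambda>_. vague_topology) I)) \<longrightarrow>
        ((\<lambda>i. \<integral>\<omega>. F (\<lambda>t\<in>I. X i t \<omega>) \<partial>M) \<longlongrightarrow> (\<integral>\<omega>. F (\<lambda>t\<in>I. Z t \<omega>) \<partial>M')) \<F>)"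


section \<open>The kernels\<close>

text \<open>The initial configuration \<open>\<xi> = \<epsilon> \<delta>\<^sub>0 + \<Sum>\<^bsub>j\<ge>1\<^esub> (\<delta>\<^bsub>a j\<^esub> + \<delta>\<^bsub>- a j\<^esub>)\<close> enters only through \<open>\<epsilon>\<close> and
  the sequence \<open>a\<close>, whose value at index \<open>0\<close> is never used.\<close>

definition canonical_product :: "nat \<Rightarrow> (nat \<Rightarrow> real) \<Rightarrow> complex \<Rightarrow> complex" where
  "canonical_product \<epsilon> a z =
     z ^ \<epsilon> * prodinf (\<lambda>j. 1 - z\<^sup>2 / (complex_of_real (a (Suc j)))\<^sup>2)"

definition heat_kernel :: "real \<Rightarrow> complex \<Rightarrow> complex \<Rightarrow> complex" where
  "heat_kernel s x z =
     complex_of_real (1 / sqrt (2 * pi * s)) * exp (- (x - z)\<^sup>2 / complex_of_real (2 * s))"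

text \<open>The two components of the contour \<open>\<Gamma>\<close>, parametrised by the real line according to their
  orientation.\<close>

definition contour_upper :: "real \<Rightarrow> complex" where
  "contour_upper r = Complex (- r) (max 1 (\<bar>r\<bar> / sqrt 3))"

definition contour_lower :: "real \<Rightarrow> complex" where
  "contour_lower r = Complex r (- max 1 (\<bar>r\<bar> / sqrt 3))"

lemma range_contour:
  "range contour_upper \<union> range contour_lower =
     {z. \<exists>x. \<bar>x\<bar> \<ge> sqrt 3 \<and> (z = of_real x + \<i> * of_real x / of_real (sqrt 3) \<or>
                              z = of_real x - \<i> * of_real x / of_real (sqrt 3))} \<union>
     {z. \<exists>x. \<bar>x\<bar> \<le> sqrt 3 \<and> (z = of_real x + \<i> \<or> z = of_real x - \<i>)}"
  (is "?L = ?R")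
proof (intro equalityI subsetI)
  fix z assume "z \<in> ?L"
  then obtain r where r: "z = contour_upper r \<or> z = contour_lower r" by blast
  define x where "x = Re z"
  have x: "\<bar>x\<bar> = \<bar>r\<bar>" and im: "\<bar>Im z\<bar> = max 1 (\<bar>x\<bar> / sqrt 3)"
    using r by (auto simp: x_def contour_upper_def contour_lower_def)
  show "z \<in> ?R"
  proof (cases "\<bar>x\<bar> \<ge> sqrt 3")
    case True
    then have "\<bar>Im z\<bar> = \<bar>x / sqrt 3\<bar>" using im by (simp add: max_def field_simps)
    then have "Im z = x / sqrt 3 \<or> Im z = - (x / sqrt 3)" by (simp only: abs_eq_iff)
    then have "z = of_real x + \<i> * of_real x / of_real (sqrt 3) \<or>
               z = of_real x - \<i> * of_real x / of_real (sqrt 3)"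
      by (auto simp: complex_eq_iff x_def Re_divide_of_real Im_divide_of_real)
    with True show ?thesis by blast
  next
    case False
    then have "\<bar>Im z\<bar> = 1" using im by (simp add: max_def field_simps)
    then have "z = of_real x + \<i> \<or> z = of_real x - \<i>"
      by (auto simp: complex_eq_iff x_def)
    moreover have "\<bar>x\<bar> \<le> sqrt 3" using False by simp
    ultimately show ?thesis by blast
  qed
next
  fix z assume "z \<in> ?R"
  then have "\<bar>Re z\<bar> \<ge> sqrt 3 \<and> \<bar>Im z\<bar> = \<bar>Re z\<bar> / sqrt 3 \<or> \<bar>Re z\<bar> \<le> sqrt 3 \<and> \<bar>Im z\<bar> = 1"
    by (auto simp: Re_divide_of_real Im_divide_of_real)
  then have "\<bar>Im z\<bar> = max 1 (\<bar>Re z\<bar> / sqrt 3)"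
    by (auto simp: max_def le_divide_eq divide_le_eq)
  then have "z = contour_upper (- Re z) \<or> z = contour_lower (Re z)"
    by (auto simp: complex_eq_iff contour_upper_def contour_lower_def abs_if split: if_splits)
  then show "z \<in> ?L" by blast
qed

text \<open>The joint integral of \<open>g z w\<close> over \<open>z\<close> in the curve \<open>\<gamma>\<close> and \<open>w\<close> in the imaginary axis, the
  latter oriented upward and parametrised by \<open>v \<mapsto> iv\<close>, whence the last factor \<open>\<i>\<close>.\<close>

definition double_contour_integral ::
  "(real \<Rightarrow> complex) \<Rightarrow> (complex \<Rightarrow> complex \<Rightarrow> complex) \<Rightarrow> complex" where
  "double_contour_integral \<gamma> g =
     (\<integral>(r, v). g (\<gamma> r) (\<i> * complex_of_real v) * vector_derivative \<gamma> (at r) * \<i>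
        \<partial>(lborel \<Otimes>\<^sub>M lborel))"

definition analytic_kernel ::
  "nat \<Rightarrow> (nat \<Rightarrow> real) \<Rightarrow> real \<times> real \<Rightarrow> real \<times> real \<Rightarrow> complex" where
  "analytic_kernel \<epsilon> a = (\<lambda>(S, x) (U, y).
     (let g = (\<lambda>z w. 1 / (w - z) *
                exp ((w - complex_of_real y)\<^sup>2 / complex_of_real (2 * U)
                     - (z - complex_of_real x)\<^sup>2 / complex_of_real (2 * S)) *
                (canonical_product \<epsilon> a w / canonical_product \<epsilon> a z))
      in 1 / ((2 * complex_of_real pi * \<i>)\<^sup>2 * complex_of_real (sqrt (S * U))) *
           (double_contour_integral contour_upper g + double_contour_integral contour_lower g))
     + (\<integral>u\<in>{-1..1}. heat_kernel S (complex_of_real x) (\<i> * complex_of_real u) *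
                     heat_kernel U (- \<i> * complex_of_real y) (complex_of_real u) \<partial>lborel))"

definition xi_kernel ::
  "nat \<Rightarrow> (nat \<Rightarrow> real) \<Rightarrow> real \<times> real \<Rightarrow> real \<times> real \<Rightarrow> complex" where
  "xi_kernel \<epsilon> a = (\<lambda>(S, x) (U, y).
     analytic_kernel \<epsilon> a (S, x) (U, y) -
     (if S > U then heat_kernel (S - U) (complex_of_real x) (complex_of_real y) else 0))"

definition sine_kernel :: "real \<Rightarrow> real \<times> real \<Rightarrow> real \<times> real \<Rightarrow> complex" where
  "sine_kernel \<rho> = (\<lambda>(s, x) (t, y).
     1 / (2 * complex_of_real pi) *
       (\<integral>u\<in>{- (pi * \<rho>)..pi * \<rho>}.
          exp (complex_of_real (u\<^sup>2 * (t - s) / 2) + \<i> * complex_of_real (u * (y - x))) \<partial>lborel) -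
     (if s > t then heat_kernel (s - t) (complex_of_real x) (complex_of_real y) else 0))"


section \<open>Scaling\<close>

text \<open>\<^const>\<open>Max\<close> is meaningful only for a finite non-empty set; for the sequences considered here
  the set is finite for every \<open>T\<close> and non-empty for all large \<open>T\<close>. Likewise \<open>scaled_time a T \<tau>\<close> is
  positive for all large \<open>T\<close>.\<close>

definition scale_index :: "(nat \<Rightarrow> real) \<Rightarrow> real \<Rightarrow> nat" where
  "scale_index a T = Max {n. 1 \<le> n \<and> (a n)\<^sup>2 \<le> T * real n}"

definition space_scale :: "(nat \<Rightarrow> real) \<Rightarrow> real \<Rightarrow> real" where
  "space_scale a T = sqrt (T / real (scale_index a T))"

definition scaled_time :: "(nat \<Rightarrow> real) \<Rightarrow> real \<Rightarrow> real \<Rightarrow> real" where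
  "scaled_time a T \<tau> = T + (space_scale a T)\<^sup>2 * \<tau>"

definition edge :: "real \<Rightarrow> real" where
  "edge q = (q * pi / sin (pi * q / 2)) powr (1 / (2 - q))"

definition sine_density :: "real \<Rightarrow> real" where
  "sine_density q = edge q / pi"

end

theory Submission
  imports Defs "HOL-Real_Asymp.Real_Asymp"
begin

text \<open>The analytic part is a saddle point argument. Write \<open>E\<close> for the canonical
  product and \<open>w = i v\<close>. Apart from the factor \<open>z^\<epsilon>\<close>, the
  exponent at equal times \<open>T\<close> is
  \<open>- v^2 / (2 T) + \<Sum>j. ln (1 + v^2 / a_j^2)\<close>, whose non-zero critical points are
  \<open>v = V\<close> and \<open>v = - V\<close> with
  \<open>(\<Sum>j. 1 / (a_j^2 + V^2)) = 1 / (2 T)\<close>. Put \<open>n = n_T\<close> and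
  \<open>L = \<sigma>_T n = sqrt (T n)\<close>, so that \<open>a_n \<le> L < a_(n+1)\<close>. With
  \<open>V = L l\<close> the equation becomes
  \<open>(1 / n) (\<Sum>j. 1 / ((a_j / L)^2 + l^2)) = 1 / 2\<close>. Since the zeros of index about
  \<open>n u\<close> are close to \<open>L u^(1/q)\<close>, the left side tends to the integral of
  \<open>1 / (u^(2/q) + l^2)\<close> over \<open>u > 0\<close>. This is a Beta integral with value
  \<open>l^(q-2) (q/2) \<pi> / sin (\<pi> q / 2)\<close>, and the limiting equation has the single
  root \<open>l = u_q\<close> (\<open>saddle_integral\<close>, \<open>Riemann_sum_limit\<close>,
  \<open>saddle_point_exists\<close>).

  The flat parts of the contour are moved from height 1 to height \<open>V\<close>. The poles
  \<open>z = w\<close> crossed on the way leave residues in which the ratio of canonical products is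
  1, and what remains is exactly the integrand of the single integral. Thus the integral over
  \<open>[-1, 1]\<close> becomes one over \<open>[-V, V]\<close>
  (\<open>analytic_kernel_deformed\<close>). In scaled variables it is an explicit integral,
  continuous in \<open>1/n\<close> and \<open>l\<close>, whose value at \<open>1/n = 0\<close> and
  \<open>l = u_q\<close> is the sine integral (\<open>segment_integral_scaled\<close>,
  \<open>segment_integral_near_edge\<close>).

  The double integral over the moved contour is negligible. Each factor of
  \<open>E (i v) / E z\<close> is at most an exponential of
  \<open>(v^2 - V^2 + M) / (a_j^2 + V^2)\<close>, where \<open>M = V^2 + Re (z^2)\<close>, times a
  weight at most 1. By the saddle equation these exponentials multiply up to one that cancels the
  Gaussian factors up to bounded corrections. The \<open>n\<close> zeros below \<open>L\<close> have
  weights below a common value, whose \<open>n\<close>-th power confines \<open>v\<close> to a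
  distance of order \<open>L / sqrt n\<close> from \<open>V\<close> or \<open>-V\<close> and
  \<open>z\<close> to distances of order \<open>L\<close>. The slope \<open>1 / sqrt 3\<close> of
  the rays is what makes the bound hold along the whole contour. The kernel
  \<open>1 / |w - z|\<close> is dominated by a product of inverse square roots, so the double
  integral is \<open>O (L n^(-1/4))\<close> and its share of the rescaled kernel is
  \<open>O (n^(-1/4))\<close> (\<open>ratio_bound_saddle\<close>,
  \<open>contour_double_scaled_bound\<close>, \<open>remainder_bound\<close>). The heat kernel term
  is invariant under Brownian scaling, so the full kernel converges as well.

  For the processes, the joint law of the numbers of points in finitely many cells is recovered from
  factorial moments, which are integrals of determinants of the kernel. By Hadamard's inequality a
  moment of order \<open>N\<close> is at most \<open>(D sqrt N)^N\<close>, so the error of the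
  Bonferroni inequalities tends to 0 uniformly. Pointwise convergence and local boundedness of the
  kernels therefore give convergence of the probabilities of all counts
  (\<open>determinantal_counts_converge\<close>). A function continuous for the vague topology is
  bounded above, with vanishing error, by functions of the counts in dyadic cells of a growing
  window, and Scheffe's argument passes from point probabilities of counts to expectations
  (\<open>expectation_upper_limit\<close>, \<open>fdd_converges_of_counts\<close>).\<close>

section \<open>Gram determinants and Hadamard's inequality\<close>

definition gram :: "nat \<Rightarrow> nat \<Rightarrow> (nat \<Rightarrow> nat \<Rightarrow> complex) \<Rightarrow> complex mat" where
  "gram d k v = Matrix.mat k k (\<lambda>(i, j). \<Sum>l<d. v i l * cnj (v j l))"

text \<open>Pythagoras: \<open>c * u\<close> is the orthogonal projection of \<open>x\<close> on
  \<open>u\<close>, and the squared length drops by that of the projection.\<close>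

lemma sum_norm_square_minus_projection:
  fixes d :: nat and x u :: "nat \<Rightarrow> complex"
  defines "g \<equiv> complex_of_real (\<Sum>l<d. (cmod (u l))\<^sup>2)"
  defines "c \<equiv> (\<Sum>l<d. x l * cnj (u l)) / g"
  assumes g0: "g \<noteq> 0"
  shows "(\<Sum>l<d. (cmod (x l - c * u l))\<^sup>2) \<le> (\<Sum>l<d. (cmod (x l))\<^sup>2)"
proof -
  have g: "g = (\<Sum>l<d. u l * cnj (u l))"
    by (simp add: g_def complex_norm_square[symmetric])
  have c: "(\<Sum>l<d. x l * cnj (u l)) = c * g" using g0 by (simp add: c_def)
  have c': "(\<Sum>l<d. u l * cnj (x l)) = cnj c * g"
  proof -
    have "cnj (\<Sum>l<d. x l * cnj (u l)) = cnj (c * g)" by (simp only: c)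
    moreover have "cnj g = g" by (simp add: g_def)
    ultimately show ?thesis by (simp add: mult.commute)
  qed
  have "complex_of_real (\<Sum>l<d. (cmod (x l - c * u l))\<^sup>2)
      = (\<Sum>l<d. (x l - c * u l) * cnj (x l - c * u l))"
    by (simp only: of_real_sum complex_norm_square)
  also have "\<dots> = (\<Sum>l<d. x l * cnj (x l)) - cnj c * (\<Sum>l<d. x l * cnj (u l))
      - c * (\<Sum>l<d. u l * cnj (x l)) + c * cnj c * (\<Sum>l<d. u l * cnj (u l))"
    by (simp add: algebra_simps sum.distrib sum_subtractf sum_distrib_left)
  also have "\<dots> = (\<Sum>l<d. x l * cnj (x l)) - c * cnj c * g"
    unfolding c c' g[symmetric] by (simp add: algebra_simps)
  also have "\<dots> = complex_of_real ((\<Sum>l<d. (cmod (x l))\<^sup>2) - (cmod c)\<^sup>2 * (\<Sum>l<d. (cmod (u l))\<^sup>2))"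
    by (simp only: g_def of_real_diff of_real_mult of_real_sum complex_norm_square)
  finally have "(\<Sum>l<d. (cmod (x l - c * u l))\<^sup>2) = (\<Sum>l<d. (cmod (x l))\<^sup>2) - (cmod c)\<^sup>2 * (\<Sum>l<d. (cmod (u l))\<^sup>2)"
    by (simp only: of_real_eq_iff)
  then show ?thesis by (simp add: sum_nonneg)
qed

text \<open>The Schur complement of the first diagonal entry of a Gram matrix is the Gram matrix of the
  vectors projected orthogonally to the first one.\<close>

lemma det_gram_Suc:
  fixes d k :: nat and v :: "nat \<Rightarrow> nat \<Rightarrow> complex"
  defines "g \<equiv> complex_of_real (\<Sum>l<d. (cmod (v 0 l))\<^sup>2)"
  assumes g0: "g \<noteq> 0"
  shows "Determinant.det (gram d (Suc k) v) =
    g * Determinant.det (gram d k (\<lambda>i l. v (Suc i) l - (\<Sum>l<d. v (Suc i) l * cnj (v 0 l)) / g * v 0 l))"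
proof -
  define c where "c i = (\<Sum>l<d. v (Suc i) l * cnj (v 0 l)) / g" for i
  define S where "S = gram d k (\<lambda>i l. v (Suc i) l - c i * v 0 l)"
  have g: "g = (\<Sum>l<d. v 0 l * cnj (v 0 l))"
    by (simp add: g_def complex_norm_square[symmetric])
  have cg: "(\<Sum>l<d. v (Suc i) l * cnj (v 0 l)) = c i * g" for i using g0 by (simp add: c_def)
  have cg': "(\<Sum>l<d. v 0 l * cnj (v (Suc i) l)) = cnj (c i) * g" for i
  proof -
    have "cnj (\<Sum>l<d. v (Suc i) l * cnj (v 0 l)) = cnj (c i * g)" by (simp only: cg)
    moreover have "cnj g = g" by (simp add: g_def)
    ultimately show ?thesis by (simp add: mult.commute)
  qed
  define G where "G = Matrix.mat 1 1 (\<lambda>_. g)"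
  define C where "C = Matrix.mat k 1 (\<lambda>(i, _). c i)"
  define R where "R = Matrix.mat 1 k (\<lambda>(_, j). cnj (c j) * g)"
  have dims: "G \<in> carrier_mat 1 1" "C \<in> carrier_mat k 1" "R \<in> carrier_mat 1 k" "S \<in> carrier_mat k k"
    by (auto simp: G_def C_def R_def S_def gram_def)
  have Sij: "(\<Sum>l<d. (v (Suc i) l - c i * v 0 l) * cnj (v (Suc j) l - c j * v 0 l))
     = (\<Sum>l<d. v (Suc i) l * cnj (v (Suc j) l)) - c i * cnj (c j) * g" for i j
  proof -
    have "(\<Sum>l<d. (v (Suc i) l - c i * v 0 l) * cnj (v (Suc j) l - c j * v 0 l)) =
       (\<Sum>l<d. v (Suc i) l * cnj (v (Suc j) l)) - cnj (c j) * (\<Sum>l<d. v (Suc i) l * cnj (v 0 l))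
       - c i * (\<Sum>l<d. v 0 l * cnj (v (Suc j) l)) + c i * cnj (c j) * (\<Sum>l<d. v 0 l * cnj (v 0 l))"
      by (simp add: algebra_simps sum.distrib sum_subtractf sum_distrib_left)
    then show ?thesis unfolding cg cg' g[symmetric] by (simp add: algebra_simps)
  qed
  \<comment> \<open>Block LU decomposition: a unit lower triangular factor times a block upper
    triangular one, with diagonal blocks \<open>g\<close> and the Schur complement
    \<open>S\<close>.\<close>
  have "gram d (Suc k) v = four_block_mat G R (C * G) (C * R + S)"
  proof (rule eq_matI)
    fix i j assume "i < dim_row (four_block_mat G R (C * G) (C * R + S))"
      "j < dim_col (four_block_mat G R (C * G) (C * R + S))"
    then have "i < Suc k" "j < Suc k" using dims by auto
    then show "gram d (Suc k) v $$ (i, j) = four_block_mat G R (C * G) (C * R + S) $$ (i, j)"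
      using cg cg' g Sij dims
      by (cases i; cases j)
        (auto simp: gram_def four_block_mat_def G_def C_def R_def S_def scalar_prod_def Let_def)
  qed (use dims in \<open>auto simp: gram_def\<close>)
  also have "\<dots> = four_block_mat (1\<^sub>m 1) (0\<^sub>m 1 k) C (1\<^sub>m k) * four_block_mat G R (0\<^sub>m k 1) S"
    using dims by (subst mult_four_block_mat[of _ 1 1 _ k _ k _ _ 1 _ k]) auto
  also have "Determinant.det \<dots> = Determinant.det (four_block_mat (1\<^sub>m 1) (0\<^sub>m 1 k) C (1\<^sub>m k)) *
      Determinant.det (four_block_mat G R (0\<^sub>m k 1) S)"
    by (rule det_mult[of _ "1 + k"]) (use dims in auto)
  also have "\<dots> = Determinant.det G * Determinant.det S"
    using dims by (simp add: det_four_block_mat_upper_right_zero[of _ 1 _ k]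
        det_four_block_mat_lower_left_zero[of _ 1 _ k])
  also have "Determinant.det G = g" by (simp add: G_def det_single)
  finally show ?thesis by (simp add: S_def c_def)
qed

text \<open>Gram-Schmidt by induction: the first vector contributes its squared length, and the
  others are replaced by projections, which are no longer than the originals. A vanishing first
  vector gives a zero row.\<close>

lemma det_gram_le:
  "\<exists>r. Determinant.det (gram d k v) = complex_of_real r \<and> 0 \<le> r \<and> r \<le> (\<Prod>i<k. \<Sum>l<d. (cmod (v i l))\<^sup>2)"
proof (induction k arbitrary: v)
  case 0
  show ?case by (intro exI[of _ 1]) (simp add: gram_def det_def)
next
  case (Suc k)
  define g where "g = (\<Sum>l<d. (cmod (v 0 l))\<^sup>2)"
  show ?case
  proof (cases "g = 0")
    case True
    then have "\<forall>l<d. v 0 l = 0" by (simp add: g_def sum_nonneg_eq_0_iff)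
    then have "Determinant.det (gram d (Suc k) v) = 0"
      by (subst det_def'[of _ "Suc k"]) (auto simp: gram_def intro!: sum.neutral prod_zero bexI[of _ "0::nat"] simp del: prod.op_ivl_Suc)
    then show ?thesis
      by (intro exI[of _ 0]) (auto intro!: prod_nonneg sum_nonneg mult_nonneg_nonneg)
  next
    case False
    define w where "w i l = v (Suc i) l - (\<Sum>l<d. v (Suc i) l * cnj (v 0 l)) / complex_of_real g * v 0 l" for i l
    obtain r where r: "Determinant.det (gram d k w) = complex_of_real r" "0 \<le> r"
      "r \<le> (\<Prod>i<k. \<Sum>l<d. (cmod (w i l))\<^sup>2)" using Suc.IH by blast
    have "(\<Prod>i<k. \<Sum>l<d. (cmod (w i l))\<^sup>2) \<le> (\<Prod>i<k. \<Sum>l<d. (cmod (v (Suc i) l))\<^sup>2)"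
      unfolding w_def g_def
      by (intro prod_mono conjI sum_nonneg sum_norm_square_minus_projection)
        (use False in \<open>auto simp: g_def simp flip: of_real_power of_real_sum\<close>)
    with r have "r \<le> (\<Prod>i<k. \<Sum>l<d. (cmod (v (Suc i) l))\<^sup>2)" by linarith
    moreover have "0 \<le> g" by (simp add: g_def sum_nonneg)
    ultimately have "g * r \<le> (\<Prod>i<Suc k. \<Sum>l<d. (cmod (v i l))\<^sup>2)"
      by (subst prod.lessThan_Suc_shift) (simp add: g_def[symmetric] mult_left_mono)
    moreover have "Determinant.det (gram d (Suc k) v) = complex_of_real (g * r)"
      using det_gram_Suc[where d = d and v = v and k = k, folded g_def, folded w_def] False r(1)
      by simp
    ultimately show ?thesis using \<open>0 \<le> g\<close> \<open>0 \<le> r\<close> by (intro exI[of _ "g * r"]) auto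
  qed
qed

text \<open>The product of the matrix with its conjugate transpose is the Gram matrix of the rows,
  so \<open>det_gram_le\<close> bounds the squared modulus of the determinant by the product of the
  squared row lengths, each at most \<open>n * C^2\<close>. The resulting growth
  \<open>n^(n/2)\<close> loses against factorials.\<close>

lemma Hadamard_inequality:
  fixes f :: "nat \<times> nat \<Rightarrow> complex"
  assumes "\<And>i j. i < n \<Longrightarrow> j < n \<Longrightarrow> cmod (f (i, j)) \<le> C"
  shows "cmod (Determinant.det (Matrix.mat n n f)) \<le> (C * sqrt (real n)) ^ n"
proof (cases "n = 0")
  case True
  then show ?thesis by (simp add: det_def)
next
  case False
  then have C0: "0 \<le> C" using assms[of 0 0] order_trans norm_ge_zero by blast
  let ?A = "Matrix.mat n n f"
  let ?B = "Matrix.mat n n (\<lambda>(i, j). cnj (f (j, i)))"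
  have "?A * ?B = gram n n (\<lambda>i j. f (i, j))"
    by (rule eq_matI) (auto simp: gram_def scalar_prod_def lessThan_atLeast0)
  moreover have "Determinant.det (?A * ?B) = Determinant.det ?A * Determinant.det ?B"
    by (rule det_mult[of _ n]) auto
  moreover have "Determinant.det ?B = cnj (Determinant.det ?A)"
  proof -
    have "Determinant.det ?B = Determinant.det (transpose_mat ?B)"
      by (rule det_transpose[symmetric, of _ n]) auto
    also have "\<dots> = cnj (Determinant.det ?A)"
      by (simp add: det_def'[of _ n] permutes_def)
    finally show ?thesis .
  qed
  moreover obtain r where r: "Determinant.det (gram n n (\<lambda>i j. f (i, j))) = complex_of_real r"
    "0 \<le> r" "r \<le> (\<Prod>i<n. \<Sum>l<n. (cmod (f (i, l)))\<^sup>2)" using det_gram_le by blast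
  ultimately have "complex_of_real ((cmod (Determinant.det ?A))\<^sup>2) = complex_of_real r"
    by (simp only: complex_norm_square)
  then have "(cmod (Determinant.det ?A))\<^sup>2 = r" by (simp only: of_real_eq_iff)
  also have "r \<le> (\<Prod>i<n. \<Sum>l<n. (cmod (f (i, l)))\<^sup>2)" by fact
  also have "\<dots> \<le> (\<Prod>i<n. \<Sum>l<n. C\<^sup>2)"
    by (intro prod_mono conjI sum_nonneg sum_mono power_mono assms) auto
  also have "\<dots> = ((C * sqrt (real n)) ^ n)\<^sup>2"
  proof -
    have "(C * sqrt (real n))\<^sup>2 = real n * C\<^sup>2" by (simp add: power_mult_distrib)
    then show ?thesis by (simp add: power_mult[symmetric] mult.commute[of n 2]) (simp add: power_mult)
  qed
  finally show ?thesis
    by (rule power2_le_imp_le) (use C0 in auto)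
qed

section \<open>Atoms of point measures and factorial sums\<close>

text \<open>A non-zero mass is at least 1, so \<open>W\<close> contains at most as many atoms as its
  mass. If the rest \<open>V\<close> of the window were charged, the function sending
  \<open>x\<close> to the mass of \<open>V\<close> up to \<open>x\<close> would be 0 and then at
  least 1, and the point where it jumps would be an atom outside \<open>Q\<close>.\<close>

lemma finite_measure_atomic:
  fixes N :: "real measure"
  assumes N: "sets N = sets borel" and W: "W \<in> sets borel" "bounded W"
    and nat: "\<And>B. B \<in> sets borel \<Longrightarrow> B \<subseteq> W \<Longrightarrow> emeasure N B \<in> \<nat>"
  defines "Q \<equiv> {x\<in>W. emeasure N {x} \<noteq> 0}"
  shows "finite Q" and "\<And>B. B \<in> sets borel \<Longrightarrow> B \<subseteq> W \<Longrightarrow> emeasure N B = (\<Sum>x\<in>Q \<inter> B. emeasure N {x})"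
proof -
  have ge1: "1 \<le> emeasure N B" if B: "B \<in> sets borel" "B \<subseteq> W" "emeasure N B \<noteq> 0" for B
  proof -
    obtain k :: nat where "emeasure N B = of_nat k" using nat[OF B(1,2)] by (auto elim: Nats_cases)
    moreover from this have "k \<noteq> 0" using B(3) by auto
    ultimately show ?thesis using of_nat_mono[of 1 k, where 'a = ennreal] by simp
  qed
  obtain k :: nat where k: "emeasure N W = of_nat k" using nat[OF W(1)] by (auto elim: Nats_cases)
  have card_le: "card F \<le> k" if F: "finite F" "F \<subseteq> Q" for F
  proof -
    have "of_nat (card F) = (\<Sum>x\<in>F. (1::ennreal))" by simp
    also have "\<dots> \<le> (\<Sum>x\<in>F. emeasure N {x})"
      by (rule sum_mono, rule ge1) (use F in \<open>auto simp: Q_def\<close>)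
    also have "\<dots> = emeasure N F"
      by (rule emeasure_eq_sum_singleton[symmetric]) (use F N in auto)
    also have "\<dots> \<le> of_nat k"
      unfolding k[symmetric] by (rule emeasure_mono) (use F W N in \<open>auto simp: Q_def\<close>)
    finally show ?thesis by simp
  qed
  show fin: "finite Q"
  proof (rule ccontr)
    assume "infinite Q"
    then obtain F where "F \<subseteq> Q" "finite F" "card F = Suc k"
      using infinite_arbitrarily_large by blast
    then show False using card_le[of F] by simp
  qed
  have null: "emeasure N (W - Q) = 0"
  proof (rule ccontr)
    assume nz: "emeasure N (W - Q) \<noteq> 0"
    define V where "V = W - Q"
    have Vb: "V \<in> sets borel" unfolding V_def
      by (rule sets.Diff[OF W(1) borel_closed[OF finite_imp_closed[OF fin]]])
    have VW: "V \<subseteq> W" by (auto simp: V_def)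
    obtain r where r: "\<And>x. x \<in> W \<Longrightarrow> \<bar>x\<bar> \<le> r" using W(2) by (auto simp: bounded_real)
    define X where "X = {x. emeasure N (V \<inter> {..x}) \<noteq> 0}"
    have "V \<inter> {..r} = V" using r VW by fastforce
    then have rX: "r \<in> X" using nz by (simp add: X_def V_def)
    have bdd: "bdd_below X"
    proof (rule bdd_belowI)
      fix x assume "x \<in> X"
      then have "V \<inter> {..x} \<noteq> {}" by (auto simp: X_def)
      then show "- r \<le> x" using r VW by fastforce
    qed
    \<comment> \<open>The jump point. The set \<open>X\<close> is closed upwards, so all half-lines
      ending to the right of \<open>x0\<close> carry mass and none to the left of it does.\<close>
    define x0 where "x0 = Inf X"
    have upX: "y \<in> X" if "x \<in> X" "x \<le> y" for x y
    proof -
      have "emeasure N (V \<inter> {..x}) \<le> emeasure N (V \<inter> {..y})"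
        by (rule emeasure_mono) (use that Vb N in auto)
      then show ?thesis using that by (auto simp: X_def)
    qed
    have below: "emeasure N (V \<inter> {..<x0}) = 0"
    proof -
      have eq: "V \<inter> {..<x0} = (\<Union>n. V \<inter> {..x0 - 1 / real (Suc n)})" (is "_ = ?U")
      proof (intro equalityI subsetI)
        fix y assume y: "y \<in> V \<inter> {..<x0}"
        then obtain n where "inverse (real (Suc n)) < x0 - y" using reals_Archimedean[of "x0 - y"] by auto
        with y show "y \<in> ?U" by (intro UN_I[of n]) (auto simp: field_simps)
      next
        fix y assume "y \<in> ?U"
        then show "y \<in> V \<inter> {..<x0}" by (auto intro: le_less_trans[of _ "x0 - 1 / real (Suc _)"])
      qed
      have "emeasure N (V \<inter> {..x0 - 1 / real (Suc n)}) = 0" for n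
      proof (rule ccontr)
        assume "emeasure N (V \<inter> {..x0 - 1 / real (Suc n)}) \<noteq> 0"
        then have "x0 - 1 / real (Suc n) \<in> X" by (simp add: X_def)
        then have "x0 \<le> x0 - 1 / real (Suc n)" unfolding x0_def using bdd by (rule cInf_lower)
        then show False by (simp add: field_simps)
      qed
      then show ?thesis unfolding eq by (intro emeasure_UN_eq_0) (use Vb N in auto)
    qed
    \<comment> \<open>Continuity from above transfers the lower bound 1 from the half-lines ending
      beyond \<open>x0\<close> to the one ending at \<open>x0\<close>.\<close>
    have lim: "(\<lambda>n. emeasure N (V \<inter> {..x0 + 1 / real (Suc n)})) \<longlonglongrightarrow> emeasure N (\<Inter>n. V \<inter> {..x0 + 1 / real (Suc n)})"
    proof (rule Lim_emeasure_decseq)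
      show "decseq (\<lambda>n. V \<inter> {..x0 + 1 / real (Suc n)})"
        unfolding decseq_def
      proof (intro allI impI)
        fix a b :: nat assume "a \<le> b"
        then have "1 / real (Suc b) \<le> 1 / real (Suc a)" by (simp add: frac_le)
        then show "V \<inter> {..x0 + 1 / real (Suc b)} \<subseteq> V \<inter> {..x0 + 1 / real (Suc a)}" by auto
      qed
      show "emeasure N (V \<inter> {..x0 + 1 / real (Suc n)}) \<noteq> \<infinity>" for n
      proof -
        have "emeasure N (V \<inter> {..x0 + 1 / real (Suc n)}) \<le> emeasure N W"
          by (rule emeasure_mono) (use VW W N in auto)
        then show ?thesis using k by (auto simp: top_unique)
      qed
      show "range (\<lambda>n. V \<inter> {..x0 + 1 / real (Suc n)}) \<subseteq> sets N"
        unfolding N by (intro image_subsetI sets.Int Vb) simp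
    qed
    have eq: "(\<Inter>n. V \<inter> {..x0 + 1 / real (Suc n)}) = V \<inter> {..x0}"
    proof -
      have "y \<le> x0" if "\<And>n. y \<le> x0 + 1 / real (Suc n)" for y
      proof (rule field_le_epsilon)
        fix e :: real assume "0 < e"
        then obtain n where "inverse (real (Suc n)) < e" using reals_Archimedean by blast
        with that[of n] show "y \<le> x0 + e" by (simp add: inverse_eq_divide)
      qed
      then show ?thesis by (auto simp del: of_nat_Suc intro: order_trans)
    qed
    have "1 \<le> emeasure N (V \<inter> {..x0 + 1 / real (Suc n)})" for n
    proof -
      obtain x where x: "x \<in> X" "x < x0 + 1 / real (Suc n)"
        using rX cInf_lessD[of X "x0 + 1 / real (Suc n)"] by (auto simp: x0_def)
      then have "x0 + 1 / real (Suc n) \<in> X" using upX by force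
      then show ?thesis by (intro ge1) (use Vb VW in \<open>auto simp: X_def\<close>)
    qed
    then have ge: "1 \<le> emeasure N (V \<inter> {..x0})"
      using LIMSEQ_le_const[OF lim[unfolded eq]] by blast
    have "V \<inter> {..x0} = (V \<inter> {..<x0}) \<union> (V \<inter> {x0})" by auto
    then have "emeasure N (V \<inter> {..x0}) \<le> emeasure N (V \<inter> {..<x0}) + emeasure N (V \<inter> {x0})"
      using emeasure_subadditive[of "V \<inter> {..<x0}" N "V \<inter> {x0}"] Vb N by simp
    with ge below have nz0: "emeasure N (V \<inter> {x0}) \<noteq> 0" by auto
    then have "x0 \<in> V" by (cases "x0 \<in> V") auto
    then have "emeasure N {x0} \<noteq> 0" using nz0 by simp
    with \<open>x0 \<in> V\<close> show False by (auto simp: V_def Q_def)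
  qed
  show "emeasure N B = (\<Sum>x\<in>Q \<inter> B. emeasure N {x})" if B: "B \<in> sets borel" "B \<subseteq> W" for B
  proof -
    have Qb: "Q \<in> sets N" unfolding N by (rule borel_closed[OF finite_imp_closed[OF fin]])
    have "emeasure N (B - Q) \<le> emeasure N (W - Q)"
      by (rule emeasure_mono) (use B W Qb N in auto)
    with null have 0: "emeasure N (B - Q) = 0" by simp
    have "emeasure N B = emeasure N ((Q \<inter> B) \<union> (B - Q))" by (rule arg_cong[where f = "emeasure N"]) auto
    also have "\<dots> = emeasure N (Q \<inter> B) + emeasure N (B - Q)"
      by (rule plus_emeasure[symmetric]) (use B Qb N in auto)
    also have "\<dots> = emeasure N (Q \<inter> B)" by (simp add: 0)
    also have "\<dots> = (\<Sum>x\<in>Q \<inter> B. emeasure N {x})"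
      by (rule emeasure_eq_sum_singleton) (use fin N in auto)
    finally show ?thesis .
  qed
qed

text \<open>The coordinates are chosen one at a time. Earlier points that lie in \<open>A n\<close>
  are exactly those with \<open>A j \<subseteq> A n\<close>, because the family is laminar, so the
  number of admissible choices for the last coordinate is the same for every choice of the others
  and the sum factors.\<close>

lemma sum_distinct_index_tuples:
  fixes m :: "'s \<Rightarrow> nat" and A :: "nat \<Rightarrow> 's set"
  assumes Q: "finite Q"
    and laminar: "\<And>i j. j < i \<Longrightarrow> i < n \<Longrightarrow> A j \<subseteq> A i \<or> A j \<inter> A i = {}"
  shows "(\<Sum>p\<in>PiE {..<n} (\<lambda>_. Q). \<Prod>i<n. if p i \<in> A i then m (p i) - card {j. j < i \<and> p j = p i} else 0)
       = (\<Prod>i<n. (\<Sum>x\<in>Q \<inter> A i. m x) - card {j. j < i \<and> A j \<subseteq> A i})"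
  using laminar
proof (induction n)
  case 0
  show ?case by simp
next
  case (Suc n)
  define g where "g p i = (if p i \<in> A i then m (p i) - card {j. j < i \<and> p j = p i} else 0)" for p i
  define F where "F p = (\<Prod>i<n. g p i)" for p
  define c where "c = card {j. j < n \<and> A j \<subseteq> A n}"
  have *: "PiE {..<Suc n} (\<lambda>_. Q) = (\<lambda>(x, p). p(n := x)) ` (Q \<times> PiE {..<n} (\<lambda>_. Q))"
    unfolding lessThan_Suc PiE_insert_eq ..
  have inj: "inj_on (\<lambda>(x, p). p(n := x)) (Q \<times> PiE {..<n} (\<lambda>_. Q))"
    by (rule inj_combinator) auto
  have inner: "F p * (\<Sum>x\<in>Q. if x \<in> A n then m x - card {j. j < n \<and> p j = x} else 0)
      = F p * ((\<Sum>x\<in>Q \<inter> A n. m x) - c)" if p: "p \<in> PiE {..<n} (\<lambda>_. Q)" for p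
  proof (cases "F p = 0")
    case False
    then have g: "g p i \<noteq> 0" if "i < n" for i using that by (auto simp: F_def)
    then have pA: "p i \<in> A i" if "i < n" for i using g[OF that] by (meson g_def)
    \<comment> \<open>A non-zero product means that no point was used more often than its
      multiplicity: look at the last index where \<open>x\<close> was used. The truncated
      subtractions below are therefore genuine.\<close>
    have le: "card {j. j < n \<and> p j = x} \<le> m x" for x
    proof (cases "{j. j < n \<and> p j = x} = {}")
      case False
      define J where "J = {j. j < n \<and> p j = x}"
      have fJ: "finite J" and neJ: "J \<noteq> {}" using False by (auto simp: J_def)
      define i where "i = Max J"
      have iJ: "i \<in> J" unfolding i_def using fJ neJ by (rule Max_in)
      have le_i: "j \<le> i" if "j \<in> J" for j unfolding i_def using fJ that by (rule Max_ge)
      have Ji: "J = insert i {j. j < i \<and> p j = p i}"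
        using iJ le_i by (force simp: J_def)
      have "g p i \<noteq> 0" using g iJ by (auto simp: J_def)
      then have "card {j. j < i \<and> p j = p i} < m (p i)" by (auto simp: g_def split: if_splits)
      moreover have "card J = Suc (card {j. j < i \<and> p j = p i})"
        by (subst Ji, rule card_insert_disjoint) auto
      moreover have "p i = x" using iJ by (simp add: J_def)
      ultimately show ?thesis by (simp add: J_def)
    qed (metis card.empty le0)
    have "(\<Sum>x\<in>Q. if x \<in> A n then m x - card {j. j < n \<and> p j = x} else 0)
        = (\<Sum>x\<in>Q \<inter> A n. m x - card {j. j < n \<and> p j = x})"
      using Q by (simp add: sum.inter_restrict)
    also have "\<dots> = (\<Sum>x\<in>Q \<inter> A n. m x) - (\<Sum>x\<in>Q \<inter> A n. card {j. j < n \<and> p j = x})"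
      by (rule sum_subtractf_nat) (use le in auto)
    also have "(\<Sum>x\<in>Q \<inter> A n. card {j. j < n \<and> p j = x}) = card (\<Union>x\<in>Q \<inter> A n. {j. j < n \<and> p j = x})"
      by (rule card_UN_disjoint[symmetric]) (use Q in auto)
    \<comment> \<open>Laminarity: \<open>p j\<close> lies in \<open>A j\<close>, so it lies in
      \<open>A n\<close> exactly when \<open>A j\<close> is contained in \<open>A n\<close>.\<close>
    also have "(\<Union>x\<in>Q \<inter> A n. {j. j < n \<and> p j = x}) = {j. j < n \<and> A j \<subseteq> A n}"
      using p pA Suc.prems[of _ n] by (fastforce simp: PiE_iff)
    finally show ?thesis by (simp add: c_def)
  qed simp
  have Fupd: "(\<Prod>i<n. g (p(n := x)) i) = F p" for p x
    unfolding F_def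
  proof (rule prod.cong[OF refl])
    fix i assume i: "i \<in> {..<n}"
    then have "{j. j < i \<and> (p(n := x)) j = (p(n := x)) i} = {j. j < i \<and> p j = p i}" by auto
    then show "g (p(n := x)) i = g p i" using i by (simp add: g_def)
  qed
  have gn: "g (p(n := x)) n = (if x \<in> A n then m x - card {j. j < n \<and> p j = x} else 0)" for p x
  proof -
    have "{j. j < n \<and> (p(n := x)) j = (p(n := x)) n} = {j. j < n \<and> p j = x}" by auto
    then show ?thesis by (simp add: g_def)
  qed
  have "(\<Sum>p\<in>PiE {..<Suc n} (\<lambda>_. Q). \<Prod>i<Suc n. g p i)
     = (\<Sum>(x, p)\<in>Q \<times> PiE {..<n} (\<lambda>_. Q). \<Prod>i<Suc n. g (p(n := x)) i)"
    unfolding * by (subst sum.reindex[OF inj]) (simp add: case_prod_unfold)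
  also have "\<dots> = (\<Sum>p\<in>PiE {..<n} (\<lambda>_. Q). \<Sum>x\<in>Q. \<Prod>i<Suc n. g (p(n := x)) i)"
    by (subst sum.swap) (simp add: sum.cartesian_product)
  also have "\<dots> = (\<Sum>p\<in>PiE {..<n} (\<lambda>_. Q). F p * (\<Sum>x\<in>Q. if x \<in> A n then m x - card {j. j < n \<and> p j = x} else 0))"
    by (simp add: Fupd gn sum_distrib_left)
  also have "\<dots> = (\<Sum>p\<in>PiE {..<n} (\<lambda>_. Q). F p) * ((\<Sum>x\<in>Q \<inter> A n. m x) - c)"
    by (simp add: inner sum_distrib_right)
  also have "(\<Sum>p\<in>PiE {..<n} (\<lambda>_. Q). F p) = (\<Prod>i<n. (\<Sum>x\<in>Q \<inter> A i. m x) - card {j. j < i \<and> A j \<subseteq> A i})"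
    unfolding F_def g_def by (rule Suc.IH) (use Suc.prems in auto)
  finally show ?case by (simp add: g_def c_def)
qed

lemma ennreal_of_nat_diff: "(of_nat a :: ennreal) - of_nat b = of_nat (a - b)"
proof -
  have "real (a - b) = max 0 (real a - real b)" by linarith
  then have "ennreal (real (a - b)) = ennreal (real a - real b)"
    by (metis ennreal_max_0 max.commute)
  then show ?thesis by (simp only: ennreal_of_nat_eq_real_of_nat ennreal_minus of_nat_0_le_iff)
qed

text \<open>Only tuples of atoms contribute: at any other tuple an indicator or a mass vanishes. The
  integral over an uncountable counting measure thereby becomes a finite sum of natural
  numbers.\<close>

lemma factorial_sum_prod_indicator:
  assumes Q: "finite Q" "Q \<subseteq> space N" and m: "\<And>x. x \<in> Q \<Longrightarrow> emeasure N {x} = of_nat (m x)"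
    and out: "\<And>x. x \<in> W - Q \<Longrightarrow> emeasure N {x} = 0" and AW: "\<And>i. i < n \<Longrightarrow> A i \<subseteq> W"
  shows "factorial_sum N n (\<lambda>p. \<Prod>i<n. indicator (A i) (p i)) =
     of_nat (\<Sum>p\<in>PiE {..<n} (\<lambda>_. Q). \<Prod>i<n. if p i \<in> A i then m (p i) - card {j. j < i \<and> p j = p i} else 0)"
proof -
  define h :: "(nat \<Rightarrow> 'a) \<Rightarrow> ennreal" where
    "h p = (\<Prod>i<n. indicator (A i) (p i)) * (\<Prod>i<n. emeasure N {p i} - of_nat (card {j. j < i \<and> p j = p i}))" for p
  have h0: "h p = 0" if p: "p \<in> PiE {..<n} (\<lambda>_. space N)" "p \<notin> PiE {..<n} (\<lambda>_. Q)" for p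
  proof -
    obtain i where i: "i < n" "p i \<notin> Q" using p by (auto simp: PiE_iff)
    show ?thesis
    proof (cases "p i \<in> A i")
      case True
      then have "emeasure N {p i} = 0" using out AW i by blast
      then have "(\<Prod>i<n. emeasure N {p i} - of_nat (card {j. j < i \<and> p j = p i})) = 0"
        using i by (intro prod_zero bexI[of _ i]) auto
      then show ?thesis by (simp add: h_def)
    next
      case False
      then have "(\<Prod>i<n. indicator (A i) (p i)) = (0::ennreal)" using i by (intro prod_zero bexI[of _ i]) auto
      then show ?thesis by (simp add: h_def)
    qed
  qed
  have fin: "finite (PiE {..<n} (\<lambda>_. Q))" using Q by (intro finite_PiE) auto
  have sub: "PiE {..<n} (\<lambda>_. Q) \<subseteq> PiE {..<n} (\<lambda>_. space N)" using Q by (intro PiE_mono) auto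
  have "factorial_sum N n (\<lambda>p. \<Prod>i<n. indicator (A i) (p i)) = (\<integral>\<^sup>+p. h p \<partial>count_space (PiE {..<n} (\<lambda>_. space N)))"
    by (simp add: factorial_sum_def h_def)
  also have "\<dots> = (\<Sum>p\<in>PiE {..<n} (\<lambda>_. Q). h p)"
    by (rule nn_integral_count_space'[OF fin h0 sub])
  also have "\<dots> = (\<Sum>p\<in>PiE {..<n} (\<lambda>_. Q). of_nat (\<Prod>i<n. if p i \<in> A i then m (p i) - card {j. j < i \<and> p j = p i} else 0))"
  proof (rule sum.cong[OF refl])
    fix p assume p: "p \<in> PiE {..<n} (\<lambda>_. Q)"
    have "h p = (\<Prod>i<n. indicator (A i) (p i) * (emeasure N {p i} - of_nat (card {j. j < i \<and> p j = p i})))"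
      by (simp add: h_def prod.distrib)
    also have "\<dots> = (\<Prod>i<n. of_nat (if p i \<in> A i then m (p i) - card {j. j < i \<and> p j = p i} else 0))"
    proof (rule prod.cong[OF refl])
      fix i assume "i \<in> {..<n}"
      then have "emeasure N {p i} = of_nat (m (p i))" using p m by (auto simp: PiE_iff)
      then show "indicator (A i) (p i) * (emeasure N {p i} - of_nat (card {j. j < i \<and> p j = p i})) =
         of_nat (if p i \<in> A i then m (p i) - card {j. j < i \<and> p j = p i} else 0)"
        by (cases "p i \<in> A i") (simp_all only: ennreal_of_nat_diff indicator_simps if_True if_False
            mult_1 mult_zero_left of_nat_0 not_False_eq_True)
    qed
    finally show "h p = of_nat (\<Prod>i<n. if p i \<in> A i then m (p i) - card {j. j < i \<and> p j = p i} else 0)"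
      by simp
  qed
  also have "\<dots> = of_nat (\<Sum>p\<in>PiE {..<n} (\<lambda>_. Q). \<Prod>i<n. if p i \<in> A i then m (p i) - card {j. j < i \<and> p j = p i} else 0)"
    by (simp add: of_nat_sum)
  finally show ?thesis .
qed

section \<open>Counts of space-time configurations\<close>

lemma point_measure_sigma_finite:
  assumes "\<mu> \<in> point_measures"
  shows "sigma_finite_measure \<mu>"
proof (rule sigma_finite_measure.intro, intro exI conjI)
  have sets: "sets \<mu> = sets borel" using assms by (simp add: point_measures_def)
  then have sp: "space \<mu> = UNIV" using sets_eq_imp_space_eq[OF sets] by simp
  let ?A = "range (\<lambda>n. {- real n..real n})"
  show "countable ?A" by simp
  show "?A \<subseteq> sets \<mu>" by (auto simp: sets)
  show "\<Union>?A = space \<mu>"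
  proof -
    have "\<exists>n. x \<in> {- real n..real n}" for x :: real
    proof -
      obtain n where "\<bar>x\<bar> \<le> real n" using real_arch_simple by blast
      then show ?thesis by (intro exI[of _ n]) auto
    qed
    then show ?thesis by (auto simp: sp)
  qed
  show "\<forall>a\<in>?A. emeasure \<mu> a \<noteq> \<infinity>"
  proof
    fix a assume "a \<in> ?A"
    then have "emeasure \<mu> a \<in> \<nat>" using assms by (auto simp: point_measures_def)
    then show "emeasure \<mu> a \<noteq> \<infinity>" by (auto elim!: Nats_cases)
  qed
qed

lemma space_time_configuration_space [simp]:
  "space (space_time_configuration I \<Xi> \<omega>) = I \<times> UNIV"
  "sets (space_time_configuration I \<Xi> \<omega>) = sets (count_space I \<Otimes>\<^sub>M borel)"
proof -
  have sub: "sets (count_space I \<Otimes>\<^sub>M borel) \<subseteq> Pow (I \<times> (UNIV :: real set))"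
    using sets.space_closed[of "count_space I \<Otimes>\<^sub>M (borel :: real measure)"] by (simp add: space_pair_measure)
  show "space (space_time_configuration I \<Xi> \<omega>) = I \<times> UNIV"
    unfolding space_time_configuration_def by (rule space_measure_of[OF sub])
  have "sigma_sets (I \<times> UNIV) (sets (count_space I \<Otimes>\<^sub>M borel)) = sets (count_space I \<Otimes>\<^sub>M (borel :: real measure))"
    using sets.sigma_sets_eq[of "count_space I \<Otimes>\<^sub>M (borel :: real measure)"] by (simp add: space_pair_measure)
  then show "sets (space_time_configuration I \<Xi> \<omega>) = sets (count_space I \<Otimes>\<^sub>M borel)"
    unfolding space_time_configuration_def by (subst sets_measure_of[OF sub])
qed

text \<open>\<open>measure_of\<close> takes the prescribed values only once countable additivity is
  known; it is inherited from the finite sum of product measures, each of which has a Dirac mass as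
  its first factor.\<close>

lemma emeasure_space_time_configuration:
  assumes I: "finite I" and pm: "\<And>t. t \<in> I \<Longrightarrow> \<Xi> t \<omega> \<in> point_measures"
    and A: "A \<in> sets (count_space I \<Otimes>\<^sub>M borel)"
  shows "emeasure (space_time_configuration I \<Xi> \<omega>) A = (\<Sum>t\<in>I. emeasure (\<Xi> t \<omega>) (Pair t -` A))"
proof -
  define N where "N t = return (count_space I) t \<Otimes>\<^sub>M \<Xi> t \<omega>" for t
  have sets: "sets (\<Xi> t \<omega>) = sets borel" if "t \<in> I" for t using pm[OF that] by (simp add: point_measures_def)
  have setsN: "sets (N t) = sets (count_space I \<Otimes>\<^sub>M borel)" if "t \<in> I" for t
    unfolding N_def by (rule sets_pair_measure_cong) (use sets that in auto)
  have "emeasure (space_time_configuration I \<Xi> \<omega>) A = (\<Sum>t\<in>I. emeasure (N t) A)"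
  proof (rule emeasure_measure_of)
    show "space_time_configuration I \<Xi> \<omega> =
        measure_of (I \<times> UNIV) (sets (count_space I \<Otimes>\<^sub>M borel)) (\<lambda>B. \<Sum>t\<in>I. emeasure (N t) B)"
      by (simp add: space_time_configuration_def N_def)
    show "sets (count_space I \<Otimes>\<^sub>M borel) \<subseteq> Pow (I \<times> (UNIV :: real set))"
      using sets.space_closed[of "count_space I \<Otimes>\<^sub>M (borel :: real measure)"] by (simp add: space_pair_measure)
    show "A \<in> sets (space_time_configuration I \<Xi> \<omega>)" using A by simp
    show "positive (sets (space_time_configuration I \<Xi> \<omega>)) (\<lambda>B. \<Sum>t\<in>I. emeasure (N t) B)"
      by (simp add: positive_def)
    show "countably_additive (sets (space_time_configuration I \<Xi> \<omega>)) (\<lambda>B. \<Sum>t\<in>I. emeasure (N t) B)"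
    proof (rule countably_additiveI)
      fix B :: "nat \<Rightarrow> (real \<times> real) set"
      assume B: "range B \<subseteq> sets (space_time_configuration I \<Xi> \<omega>)" "disjoint_family B"
      have "(\<Sum>i. \<Sum>t\<in>I. emeasure (N t) (B i)) = (\<Sum>t\<in>I. \<Sum>i. emeasure (N t) (B i))"
        by (rule suminf_sum) simp
      also have "\<dots> = (\<Sum>t\<in>I. emeasure (N t) (\<Union>i. B i))"
        by (intro sum.cong refl suminf_emeasure) (use B setsN in auto)
      finally show "(\<Sum>i. \<Sum>t\<in>I. emeasure (N t) (B i)) = (\<Sum>t\<in>I. emeasure (N t) (\<Union>i. B i))" .
    qed
  qed
  also have "\<dots> = (\<Sum>t\<in>I. emeasure (\<Xi> t \<omega>) (Pair t -` A))"
  proof (rule sum.cong[OF refl])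
    fix t assume t: "t \<in> I"
    interpret sigma_finite_measure "\<Xi> t \<omega>" using pm[OF t] by (rule point_measure_sigma_finite)
    have "emeasure (N t) A = (\<integral>\<^sup>+x. emeasure (\<Xi> t \<omega>) (Pair x -` A) \<partial>return (count_space I) t)"
      unfolding N_def by (rule emeasure_pair_measure_alt) (use setsN[OF t] A in \<open>simp add: N_def\<close>)
    also have "\<dots> = emeasure (\<Xi> t \<omega>) (Pair t -` A)"
      by (rule nn_integral_return) (use t in auto)
    finally show "emeasure (N t) A = emeasure (\<Xi> t \<omega>) (Pair t -` A)" .
  qed
  finally show ?thesis .
qed

text \<open>A mass with values in \<open>nat\<close>, so that falling factorials and countable state
  spaces are available. The floor keeps it measurable in the configuration; on bounded Borel sets it
  is the mass itself.\<close>

definition point_count :: "real measure \<Rightarrow> real set \<Rightarrow> nat" where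
  "point_count \<mu> B = nat \<lfloor>measure \<mu> B\<rfloor>"

lemma emeasure_point_measure:
  assumes "\<mu> \<in> point_measures" "B \<in> sets borel" "bounded B"
  shows "emeasure \<mu> B = of_nat (point_count \<mu> B)"
proof -
  obtain k :: nat where k: "emeasure \<mu> B = of_nat k"
    using assms by (auto simp: point_measures_def elim!: Nats_cases)
  then have "measure \<mu> B = real k" by (simp add: measure_def)
  then show ?thesis by (simp add: point_count_def k)
qed

definition space_time_count :: "real set \<Rightarrow> (real \<Rightarrow> real measure) \<Rightarrow> (real \<times> real) set \<Rightarrow> nat" where
  "space_time_count I \<eta> A = (\<Sum>t\<in>I. point_count (\<eta> t) (Pair t -` A))"

text \<open>The bounded union of the sets \<open>A i\<close> meets the configuration in finitely
  many atoms, to which the two counting lemmas above apply. Repetitions of a set produce falling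
  factorials of its count; a set that contains all earlier ones has all earlier points
  subtracted.\<close>

lemma factorial_sum_space_time:
  assumes I: "finite I" and pm: "\<And>t. t \<in> I \<Longrightarrow> \<Xi> t \<omega> \<in> point_measures"
    and A: "\<And>i. i < n \<Longrightarrow> A i \<in> sets (count_space I \<Otimes>\<^sub>M borel)"
    and bdd: "\<And>i. i < n \<Longrightarrow> bounded (A i)"
    and laminar: "\<And>i j. j < i \<Longrightarrow> i < n \<Longrightarrow> A j \<subseteq> A i \<or> A j \<inter> A i = {}"
  shows "factorial_sum (space_time_configuration I \<Xi> \<omega>) n (\<lambda>p. \<Prod>i<n. indicator (A i) (p i)) =
    of_nat (\<Prod>i<n. space_time_count I (\<lambda>t. \<Xi> t \<omega>) (A i) - card {j. j < i \<and> A j \<subseteq> A i})"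
proof -
  let ?N = "space_time_configuration I \<Xi> \<omega>"
  have sec_meas: "Pair t -` B \<in> sets borel" if "B \<in> sets (count_space I \<Otimes>\<^sub>M borel)" for t and B :: "(real \<times> real) set"
    using that by (rule sets_Pair1)
  have sec_bdd: "bounded (Pair t -` B)" if "bounded B" for t :: real and B :: "(real \<times> real) set"
  proof -
    have "Pair t -` B \<subseteq> snd ` B" by force
    then show ?thesis using bounded_snd[OF that] bounded_subset by blast
  qed
  define W where "W = (\<Union>i<n. A i)"
  have W: "W \<in> sets (count_space I \<Otimes>\<^sub>M borel)" unfolding W_def using A by auto
  have bW: "bounded W" unfolding W_def using bdd by auto
  have WI: "W \<subseteq> I \<times> UNIV" using sets.sets_into_space[OF W] by (simp add: space_pair_measure)
  define Wt where "Wt t = Pair t -` W" for t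
  define Q where "Q = (SIGMA t:I. {x\<in>Wt t. emeasure (\<Xi> t \<omega>) {x} \<noteq> 0})"
  have fact: "finite {x\<in>Wt t. emeasure (\<Xi> t \<omega>) {x} \<noteq> 0} \<and> (\<forall>B. B \<in> sets borel \<longrightarrow> B \<subseteq> Wt t \<longrightarrow>
      emeasure (\<Xi> t \<omega>) B = (\<Sum>x\<in>{x\<in>Wt t. emeasure (\<Xi> t \<omega>) {x} \<noteq> 0} \<inter> B. emeasure (\<Xi> t \<omega>) {x}))" if t: "t \<in> I" for t
  proof -
    have 1: "sets (\<Xi> t \<omega>) = sets borel" "Wt t \<in> sets borel" "bounded (Wt t)"
      using pm[OF t] sec_meas[OF W] sec_bdd[OF bW] by (auto simp: point_measures_def Wt_def)
    have 2: "emeasure (\<Xi> t \<omega>) B \<in> \<nat>" if "B \<in> sets borel" "B \<subseteq> Wt t" for B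
      using pm[OF t] that bounded_subset[OF 1(3)] by (auto simp: point_measures_def)
    show ?thesis using finite_measure_atomic[OF 1 2] by blast
  qed
  have finQ: "finite Q" unfolding Q_def using I fact by auto
  have em1: "emeasure ?N {(t, x)} = emeasure (\<Xi> t \<omega>) {x}" if t: "t \<in> I" for t x
  proof -
    have "{t} \<times> {x} \<in> sets (count_space I \<Otimes>\<^sub>M borel)" by (rule pair_measureI) (use t in auto)
    then have "emeasure ?N {(t, x)} = (\<Sum>s\<in>I. emeasure (\<Xi> s \<omega>) (Pair s -` {(t, x)}))"
      by (intro emeasure_space_time_configuration) (use I pm in auto)
    also have "\<dots> = (\<Sum>s\<in>I. if s = t then emeasure (\<Xi> t \<omega>) {x} else 0)"
      by (rule sum.cong) (auto simp: vimage_def)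
    finally show ?thesis using I t by simp
  qed
  define m where "m = (\<lambda>(t, x). point_count (\<Xi> t \<omega>) {x})"
  have m: "emeasure ?N z = of_nat (m y)" if "y \<in> Q" "z = {y}" for y z
    using that em1 pm by (auto simp: Q_def m_def emeasure_point_measure)
  have cnt: "(\<Sum>x\<in>Q \<inter> A i. m x) = space_time_count I (\<lambda>t. \<Xi> t \<omega>) (A i)" if i: "i < n" for i
  proof -
    have sub: "Pair t -` A i \<subseteq> Wt t" for t using i by (auto simp: Wt_def W_def)
    have QA: "Q \<inter> A i = (SIGMA t:I. {x\<in>Wt t. emeasure (\<Xi> t \<omega>) {x} \<noteq> 0} \<inter> Pair t -` A i)"
      by (auto simp: Q_def)
    have "(of_nat (\<Sum>x\<in>Q \<inter> A i. m x) :: ennreal) =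
       (\<Sum>t\<in>I. \<Sum>x\<in>{x\<in>Wt t. emeasure (\<Xi> t \<omega>) {x} \<noteq> 0} \<inter> Pair t -` A i. of_nat (m (t, x)))"
      unfolding QA of_nat_sum by (subst sum.Sigma) (use I fact in auto)
    also have "\<dots> = (\<Sum>t\<in>I. emeasure (\<Xi> t \<omega>) (Pair t -` A i))"
    proof (rule sum.cong[OF refl])
      fix t assume t: "t \<in> I"
      have "emeasure (\<Xi> t \<omega>) (Pair t -` A i) =
          (\<Sum>x\<in>{x\<in>Wt t. emeasure (\<Xi> t \<omega>) {x} \<noteq> 0} \<inter> Pair t -` A i. emeasure (\<Xi> t \<omega>) {x})"
        using fact[OF t] sub[of t] sec_meas[OF A[OF i]] by blast
      also have "\<dots> = (\<Sum>x\<in>{x\<in>Wt t. emeasure (\<Xi> t \<omega>) {x} \<noteq> 0} \<inter> Pair t -` A i. of_nat (m (t, x)))"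
        by (rule sum.cong) (auto simp: m_def emeasure_point_measure[OF pm[OF t]])
      finally show "(\<Sum>x\<in>{x\<in>Wt t. emeasure (\<Xi> t \<omega>) {x} \<noteq> 0} \<inter> Pair t -` A i. of_nat (m (t, x)))
         = emeasure (\<Xi> t \<omega>) (Pair t -` A i)" by simp
    qed
    also have "\<dots> = (\<Sum>t\<in>I. of_nat (point_count (\<Xi> t \<omega>) (Pair t -` A i)))"
      by (intro sum.cong refl emeasure_point_measure pm sec_meas sec_bdd A bdd i)
    also have "\<dots> = of_nat (space_time_count I (\<lambda>t. \<Xi> t \<omega>) (A i))"
      by (simp add: space_time_count_def)
    finally show ?thesis by (simp only: of_nat_eq_iff)
  qed
  have "factorial_sum ?N n (\<lambda>p. \<Prod>i<n. indicator (A i) (p i)) =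
     of_nat (\<Sum>p\<in>PiE {..<n} (\<lambda>_. Q). \<Prod>i<n. if p i \<in> A i then m (p i) - card {j. j < i \<and> p j = p i} else 0)"
  proof (rule factorial_sum_prod_indicator[OF finQ])
    show "Q \<subseteq> space ?N" by (auto simp: Q_def)
    show "emeasure ?N {x} = of_nat (m x)" if "x \<in> Q" for x using m that by blast
    show "emeasure ?N {x} = 0" if "x \<in> W - Q" for x
      using that WI em1 by (cases x) (auto simp: Q_def Wt_def)
    show "A i \<subseteq> W" if "i < n" for i using that by (auto simp: W_def)
  qed
  also have "(\<Sum>p\<in>PiE {..<n} (\<lambda>_. Q). \<Prod>i<n. if p i \<in> A i then m (p i) - card {j. j < i \<and> p j = p i} else 0)
     = (\<Prod>i<n. (\<Sum>x\<in>Q \<inter> A i. m x) - card {j. j < i \<and> A j \<subseteq> A i})"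
    by (rule sum_distinct_index_tuples[OF finQ laminar])
  also have "\<dots> = (\<Prod>i<n. space_time_count I (\<lambda>t. \<Xi> t \<omega>) (A i) - card {j. j < i \<and> A j \<subseteq> A i})"
    by (rule prod.cong) (use cnt in auto)
  finally show ?thesis .
qed

section \<open>Factorial moments of a rescaled determinantal process\<close>

text \<open>Induction on \<open>n\<close>, splitting off the last coordinate by Tonelli. The
  restriction to \<open>{..<n}\<close> keeps the image tuple in the extensional function space that
  carries the product measure.\<close>

lemma nn_integral_PiM_change_of_variables:
  assumes L: "sigma_finite_measure L" and L': "sigma_finite_measure L'"
    and \<phi>: "\<phi> \<in> measurable L L'"
    and cov: "\<And>g. g \<in> borel_measurable L' \<Longrightarrow> (\<integral>\<^sup>+q. g q \<partial>L') = s * (\<integral>\<^sup>+q. g (\<phi> q) \<partial>L)"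
    and g: "g \<in> borel_measurable (Pi\<^sub>M {..<n} (\<lambda>_. L'))"
  shows "(\<integral>\<^sup>+p. g p \<partial>Pi\<^sub>M {..<n} (\<lambda>_. L')) = s ^ n * (\<integral>\<^sup>+p. g (\<lambda>i\<in>{..<n}. \<phi> (p i)) \<partial>Pi\<^sub>M {..<n} (\<lambda>_. L))"
  using g
proof (induction n arbitrary: g)
  case 0
  show ?case by (simp add: PiM_empty nn_integral_count_space_finite restrict_def)
next
  case (Suc n)
  interpret A: product_sigma_finite "\<lambda>_::nat. L" by (rule product_sigma_finite.intro[OF L])
  interpret B: product_sigma_finite "\<lambda>_::nat. L'" by (rule product_sigma_finite.intro[OF L'])
  have ins: "{..<Suc n} = insert n {..<n}" by auto
  have g: "g \<in> borel_measurable (Pi\<^sub>M (insert n {..<n}) (\<lambda>_. L'))" using Suc.prems by (simp add: ins)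
  have upd: "(\<lambda>(p, q). p(n := q)) \<in> measurable (Pi\<^sub>M {..<n} (\<lambda>_. L') \<Otimes>\<^sub>M L') (Pi\<^sub>M (insert n {..<n}) (\<lambda>_. L'))"
    by (rule measurable_add_dim)
  have gu: "(\<lambda>(p, q). g (p(n := q))) \<in> borel_measurable (Pi\<^sub>M {..<n} (\<lambda>_. L') \<Otimes>\<^sub>M L')"
    using measurable_compose[OF upd g] by (simp add: case_prod_unfold)
  have meas_inner: "(\<lambda>p. \<integral>\<^sup>+q. g (p(n := q)) \<partial>L') \<in> borel_measurable (Pi\<^sub>M {..<n} (\<lambda>_. L'))"
    using sigma_finite_measure.borel_measurable_nn_integral_fst[OF L' gu] by simp
  have sec: "(\<lambda>q. g (p(n := q))) \<in> borel_measurable L'" if "p \<in> space (Pi\<^sub>M {..<n} (\<lambda>_. L'))" for p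
    using measurable_Pair2[OF gu that] by simp
  have \<phi>n: "(\<lambda>p. \<lambda>i\<in>{..<m}. \<phi> (p i)) \<in> measurable (Pi\<^sub>M {..<m} (\<lambda>_. L)) (Pi\<^sub>M {..<m} (\<lambda>_. L'))" for m
    using \<phi> by measurable
  have gs: "(\<lambda>p. g (\<lambda>i\<in>{..<Suc n}. \<phi> (p i))) \<in> borel_measurable (Pi\<^sub>M (insert n {..<n}) (\<lambda>_. L))"
    using measurable_compose[OF \<phi>n Suc.prems] unfolding ins .
  have "(\<integral>\<^sup>+p. g p \<partial>Pi\<^sub>M {..<Suc n} (\<lambda>_. L')) = (\<integral>\<^sup>+p. \<integral>\<^sup>+q. g (p(n := q)) \<partial>L' \<partial>Pi\<^sub>M {..<n} (\<lambda>_. L'))"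
    unfolding ins by (rule B.product_nn_integral_insert) (use g in auto)
  also have "\<dots> = s ^ n * (\<integral>\<^sup>+p. \<integral>\<^sup>+q. g ((\<lambda>i\<in>{..<n}. \<phi> (p i))(n := q)) \<partial>L' \<partial>Pi\<^sub>M {..<n} (\<lambda>_. L))"
    by (rule Suc.IH[OF meas_inner])
  also have "(\<integral>\<^sup>+p. \<integral>\<^sup>+q. g ((\<lambda>i\<in>{..<n}. \<phi> (p i))(n := q)) \<partial>L' \<partial>Pi\<^sub>M {..<n} (\<lambda>_. L))
      = (\<integral>\<^sup>+p. s * (\<integral>\<^sup>+q. g (\<lambda>i\<in>{..<Suc n}. \<phi> ((p(n := q)) i)) \<partial>L) \<partial>Pi\<^sub>M {..<n} (\<lambda>_. L))"
  proof (rule nn_integral_cong)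
    fix p assume "p \<in> space (Pi\<^sub>M {..<n} (\<lambda>_. L))"
    then have "(\<lambda>i\<in>{..<n}. \<phi> (p i)) \<in> space (Pi\<^sub>M {..<n} (\<lambda>_. L'))"
      using measurable_space[OF \<phi>n] by blast
    then have "(\<integral>\<^sup>+q. g ((\<lambda>i\<in>{..<n}. \<phi> (p i))(n := q)) \<partial>L') =
        s * (\<integral>\<^sup>+q. g ((\<lambda>i\<in>{..<n}. \<phi> (p i))(n := \<phi> q)) \<partial>L)"
      by (intro cov sec)
    moreover have "(\<lambda>i\<in>{..<n}. \<phi> (p i))(n := \<phi> q) = (\<lambda>i\<in>{..<Suc n}. \<phi> ((p(n := q)) i))" for q
      by (auto simp: fun_eq_iff restrict_def)
    ultimately show "(\<integral>\<^sup>+q. g ((\<lambda>i\<in>{..<n}. \<phi> (p i))(n := q)) \<partial>L') =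
        s * (\<integral>\<^sup>+q. g (\<lambda>i\<in>{..<Suc n}. \<phi> ((p(n := q)) i)) \<partial>L)" by simp
  qed
  also have "\<dots> = s * (\<integral>\<^sup>+p. \<integral>\<^sup>+q. g (\<lambda>i\<in>{..<Suc n}. \<phi> ((p(n := q)) i)) \<partial>L \<partial>Pi\<^sub>M {..<n} (\<lambda>_. L))"
  proof (rule nn_integral_cmult)
    have upd': "(\<lambda>(p, q). p(n := q)) \<in> measurable (Pi\<^sub>M {..<n} (\<lambda>_. L) \<Otimes>\<^sub>M L) (Pi\<^sub>M (insert n {..<n}) (\<lambda>_. L))"
      by (rule measurable_add_dim)
    have "(\<lambda>(p, q). g (\<lambda>i\<in>{..<Suc n}. \<phi> ((p(n := q)) i))) \<in> borel_measurable (Pi\<^sub>M {..<n} (\<lambda>_. L) \<Otimes>\<^sub>M L)"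
      using measurable_compose[OF upd' gs] by (simp add: case_prod_unfold)
    then show "(\<lambda>p. \<integral>\<^sup>+q. g (\<lambda>i\<in>{..<Suc n}. \<phi> ((p(n := q)) i)) \<partial>L) \<in> borel_measurable (Pi\<^sub>M {..<n} (\<lambda>_. L))"
      using sigma_finite_measure.borel_measurable_nn_integral_fst[OF L] by fastforce
  qed
  also have "(\<integral>\<^sup>+p. \<integral>\<^sup>+q. g (\<lambda>i\<in>{..<Suc n}. \<phi> ((p(n := q)) i)) \<partial>L \<partial>Pi\<^sub>M {..<n} (\<lambda>_. L))
      = (\<integral>\<^sup>+p. g (\<lambda>i\<in>{..<Suc n}. \<phi> (p i)) \<partial>Pi\<^sub>M (insert n {..<n}) (\<lambda>_. L))"
    by (rule A.product_nn_integral_insert[symmetric]) (use gs in auto)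
  finally show ?case unfolding ins by (simp only: power_Suc mult_ac)
qed

lemma sigma_finite_space_time: "finite I \<Longrightarrow> sigma_finite_measure (count_space I \<Otimes>\<^sub>M (lborel :: real measure))"
  by (intro sigma_finite_pair_measure sigma_finite_measure_count_space_finite sigma_finite_lborel)

lemma sets_space_time: "sets (count_space I \<Otimes>\<^sub>M lborel) = sets (count_space I \<Otimes>\<^sub>M (borel :: real measure))"
  by (rule sets_pair_measure_cong) simp_all

lemma nn_integral_space_time:
  fixes g :: "'i \<times> real \<Rightarrow> ennreal"
  assumes "finite I" "g \<in> borel_measurable (count_space I \<Otimes>\<^sub>M lborel)"
  shows "(\<integral>\<^sup>+q. g q \<partial>(count_space I \<Otimes>\<^sub>M lborel)) = (\<Sum>t\<in>I. \<integral>\<^sup>+x. g (t, x) \<partial>lborel)"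
  using assms by (subst lborel.nn_integral_fst[symmetric]) (auto simp: nn_integral_count_space_finite)

lemma space_time_affine_measurable:
  fixes \<theta> :: "real \<Rightarrow> real" and \<sigma> :: real
  shows "(\<lambda>q. (\<theta> (fst q), \<sigma> * snd q)) \<in> measurable (count_space I \<Otimes>\<^sub>M borel) (count_space (\<theta> ` I) \<Otimes>\<^sub>M borel)"
  by (intro measurable_Pair measurable_compose[OF measurable_fst]) auto

lemma nn_integral_space_time_affine:
  fixes \<theta> :: "real \<Rightarrow> real" and \<sigma> :: real
  assumes I: "finite I" and \<theta>: "inj_on \<theta> I" and \<sigma>: "0 < \<sigma>"
    and g: "g \<in> borel_measurable (count_space (\<theta> ` I) \<Otimes>\<^sub>M lborel)"
  shows "(\<integral>\<^sup>+q. g q \<partial>(count_space (\<theta> ` I) \<Otimes>\<^sub>M lborel)) =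
     ennreal \<sigma> * (\<integral>\<^sup>+q. g (\<theta> (fst q), \<sigma> * snd q) \<partial>(count_space I \<Otimes>\<^sub>M lborel))"
proof -
  have sec: "(\<lambda>x. g (\<theta> t, x)) \<in> borel_measurable borel" if "t \<in> I" for t
    using measurable_Pair2[OF g, of "\<theta> t"] that by simp
  have gc: "(\<lambda>q. g (\<theta> (fst q), \<sigma> * snd q)) \<in> borel_measurable (count_space I \<Otimes>\<^sub>M lborel)"
  proof -
    have "g \<in> borel_measurable (count_space (\<theta> ` I) \<Otimes>\<^sub>M borel)"
      using g by (subst measurable_cong_sets[OF sets_space_time[symmetric] refl])
    then have "(\<lambda>q. g (\<theta> (fst q), \<sigma> * snd q)) \<in> borel_measurable (count_space I \<Otimes>\<^sub>M borel)"
      by (rule measurable_compose[OF space_time_affine_measurable])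
    then show ?thesis by (subst measurable_cong_sets[OF sets_space_time refl])
  qed
  have "(\<integral>\<^sup>+q. g q \<partial>(count_space (\<theta> ` I) \<Otimes>\<^sub>M lborel)) = (\<Sum>t\<in>I. \<integral>\<^sup>+x. g (\<theta> t, x) \<partial>lborel)"
    using I g \<theta> by (simp add: nn_integral_space_time sum.reindex)
  also have "\<dots> = (\<Sum>t\<in>I. ennreal \<sigma> * \<integral>\<^sup>+x. g (\<theta> t, \<sigma> * x) \<partial>lborel)"
  proof (rule sum.cong[OF refl])
    fix t assume "t \<in> I"
    then show "(\<integral>\<^sup>+x. g (\<theta> t, x) \<partial>lborel) = ennreal \<sigma> * \<integral>\<^sup>+x. g (\<theta> t, \<sigma> * x) \<partial>lborel"
      using nn_integral_real_affine[OF sec, of t \<sigma> 0] \<sigma> by simp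
  qed
  also have "\<dots> = ennreal \<sigma> * (\<integral>\<^sup>+q. g (\<theta> (fst q), \<sigma> * snd q) \<partial>(count_space I \<Otimes>\<^sub>M lborel))"
    using I gc by (simp add: nn_integral_space_time sum_distrib_left)
  finally show ?thesis .
qed

lemma space_time_count_distr:
  fixes \<theta> :: "real \<Rightarrow> real" and \<sigma> :: real
  assumes \<theta>: "inj_on \<theta> I" and \<sigma>: "0 < \<sigma>"
    and pm: "\<And>t. t \<in> I \<Longrightarrow> \<eta> (\<theta> t) \<in> point_measures"
    and A: "A \<in> sets (count_space I \<Otimes>\<^sub>M borel)"
  shows "space_time_count I (\<lambda>t. distr (\<eta> (\<theta> t)) borel (\<lambda>x. x / \<sigma>)) A =
         space_time_count (\<theta> ` I) \<eta> ((\<lambda>q. (\<theta> (fst q), \<sigma> * snd q)) ` A)"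
proof -
  have AI: "A \<subseteq> I \<times> UNIV" using sets.sets_into_space[OF A] by (simp add: space_pair_measure)
  have "point_count (distr (\<eta> (\<theta> t)) borel (\<lambda>x. x / \<sigma>)) (Pair t -` A) =
      point_count (\<eta> (\<theta> t)) (Pair (\<theta> t) -` ((\<lambda>q. (\<theta> (fst q), \<sigma> * snd q)) ` A))" if t: "t \<in> I" for t
  proof -
    have s: "sets (\<eta> (\<theta> t)) = sets borel" using pm[OF t] by (simp add: point_measures_def)
    then have sp: "space (\<eta> (\<theta> t)) = UNIV" using sets_eq_imp_space_eq[OF s] by simp
    have "(\<lambda>x. x / \<sigma>) -` (Pair t -` A) = Pair (\<theta> t) -` ((\<lambda>q. (\<theta> (fst q), \<sigma> * snd q)) ` A)"
    proof (intro equalityI subsetI)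
      fix x assume "x \<in> (\<lambda>x. x / \<sigma>) -` (Pair t -` A)"
      then have "(t, x / \<sigma>) \<in> A" by simp
      then have "(\<theta> t, \<sigma> * (x / \<sigma>)) \<in> (\<lambda>q. (\<theta> (fst q), \<sigma> * snd q)) ` A" by force
      then show "x \<in> Pair (\<theta> t) -` ((\<lambda>q. (\<theta> (fst q), \<sigma> * snd q)) ` A)" using \<sigma> by simp
    next
      fix x assume "x \<in> Pair (\<theta> t) -` ((\<lambda>q. (\<theta> (fst q), \<sigma> * snd q)) ` A)"
      then obtain q where q: "q \<in> A" "\<theta> t = \<theta> (fst q)" "x = \<sigma> * snd q" by auto
      then have "fst q = t" using AI t \<theta> by (metis (no_types, lifting) inj_onD mem_Sigma_iff prod.collapse subsetD)
      then show "x \<in> (\<lambda>x. x / \<sigma>) -` (Pair t -` A)" using q \<sigma> by (cases q) auto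
    qed
    moreover have "Pair t -` A \<in> sets borel" using A by (rule sets_Pair1)
    ultimately have "measure (distr (\<eta> (\<theta> t)) borel (\<lambda>x. x / \<sigma>)) (Pair t -` A) =
      measure (\<eta> (\<theta> t)) (Pair (\<theta> t) -` ((\<lambda>q. (\<theta> (fst q), \<sigma> * snd q)) ` A))"
      by (subst measure_distr) (auto simp: sp s cong: measurable_cong_sets)
    then show ?thesis by (simp add: point_count_def)
  qed
  then show ?thesis
    using \<theta> by (simp add: space_time_count_def sum.reindex cong: sum.cong)
qed

lemma bounded_space_time_affine:
  fixes \<theta> :: "real \<Rightarrow> real" and \<sigma> :: real
  assumes "finite I" "bounded A" "A \<subseteq> I \<times> UNIV"
  shows "bounded ((\<lambda>q. (\<theta> (fst q), \<sigma> * snd q)) ` A)"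
proof -
  have "(\<lambda>q. (\<theta> (fst q), \<sigma> * snd q)) ` A \<subseteq> \<theta> ` I \<times> (\<lambda>x. \<sigma> * x) ` snd ` A"
    using assms by force
  moreover have "bounded ((\<lambda>x. \<sigma> *\<^sub>R x) ` snd ` A)"
    using assms by (intro bounded_scaling bounded_snd)
  moreover have "bounded (\<theta> ` I)" using assms(1) by (intro finite_imp_bounded finite_imageI)
  ultimately show ?thesis using bounded_subset[OF bounded_Times] by simp
qed

lemma space_time_affine_image_sets:
  fixes \<theta> :: "real \<Rightarrow> real" and \<sigma> :: real
  assumes \<theta>: "inj_on \<theta> I" and \<sigma>: "0 < \<sigma>" and A: "A \<in> sets (count_space I \<Otimes>\<^sub>M borel)"
  shows "(\<lambda>q. (\<theta> (fst q), \<sigma> * snd q)) ` A \<in> sets (count_space (\<theta> ` I) \<Otimes>\<^sub>M borel)"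
proof -
  let ?\<psi> = "\<lambda>q. (the_inv_into I \<theta> (fst q), snd q / \<sigma>)"
  have AI: "A \<subseteq> I \<times> UNIV" using sets.sets_into_space[OF A] by (simp add: space_pair_measure)
  have "?\<psi> \<in> measurable (count_space (\<theta> ` I) \<Otimes>\<^sub>M borel) (count_space I \<Otimes>\<^sub>M borel)"
    by (intro measurable_Pair measurable_compose[OF measurable_fst])
      (use \<theta> in \<open>auto simp: the_inv_into_f_f\<close>)
  then have "?\<psi> -` A \<inter> space (count_space (\<theta> ` I) \<Otimes>\<^sub>M (borel :: real measure)) \<in> sets (count_space (\<theta> ` I) \<Otimes>\<^sub>M borel)"
    using A by (rule measurable_sets)
  moreover have "?\<psi> -` A \<inter> space (count_space (\<theta> ` I) \<Otimes>\<^sub>M (borel :: real measure)) = (\<lambda>q. (\<theta> (fst q), \<sigma> * snd q)) ` A"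
  proof (intro equalityI subsetI)
    fix q assume "q \<in> ?\<psi> -` A \<inter> space (count_space (\<theta> ` I) \<Otimes>\<^sub>M (borel :: real measure))"
    then have q: "?\<psi> q \<in> A" "fst q \<in> \<theta> ` I" by (auto simp: space_pair_measure)
    then have "q = (\<theta> (fst (?\<psi> q)), \<sigma> * snd (?\<psi> q))"
      using \<sigma> f_the_inv_into_f[OF \<theta> q(2)] by (cases q) simp
    with q show "q \<in> (\<lambda>q. (\<theta> (fst q), \<sigma> * snd q)) ` A" by (metis (no_types, lifting) image_eqI)
  qed (use AI \<theta> \<sigma> in \<open>auto simp: space_pair_measure the_inv_into_f_f\<close>)
  ultimately show ?thesis by simp
qed

lemma det_scale_kernel:
  "Determinant.det (Matrix.mat n n (\<lambda>(i, j). c * f i j)) = c ^ n * Determinant.det (Matrix.mat n n (\<lambda>(i, j). f i j))"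
    for c :: complex
proof -
  have "Matrix.mat n n (\<lambda>(i, j). c * f i j) = c \<cdot>\<^sub>m Matrix.mat n n (\<lambda>(i, j). f i j)"
    by (rule eq_matI) auto
  then show ?thesis by (simp add: det_smult)
qed

text \<open>The rescaled process has the kernel \<open>\<sigma> K\<close> in the new variables:
  counts of the rescaled process are counts of the original one in the image sets, an injective map
  preserves inclusion and disjointness, and the Jacobian \<open>\<sigma>\<close> of each of the
  \<open>n\<close> coordinates is absorbed by the determinant, which is homogeneous of degree
  \<open>n\<close>.\<close>

lemma determinantal_process_scaled_moments:
  fixes \<theta> :: "real \<Rightarrow> real" and \<sigma> :: real and K :: "real \<times> real \<Rightarrow> real \<times> real \<Rightarrow> complex"
  assumes det: "determinantal_process M J \<Xi> K"
    and I: "finite I" and \<theta>: "inj_on \<theta> I" "\<theta> ` I \<subseteq> J" and \<sigma>: "0 < \<sigma>"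
    and A: "\<And>i. i < n \<Longrightarrow> A i \<in> sets (count_space I \<Otimes>\<^sub>M borel)"
    and bdd: "\<And>i. i < n \<Longrightarrow> bounded (A i)"
    and laminar: "\<And>i j. j < i \<Longrightarrow> i < n \<Longrightarrow> A j \<subseteq> A i \<or> A j \<inter> A i = {}"
  defines "\<phi> \<equiv> \<lambda>q. (\<theta> (fst q), \<sigma> * snd q)"
  defines "\<rho> \<equiv> \<lambda>p. Determinant.det (Matrix.mat n n (\<lambda>(i, j). complex_of_real \<sigma> * K (\<phi> (p i)) (\<phi> (p j))))"
  shows "\<rho> \<in> borel_measurable (Pi\<^sub>M {..<n} (\<lambda>_. count_space I \<Otimes>\<^sub>M lborel))"
    and "(\<integral>\<^sup>+\<omega>. of_nat (\<Prod>i<n. space_time_count I (\<lambda>t. distr (\<Xi> (\<theta> t) \<omega>) borel (\<lambda>x. x / \<sigma>)) (A i) -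
              card {j. j < i \<and> A j \<subseteq> A i}) \<partial>M) =
         (\<integral>\<^sup>+p. (\<Prod>i<n. indicator (A i) (p i)) * ennreal (Re (\<rho> p)) \<partial>Pi\<^sub>M {..<n} (\<lambda>_. count_space I \<Otimes>\<^sub>M lborel))"
proof -
  let ?L = "count_space I \<Otimes>\<^sub>M (lborel :: real measure)" and ?L' = "count_space (\<theta> ` I) \<Otimes>\<^sub>M (lborel :: real measure)"
  define \<rho>' where "\<rho>' p = Determinant.det (Matrix.mat n n (\<lambda>(i, j). K (p i) (p j)))" for p :: "nat \<Rightarrow> real \<times> real"
  have I': "finite (\<theta> ` I)" using I by simp
  have corr: "has_correlation_function M (space_time_configuration (\<theta> ` I) \<Xi>) ?L' n \<rho>'"
    using det I' \<theta>(2) unfolding determinantal_process_def \<rho>'_def by blast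
  have \<rho>'m: "\<rho>' \<in> borel_measurable (Pi\<^sub>M {..<n} (\<lambda>_. ?L'))"
    using corr by (simp add: has_correlation_function_def)
  have setsL: "sets ?L = sets (count_space I \<Otimes>\<^sub>M borel)" "sets ?L' = sets (count_space (\<theta> ` I) \<Otimes>\<^sub>M borel)"
    by (rule sets_space_time)+
  have \<phi>m: "\<phi> \<in> measurable ?L ?L'"
    using space_time_affine_measurable[of \<theta> \<sigma> I] unfolding \<phi>_def
    by (subst measurable_cong_sets[OF setsL])
  have \<phi>n: "(\<lambda>p. \<lambda>i\<in>{..<n}. \<phi> (p i)) \<in> measurable (Pi\<^sub>M {..<n} (\<lambda>_. ?L)) (Pi\<^sub>M {..<n} (\<lambda>_. ?L'))"
    using \<phi>m by measurable
  have \<rho>eq: "\<rho> p = complex_of_real \<sigma> ^ n * \<rho>' (\<lambda>i\<in>{..<n}. \<phi> (p i))" for p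
  proof -
    have "Matrix.mat n n (\<lambda>(i, j). K (\<phi> (p i)) (\<phi> (p j))) =
       Matrix.mat n n (\<lambda>(i, j). K ((\<lambda>i\<in>{..<n}. \<phi> (p i)) i) ((\<lambda>i\<in>{..<n}. \<phi> (p i)) j))"
      by (rule eq_matI) auto
    then show ?thesis unfolding \<rho>_def det_scale_kernel \<rho>'_def by simp
  qed
  show "\<rho> \<in> borel_measurable (Pi\<^sub>M {..<n} (\<lambda>_. ?L))"
    unfolding \<rho>eq by (intro borel_measurable_times measurable_const measurable_compose[OF \<phi>n \<rho>'m]) simp
  define A' where "A' i = \<phi> ` A i" for i
  have AI: "A i \<subseteq> I \<times> UNIV" if "i < n" for i
    using sets.sets_into_space[OF A[OF that]] by (simp add: space_pair_measure)
  have injphi: "inj_on \<phi> (I \<times> UNIV)"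
    using \<theta>(1) \<sigma> by (auto simp: \<phi>_def inj_on_def)
  have A'm: "A' i \<in> sets (count_space (\<theta> ` I) \<Otimes>\<^sub>M borel)" if "i < n" for i
    unfolding A'_def \<phi>_def by (rule space_time_affine_image_sets[OF \<theta>(1) \<sigma> A[OF that]])
  have A'b: "bounded (A' i)" if "i < n" for i
    unfolding A'_def \<phi>_def by (rule bounded_space_time_affine[OF I bdd[OF that] AI[OF that]])
  have A'sub: "A' j \<subseteq> A' i \<longleftrightarrow> A j \<subseteq> A i" if "j < n" "i < n" for i j
    unfolding A'_def using AI[OF that(1)] AI[OF that(2)] injphi
    by (metis inj_on_image_subset_iff)
  have A'disj: "A' j \<inter> A' i = {} \<longleftrightarrow> A j \<inter> A i = {}" if "j < n" "i < n" for i j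
  proof -
    have "A' j \<inter> A' i = \<phi> ` (A j \<inter> A i)"
      unfolding A'_def by (rule inj_on_image_Int[symmetric, OF injphi]) (use AI that in auto)
    then show ?thesis by simp
  qed
  have pm: "\<Xi> t \<omega> \<in> point_measures" if "t \<in> J" "\<omega> \<in> space M" for t \<omega>
    using det that by (auto simp: determinantal_process_def configuration_process_def)
  have "(\<integral>\<^sup>+\<omega>. of_nat (\<Prod>i<n. space_time_count I (\<lambda>t. distr (\<Xi> (\<theta> t) \<omega>) borel (\<lambda>x. x / \<sigma>)) (A i) -
              card {j. j < i \<and> A j \<subseteq> A i}) \<partial>M) =
      (\<integral>\<^sup>+\<omega>. factorial_sum (space_time_configuration (\<theta> ` I) \<Xi> \<omega>) n (\<lambda>p. \<Prod>i<n. indicator (A' i) (p i)) \<partial>M)"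
  proof (rule nn_integral_cong)
    fix \<omega> assume \<omega>: "\<omega> \<in> space M"
    have "factorial_sum (space_time_configuration (\<theta> ` I) \<Xi> \<omega>) n (\<lambda>p. \<Prod>i<n. indicator (A' i) (p i)) =
       of_nat (\<Prod>i<n. space_time_count (\<theta> ` I) (\<lambda>t. \<Xi> t \<omega>) (A' i) - card {j. j < i \<and> A' j \<subseteq> A' i})"
    proof (rule factorial_sum_space_time[OF I'])
      show "\<Xi> t \<omega> \<in> point_measures" if "t \<in> \<theta> ` I" for t using pm \<omega> \<theta>(2) that by blast
      show "A' j \<subseteq> A' i \<or> A' j \<inter> A' i = {}" if "j < i" "i < n" for i j
        using laminar[OF that] A'sub[of j i] A'disj[of j i] that by simp
    qed (use A'm A'b in auto)
    also have "(\<Prod>i<n. space_time_count (\<theta> ` I) (\<lambda>t. \<Xi> t \<omega>) (A' i) - card {j. j < i \<and> A' j \<subseteq> A' i}) =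
       (\<Prod>i<n. space_time_count I (\<lambda>t. distr (\<Xi> (\<theta> t) \<omega>) borel (\<lambda>x. x / \<sigma>)) (A i) - card {j. j < i \<and> A j \<subseteq> A i})"
    proof (rule prod.cong[OF refl])
      fix i assume "i \<in> {..<n}"
      then have i: "i < n" by simp
      have "{j. j < i \<and> A' j \<subseteq> A' i} = {j. j < i \<and> A j \<subseteq> A i}" using A'sub i less_trans
        by (intro Collect_cong) blast
      moreover have "space_time_count I (\<lambda>t. distr (\<Xi> (\<theta> t) \<omega>) borel (\<lambda>x. x / \<sigma>)) (A i) =
          space_time_count (\<theta> ` I) (\<lambda>t. \<Xi> t \<omega>) (A' i)"
        unfolding A'_def \<phi>_def
        by (rule space_time_count_distr[OF \<theta>(1) \<sigma>, of "\<lambda>t. \<Xi> t \<omega>"]) (use pm \<omega> \<theta>(2) A i in auto)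
      ultimately show "space_time_count (\<theta> ` I) (\<lambda>t. \<Xi> t \<omega>) (A' i) - card {j. j < i \<and> A' j \<subseteq> A' i} =
        space_time_count I (\<lambda>t. distr (\<Xi> (\<theta> t) \<omega>) borel (\<lambda>x. x / \<sigma>)) (A i) - card {j. j < i \<and> A j \<subseteq> A i}" by simp
    qed
    finally show "of_nat (\<Prod>i<n. space_time_count I (\<lambda>t. distr (\<Xi> (\<theta> t) \<omega>) borel (\<lambda>x. x / \<sigma>)) (A i) -
              card {j. j < i \<and> A j \<subseteq> A i}) =
      factorial_sum (space_time_configuration (\<theta> ` I) \<Xi> \<omega>) n (\<lambda>p. \<Prod>i<n. indicator (A' i) (p i))" by simp
  qed
  also have "\<dots> = (\<integral>\<^sup>+p. (\<Prod>i<n. indicator (A' i) (p i)) * ennreal (Re (\<rho>' p)) \<partial>Pi\<^sub>M {..<n} (\<lambda>_. ?L'))"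
  proof -
    have "(\<lambda>p. \<Prod>i<n. indicator (A' i) (p i) :: ennreal) \<in> borel_measurable (Pi\<^sub>M {..<n} (\<lambda>_. ?L'))"
    proof (rule borel_measurable_prod_ennreal)
      fix i assume i: "i \<in> {..<n}"
      have "A' i \<in> sets ?L'" using A'm i setsL by simp
      then show "(\<lambda>p. indicator (A' i) (p i)) \<in> borel_measurable (Pi\<^sub>M {..<n} (\<lambda>_. ?L'))"
        using i by (intro measurable_compose[OF measurable_component_singleton[of i]] borel_measurable_indicator) auto
    qed
    then show ?thesis using corr unfolding has_correlation_function_def by blast
  qed
  also have "\<dots> = ennreal \<sigma> ^ n * (\<integral>\<^sup>+p. (\<Prod>i<n. indicator (A' i) ((\<lambda>i\<in>{..<n}. \<phi> (p i)) i)) *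
        ennreal (Re (\<rho>' (\<lambda>i\<in>{..<n}. \<phi> (p i)))) \<partial>Pi\<^sub>M {..<n} (\<lambda>_. ?L))"
  proof (rule nn_integral_PiM_change_of_variables[OF _ _ \<phi>m])
    show "sigma_finite_measure ?L" "sigma_finite_measure ?L'" using sigma_finite_space_time I by auto
    show "(\<integral>\<^sup>+q. g q \<partial>?L') = ennreal \<sigma> * (\<integral>\<^sup>+q. g (\<phi> q) \<partial>?L)" if "g \<in> borel_measurable ?L'" for g
      unfolding \<phi>_def by (rule nn_integral_space_time_affine[OF I \<theta>(1) \<sigma> that])
    have "(\<lambda>p. indicator (A' i) (p i)) \<in> borel_measurable (Pi\<^sub>M {..<n} (\<lambda>_. ?L'))" if i: "i < n" for i
    proof -
      have "A' i \<in> sets ?L'" using A'm i setsL by simp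
      then show ?thesis
        using i by (intro measurable_compose[OF measurable_component_singleton[of i]] borel_measurable_indicator) auto
    qed
    then show "(\<lambda>p. (\<Prod>i<n. indicator (A' i) (p i)) * ennreal (Re (\<rho>' p))) \<in> borel_measurable (Pi\<^sub>M {..<n} (\<lambda>_. ?L'))"
      using \<rho>'m by (intro borel_measurable_times_ennreal borel_measurable_prod_ennreal measurable_compose[OF _ measurable_ennreal]) (auto intro: measurable_compose[OF _ borel_measurable_Re])
  qed
  also have "\<dots> = (\<integral>\<^sup>+p. ennreal \<sigma> ^ n * ((\<Prod>i<n. indicator (A' i) ((\<lambda>i\<in>{..<n}. \<phi> (p i)) i)) *
        ennreal (Re (\<rho>' (\<lambda>i\<in>{..<n}. \<phi> (p i))))) \<partial>Pi\<^sub>M {..<n} (\<lambda>_. ?L))"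
  proof (rule nn_integral_cmult[symmetric])
    have "(\<lambda>p. indicator (A' i) ((\<lambda>i\<in>{..<n}. \<phi> (p i)) i)) \<in> borel_measurable (Pi\<^sub>M {..<n} (\<lambda>_. ?L))" if i: "i < n" for i
    proof -
      have "A' i \<in> sets ?L'" using A'm i setsL by simp
      then have "(\<lambda>p. indicator (A' i) (\<phi> (p i))) \<in> borel_measurable (Pi\<^sub>M {..<n} (\<lambda>_. ?L))"
        using i by (intro measurable_compose[OF measurable_compose[OF measurable_component_singleton[of i] \<phi>m]] borel_measurable_indicator) auto
      then show ?thesis using i by simp
    qed
    then show "(\<lambda>p. (\<Prod>i<n. indicator (A' i) ((\<lambda>i\<in>{..<n}. \<phi> (p i)) i)) * ennreal (Re (\<rho>' (\<lambda>i\<in>{..<n}. \<phi> (p i))))) \<in> borel_measurable (Pi\<^sub>M {..<n} (\<lambda>_. ?L))"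
      by (intro borel_measurable_times_ennreal borel_measurable_prod_ennreal measurable_compose[OF _ measurable_ennreal])
        (auto intro: measurable_compose[OF measurable_compose[OF \<phi>n \<rho>'m] borel_measurable_Re])
  qed
  also have "\<dots> = (\<integral>\<^sup>+p. (\<Prod>i<n. indicator (A i) (p i)) * ennreal (Re (\<rho> p)) \<partial>Pi\<^sub>M {..<n} (\<lambda>_. ?L))"
  proof (rule nn_integral_cong)
    fix p assume p: "p \<in> space (Pi\<^sub>M {..<n} (\<lambda>_. ?L))"
    have pI: "p i \<in> I \<times> UNIV" if "i < n" for i using p that by (auto simp: space_PiM space_pair_measure PiE_iff)
    have "(\<Prod>i<n. indicator (A' i) ((\<lambda>i\<in>{..<n}. \<phi> (p i)) i)) = (\<Prod>i<n. indicator (A i) (p i) :: ennreal)"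
    proof (rule prod.cong[OF refl])
      fix i assume "i \<in> {..<n}"
      then have i: "i < n" by simp
      have "\<phi> (p i) \<in> A' i \<longleftrightarrow> p i \<in> A i"
        unfolding A'_def using inj_on_image_mem_iff[OF injphi pI[OF i] AI[OF i]] .
      then show "indicator (A' i) ((\<lambda>i\<in>{..<n}. \<phi> (p i)) i) = (indicator (A i) (p i) :: ennreal)"
        using i by (simp add: indicator_def)
    qed
    moreover have "ennreal (Re (\<rho> p)) = ennreal \<sigma> ^ n * ennreal (Re (\<rho>' (\<lambda>i\<in>{..<n}. \<phi> (p i))))"
    proof -
      have "Re (\<rho> p) = \<sigma> ^ n * Re (\<rho>' (\<lambda>i\<in>{..<n}. \<phi> (p i)))"
        unfolding \<rho>eq of_real_power[symmetric] by simp
      then show ?thesis using \<sigma> by (simp add: ennreal_mult' ennreal_power)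
    qed
    ultimately show "ennreal \<sigma> ^ n * ((\<Prod>i<n. indicator (A' i) ((\<lambda>i\<in>{..<n}. \<phi> (p i)) i)) *
        ennreal (Re (\<rho>' (\<lambda>i\<in>{..<n}. \<phi> (p i))))) = (\<Prod>i<n. indicator (A i) (p i)) * ennreal (Re (\<rho> p))"
      by (simp add: mult_ac)
  qed
  finally show "(\<integral>\<^sup>+\<omega>. of_nat (\<Prod>i<n. space_time_count I (\<lambda>t. distr (\<Xi> (\<theta> t) \<omega>) borel (\<lambda>x. x / \<sigma>)) (A i) -
              card {j. j < i \<and> A j \<subseteq> A i}) \<partial>M) =
         (\<integral>\<^sup>+p. (\<Prod>i<n. indicator (A i) (p i)) * ennreal (Re (\<rho> p)) \<partial>Pi\<^sub>M {..<n} (\<lambda>_. ?L))" .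
qed

section \<open>Bonferroni inequalities and recovery of probabilities from moments\<close>

lemma falling_factorial_binomial: "(\<Prod>l<k. m - l) = fact k * (m choose k)"
proof (induction k)
  case (Suc k)
  have "fact k * ((m choose k) * (m - k)) = fact k * (Suc k * (m choose Suc k))"
  proof (cases "k < m")
    case True
    then obtain m' where m: "m = Suc m'" "k \<le> m'" by (cases m) auto
    have "Suc k * (Suc m' choose Suc k) = Suc m' * (m' choose k)" using Suc_times_binomial_eq[of m' k] by (simp only: mult.commute)
    also have "\<dots> = (Suc m' - k) * (Suc m' choose k)"
      using binomial_absorb_comp[of "Suc m'" k] by simp
    finally show ?thesis by (simp only: m mult.commute)
  qed (auto simp: binomial_eq_0)
  then show ?case using Suc by (simp add: algebra_simps)
qed simp

text \<open>For \<open>m > 0\<close> Pascal's rule collapses the truncated alternating sum into a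
  single binomial coefficient of \<open>m - 1\<close>, up to sign, and this is at most
  \<open>m choose r\<close>.\<close>

lemma Bonferroni_count:
  "\<bar>(if m = 0 then 1 else 0) - (\<Sum>k<r. (- 1) ^ k * real (m choose k))\<bar> \<le> real (m choose r)"
proof (cases "m = 0")
  case True
  have "(\<Sum>k<r. (- 1) ^ k * real (0 choose k)) = (\<Sum>k<r. if k = 0 then 1 else 0)"
    by (rule sum.cong) (auto simp: binomial_eq_0)
  also have "\<dots> = (if r = 0 then 0 else 1)" by (simp add: sum.delta)
  finally show ?thesis using True by (auto simp: binomial_eq_0)
next
  case False
  then obtain m' where m: "m = Suc m'" by (cases m) auto
  show ?thesis
  proof (cases r)
    case (Suc r')
    have "(\<Sum>k<Suc r'. (- 1) ^ k * real (Suc m' choose k)) = (- 1) ^ r' * real (m' choose r')" for r'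
      by (induction r') (auto simp: algebra_simps)
    then show ?thesis by (simp add: m Suc abs_mult)
  qed (use m in simp)
qed

text \<open>The number of ways to pick distinct points, the \<open>i\<close>-th one from cell
  \<open>c i\<close>, when cell \<open>b\<close> holds \<open>N b\<close> points. It is the product
  over cells of falling factorials whose lengths are the numbers of occurrences in
  \<open>c\<close>.\<close>

definition pattern_product :: "(nat \<Rightarrow> 'b) \<Rightarrow> nat \<Rightarrow> ('b \<Rightarrow> nat) \<Rightarrow> nat" where
  "pattern_product c n N = (\<Prod>i<n. N (c i) - card {j. j < i \<and> c j = c i})"

text \<open>The factor at the last occurrence of \<open>b\<close> in the pattern is positive only if
  the cell holds enough points for all occurrences.\<close>

lemma pattern_product_nonzero:
  assumes c: "\<And>b. b \<in> B \<Longrightarrow> card {i. i < n \<and> c i = b} = v b"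
    and nz: "pattern_product c n N \<noteq> 0" and b: "b \<in> B"
  shows "v b \<le> N b"
proof (cases "{i. i < n \<and> c i = b} = {}")
  case True
  then show ?thesis using c[OF b] by (metis card.empty le0)
next
  case False
  define J where "J = {i. i < n \<and> c i = b}"
  have fJ: "finite J" "J \<noteq> {}" using False by (auto simp: J_def)
  define i where "i = Max J"
  have iJ: "i \<in> J" unfolding i_def using fJ by (rule Max_in)
  have le_i: "j \<le> i" if "j \<in> J" for j unfolding i_def using fJ(1) that by (rule Max_ge)
  have Ji: "J = insert i {j. j < i \<and> c j = c i}" using iJ le_i by (force simp: J_def)
  have "N (c i) - card {j. j < i \<and> c j = c i} \<noteq> 0" using nz iJ by (auto simp: pattern_product_def J_def)
  moreover have "card J = Suc (card {j. j < i \<and> c j = c i})"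
    by (subst Ji, rule card_insert_disjoint) auto
  ultimately show ?thesis using c[OF b] iJ by (auto simp: J_def)
qed

lemma pattern_product_self:
  assumes c: "\<And>b. b \<in> B \<Longrightarrow> card {i. i < n \<and> c i = b} = v b" and cB: "\<And>i. i < n \<Longrightarrow> c i \<in> B"
  shows "pattern_product c n v \<noteq> 0"
proof -
  have "card {j. j < i \<and> c j = c i} < v (c i)" if i: "i < n" for i
  proof -
    have "card {j. j < i \<and> c j = c i} < card {j. j < n \<and> c j = c i}"
      by (rule psubset_card_mono) (use i in auto)
    then show ?thesis using c[OF cB[OF i]] by simp
  qed
  then show ?thesis unfolding pattern_product_def by (simp add: not_le)
qed

lemma pattern_exists:
  fixes B :: "'b set" and v :: "'b \<Rightarrow> nat"
  assumes "finite B"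
  shows "\<exists>(c :: nat \<Rightarrow> 'b) n. (\<forall>i<n. c i \<in> B) \<and> (\<forall>b\<in>B. card {i. i < n \<and> c i = b} = v b)"
  using assms
proof induction
  case empty
  have "(\<forall>i<0. c i \<in> {}) \<and> (\<forall>b\<in>{}. card {i. i < 0 \<and> c i = b} = v b)" for c :: "nat \<Rightarrow> 'b" by simp
  then show ?case by blast
next
  case (insert b B)
  then obtain c :: "nat \<Rightarrow> 'b" and n where c: "\<forall>i<n. c i \<in> B" "\<forall>b\<in>B. card {i. i < n \<and> c i = b} = v b" by blast
  define c' where "c' i = (if i < n then c i else b)" for i
  have "{i. i < n + v b \<and> c' i = b} = {n..<n + v b}"
    using c(1) insert.hyps(2) by (auto simp: c'_def not_less[symmetric])
  moreover have "{i. i < n + v b \<and> c' i = b'} = {i. i < n \<and> c i = b'}" if "b' \<in> B" for b'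
    using that insert.hyps(2) by (auto simp: c'_def)
  ultimately show ?case using c
    by (intro exI[of _ c'] exI[of _ "n + v b"]) (auto simp: c'_def)
qed

lemma pattern_length:
  assumes "finite B" "\<And>i. i < n \<Longrightarrow> c i \<in> B" "\<And>b. b \<in> B \<Longrightarrow> card {i. i < n \<and> c i = b} = v b"
  shows "(\<Sum>b\<in>B. v b) = n"
proof -
  have "(\<Sum>b\<in>B. v b) = card (\<Union>b\<in>B. {i. i < n \<and> c i = b})"
    using assms by (subst card_UN_disjoint) auto
  also have "(\<Union>b\<in>B. {i. i < n \<and> c i = b}) = {..<n}" using assms by auto
  finally show ?thesis by simp
qed

text \<open>Given the pattern, the total count equals \<open>n\<close> only if all cell counts are as prescribed; the
  Bonferroni inequalities are thus needed for the total count only.\<close>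

lemma counts_eq_Bonferroni:
  fixes N v :: "'b \<Rightarrow> nat"
  assumes B: "finite B" and cB: "\<And>i. i < n \<Longrightarrow> c i \<in> B"
    and c: "\<And>b. b \<in> B \<Longrightarrow> card {i. i < n \<and> c i = b} = v b"
  defines "Q \<equiv> \<lambda>k. pattern_product c n N * (\<Prod>l<k. (\<Sum>b\<in>B. N b) - (n + l))"
  shows "\<bar>real (pattern_product c n v) * (if \<forall>b\<in>B. N b = v b then 1 else 0) - (\<Sum>k<r. (- 1) ^ k / fact k * real (Q k))\<bar>
     \<le> real (Q r) / fact r"
proof -
  define S where "S = (\<Sum>b\<in>B. N b)"
  have n: "(\<Sum>b\<in>B. v b) = n" using pattern_length[OF B cB c] by simp
  have prodS: "(\<Prod>l<k. S - (n + l)) = fact k * ((S - n) choose k)" for k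
    using falling_factorial_binomial[where k = k and m = "S - n"] by simp
  have Q: "real (Q k) = real (pattern_product c n N) * (fact k * real ((S - n) choose k))" for k
    unfolding Q_def S_def[symmetric] prodS by simp
  show ?thesis
  proof (cases "pattern_product c n N = 0")
    case True
    moreover have "\<not> (\<forall>b\<in>B. N b = v b)"
    proof
      assume "\<forall>b\<in>B. N b = v b"
      then have "pattern_product c n N = pattern_product c n v"
        using cB by (simp add: pattern_product_def)
      then show False using pattern_product_self[OF c cB] True by simp
    qed
    ultimately show ?thesis by (auto simp: Q)
  next
    case False
    then have ge: "v b \<le> N b" if "b \<in> B" for b using pattern_product_nonzero[OF c _ that] that by blast
    then have "n \<le> S" unfolding n[symmetric] S_def by (rule sum_mono)
    \<comment> \<open>Every count is at least the prescribed one, so equality of the totals forces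
      equality in each cell.\<close>
    have iff: "(\<forall>b\<in>B. N b = v b) \<longleftrightarrow> S - n = 0"
    proof
      assume "S - n = 0"
      with \<open>n \<le> S\<close> have "(\<Sum>b\<in>B. v b) = (\<Sum>b\<in>B. N b)" using n by (simp add: S_def)
      then have "(\<Sum>b\<in>B. N b - v b) = 0" using sum_subtractf_nat[of B v N] ge by simp
      then show "\<forall>b\<in>B. N b = v b" using B ge by (simp add: le_antisym)
    qed (use n in \<open>simp add: S_def\<close>)
    have eq: "real (pattern_product c n v) * (if \<forall>b\<in>B. N b = v b then 1 else 0) =
        real (pattern_product c n N) * (if S - n = 0 then 1 else 0)"
    proof (cases "\<forall>b\<in>B. N b = v b")
      case True
      then have "pattern_product c n N = pattern_product c n v"
        using cB by (simp add: pattern_product_def)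
      with True show ?thesis using iff by simp
    qed (use iff in auto)
    have "(\<Sum>k<r. (- 1) ^ k / fact k * real (Q k)) = real (pattern_product c n N) * (\<Sum>k<r. (- 1) ^ k * real ((S - n) choose k))"
      by (simp add: Q sum_distrib_left mult_ac)
    then have "real (pattern_product c n v) * (if \<forall>b\<in>B. N b = v b then 1 else 0) - (\<Sum>k<r. (- 1) ^ k / fact k * real (Q k))
       = real (pattern_product c n N) * ((if S - n = 0 then 1 else 0) - (\<Sum>k<r. (- 1) ^ k * real ((S - n) choose k)))"
      unfolding eq by (simp only: right_diff_distrib)
    also have "\<bar>\<dots>\<bar> = real (pattern_product c n N) * \<bar>(if S - n = 0 then 1 else 0) - (\<Sum>k<r. (- 1) ^ k * real ((S - n) choose k))\<bar>"
      by (simp add: abs_mult)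
    also have "\<dots> \<le> real (pattern_product c n N) * real ((S - n) choose r)"
      by (intro mult_left_mono Bonferroni_count) simp
    finally show ?thesis by (simp add: Q)
  qed
qed

text \<open>Expectation of the pointwise bound \<open>counts_eq_Bonferroni\<close>. The error of
  truncating at order \<open>r\<close> is controlled by the single moment \<open>m r\<close>, which
  allows a bound uniform along a family of processes.\<close>

lemma prob_counts_Bonferroni:
  fixes N :: "'w \<Rightarrow> 'b \<Rightarrow> nat"
  assumes M: "prob_space M" and B: "finite B" and cB: "\<And>i. i < n \<Longrightarrow> c i \<in> B"
    and c: "\<And>b. b \<in> B \<Longrightarrow> card {i. i < n \<and> c i = b} = v b"
    and N: "\<And>b. b \<in> B \<Longrightarrow> (\<lambda>\<omega>. N \<omega> b) \<in> measurable M (count_space UNIV)"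
    and m: "\<And>k. (\<integral>\<^sup>+\<omega>. of_nat (pattern_product c n (N \<omega>) * (\<Prod>l<k. (\<Sum>b\<in>B. N \<omega> b) - (n + l))) \<partial>M) = ennreal (m k)"
    and m0: "\<And>k. 0 \<le> m k"
  shows "\<bar>real (pattern_product c n v) * measure M {\<omega>\<in>space M. \<forall>b\<in>B. N \<omega> b = v b} - (\<Sum>k<r. (- 1) ^ k / fact k * m k)\<bar>
     \<le> m r / fact r"
proof -
  interpret prob_space M by (rule M)
  define Q where "Q \<omega> k = pattern_product c n (N \<omega>) * (\<Prod>l<k. (\<Sum>b\<in>B. N \<omega> b) - (n + l))" for \<omega> k
  have Nc: "(\<lambda>\<omega>. N \<omega> (c i)) \<in> measurable M (count_space UNIV)" if "i < n" for i using N cB that by blast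
  have Qm: "(\<lambda>\<omega>. Q \<omega> k) \<in> measurable M (count_space UNIV)" for k
    unfolding Q_def pattern_product_def
  proof -
    have 1: "(\<lambda>\<omega>. \<Prod>i\<in>{..<n}. N \<omega> (c i) - card {j. j < i \<and> c j = c i}) \<in> measurable M (count_space UNIV)"
    proof -
      have "(\<lambda>\<omega>. \<Prod>i\<in>F. N \<omega> (c i) - card {j. j < i \<and> c j = c i}) \<in> measurable M (count_space UNIV)" if "F \<subseteq> {..<n}" for F
        using finite_subset[OF that finite_lessThan] that
      proof (induction F)
        case (insert i F)
        then have "(\<lambda>\<omega>. N \<omega> (c i)) \<in> measurable M (count_space UNIV)" using Nc by auto
        with insert show ?case by simp
      qed simp
      then show ?thesis by blast
    qed
    have 2: "(\<lambda>\<omega>. \<Sum>b\<in>B. N \<omega> b) \<in> measurable M (count_space UNIV)"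
      using B N
    proof (induction B)
      case (insert b F)
      then have "(\<lambda>\<omega>. N \<omega> b) \<in> measurable M (count_space UNIV)" by auto
      with insert show ?case by simp
    qed simp
    have 3: "(\<lambda>\<omega>. \<Prod>l<k. (\<Sum>b\<in>B. N \<omega> b) - (n + l)) \<in> measurable M (count_space UNIV)"
      using 2 by (induction k) simp_all
    show "(\<lambda>\<omega>. (\<Prod>i<n. N \<omega> (c i) - card {j. j < i \<and> c j = c i}) * (\<Prod>l<k. (\<Sum>b\<in>B. N \<omega> b) - (n + l))) \<in> measurable M (count_space UNIV)"
      using 1 3 by simp
  qed
  have Qr: "(\<lambda>\<omega>. real (Q \<omega> k)) \<in> borel_measurable M" for k
    using Qm[of k] by simp
  have nnQ: "(\<integral>\<^sup>+\<omega>. ennreal (real (Q \<omega> k)) \<partial>M) = ennreal (m k)" for k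
    using m[of k] by (simp add: Q_def ennreal_of_nat_eq_real_of_nat)
  have int: "integrable M (\<lambda>\<omega>. real (Q \<omega> k))" for k
    by (rule integrableI_nonneg) (use Qr nnQ in auto)
  have E: "(\<integral>\<omega>. real (Q \<omega> k) \<partial>M) = m k" for k
    by (rule integral_eq_nn_integral[THEN trans]) (use Qr nnQ m0 in auto)
  define A where "A = {\<omega>\<in>space M. \<forall>b\<in>B. N \<omega> b = v b}"
  have "{\<omega>\<in>space M. N \<omega> b = v b} \<in> sets M" if "b \<in> B" for b
    using measurable_sets[OF N[OF that], of "{v b}"] by (simp add: vimage_def Int_def conj_commute)
  then have A: "A \<in> sets M" unfolding A_def using B by (intro sets.sets_Collect_finite_All) auto
  define C where "C = real (pattern_product c n v)"
  have intA: "integrable M (\<lambda>\<omega>. C * indicator A \<omega>)" using A by (simp add: emeasure_eq_measure)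
  have ints: "integrable M (\<lambda>\<omega>. \<Sum>k<r. (- 1) ^ k / fact k * real (Q \<omega> k))" using int by simp
  have "C * measure M A - (\<Sum>k<r. (- 1) ^ k / fact k * m k)
      = (\<integral>\<omega>. C * indicator A \<omega> - (\<Sum>k<r. (- 1) ^ k / fact k * real (Q \<omega> k)) \<partial>M)"
    using intA ints int A E by (simp add: Bochner_Integration.integral_diff Bochner_Integration.integral_sum)
  also have "\<bar>\<dots>\<bar> \<le> (\<integral>\<omega>. \<bar>C * indicator A \<omega> - (\<Sum>k<r. (- 1) ^ k / fact k * real (Q \<omega> k))\<bar> \<partial>M)"
    by (rule integral_abs_bound)
  also have "\<dots> \<le> (\<integral>\<omega>. real (Q \<omega> r) / fact r \<partial>M)"
  proof (rule integral_mono)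
    show "integrable M (\<lambda>\<omega>. \<bar>C * indicator A \<omega> - (\<Sum>k<r. (- 1) ^ k / fact k * real (Q \<omega> k))\<bar>)"
      using intA ints by simp
    show "integrable M (\<lambda>\<omega>. real (Q \<omega> r) / fact r)" using int by simp
    fix \<omega> assume "\<omega> \<in> space M"
    then have "indicator A \<omega> = (if \<forall>b\<in>B. N \<omega> b = v b then 1 else 0 :: real)" by (simp add: A_def)
    then show "\<bar>C * indicator A \<omega> - (\<Sum>k<r. (- 1) ^ k / fact k * real (Q \<omega> k))\<bar> \<le> real (Q \<omega> r) / fact r"
      using counts_eq_Bonferroni[OF B cB c, where N = "N \<omega>" and r = r] by (simp add: Q_def C_def)
  qed
  also have "\<dots> = m r / fact r" using E by simp
  finally show ?thesis by (simp add: A_def C_def)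
qed

text \<open>An interchange of limits: the truncation error \<open>e r\<close> is the same for all
  indices \<open>i\<close>, so three pieces of size a third of \<epsilon> suffice.\<close>

lemma tendsto_of_uniform_partial_sums:
  fixes p :: "'i \<Rightarrow> real" and S :: "'i \<Rightarrow> nat \<Rightarrow> real"
  assumes S: "\<And>r. ((\<lambda>i. S i r) \<longlongrightarrow> S' r) F"
    and e: "e \<longlonglongrightarrow> 0" and p: "\<And>r. \<forall>\<^sub>F i in F. \<bar>p i - S i r\<bar> \<le> e r" and p': "\<And>r. \<bar>p' - S' r\<bar> \<le> e r"
  shows "(p \<longlongrightarrow> p') F"
proof (rule tendstoI)
  fix \<epsilon> :: real assume \<epsilon>: "0 < \<epsilon>"
  then have "\<forall>\<^sub>F r in sequentially. \<bar>e r\<bar> < \<epsilon> / 3" using tendstoD[OF e, of "\<epsilon> / 3"] by (simp add: dist_real_def)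
  then obtain r where r: "\<bar>e r\<bar> < \<epsilon> / 3" by (auto simp: eventually_sequentially)
  have "\<forall>\<^sub>F i in F. \<bar>S i r - S' r\<bar> < \<epsilon> / 3" using tendstoD[OF S, of "\<epsilon> / 3" r] \<epsilon> by (simp add: dist_real_def)
  then show "\<forall>\<^sub>F i in F. dist (p i) p' < \<epsilon>"
    using p[of r]
  proof eventually_elim
    case (elim i)
    then show ?case using p'[of r] r unfolding dist_real_def by linarith
  qed
qed

text \<open>With \<open>N = n + r\<close>, Hadamard's bound has size \<open>N^(N/2)\<close>, whereas
  \<open>r!\<close> is at least \<open>(N / e)^N\<close> divided by \<open>N^n\<close>. The quotient
  decays faster than any exponential.\<close>

lemma Hadamard_moment_decay:
  fixes C :: real
  assumes "0 \<le> C"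
  shows "(\<lambda>r. (C * sqrt (real (n + r))) ^ (n + r) / fact r) \<longlonglongrightarrow> 0"
proof -
  have bound: "(C * sqrt (real (n + r))) ^ (n + r) / fact r \<le>
      (C * exp 1) ^ (n + r) * real (n + r) ^ n / sqrt (real (n + r)) ^ (n + r)" if r: "0 < r" for r
  proof -
    let ?N = "n + r"
    have N: "0 < ?N" using r by simp
    have "real ?N ^ ?N / fact ?N \<le> exp (real ?N)"
    proof -
      have "(\<lambda>k. real ?N ^ k /\<^sub>R fact k) sums exp (real ?N)" by (rule exp_converges)
      then have s: "(\<lambda>k. real ?N ^ k / fact k) sums exp (real ?N)" by (simp add: divide_real_def mult.commute)
      have "(\<Sum>k\<in>{?N}. real ?N ^ k / fact k) \<le> (\<Sum>k. real ?N ^ k / fact k)"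
        by (rule sum_le_suminf) (use s in \<open>auto simp: sums_iff\<close>)
      then show ?thesis using s by (simp add: sums_iff)
    qed
    also have "exp (real ?N) = exp 1 ^ ?N" by (simp add: exp_of_nat_mult[symmetric])
    finally have 1: "real ?N ^ ?N \<le> exp 1 ^ ?N * fact ?N" by (simp add: divide_le_eq)
    \<comment> \<open>Replacing \<open>(n + r)!\<close> by \<open>r!\<close> costs at most the fixed
      power \<open>N^n\<close>.\<close>
    have "fact ?N \<le> fact r * real ?N ^ n"
    proof -
      have "fact ?N / fact (?N - n) \<le> real ?N ^ n" using fact_div_fact_le_pow[of n ?N]
        by (metis add_diff_cancel_left' fact_div_fact_le_pow le_add1 of_nat_fact of_nat_le_iff of_nat_power real_of_nat_div fact_dvd diff_le_self)
      then show ?thesis by (simp add: divide_le_eq mult.commute)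
    qed
    with 1 have 2: "real ?N ^ ?N \<le> exp 1 ^ ?N * (fact r * real ?N ^ n)"
      by (meson exp_ge_zero mult_left_mono order_trans zero_le_power)
    have sq: "real ?N ^ ?N = sqrt (real ?N) ^ ?N * sqrt (real ?N) ^ ?N"
      by (metis of_nat_0_le_iff power_mult_distrib real_sqrt_mult_self abs_of_nonneg)
    have pos: "0 < sqrt (real ?N) ^ ?N" using N by (intro zero_less_power real_sqrt_gt_zero) linarith
    have "sqrt (real ?N) ^ ?N \<le> exp 1 ^ ?N * (fact r * real ?N ^ n) / sqrt (real ?N) ^ ?N"
      using 2 pos unfolding sq by (simp add: pos_le_divide_eq)
    then have "C ^ ?N * sqrt (real ?N) ^ ?N \<le> C ^ ?N * (exp 1 ^ ?N * (fact r * real ?N ^ n) / sqrt (real ?N) ^ ?N)"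
      using assms by (intro mult_left_mono) auto
    then have "(C * sqrt (real ?N)) ^ ?N \<le> (C * exp 1) ^ ?N * real ?N ^ n / sqrt (real ?N) ^ ?N * fact r"
      by (simp add: power_mult_distrib mult_ac)
    then show ?thesis by (simp add: divide_le_eq)
  qed
  have lim0: "((\<lambda>x::real. (D powr x * x powr real n / sqrt x powr x)) \<longlongrightarrow> 0) at_top" if "0 < D" for D :: real
  proof (rule Lim_transform_eventually)
    show "((\<lambda>x::real. exp (d * x + m * ln x - x * ln x / 2)) \<longlongrightarrow> 0) at_top" for d m :: real
      by real_asymp
    show "\<forall>\<^sub>F x in at_top. exp (ln D * x + real n * ln x - x * ln x / 2) = D powr x * x powr real n / sqrt x powr x"
      using eventually_gt_at_top[of 0]
      by eventually_elim (use that in \<open>simp add: powr_def ln_sqrt exp_add exp_diff mult_ac\<close>)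
  qed
  have lim: "(\<lambda>r. (C * exp 1) ^ (n + r) * real (n + r) ^ n / sqrt (real (n + r)) ^ (n + r)) \<longlonglongrightarrow> 0"
  proof (cases "C = 0")
    case True
    have "\<forall>\<^sub>F r in sequentially. (C * exp 1) ^ (n + r) * real (n + r) ^ n / sqrt (real (n + r)) ^ (n + r) = 0"
      using eventually_gt_at_top[of 0] by eventually_elim (simp add: True)
    then show ?thesis by (rule tendsto_eventually)
  next
    case False
    then have D: "0 < C * exp 1" using assms by simp
    have "filterlim (\<lambda>r. real (n + r)) at_top sequentially"
      by (rule filterlim_compose[OF filterlim_real_sequentially]) (auto intro: filterlim_subseq simp: strict_mono_def)
    then have "((\<lambda>r. (C * exp 1) powr real (n + r) * real (n + r) powr real n / sqrt (real (n + r)) powr real (n + r)) \<longlongrightarrow> 0) sequentially"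
      by (rule filterlim_compose[OF lim0[OF D]])
    then show ?thesis
    proof (rule Lim_transform_eventually)
      show "\<forall>\<^sub>F r in sequentially. (C * exp 1) powr real (n + r) * real (n + r) powr real n / sqrt (real (n + r)) powr real (n + r)
         = (C * exp 1) ^ (n + r) * real (n + r) ^ n / sqrt (real (n + r)) ^ (n + r)"
        using eventually_gt_at_top[of 0]
      proof eventually_elim
        case (elim r)
        then have "0 < real (n + r)" "0 < sqrt (real (n + r))" by simp_all
        then show ?case by (simp only: powr_realpow D)
      qed
    qed
  qed
  show ?thesis
  proof (rule tendsto_sandwich[OF _ _ tendsto_const lim])
    show "\<forall>\<^sub>F r in sequentially. 0 \<le> (C * sqrt (real (n + r))) ^ (n + r) / fact r"
      using assms by (intro always_eventually allI) simp
    show "\<forall>\<^sub>F r in sequentially. (C * sqrt (real (n + r))) ^ (n + r) / fact r \<le>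
       (C * exp 1) ^ (n + r) * real (n + r) ^ n / sqrt (real (n + r)) ^ (n + r)"
      using eventually_gt_at_top[of 0] by eventually_elim (rule bound)
  qed
qed

section \<open>Dyadic cells and the vague topology\<close>

text \<open>Cells are half-open so that they partition the window.\<close>

definition grid_cell :: "nat \<Rightarrow> int \<Rightarrow> real set" where
  "grid_cell m k = {of_int k / 2 ^ m..<(of_int k + 1) / 2 ^ m}"

text \<open>The one parameter \<open>m\<close> governs both the mesh \<open>2^(-m)\<close> and the
  window from \<open>-m\<close> to \<open>m\<close>, so that letting it grow refines the partition
  and exhausts the line at once.\<close>

definition grid_index :: "nat \<Rightarrow> int set" where
  "grid_index m = {- (int m * 2 ^ m)..<int m * 2 ^ m}"

lemma finite_grid_index [simp]: "finite (grid_index m)"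
  by (simp add: grid_index_def)

lemma grid_cell_borel [measurable, simp]: "grid_cell m k \<in> sets borel"
  by (simp add: grid_cell_def)

lemma bounded_grid_cell [simp]: "bounded (grid_cell m k)"
  unfolding grid_cell_def
  by (rule bounded_subset[OF bounded_closed_interval[of "of_int k / 2 ^ m" "(of_int k + 1) / 2 ^ m"]]) auto

lemma grid_cell_iff: "x \<in> grid_cell m k \<longleftrightarrow> k = \<lfloor>x * 2 ^ m\<rfloor>"
  by (auto simp: grid_cell_def field_simps floor_unique floor_eq_iff) linarith+

lemma grid_cells_disjoint: "k \<noteq> l \<Longrightarrow> grid_cell m k \<inter> grid_cell m l = {}"
  by (auto simp: grid_cell_iff)

lemma grid_cell_nonempty: "of_int k / 2 ^ m \<in> grid_cell m k"
  by (simp add: grid_cell_def field_simps)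

lemma in_grid_window: "- real m \<le> x \<Longrightarrow> x < real m \<Longrightarrow> \<exists>k\<in>grid_index m. x \<in> grid_cell m k"
proof -
  assume x: "- real m \<le> x" "x < real m"
  have "- (real m * 2 ^ m) \<le> x * 2 ^ m" "x * 2 ^ m < real m * 2 ^ m"
    using x mult_right_mono[of "- real m" x "2 ^ m"] by auto
  then have "- (int m * 2 ^ m) \<le> \<lfloor>x * 2 ^ m\<rfloor>" "\<lfloor>x * 2 ^ m\<rfloor> < int m * 2 ^ m"
    by (auto simp: le_floor_iff floor_less_iff)
  then show ?thesis by (intro bexI[of _ "\<lfloor>x * 2 ^ m\<rfloor>"]) (auto simp: grid_index_def grid_cell_iff)
qed

definition same_counts :: "nat \<Rightarrow> real measure \<Rightarrow> real measure \<Rightarrow> bool" where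
  "same_counts m \<mu> \<nu> \<longleftrightarrow> (\<forall>k\<in>grid_index m. point_count \<mu> (grid_cell m k) = point_count \<nu> (grid_cell m k))"

text \<open>The test function is replaced by the step function \<open>g\<close> taking its values at
  the left ends of the cells. Equal counts give equal integrals of \<open>g\<close>, and each of the
  two replacements costs at most \<open>e\<close> per point.\<close>

lemma integral_same_counts:
  fixes f :: "real \<Rightarrow> real"
  assumes \<mu>: "\<mu> \<in> point_measures" and \<nu>: "\<nu> \<in> point_measures" and same: "same_counts m \<mu> \<nu>"
    and f: "f \<in> borel_measurable borel" and K: "\<And>x. f x \<noteq> 0 \<Longrightarrow> \<bar>x\<bar> \<le> K" "0 \<le> K" and m: "K < real m"
    and osc: "\<And>x y. \<bar>x - y\<bar> \<le> 1 / 2 ^ m \<Longrightarrow> \<bar>f x - f y\<bar> \<le> e"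
  shows "\<bar>(\<integral>x. f x \<partial>\<mu>) - (\<integral>x. f x \<partial>\<nu>)\<bar> \<le> 2 * e * measure \<mu> {- K - 1..K + 1}"
proof -
  \<comment> \<open>Cells have length at most 1, so those meeting \<open>[-K, K]\<close> stay in
    \<open>[-K - 1, K + 1]\<close>.\<close>
  define J where "J = {k\<in>grid_index m. grid_cell m k \<inter> {-K..K} \<noteq> {}}"
  define g where "g x = (\<Sum>k\<in>J. f (of_int k / 2 ^ m) * indicator (grid_cell m k) x)" for x
  define W where "W = (\<Union>k\<in>J. grid_cell m k)"
  have finJ: "finite J" by (simp add: J_def)
  have e0: "0 \<le> e" using osc[of 0 0] by simp
  have Wb: "W \<in> sets borel" unfolding W_def using finJ by auto
  have WK: "W \<subseteq> {- K - 1..K + 1}"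
  proof
    fix x assume "x \<in> W"
    then obtain k y where k: "x \<in> grid_cell m k" "y \<in> grid_cell m k" "- K \<le> y" "y \<le> K"
      by (auto simp: W_def J_def)
    then have "\<bar>x - y\<bar> \<le> 1 / 2 ^ m" by (auto simp: grid_cell_def add_divide_distrib)
    also have "\<dots> \<le> 1" by simp
    finally show "x \<in> {- K - 1..K + 1}" using k by auto
  qed
  have gx: "g x = f (of_int k / 2 ^ m)" if "k \<in> J" "x \<in> grid_cell m k" for x k
  proof -
    have "g x = (\<Sum>l\<in>J. if l = k then f (of_int k / 2 ^ m) else 0)"
      unfolding g_def using that by (intro sum.cong) (auto simp: indicator_def grid_cell_iff)
    then show ?thesis using that finJ by simp
  qed
  have g0: "g x = 0" if "x \<notin> W" for x
    unfolding g_def using that by (intro sum.neutral) (auto simp: W_def indicator_def)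
  have f0: "f x = 0" if "x \<notin> W" for x
  proof (rule ccontr)
    assume nz: "f x \<noteq> 0"
    then have "\<bar>x\<bar> \<le> K" using K by blast
    then have "- real m \<le> x" "x < real m" using m by auto
    then obtain k where "k \<in> grid_index m" "x \<in> grid_cell m k" using in_grid_window by blast
    moreover from this have "k \<in> J" using \<open>\<bar>x\<bar> \<le> K\<close> by (auto simp: J_def abs_le_iff)
    ultimately show False using that by (auto simp: W_def)
  qed
  have fg: "\<bar>f x - g x\<bar> \<le> e * indicator W x" for x
  proof (cases "x \<in> W")
    case True
    then obtain k where k: "k \<in> J" "x \<in> grid_cell m k" by (auto simp: W_def)
    then have "\<bar>x - of_int k / 2 ^ m\<bar> \<le> 1 / 2 ^ m" by (auto simp: grid_cell_def add_divide_distrib)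
    then show ?thesis using osc gx[OF k] True by simp
  qed (simp add: g0 f0)
  have key: "integrable \<kappa> f \<and> integrable \<kappa> g \<and> (\<integral>x. g x \<partial>\<kappa>) = (\<Sum>k\<in>J. f (of_int k / 2 ^ m) * real (point_count \<kappa> (grid_cell m k)))
      \<and> \<bar>(\<integral>x. f x \<partial>\<kappa>) - (\<integral>x. g x \<partial>\<kappa>)\<bar> \<le> e * measure \<kappa> W \<and> measure \<kappa> W = (\<Sum>k\<in>J. real (point_count \<kappa> (grid_cell m k)))"
    if \<kappa>: "\<kappa> \<in> point_measures" for \<kappa>
  proof -
    have s: "sets \<kappa> = sets borel" using \<kappa> by (simp add: point_measures_def)
    have fm: "f \<in> borel_measurable \<kappa>" using f by (simp cong: measurable_cong_sets add: s)
    have fin: "emeasure \<kappa> B < \<infinity>" "measure \<kappa> B = real (point_count \<kappa> B)" if "B \<in> sets borel" "bounded B" for B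
      using emeasure_point_measure[OF \<kappa> that] by (auto simp: measure_def of_nat_less_top)
    have intc: "integrable \<kappa> (\<lambda>x. f (of_int k / 2 ^ m) * indicator (grid_cell m k) x)" for k
      using fin[of "grid_cell m k"] by (intro integrable_mult_right integrable_real_indicator) (auto simp: s)
    have intg: "integrable \<kappa> g" unfolding g_def using intc by simp
    have bW: "bounded W" using WK bounded_subset bounded_closed_interval by blast
    have intW: "integrable \<kappa> (\<lambda>x. e * indicator W x)"
      using fin[OF Wb bW] Wb by (intro integrable_mult_right integrable_real_indicator) (auto simp: s)
    have intfg: "integrable \<kappa> (\<lambda>x. f x - g x)"
    proof (rule Bochner_Integration.integrable_bound[OF intW])
      show "(\<lambda>x. f x - g x) \<in> borel_measurable \<kappa>"
        using fm borel_measurable_integrable[OF intg] by (rule borel_measurable_diff)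
      have "norm (f x - g x) \<le> norm (e * indicator W x)" for x
        using fg[of x] e0 by (simp add: abs_mult)
      then show "AE x in \<kappa>. norm (f x - g x) \<le> norm (e * indicator W x)" by simp
    qed
    have intf: "integrable \<kappa> f" using Bochner_Integration.integrable_add[OF intfg intg] by simp
    have "(\<integral>x. g x \<partial>\<kappa>) = (\<Sum>k\<in>J. f (of_int k / 2 ^ m) * measure \<kappa> (grid_cell m k))"
      unfolding g_def using intc by (subst Bochner_Integration.integral_sum) (auto simp: s)
    also have "\<dots> = (\<Sum>k\<in>J. f (of_int k / 2 ^ m) * real (point_count \<kappa> (grid_cell m k)))"
      using fin by simp
    finally have 1: "(\<integral>x. g x \<partial>\<kappa>) = (\<Sum>k\<in>J. f (of_int k / 2 ^ m) * real (point_count \<kappa> (grid_cell m k)))" .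
    have "\<bar>\<integral>x. f x - g x \<partial>\<kappa>\<bar> \<le> (\<integral>x. e * indicator W x \<partial>\<kappa>)"
      using fg by (intro order_trans[OF integral_abs_bound] integral_mono integrable_abs intfg intW)
    then have 2: "\<bar>(\<integral>x. f x \<partial>\<kappa>) - (\<integral>x. g x \<partial>\<kappa>)\<bar> \<le> e * measure \<kappa> W"
      using intf intg Wb by (simp add: s)
    have "measure \<kappa> W = (\<Sum>k\<in>J. measure \<kappa> (grid_cell m k))"
      unfolding W_def
      by (rule measure_finite_Union) (use finJ fin in \<open>auto simp: s disjoint_family_on_def grid_cells_disjoint less_top[symmetric]\<close>)
    with 1 2 intf intg fin show ?thesis by simp
  qed
  have J_grid: "k \<in> grid_index m" if "k \<in> J" for k using that by (simp add: J_def)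
  have "(\<integral>x. g x \<partial>\<mu>) = (\<integral>x. g x \<partial>\<nu>)" "measure \<mu> W = measure \<nu> W"
    using key[OF \<mu>] key[OF \<nu>] same J_grid by (auto simp: same_counts_def)
  then have "\<bar>(\<integral>x. f x \<partial>\<mu>) - (\<integral>x. f x \<partial>\<nu>)\<bar> \<le> 2 * e * measure \<mu> W"
  proof -
    assume eq: "(\<integral>x. g x \<partial>\<mu>) = (\<integral>x. g x \<partial>\<nu>)" "measure \<mu> W = measure \<nu> W"
    have "\<bar>(\<integral>x. f x \<partial>\<mu>) - (\<integral>x. g x \<partial>\<mu>)\<bar> \<le> e * measure \<mu> W" "\<bar>(\<integral>x. f x \<partial>\<nu>) - (\<integral>x. g x \<partial>\<nu>)\<bar> \<le> e * measure \<nu> W"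
      using key[OF \<mu>] key[OF \<nu>] by blast+
    then show ?thesis unfolding eq by linarith
  qed
  also have "measure \<mu> W \<le> measure \<mu> {- K - 1..K + 1}"
  proof (rule measure_mono_fmeasurable[OF WK])
    have s: "sets \<mu> = sets borel" using \<mu> by (simp add: point_measures_def)
    show "W \<in> sets \<mu>" unfolding s by (rule Wb)
    show "{- K - 1..K + 1} \<in> fmeasurable \<mu>"
    proof (rule fmeasurableI)
      have "emeasure \<mu> {- K - 1..K + 1} = of_nat (point_count \<mu> {- K - 1..K + 1})"
        by (rule emeasure_point_measure[OF \<mu>]) (simp_all add: bounded_closed_interval)
      then show "emeasure \<mu> {- K - 1..K + 1} < \<infinity>" by (simp add: of_nat_less_top)
    qed (simp add: s)
  qed
  finally show ?thesis using e0 by (simp add: mult_left_mono)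
qed

text \<open>Fine enough counts decide membership in a vague neighbourhood of \<open>\<mu>\<close>.
  The property passes through finite intersections and unions, so only subbasic sets matter, and for
  these uniform continuity of the test function makes its oscillation on cells small.\<close>

lemma vague_open_same_counts:
  assumes "openin vague_topology V" "\<mu> \<in> V"
  shows "\<forall>\<^sub>F m in sequentially. \<forall>\<nu>\<in>point_measures. same_counts m \<mu> \<nu> \<longrightarrow> \<nu> \<in> V"
proof -
  let ?S = "{{\<mu> \<in> point_measures. (\<integral>x. f x \<partial>\<mu>) \<in> U} | (f :: real \<Rightarrow> real) U.
        continuous_on UNIV f \<and> compact (closure {x. f x \<noteq> 0}) \<and> open U}"
  have "generate_topology_on ?S V"
    using assms(1) unfolding vague_topology_def openin_topology_generated_by_iff .
  then show ?thesis using assms(2)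
  proof induction
    case (Int a b)
    then have "\<forall>\<^sub>F m in sequentially. \<forall>\<nu>\<in>point_measures. same_counts m \<mu> \<nu> \<longrightarrow> \<nu> \<in> a"
      "\<forall>\<^sub>F m in sequentially. \<forall>\<nu>\<in>point_measures. same_counts m \<mu> \<nu> \<longrightarrow> \<nu> \<in> b" by auto
    then show ?case by eventually_elim auto
  next
    case (UN K)
    then obtain k where "k \<in> K" "\<mu> \<in> k" by auto
    with UN have "\<forall>\<^sub>F m in sequentially. \<forall>\<nu>\<in>point_measures. same_counts m \<mu> \<nu> \<longrightarrow> \<nu> \<in> k" by blast
    then show ?case by eventually_elim (meson \<open>k \<in> K\<close> UnionI)
  next
    case (Basis s)
    then obtain f :: "real \<Rightarrow> real" and U where s: "s = {\<mu> \<in> point_measures. (\<integral>x. f x \<partial>\<mu>) \<in> U}"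
      and f: "continuous_on UNIV f" "compact (closure {x. f x \<noteq> 0})" and U: "open U" by auto
    have \<mu>: "\<mu> \<in> point_measures" "(\<integral>x. f x \<partial>\<mu>) \<in> U" using Basis.prems s by auto
    obtain K where K: "\<And>x. f x \<noteq> 0 \<Longrightarrow> \<bar>x\<bar> \<le> K" "0 \<le> K"
    proof -
      have "bounded (closure {x. f x \<noteq> 0})" using f(2) by (rule compact_imp_bounded)
      then obtain b where "\<And>x. x \<in> closure {x. f x \<noteq> 0} \<Longrightarrow> norm x \<le> b" by (auto simp: bounded_iff)
      then have "\<And>x. f x \<noteq> 0 \<Longrightarrow> \<bar>x\<bar> \<le> max b 0" using closure_subset[of "{x. f x \<noteq> 0}"] by force
      then show thesis using that[of "max b 0"] by simp
    qed
    have uc: "uniformly_continuous_on UNIV f"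
    proof -
      have "uniformly_continuous_on {- K - 2..K + 2} f"
        by (rule compact_uniformly_continuous) (use f(1) continuous_on_subset in auto)
      show ?thesis unfolding uniformly_continuous_on_def
      proof (intro allI impI)
        fix \<epsilon> :: real assume "0 < \<epsilon>"
        then obtain d where d: "0 < d" "\<And>x y. x \<in> {- K - 2..K + 2} \<Longrightarrow> y \<in> {- K - 2..K + 2} \<Longrightarrow> dist y x < d \<Longrightarrow> dist (f y) (f x) < \<epsilon>"
          using \<open>uniformly_continuous_on {- K - 2..K + 2} f\<close> unfolding uniformly_continuous_on_def by blast
        \<comment> \<open>Two points at distance less than 1 either both lie in the interval
          enlarged by 2 or both lie outside the support.\<close>
        have "dist (f y) (f x) < \<epsilon>" if "dist y x < min d 1" for x y
        proof (cases "x \<in> {- K - 2..K + 2} \<and> y \<in> {- K - 2..K + 2}")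
          case True
          then show ?thesis using d that by auto
        next
          case False
          then have "\<not> \<bar>x\<bar> \<le> K" "\<not> \<bar>y\<bar> \<le> K" using that by (auto simp: dist_real_def)
          then have "f x = 0" "f y = 0" using K(1) by blast+
          then show ?thesis using \<open>0 < \<epsilon>\<close> by simp
        qed
        then show "\<exists>d>0. \<forall>x\<in>UNIV. \<forall>x'\<in>UNIV. dist x' x < d \<longrightarrow> dist (f x') (f x) < \<epsilon>"
          using d(1) by (intro exI[of _ "min d 1"]) auto
      qed
    qed
    obtain \<epsilon> where \<epsilon>: "0 < \<epsilon>" "\<And>y. dist y (\<integral>x. f x \<partial>\<mu>) < \<epsilon> \<Longrightarrow> y \<in> U"
      using U \<mu>(2) unfolding open_dist by blast
    define C where "C = measure \<mu> {- K - 1..K + 1}"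
    \<comment> \<open>Chosen to make \<open>2 * e * C\<close> less than \<epsilon>; the summand 1
      keeps the denominator positive when the window carries no mass.\<close>
    define e where "e = \<epsilon> / (2 * C + 1)"
    have C: "0 \<le> C" by (simp add: C_def)
    have e: "0 < e" "2 * e * C < \<epsilon>"
    proof -
      show "0 < e" using \<epsilon> C by (simp add: e_def)
      have "2 * e * C < e * (2 * C + 1)" using \<open>0 < e\<close> by (simp add: algebra_simps)
      also have "\<dots> = \<epsilon>" using C by (simp add: e_def)
      finally show "2 * e * C < \<epsilon>" .
    qed
    obtain d where d: "0 < d" "\<And>x y. dist y x < d \<Longrightarrow> dist (f y) (f x) < e"
      using uc[unfolded uniformly_continuous_on_def, rule_format, OF e(1)] by auto
    have "(\<lambda>m. (1 / 2 :: real) ^ m) \<longlonglongrightarrow> 0" by (rule LIMSEQ_power_zero) simp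
    then have "\<forall>\<^sub>F m in sequentially. (1 / 2) ^ m < d" using d(1) by (rule order_tendstoD)
    moreover have "\<forall>\<^sub>F m in sequentially. K < real m"
      using filterlim_real_sequentially by (simp add: filterlim_at_top_dense)
    ultimately show ?case
    proof eventually_elim
      case (elim m)
      show ?case
      proof (intro ballI impI)
        fix \<nu> assume \<nu>: "\<nu> \<in> point_measures" "same_counts m \<mu> \<nu>"
        have "\<bar>(\<integral>x. f x \<partial>\<mu>) - (\<integral>x. f x \<partial>\<nu>)\<bar> \<le> 2 * e * measure \<mu> {- K - 1..K + 1}"
        proof (rule integral_same_counts[OF \<mu>(1) \<nu> _ K elim(2)])
          show "f \<in> borel_measurable borel" using f(1) by (rule borel_measurable_continuous_onI)
          show "\<bar>f x - f y\<bar> \<le> e" if "\<bar>x - y\<bar> \<le> 1 / 2 ^ m" for x y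
          proof -
            have "dist x y < d" using that elim(1) by (simp add: dist_real_def power_one_over)
            then show ?thesis using d(2)[of x y] by (simp add: dist_real_def)
          qed
        qed
        also have "\<dots> < \<epsilon>" using e(2) by (simp add: C_def)
        finally show "\<nu> \<in> s" using \<epsilon>(2) \<nu>(1) by (simp add: s dist_real_def abs_minus_commute)
      qed
    qed
  qed simp
qed

text \<open>The preimage of a ball is open in a finite product, hence contains a box around
  \<open>\<eta>\<close>, and \<open>vague_open_same_counts\<close> applies to each of its finitely
  many sides.\<close>

lemma continuous_map_same_counts:
  assumes I: "finite I" and F: "continuous_map (product_topology (\<lambda>_. vague_topology) I) euclideanreal F"
    and \<eta>: "\<eta> \<in> PiE I (\<lambda>_. point_measures)" and e: "0 < e"
  shows "\<forall>\<^sub>F m in sequentially. \<forall>\<eta>'\<in>PiE I (\<lambda>_. point_measures).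
     (\<forall>t\<in>I. same_counts m (\<eta> t) (\<eta>' t)) \<longrightarrow> \<bar>F \<eta>' - F \<eta>\<bar> < e"
proof -
  let ?T = "product_topology (\<lambda>_. vague_topology) I"
  have top: "topspace ?T = PiE I (\<lambda>_. point_measures)" by (simp add: topspace_vague_topology)
  define V where "V = {\<eta>' \<in> topspace ?T. F \<eta>' \<in> {y. \<bar>y - F \<eta>\<bar> < e}}"
  have "open {y. \<bar>y - F \<eta>\<bar> < e}" by (intro open_Collect_less continuous_intros)
  then have "openin ?T V" unfolding V_def using F by (intro openin_continuous_map_preimage[OF F]) auto
  moreover have "\<eta> \<in> V" using \<eta> e by (simp add: V_def topspace_vague_topology)
  ultimately have "\<exists>U. finite {i \<in> I. U i \<noteq> topspace vague_topology} \<and> (\<forall>i\<in>I. openin vague_topology (U i)) \<and>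
      \<eta> \<in> PiE I U \<and> PiE I U \<subseteq> V"
    using openin_product_topology_alt[THEN iffD1, THEN bspec] by fast
  then obtain U where U: "\<And>i. i \<in> I \<Longrightarrow> openin vague_topology (U i)" "\<eta> \<in> PiE I U" "PiE I U \<subseteq> V"
    by auto
  have "\<forall>t\<in>I. \<forall>\<^sub>F m in sequentially. \<forall>\<nu>\<in>point_measures. same_counts m (\<eta> t) \<nu> \<longrightarrow> \<nu> \<in> U t"
    using U(1,2) vague_open_same_counts by (auto simp: PiE_iff)
  then have "\<forall>\<^sub>F m in sequentially. \<forall>t\<in>I. \<forall>\<nu>\<in>point_measures. same_counts m (\<eta> t) \<nu> \<longrightarrow> \<nu> \<in> U t"
    by (rule eventually_ball_finite[OF I])
  then show ?thesis
  proof eventually_elim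
    case (elim m)
    show ?case
    proof (intro ballI impI)
      fix \<eta>' assume "\<eta>' \<in> PiE I (\<lambda>_. point_measures)" "\<forall>t\<in>I. same_counts m (\<eta> t) (\<eta>' t)"
      then have "\<eta>' \<in> PiE I U" using elim by (auto simp: PiE_iff)
      then show "\<bar>F \<eta>' - F \<eta>\<bar> < e" using U(3) by (auto simp: V_def)
    qed
  qed
qed

section \<open>From laws of counts to weak convergence\<close>

lemma expectation_finite_approximation:
  fixes H :: "'v \<Rightarrow> real"
  assumes M: "prob_space M" and V: "countable V" and X: "X \<in> measurable M (count_space V)"
    and S: "finite S" "S \<subseteq> V" and H: "\<And>v. v \<in> V \<Longrightarrow> \<bar>H v\<bar> \<le> C"
  shows "\<bar>(\<integral>\<omega>. H (X \<omega>) \<partial>M) - (\<Sum>v\<in>S. H v * measure M {\<omega>\<in>space M. X \<omega> = v})\<bar>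
     \<le> C * (1 - (\<Sum>v\<in>S. measure M {\<omega>\<in>space M. X \<omega> = v}))"
proof -
  interpret prob_space M by (rule M)
  have XV: "X \<omega> \<in> V" if "\<omega> \<in> space M" for \<omega> using measurable_space[OF X that] by simp
  have Am: "{\<omega>\<in>space M. X \<omega> = v} \<in> sets M" if "v \<in> S" for v
    using measurable_sets[OF X, of "{v}"] that S by (simp add: vimage_def Int_def conj_commute subset_iff)
  have Hm: "(\<lambda>\<omega>. H (X \<omega>)) \<in> borel_measurable M"
    by (rule measurable_compose[OF X]) simp
  have intH: "integrable M (\<lambda>\<omega>. H (X \<omega>))"
    by (rule integrable_const_bound[of _ C]) (use Hm H XV in auto)
  have intv: "integrable M (\<lambda>\<omega>. indicator {\<omega>\<in>space M. X \<omega> = v} \<omega> :: real)" if "v \<in> S" for v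
    using Am[OF that] by (simp add: emeasure_eq_measure)
  have intv': "integrable M (\<lambda>\<omega>. f v * indicator {\<omega>\<in>space M. X \<omega> = v} \<omega> :: real)" if "v \<in> S" for v f
    using intv[OF that] by (rule integrable_mult_right)
  have sumv: "(\<Sum>v\<in>S. f v * indicator {\<omega>\<in>space M. X \<omega> = v} \<omega>) = (if X \<omega> \<in> S then f (X \<omega>) else 0)"
    if "\<omega> \<in> space M" for \<omega> and f :: "'v \<Rightarrow> real"
  proof -
    have "(\<Sum>v\<in>S. f v * indicator {\<omega>\<in>space M. X \<omega> = v} \<omega>) = (\<Sum>v\<in>S. if v = X \<omega> then f (X \<omega>) else 0)"
      by (rule sum.cong) (use that in auto)
    then show ?thesis using S by simp
  qed
  have Esum: "(\<integral>\<omega>. (\<Sum>v\<in>S. f v * indicator {\<omega>\<in>space M. X \<omega> = v} \<omega>) \<partial>M) = (\<Sum>v\<in>S. f v * measure M {\<omega>\<in>space M. X \<omega> = v})" for f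
    using intv' Am by (subst Bochner_Integration.integral_sum) auto
  have ints: "integrable M (\<lambda>\<omega>. \<Sum>v\<in>S. f v * indicator {\<omega>\<in>space M. X \<omega> = v} \<omega>)" for f :: "'v \<Rightarrow> real"
    using intv' by simp
  have "(\<integral>\<omega>. H (X \<omega>) \<partial>M) - (\<Sum>v\<in>S. H v * measure M {\<omega>\<in>space M. X \<omega> = v})
     = (\<integral>\<omega>. H (X \<omega>) - (\<Sum>v\<in>S. H v * indicator {\<omega>\<in>space M. X \<omega> = v} \<omega>) \<partial>M)"
    using intH ints by (simp add: Esum)
  also have "\<bar>\<dots>\<bar> \<le> (\<integral>\<omega>. C * (1 - (\<Sum>v\<in>S. 1 * indicator {\<omega>\<in>space M. X \<omega> = v} \<omega>)) \<partial>M)"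
  proof (rule order_trans[OF integral_abs_bound integral_mono])
    show "integrable M (\<lambda>\<omega>. \<bar>H (X \<omega>) - (\<Sum>v\<in>S. H v * indicator {\<omega>\<in>space M. X \<omega> = v} \<omega>)\<bar>)"
      using intH ints by (intro integrable_abs Bochner_Integration.integrable_diff)
    show "integrable M (\<lambda>\<omega>. C * (1 - (\<Sum>v\<in>S. 1 * indicator {\<omega>\<in>space M. X \<omega> = v} \<omega>)))"
      by (intro integrable_mult_right Bochner_Integration.integrable_diff ints integrable_const)
    fix \<omega> assume \<omega>: "\<omega> \<in> space M"
    show "\<bar>H (X \<omega>) - (\<Sum>v\<in>S. H v * indicator {\<omega>\<in>space M. X \<omega> = v} \<omega>)\<bar> \<le> C * (1 - (\<Sum>v\<in>S. 1 * indicator {\<omega>\<in>space M. X \<omega> = v} \<omega>))"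
      unfolding sumv[OF \<omega>] using H[OF XV[OF \<omega>]] by auto
  qed
  also have "\<dots> = C * (1 - (\<Sum>v\<in>S. 1 * measure M {\<omega>\<in>space M. X \<omega> = v}))"
  proof -
    have "(\<integral>\<omega>. C * (1 - (\<Sum>v\<in>S. 1 * indicator {\<omega>\<in>space M. X \<omega> = v} \<omega>)) \<partial>M) =
      C * ((\<integral>\<omega>. 1 \<partial>M) - (\<integral>\<omega>. (\<Sum>v\<in>S. 1 * indicator {\<omega>\<in>space M. X \<omega> = v} \<omega>) \<partial>M))"
      unfolding integral_mult_right_zero
      by (subst Bochner_Integration.integral_diff) (use ints[of "\<lambda>_. 1"] in auto)
    then show ?thesis unfolding Esum by (simp add: prob_space)
  qed
  finally show ?thesis by simp
qed

text \<open>Tightness comes for free because the limiting masses sum to 1: a finite set that carries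
  nearly all of the limiting mass eventually carries nearly all of the mass of \<open>X i\<close>
  too, and on a finite set the expectations converge.\<close>

lemma Scheffe_countable:
  fixes H :: "'v \<Rightarrow> real"
  assumes M: "prob_space M" and M': "prob_space M'" and V: "countable V"
    and X: "\<forall>\<^sub>F i in F. X i \<in> measurable M (count_space V)" and X': "X' \<in> measurable M' (count_space V)"
    and conv: "\<And>v. v \<in> V \<Longrightarrow> ((\<lambda>i. measure M {\<omega>\<in>space M. X i \<omega> = v}) \<longlongrightarrow> measure M' {\<omega>\<in>space M'. X' \<omega> = v}) F"
    and H: "\<And>v. v \<in> V \<Longrightarrow> \<bar>H v\<bar> \<le> C"
  shows "((\<lambda>i. \<integral>\<omega>. H (X i \<omega>) \<partial>M) \<longlongrightarrow> (\<integral>\<omega>. H (X' \<omega>) \<partial>M')) F"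
proof (rule tendstoI)
  interpret M': prob_space M' by (rule M')
  fix \<epsilon> :: real assume \<epsilon>: "0 < \<epsilon>"
  define p where "p i v = measure M {\<omega>\<in>space M. X i \<omega> = v}" for i v
  define p' where "p' v = measure M' {\<omega>\<in>space M'. X' \<omega> = v}" for v
  have XV: "X' \<omega> \<in> V" if "\<omega> \<in> space M'" for \<omega> using measurable_space[OF X' that] by simp
  have ne: "V \<noteq> {}" using M'.not_empty XV by blast
  \<comment> \<open>A strictly positive bound, since the tolerance is divided by it.\<close>
  define C' where "C' = \<bar>C\<bar> + 1"
  have C': "0 < C'" "\<And>v. v \<in> V \<Longrightarrow> \<bar>H v\<bar> \<le> C'" using H by (force simp: C'_def)+
  define S where "S k = from_nat_into V ` {..k}" for k :: nat
  have S: "finite (S k)" "S k \<subseteq> V" for k using from_nat_into[OF ne] by (auto simp: S_def)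
  define E where "E k = {\<omega>\<in>space M'. X' \<omega> \<in> S k}" for k
  have Em: "E k \<in> sets M'" for k
    using measurable_sets[OF X', of "S k"] S by (simp add: E_def vimage_def Int_def conj_commute)
  have "(\<lambda>k. measure M' (E k)) \<longlonglongrightarrow> measure M' (\<Union>k. E k)"
    by (rule M'.finite_Lim_measure_incseq) (use Em in \<open>auto simp: incseq_def E_def S_def\<close>)
  also have "(\<Union>k. E k) = space M'"
  proof -
    have "\<exists>k. X' \<omega> \<in> S k" if "\<omega> \<in> space M'" for \<omega>
      using from_nat_into_surj[OF V XV[OF that]] by (auto simp: S_def intro: image_eqI[OF sym])
    then show ?thesis by (auto simp: E_def)
  qed
  finally have "(\<lambda>k. measure M' (E k)) \<longlonglongrightarrow> 1" by (simp add: M'.prob_space)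
  moreover have "1 - \<epsilon> / (4 * C') < 1" using \<epsilon> C' by simp
  ultimately have "\<forall>\<^sub>F k in sequentially. 1 - \<epsilon> / (4 * C') < measure M' (E k)" by (rule order_tendstoD)
  then obtain k where k: "1 - \<epsilon> / (4 * C') < measure M' (E k)" by (auto simp: eventually_sequentially)
  have "measure M' (E k) = (\<Sum>v\<in>S k. p' v)"
  proof -
    have "E k = (\<Union>v\<in>S k. {\<omega>\<in>space M'. X' \<omega> = v})" by (auto simp: E_def)
    moreover have "{\<omega>\<in>space M'. X' \<omega> = v} \<in> sets M'" if "v \<in> S k" for v
      using measurable_sets[OF X', of "{v}"] that S by (simp add: vimage_def Int_def conj_commute subset_iff)
    ultimately show ?thesis unfolding p'_def
      using S by (auto intro!: M'.finite_measure_finite_Union simp: disjoint_family_on_def)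
  qed
  with k have tail: "C' * (1 - (\<Sum>v\<in>S k. p' v)) < \<epsilon> / 4" using C' by (simp add: field_simps)
  have lim1: "((\<lambda>i. \<Sum>v\<in>S k. H v * p i v) \<longlongrightarrow> (\<Sum>v\<in>S k. H v * p' v)) F"
    unfolding p_def p'_def by (intro tendsto_sum tendsto_mult tendsto_const conv) (use S in auto)
  have lim2: "((\<lambda>i. C' * (1 - (\<Sum>v\<in>S k. p i v))) \<longlongrightarrow> C' * (1 - (\<Sum>v\<in>S k. p' v))) F"
    unfolding p_def p'_def by (intro tendsto_sum tendsto_mult tendsto_diff tendsto_const conv) (use S in auto)
  have "\<forall>\<^sub>F i in F. dist (\<Sum>v\<in>S k. H v * p i v) (\<Sum>v\<in>S k. H v * p' v) < \<epsilon> / 4"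
    using lim1 \<epsilon> by (intro tendstoD) auto
  moreover have "\<forall>\<^sub>F i in F. C' * (1 - (\<Sum>v\<in>S k. p i v)) < \<epsilon> / 4" using lim2 tail by (rule order_tendstoD)
  ultimately show "\<forall>\<^sub>F i in F. dist (\<integral>\<omega>. H (X i \<omega>) \<partial>M) (\<integral>\<omega>. H (X' \<omega>) \<partial>M') < \<epsilon>"
    using X
  proof eventually_elim
    case (elim i)
    have "\<bar>(\<integral>\<omega>. H (X i \<omega>) \<partial>M) - (\<Sum>v\<in>S k. H v * p i v)\<bar> \<le> C' * (1 - (\<Sum>v\<in>S k. p i v))"
      unfolding p_def by (rule expectation_finite_approximation[OF M V elim(3) S C'(2)])
    moreover have "\<bar>(\<integral>\<omega>. H (X' \<omega>) \<partial>M') - (\<Sum>v\<in>S k. H v * p' v)\<bar> \<le> C' * (1 - (\<Sum>v\<in>S k. p' v))"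
      unfolding p'_def by (rule expectation_finite_approximation[OF M' V X' S C'(2)])
    ultimately show ?case using elim(1,2) tail unfolding dist_real_def by linarith
  qed
qed

definition grid_counts :: "'t set \<Rightarrow> nat \<Rightarrow> ('t \<Rightarrow> real measure) \<Rightarrow> 't \<times> int \<Rightarrow> nat" where
  "grid_counts I m \<eta> = (\<lambda>b\<in>I \<times> grid_index m. point_count (\<eta> (fst b)) (grid_cell m (snd b)))"

lemma grid_counts_eq_iff:
  "grid_counts I m \<eta> = grid_counts I m \<eta>' \<longleftrightarrow> (\<forall>t\<in>I. same_counts m (\<eta> t) (\<eta>' t))"
proof -
  have "grid_counts I m \<eta> = grid_counts I m \<eta>' \<longleftrightarrow> (\<forall>b\<in>I \<times> grid_index m.
      point_count (\<eta> (fst b)) (grid_cell m (snd b)) = point_count (\<eta>' (fst b)) (grid_cell m (snd b)))"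
    unfolding grid_counts_def restrict_def fun_eq_iff by metis
  then show ?thesis by (auto simp: same_counts_def)
qed

lemma measurable_point_count:
  assumes "(\<lambda>\<omega>. emeasure (X \<omega>) B) \<in> borel_measurable M"
  shows "(\<lambda>\<omega>. point_count (X \<omega>) B) \<in> measurable M (count_space UNIV)"
proof -
  have "(\<lambda>\<omega>. measure (X \<omega>) B) \<in> borel_measurable M"
    using assms unfolding measure_def by measurable
  then show ?thesis unfolding point_count_def by measurable
qed

lemma measurable_grid_counts:
  assumes I: "finite I" and X: "\<And>t B. t \<in> I \<Longrightarrow> B \<in> sets borel \<Longrightarrow> (\<lambda>\<omega>. emeasure (X t \<omega>) B) \<in> borel_measurable M"
  shows "(\<lambda>\<omega>. grid_counts I m (\<lambda>t\<in>I. X t \<omega>)) \<in> measurable M (count_space (PiE (I \<times> grid_index m) (\<lambda>_. UNIV)))"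
proof -
  have cV: "countable (PiE (I \<times> grid_index m) (\<lambda>_. UNIV :: nat set))" using I by (intro countable_PiE) auto
  have "{\<omega>\<in>space M. grid_counts I m (\<lambda>t\<in>I. X t \<omega>) = v} \<in> sets M"
    if v: "v \<in> PiE (I \<times> grid_index m) (\<lambda>_. UNIV)" for v
  proof -
    have "{\<omega>\<in>space M. grid_counts I m (\<lambda>t\<in>I. X t \<omega>) = v} =
      {\<omega>\<in>space M. \<forall>b\<in>I \<times> grid_index m. point_count (X (fst b) \<omega>) (grid_cell m (snd b)) = v b}"
    proof (intro Collect_cong conj_cong refl)
      fix \<omega>
      have "grid_counts I m (\<lambda>t\<in>I. X t \<omega>) = v \<longleftrightarrow> (\<forall>b\<in>I \<times> grid_index m. grid_counts I m (\<lambda>t\<in>I. X t \<omega>) b = v b)"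
        using v by (intro iffI PiE_ext[of _ _ "\<lambda>_. UNIV"]) (auto simp: grid_counts_def)
      then show "grid_counts I m (\<lambda>t\<in>I. X t \<omega>) = v \<longleftrightarrow>
        (\<forall>b\<in>I \<times> grid_index m. point_count (X (fst b) \<omega>) (grid_cell m (snd b)) = v b)"
        by (auto simp: grid_counts_def)
    qed
    also have "\<dots> \<in> sets M"
    proof (rule sets.sets_Collect_finite_All)
      fix b assume b: "b \<in> I \<times> grid_index m"
      then have "(\<lambda>\<omega>. point_count (X (fst b) \<omega>) (grid_cell m (snd b))) \<in> measurable M (count_space UNIV)"
        by (intro measurable_point_count X) auto
      from measurable_sets[OF this, of "{v b}"]
      show "{\<omega>\<in>space M. point_count (X (fst b) \<omega>) (grid_cell m (snd b)) = v b} \<in> sets M"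
        by (simp add: vimage_def Int_def conj_commute)
    qed (use I in auto)
    finally show ?thesis .
  qed
  then show ?thesis
    unfolding measurable_count_space_eq_countable[OF cV]
    by (auto simp: grid_counts_def vimage_def Int_def conj_commute)
qed

text \<open>\<open>F\<close> lies below \<open>H m\<close>, its supremum over all configurations
  with the given counts, and \<open>H m\<close> of the counts tends to \<open>F\<close> by
  continuity. For fixed \<open>m\<close> the expectation of \<open>H m\<close> converges by
  \<open>Scheffe_countable\<close>; for the limit process dominated convergence lets
  \<open>m\<close> grow. Only the upper bound is proved, because it is applied to \<open>F\<close>
  and to its negative.\<close>

lemma expectation_upper_limit:
  fixes F :: "('t \<Rightarrow> real measure) \<Rightarrow> real"
  assumes M: "prob_space M" and M': "prob_space M'" and I: "finite I"
    and X: "\<forall>\<^sub>F i in \<F>. \<forall>t\<in>I. (\<forall>\<omega>\<in>space M. X i t \<omega> \<in> point_measures) \<and>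
       (\<forall>B\<in>sets borel. (\<lambda>\<omega>. emeasure (X i t \<omega>) B) \<in> borel_measurable M)"
    and Z: "\<forall>t\<in>I. (\<forall>\<omega>\<in>space M'. Z t \<omega> \<in> point_measures) \<and>
       (\<forall>B\<in>sets borel. (\<lambda>\<omega>. emeasure (Z t \<omega>) B) \<in> borel_measurable M')"
    and conv: "\<And>m v. ((\<lambda>i. measure M {\<omega>\<in>space M. \<forall>b\<in>I \<times> grid_index m. point_count (X i (fst b) \<omega>) (grid_cell m (snd b)) = v b})
       \<longlongrightarrow> measure M' {\<omega>\<in>space M'. \<forall>b\<in>I \<times> grid_index m. point_count (Z (fst b) \<omega>) (grid_cell m (snd b)) = v b}) \<F>"
    and F: "continuous_map (product_topology (\<lambda>_. vague_topology) I) euclideanreal F"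
    and C: "\<And>\<eta>. \<eta> \<in> PiE I (\<lambda>_. point_measures) \<Longrightarrow> \<bar>F \<eta>\<bar> \<le> C"
    and e: "0 < e"
  shows "\<forall>\<^sub>F i in \<F>. (\<integral>\<omega>. F (\<lambda>t\<in>I. X i t \<omega>) \<partial>M) < (\<integral>\<omega>. F (\<lambda>t\<in>I. Z t \<omega>) \<partial>M') + e"
proof -
  interpret M: prob_space M by (rule M)
  interpret M': prob_space M' by (rule M')
  define V where "V m = PiE (I \<times> grid_index m) (\<lambda>_. UNIV :: nat set)" for m
  have cV: "countable (V m)" for m using I unfolding V_def by (intro countable_PiE) auto
  \<comment> \<open>Inserting \<open>- C\<close> keeps the supremum meaningful for count vectors
    that no configuration realises.\<close>
  define H where "H m v = Sup (insert (- C) {F \<eta> |\<eta>. \<eta> \<in> PiE I (\<lambda>_. point_measures) \<and> grid_counts I m \<eta> = v})" for m v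
  have C0: "0 \<le> C"
  proof -
    obtain \<omega> where "\<omega> \<in> space M'" using M'.not_empty by blast
    then have "(\<lambda>t\<in>I. Z t \<omega>) \<in> PiE I (\<lambda>_. point_measures)" using Z by auto
    then show ?thesis using C abs_ge_zero order_trans by blast
  qed
  have bdd: "bdd_above (insert (- C) {F \<eta> |\<eta>. \<eta> \<in> PiE I (\<lambda>_. point_measures) \<and> grid_counts I m \<eta> = v})" for m v
    by (rule bdd_aboveI[of _ C]) (use C C0 in \<open>auto simp: abs_le_iff\<close>)
  have Hb: "\<bar>H m v\<bar> \<le> C" for m v
  proof -
    have "- C \<le> H m v" unfolding H_def by (rule cSup_upper[OF _ bdd]) simp
    moreover have "H m v \<le> C" unfolding H_def
      by (rule cSup_least) (use C C0 in \<open>auto simp: abs_le_iff\<close>)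
    ultimately show ?thesis by (simp add: abs_le_iff)
  qed
  have FH: "F \<eta> \<le> H m (grid_counts I m \<eta>)" if "\<eta> \<in> PiE I (\<lambda>_. point_measures)" for m \<eta>
    unfolding H_def by (rule cSup_upper[OF _ bdd]) (use that in auto)
  have Hlim: "(\<lambda>m. H m (grid_counts I m \<eta>)) \<longlonglongrightarrow> F \<eta>" if \<eta>: "\<eta> \<in> PiE I (\<lambda>_. point_measures)" for \<eta>
  proof (rule tendstoI)
    fix \<epsilon> :: real assume \<epsilon>: "0 < \<epsilon>"
    have "\<forall>\<^sub>F m in sequentially. \<forall>\<eta>'\<in>PiE I (\<lambda>_. point_measures).
       (\<forall>t\<in>I. same_counts m (\<eta> t) (\<eta>' t)) \<longrightarrow> \<bar>F \<eta>' - F \<eta>\<bar> < \<epsilon> / 2"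
      using \<epsilon> by (intro continuous_map_same_counts[OF I F \<eta>]) simp
    then show "\<forall>\<^sub>F m in sequentially. dist (H m (grid_counts I m \<eta>)) (F \<eta>) < \<epsilon>"
    proof eventually_elim
      case (elim m)
      have "H m (grid_counts I m \<eta>) \<le> F \<eta> + \<epsilon> / 2" unfolding H_def
      proof (rule cSup_least)
        fix y assume "y \<in> insert (- C) {F \<eta>' |\<eta>'. \<eta>' \<in> PiE I (\<lambda>_. point_measures) \<and> grid_counts I m \<eta>' = grid_counts I m \<eta>}"
        then consider "y = - C" | \<eta>' where "y = F \<eta>'" "\<eta>' \<in> PiE I (\<lambda>_. point_measures)" "grid_counts I m \<eta> = grid_counts I m \<eta>'"
          by auto
        then show "y \<le> F \<eta> + \<epsilon> / 2"
        proof cases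
          case 1
          then show ?thesis using C[OF \<eta>] \<epsilon> by (simp add: abs_le_iff)
        next
          case 2
          have "\<bar>F \<eta>' - F \<eta>\<bar> < \<epsilon> / 2"
            by (rule elim[THEN bspec, OF 2(2), THEN mp, OF 2(3)[unfolded grid_counts_eq_iff]])
          then show ?thesis unfolding 2(1) by linarith
        qed
      qed simp
      then show ?case using FH[OF \<eta>, of m] \<epsilon> by (simp add: dist_real_def)
    qed
  qed
  have meas: "(\<lambda>\<omega>. H m (grid_counts I m (\<lambda>t\<in>I. Y t \<omega>))) \<in> borel_measurable P \<and>
      (\<lambda>\<omega>. F (\<lambda>t\<in>I. Y t \<omega>)) \<in> borel_measurable P \<and> (\<lambda>\<omega>. grid_counts I m (\<lambda>t\<in>I. Y t \<omega>)) \<in> measurable P (count_space (V m))"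
    if Y: "\<forall>t\<in>I. (\<forall>\<omega>\<in>space P. Y t \<omega> \<in> point_measures) \<and> (\<forall>B\<in>sets borel. (\<lambda>\<omega>. emeasure (Y t \<omega>) B) \<in> borel_measurable P)"
    for Y and P :: "'p measure" and m
  proof -
    have 1: "(\<lambda>\<omega>. grid_counts I m (\<lambda>t\<in>I. Y t \<omega>)) \<in> measurable P (count_space (V m))" for m
      unfolding V_def by (rule measurable_grid_counts[OF I]) (use Y in auto)
    have 2: "(\<lambda>\<omega>. H m (grid_counts I m (\<lambda>t\<in>I. Y t \<omega>))) \<in> borel_measurable P" for m
      by (rule measurable_compose[OF 1[of m]]) simp
    \<comment> \<open>A vaguely continuous \<open>F\<close> is measurable for the evaluations
      because it is a pointwise limit of functions of finitely many counts.\<close>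
    have "(\<lambda>\<omega>. F (\<lambda>t\<in>I. Y t \<omega>)) \<in> borel_measurable P"
      by (rule borel_measurable_LIMSEQ_real[OF Hlim 2]) (use Y in auto)
    with 1 2 show ?thesis by simp
  qed
  note measZ = meas[OF Z]
  have "(\<lambda>m. \<integral>\<omega>. H m (grid_counts I m (\<lambda>t\<in>I. Z t \<omega>)) \<partial>M') \<longlonglongrightarrow> (\<integral>\<omega>. F (\<lambda>t\<in>I. Z t \<omega>) \<partial>M')"
  proof (rule integral_dominated_convergence[where w = "\<lambda>_. C"])
    show "AE \<omega> in M'. (\<lambda>m. H m (grid_counts I m (\<lambda>t\<in>I. Z t \<omega>))) \<longlonglongrightarrow> F (\<lambda>t\<in>I. Z t \<omega>)"
      by (rule AE_I2, rule Hlim) (use Z in auto)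
  qed (use measZ Hb in auto)
  then have "\<forall>\<^sub>F m in sequentially. (\<integral>\<omega>. H m (grid_counts I m (\<lambda>t\<in>I. Z t \<omega>)) \<partial>M') < (\<integral>\<omega>. F (\<lambda>t\<in>I. Z t \<omega>) \<partial>M') + e"
    by (rule order_tendstoD) (use e in simp)
  then obtain m where m: "(\<integral>\<omega>. H m (grid_counts I m (\<lambda>t\<in>I. Z t \<omega>)) \<partial>M') < (\<integral>\<omega>. F (\<lambda>t\<in>I. Z t \<omega>) \<partial>M') + e"
    by (auto simp: eventually_sequentially)
  have "((\<lambda>i. \<integral>\<omega>. H m (grid_counts I m (\<lambda>t\<in>I. X i t \<omega>)) \<partial>M) \<longlongrightarrow> (\<integral>\<omega>. H m (grid_counts I m (\<lambda>t\<in>I. Z t \<omega>)) \<partial>M')) \<F>"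
  proof (rule Scheffe_countable[OF M M' cV[of m]])
    show "\<forall>\<^sub>F i in \<F>. (\<lambda>\<omega>. grid_counts I m (\<lambda>t\<in>I. X i t \<omega>)) \<in> measurable M (count_space (V m))"
      using X by eventually_elim (use meas in blast)
    show "(\<lambda>\<omega>. grid_counts I m (\<lambda>t\<in>I. Z t \<omega>)) \<in> measurable M' (count_space (V m))" using measZ by blast
    fix v assume v: "v \<in> V m"
    have eq: "grid_counts I m (\<lambda>t\<in>I. Y t) = v \<longleftrightarrow> (\<forall>b\<in>I \<times> grid_index m. point_count (Y (fst b)) (grid_cell m (snd b)) = v b)" for Y
    proof -
      have "grid_counts I m (\<lambda>t\<in>I. Y t) = v \<longleftrightarrow> (\<forall>b\<in>I \<times> grid_index m. grid_counts I m (\<lambda>t\<in>I. Y t) b = v b)"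
        using v unfolding V_def by (intro iffI PiE_ext[of _ _ "\<lambda>_. UNIV"]) (auto simp: grid_counts_def)
      then show ?thesis by (auto simp: grid_counts_def)
    qed
    show "((\<lambda>i. measure M {\<omega>\<in>space M. grid_counts I m (\<lambda>t\<in>I. X i t \<omega>) = v}) \<longlongrightarrow>
       measure M' {\<omega>\<in>space M'. grid_counts I m (\<lambda>t\<in>I. Z t \<omega>) = v}) \<F>"
      unfolding eq by (rule conv)
  qed (rule Hb)
  then have "\<forall>\<^sub>F i in \<F>. (\<integral>\<omega>. H m (grid_counts I m (\<lambda>t\<in>I. X i t \<omega>)) \<partial>M) < (\<integral>\<omega>. F (\<lambda>t\<in>I. Z t \<omega>) \<partial>M') + e"
    using m by (rule order_tendstoD)
  then show ?thesis using X
  proof eventually_elim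
    case (elim i)
    have pm: "(\<lambda>t\<in>I. X i t \<omega>) \<in> PiE I (\<lambda>_. point_measures)" if "\<omega> \<in> space M" for \<omega> using elim(2) that by auto
    have "(\<integral>\<omega>. F (\<lambda>t\<in>I. X i t \<omega>) \<partial>M) \<le> (\<integral>\<omega>. H m (grid_counts I m (\<lambda>t\<in>I. X i t \<omega>)) \<partial>M)"
    proof (rule integral_mono)
      show "integrable M (\<lambda>\<omega>. F (\<lambda>t\<in>I. X i t \<omega>))"
        by (rule M.integrable_const_bound[of _ C]) (use meas[OF elim(2)] C pm in auto)
      show "integrable M (\<lambda>\<omega>. H m (grid_counts I m (\<lambda>t\<in>I. X i t \<omega>)))"
        by (rule M.integrable_const_bound[of _ C]) (use meas[OF elim(2)] Hb in auto)
    qed (use FH pm in blast)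
    with elim(1) show ?case by simp
  qed
qed

text \<open>The one-sided bound \<open>expectation_upper_limit\<close>, applied to \<open>F\<close>
  and to \<open>- F\<close>, squeezes the expectations.\<close>

lemma fdd_converges_of_counts:
  fixes X :: "'i \<Rightarrow> 't \<Rightarrow> 'w \<Rightarrow> real measure" and Z :: "'t \<Rightarrow> 'v \<Rightarrow> real measure"
  assumes M: "prob_space M" and M': "prob_space M'"
    and X: "\<And>t. \<forall>\<^sub>F i in \<F>. (\<forall>\<omega>\<in>space M. X i t \<omega> \<in> point_measures) \<and>
       (\<forall>B\<in>sets borel. (\<lambda>\<omega>. emeasure (X i t \<omega>) B) \<in> borel_measurable M)"
    and Z: "\<And>t. (\<forall>\<omega>\<in>space M'. Z t \<omega> \<in> point_measures) \<and>
       (\<forall>B\<in>sets borel. (\<lambda>\<omega>. emeasure (Z t \<omega>) B) \<in> borel_measurable M')"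
    and conv: "\<And>I m v. finite I \<Longrightarrow>
      ((\<lambda>i. measure M {\<omega>\<in>space M. \<forall>b\<in>I \<times> grid_index m. point_count (X i (fst b) \<omega>) (grid_cell m (snd b)) = v b})
       \<longlongrightarrow> measure M' {\<omega>\<in>space M'. \<forall>b\<in>I \<times> grid_index m. point_count (Z (fst b) \<omega>) (grid_cell m (snd b)) = v b}) \<F>"
  shows "fdd_converges \<F> M X M' Z"
  unfolding fdd_converges_def
proof (intro allI impI, elim conjE)
  fix I :: "'t set" and F :: "('t \<Rightarrow> real measure) \<Rightarrow> real"
  assume I: "finite I" and F: "continuous_map (product_topology (\<lambda>_. vague_topology) I) euclideanreal F"
    and bdd: "bounded (F ` topspace (product_topology (\<lambda>_. vague_topology) I))"
  obtain C where "\<forall>y\<in>F ` topspace (product_topology (\<lambda>_. vague_topology) I). norm y \<le> C"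
    using bdd unfolding bounded_iff by blast
  then have C: "\<bar>F \<eta>\<bar> \<le> C" if "\<eta> \<in> PiE I (\<lambda>_. point_measures)" for \<eta>
    using that by (simp add: topspace_vague_topology)
  have X': "\<forall>\<^sub>F i in \<F>. \<forall>t\<in>I. (\<forall>\<omega>\<in>space M. X i t \<omega> \<in> point_measures) \<and>
       (\<forall>B\<in>sets borel. (\<lambda>\<omega>. emeasure (X i t \<omega>) B) \<in> borel_measurable M)"
    by (rule eventually_ball_finite[OF I]) (use X in blast)
  have Z': "\<forall>t\<in>I. (\<forall>\<omega>\<in>space M'. Z t \<omega> \<in> point_measures) \<and>
       (\<forall>B\<in>sets borel. (\<lambda>\<omega>. emeasure (Z t \<omega>) B) \<in> borel_measurable M')" using Z by blast
  have F': "continuous_map (product_topology (\<lambda>_. vague_topology) I) euclideanreal (\<lambda>\<eta>. - F \<eta>)"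
    using F by (rule continuous_map_minus)
  show "((\<lambda>i. \<integral>\<omega>. F (\<lambda>t\<in>I. X i t \<omega>) \<partial>M) \<longlongrightarrow> (\<integral>\<omega>. F (\<lambda>t\<in>I. Z t \<omega>) \<partial>M')) \<F>"
  proof (rule tendstoI)
    fix e :: real assume e: "0 < e"
    have "\<forall>\<^sub>F i in \<F>. (\<integral>\<omega>. F (\<lambda>t\<in>I. X i t \<omega>) \<partial>M) < (\<integral>\<omega>. F (\<lambda>t\<in>I. Z t \<omega>) \<partial>M') + e"
      by (rule expectation_upper_limit[OF M M' I X' Z' conv[OF I] F C e])
    moreover have "\<forall>\<^sub>F i in \<F>. (\<integral>\<omega>. - F (\<lambda>t\<in>I. X i t \<omega>) \<partial>M) < (\<integral>\<omega>. - F (\<lambda>t\<in>I. Z t \<omega>) \<partial>M') + e"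
      by (rule expectation_upper_limit[OF M M' I X' Z' conv[OF I] F' _ e]) (use C in auto)
    ultimately show "\<forall>\<^sub>F i in \<F>. dist (\<integral>\<omega>. F (\<lambda>t\<in>I. X i t \<omega>) \<partial>M) (\<integral>\<omega>. F (\<lambda>t\<in>I. Z t \<omega>) \<partial>M') < e"
      by eventually_elim (simp add: dist_real_def abs_less_iff)
  qed
qed

section \<open>Convergence of determinantal processes from convergence of kernels\<close>

lemma prod_lessThan_add: "(\<Prod>i<n + k. f i) = (\<Prod>i<n. f i) * (\<Prod>l<k. f (n + l))"
  for f :: "nat \<Rightarrow> 'a::comm_monoid_mult"
  by (induction k) (simp_all add: mult.assoc)

lemma point_count_UN:
  assumes \<mu>: "\<mu> \<in> point_measures" and J: "finite J" and B: "\<And>k. k \<in> J \<Longrightarrow> B k \<in> sets borel" "\<And>k. k \<in> J \<Longrightarrow> bounded (B k)"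
    and disj: "disjoint_family_on B J"
  shows "point_count \<mu> (\<Union>k\<in>J. B k) = (\<Sum>k\<in>J. point_count \<mu> (B k))"
proof -
  have s: "sets \<mu> = sets borel" using \<mu> by (simp add: point_measures_def)
  have "(of_nat (point_count \<mu> (\<Union>k\<in>J. B k)) :: ennreal) = emeasure \<mu> (\<Union>k\<in>J. B k)"
    by (rule emeasure_point_measure[OF \<mu>, symmetric]) (use J B in auto)
  also have "\<dots> = (\<Sum>k\<in>J. emeasure \<mu> (B k))"
    by (rule sum_emeasure[symmetric]) (use J B disj s in auto)
  also have "\<dots> = (\<Sum>k\<in>J. of_nat (point_count \<mu> (B k)))"
    by (intro sum.cong refl emeasure_point_measure \<mu> B)
  also have "\<dots> = of_nat (\<Sum>k\<in>J. point_count \<mu> (B k))" by (rule of_nat_sum[symmetric])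
  finally show ?thesis by (simp only: of_nat_eq_iff)
qed

lemma emeasure_distr_scale:
  assumes "\<mu> \<in> point_measures" "B \<in> sets borel"
  shows "emeasure (distr \<mu> borel (\<lambda>x. x / \<sigma>)) B = emeasure \<mu> ((\<lambda>x. x / \<sigma>) -` B)"
proof -
  have s: "sets \<mu> = sets borel" using assms by (simp add: point_measures_def)
  then have sp: "space \<mu> = UNIV" using sets_eq_imp_space_eq[OF s] by simp
  show ?thesis using assms by (subst emeasure_distr) (auto simp: sp s cong: measurable_cong_sets)
qed

lemma point_measures_distr_scale:
  assumes \<mu>: "\<mu> \<in> point_measures" and \<sigma>: "0 < \<sigma>"
  shows "distr \<mu> borel (\<lambda>x. x / \<sigma>) \<in> point_measures"
proof -
  have "emeasure (distr \<mu> borel (\<lambda>x. x / \<sigma>)) B \<in> \<nat>" if B: "B \<in> sets borel" "bounded B" for B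
  proof -
    have "(\<lambda>x. x / \<sigma>) -` B \<in> sets borel"
      using measurable_sets_borel[of "\<lambda>x. x / \<sigma>" borel B] B by simp
    moreover have "bounded ((\<lambda>x. x / \<sigma>) -` B)"
    proof -
      have "(\<lambda>x. x / \<sigma>) -` B \<subseteq> (\<lambda>x. \<sigma> *\<^sub>R x) ` B"
      proof
        fix x assume "x \<in> (\<lambda>x. x / \<sigma>) -` B"
        then have "x / \<sigma> \<in> B" "x = \<sigma> *\<^sub>R (x / \<sigma>)" using \<sigma> by auto
        then show "x \<in> (\<lambda>x. \<sigma> *\<^sub>R x) ` B" by blast
      qed
      then show ?thesis using bounded_scaling[OF B(2)] bounded_subset by blast
    qed
    ultimately show ?thesis using \<mu> emeasure_distr_scale[OF \<mu> B(1)] by (auto simp: point_measures_def)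
  qed
  then show ?thesis by (simp add: point_measures_def)
qed

text \<open>The cells of the pattern followed by copies of the whole space-time window. For a
  pattern of grid cells this family is laminar, and its factorial moments are the quantities of the
  Bonferroni inequality: the pattern product times a falling factorial of the total count, shifted
  by \<open>n\<close>.\<close>

definition pattern_sets :: "real set \<Rightarrow> nat \<Rightarrow> (nat \<Rightarrow> real \<times> int) \<Rightarrow> nat \<Rightarrow> nat \<Rightarrow> (real \<times> real) set" where
  "pattern_sets I m c n i = (if i < n then {fst (c i)} \<times> grid_cell m (snd (c i))
     else I \<times> (\<Union>k\<in>grid_index m. grid_cell m k))"

lemma grid_window_subset: "(\<Union>k\<in>grid_index m. grid_cell m k) \<subseteq> {- real m..real m}"
proof
  fix x assume "x \<in> (\<Union>k\<in>grid_index m. grid_cell m k)"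
  then have "- (int m * 2 ^ m) \<le> \<lfloor>x * 2 ^ m\<rfloor>" "\<lfloor>x * 2 ^ m\<rfloor> < int m * 2 ^ m"
    by (auto simp: grid_index_def grid_cell_iff)
  then have "- (real m * 2 ^ m) \<le> x * 2 ^ m" "x * 2 ^ m < real m * 2 ^ m"
    by (auto simp: le_floor_iff floor_less_iff)
  then have "- real m \<le> x" "x < real m"
    using mult_le_cancel_right[of "- real m" "2 ^ m" x] by (auto simp: mult_less_cancel_right)
  then show "x \<in> {- real m..real m}" by simp
qed

lemma pattern_sets_properties:
  assumes I: "finite I" and c: "\<And>i. i < n \<Longrightarrow> c i \<in> I \<times> grid_index m"
  shows "pattern_sets I m c n i \<in> sets (count_space I \<Otimes>\<^sub>M borel)"
    and "bounded (pattern_sets I m c n i)"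
    and "j < i \<Longrightarrow> pattern_sets I m c n j \<subseteq> pattern_sets I m c n i \<or> pattern_sets I m c n j \<inter> pattern_sets I m c n i = {}"
    and "i < n \<Longrightarrow> j < i \<Longrightarrow> pattern_sets I m c n j \<subseteq> pattern_sets I m c n i \<longleftrightarrow> c j = c i"
    and "n \<le> i \<Longrightarrow> pattern_sets I m c n j \<subseteq> pattern_sets I m c n i"
    and "pattern_sets I m c n i \<subseteq> I \<times> {- real m..real m}"
proof -
  let ?W = "\<Union>k\<in>grid_index m. grid_cell m k"
  have W: "?W \<in> sets borel" by (intro sets.finite_UN) auto
  have cI: "fst (c i) \<in> I" "snd (c i) \<in> grid_index m" if "i < n" for i using c[OF that] by auto
  show "pattern_sets I m c n i \<in> sets (count_space I \<Otimes>\<^sub>M borel)"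
    unfolding pattern_sets_def using cI W by (auto intro!: pair_measureI)
  have sub: "pattern_sets I m c n i \<subseteq> I \<times> ?W" for i
    using cI by (auto simp: pattern_sets_def)
  then show 6: "pattern_sets I m c n i \<subseteq> I \<times> {- real m..real m}"
    using Sigma_mono[OF order_refl grid_window_subset[of m], of I] by (rule order_trans)
  show "bounded (pattern_sets I m c n i)"
    by (rule bounded_subset[OF bounded_Times 6]) (use I finite_imp_bounded in auto)
  show 5: "pattern_sets I m c n j \<subseteq> pattern_sets I m c n i" if "n \<le> i" for i j
    using sub that by (simp add: pattern_sets_def)
  have dj: "c j = c i \<or> pattern_sets I m c n j \<inter> pattern_sets I m c n i = {}" if "i < n" "j < n" for i j
  proof (cases "fst (c j) = fst (c i)")
    case True
    show ?thesis
    proof (cases "snd (c j) = snd (c i)")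
      case False
      then have "grid_cell m (snd (c j)) \<inter> grid_cell m (snd (c i)) = {}" by (rule grid_cells_disjoint)
      then show ?thesis using that by (simp add: pattern_sets_def Times_Int_Times)
    qed (simp add: True prod_eq_iff)
  next
    case False
    then show ?thesis using that by (simp add: pattern_sets_def Times_Int_Times)
  qed
  have ne: "pattern_sets I m c n j \<noteq> {}" if "j < n" for j
    using that grid_cell_nonempty[of "snd (c j)" m] by (auto simp: pattern_sets_def)
  have eq: "pattern_sets I m c n j = pattern_sets I m c n i" if "i < n" "j < n" "c j = c i" for i j
    using that by (simp add: pattern_sets_def)
  show "pattern_sets I m c n j \<subseteq> pattern_sets I m c n i \<longleftrightarrow> c j = c i" if "i < n" "j < i"
    using dj[of i j] ne[of j] eq[of i j] that by auto
  show "pattern_sets I m c n j \<subseteq> pattern_sets I m c n i \<or> pattern_sets I m c n j \<inter> pattern_sets I m c n i = {}" if "j < i"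
  proof (cases "i < n")
    case True
    then show ?thesis using dj[of i j] eq[of i j] that by auto
  next
    case False
    then show ?thesis using 5[of i j] by simp
  qed
qed

lemma space_time_count_cell:
  assumes "finite I" "t \<in> I"
  shows "space_time_count I \<eta> ({t} \<times> B) = point_count (\<eta> t) B"
proof -
  have "space_time_count I \<eta> ({t} \<times> B) = (\<Sum>s\<in>I. if s = t then point_count (\<eta> t) B else 0)"
    unfolding space_time_count_def
    by (rule sum.cong) (auto simp: vimage_def point_count_def)
  then show ?thesis using assms by simp
qed

lemma space_time_count_window:
  assumes I: "finite I" and pm: "\<And>t. t \<in> I \<Longrightarrow> \<eta> t \<in> point_measures"
  shows "space_time_count I \<eta> (I \<times> (\<Union>k\<in>grid_index m. grid_cell m k)) =
    (\<Sum>b\<in>I \<times> grid_index m. point_count (\<eta> (fst b)) (grid_cell m (snd b)))"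
proof -
  have "space_time_count I \<eta> (I \<times> (\<Union>k\<in>grid_index m. grid_cell m k)) = (\<Sum>t\<in>I. point_count (\<eta> t) (\<Union>k\<in>grid_index m. grid_cell m k))"
    unfolding space_time_count_def by (rule sum.cong) (auto simp: vimage_def intro!: arg_cong[where f = "point_count _"])
  also have "\<dots> = (\<Sum>t\<in>I. \<Sum>k\<in>grid_index m. point_count (\<eta> t) (grid_cell m k))"
    by (intro sum.cong refl point_count_UN pm) (auto simp: disjoint_family_on_def grid_cells_disjoint)
  also have "\<dots> = (\<Sum>b\<in>I \<times> grid_index m. point_count (\<eta> (fst b)) (grid_cell m (snd b)))"
    by (simp add: sum.cartesian_product case_prod_unfold)
  finally show ?thesis .
qed

text \<open>The density of the joint factorial moment of the cell counts.\<close>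

definition moment_density ::
  "real set \<Rightarrow> nat \<Rightarrow> (nat \<Rightarrow> real \<times> int) \<Rightarrow> nat \<Rightarrow> nat \<Rightarrow> (real \<times> real \<Rightarrow> real \<times> real \<Rightarrow> complex) \<Rightarrow> (nat \<Rightarrow> real \<times> real) \<Rightarrow> real" where
  "moment_density I m c n k \<kappa> p = (\<Prod>i<n + k. indicator (pattern_sets I m c n i) (p i)) *
     max 0 (Re (Determinant.det (Matrix.mat (n + k) (n + k) (\<lambda>(i, j). \<kappa> (p i) (p j)))))"

text \<open>Hadamard's inequality where all the indicators are 1. The truncation
  \<open>max 0\<close> in the density mirrors \<open>ennreal\<close>, which sends negative reals to
  0, so the density is non-negative everywhere while the correlation function is so only almost
  everywhere.\<close>

lemma moment_density_bound:
  assumes I: "finite I" and c: "\<And>i. i < n \<Longrightarrow> c i \<in> I \<times> grid_index m"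
    and \<kappa>: "\<And>x y. x \<in> I \<times> {- real m..real m} \<Longrightarrow> y \<in> I \<times> {- real m..real m} \<Longrightarrow> norm (\<kappa> x y) \<le> C"
  shows "0 \<le> moment_density I m c n k \<kappa> p"
    and "0 \<le> C \<Longrightarrow> moment_density I m c n k \<kappa> p \<le> (C * sqrt (real (n + k))) ^ (n + k) * (\<Prod>i<n + k. indicator (I \<times> {- real m..real m}) (p i))"
proof -
  show "0 \<le> moment_density I m c n k \<kappa> p"
    unfolding moment_density_def by (intro mult_nonneg_nonneg prod_nonneg) auto
  assume C: "0 \<le> C"
  have sub: "pattern_sets I m c n i \<subseteq> I \<times> {- real m..real m}" for i
    using I c by (rule pattern_sets_properties(6))
  show "moment_density I m c n k \<kappa> p \<le> (C * sqrt (real (n + k))) ^ (n + k) * (\<Prod>i<n + k. indicator (I \<times> {- real m..real m}) (p i))"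
  proof (cases "\<forall>i<n + k. p i \<in> pattern_sets I m c n i")
    case True
    have pI: "p i \<in> I \<times> {- real m..real m}" if "i < n + k" for i
      by (rule subsetD[OF sub True[rule_format, OF that]])
    have "norm (Determinant.det (Matrix.mat (n + k) (n + k) (\<lambda>(i, j). \<kappa> (p i) (p j)))) \<le> (C * sqrt (real (n + k))) ^ (n + k)"
      by (rule Hadamard_inequality) (use \<kappa> pI in auto)
    then have "max 0 (Re (Determinant.det (Matrix.mat (n + k) (n + k) (\<lambda>(i, j). \<kappa> (p i) (p j))))) \<le> (C * sqrt (real (n + k))) ^ (n + k)"
      using complex_Re_le_cmod order_trans C by (simp add: order_trans[OF complex_Re_le_cmod])
    moreover have "(\<Prod>i<n + k. indicator (pattern_sets I m c n i) (p i)) = (1 :: real)"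
      using True by (intro prod.neutral) auto
    moreover have "(\<Prod>i<n + k. indicator (I \<times> {- real m..real m}) (p i)) = (1 :: real)"
      using pI by (intro prod.neutral) auto
    ultimately show ?thesis by (simp add: moment_density_def)
  next
    case False
    then obtain i where "i < n + k" "p i \<notin> pattern_sets I m c n i" by auto
    then have z: "(\<Prod>i<n + k. indicator (pattern_sets I m c n i) (p i)) = (0 :: real)"
      by (intro prod_zero bexI[of _ i]) auto
    show ?thesis unfolding moment_density_def z
      using C by (simp only: mult_zero_left) (intro mult_nonneg_nonneg zero_le_power prod_nonneg, auto)
  qed
qed

lemma window_indicator_integral:
  fixes I :: "real set" and m :: nat
  assumes I: "finite I"
  defines "w \<equiv> \<lambda>N p. \<Prod>i<N. indicator (I \<times> {- real m..real m}) (p i) :: real"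
  shows "integrable (Pi\<^sub>M {..<N} (\<lambda>_. count_space I \<Otimes>\<^sub>M lborel)) (w N)"
    and "(\<integral>p. w N p \<partial>Pi\<^sub>M {..<N} (\<lambda>_. count_space I \<Otimes>\<^sub>M lborel)) = (real (card I) * (2 * real m)) ^ N"
proof -
  interpret product_sigma_finite "\<lambda>_::nat. count_space I \<Otimes>\<^sub>M (lborel :: real measure)"
    by (rule product_sigma_finite.intro) (rule sigma_finite_space_time[OF I])
  have W: "I \<times> {- real m..real m} \<in> sets (count_space I \<Otimes>\<^sub>M lborel)" by (rule pair_measureI) auto
  have "emeasure (count_space I \<Otimes>\<^sub>M lborel) (I \<times> {- real m..real m}) = emeasure (count_space I) I * emeasure lborel {- real m..real m}"
    by (rule lborel.emeasure_pair_measure_Times) auto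
  also have "\<dots> = ennreal (real (card I) * (2 * real m))"
    using I by (simp add: ennreal_of_nat_eq_real_of_nat ennreal_mult)
  finally have em: "emeasure (count_space I \<Otimes>\<^sub>M lborel) (I \<times> {- real m..real m}) = ennreal (real (card I) * (2 * real m))" .
  then have int1: "integrable (count_space I \<Otimes>\<^sub>M lborel) (indicator (I \<times> {- real m..real m}) :: real \<times> real \<Rightarrow> real)"
    using W by (simp add: integrable_indicator_iff)
  show "integrable (Pi\<^sub>M {..<N} (\<lambda>_. count_space I \<Otimes>\<^sub>M lborel)) (w N)"
    unfolding w_def by (rule product_integrable_prod) (use int1 in auto)
  have "(\<integral>p. w N p \<partial>Pi\<^sub>M {..<N} (\<lambda>_. count_space I \<Otimes>\<^sub>M lborel)) =
     (\<Prod>i<N. \<integral>q. indicator (I \<times> {- real m..real m}) q \<partial>(count_space I \<Otimes>\<^sub>M lborel))"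
    unfolding w_def by (rule product_integral_prod) (use int1 in auto)
  also have "\<dots> = (real (card I) * (2 * real m)) ^ N"
    using W em by (simp add: measure_def)
  finally show "(\<integral>p. w N p \<partial>Pi\<^sub>M {..<N} (\<lambda>_. count_space I \<Otimes>\<^sub>M lborel)) = (real (card I) * (2 * real m)) ^ N" .
qed

lemma moment_density_measurable:
  assumes I: "finite I" and c: "\<And>i. i < n \<Longrightarrow> c i \<in> I \<times> grid_index m"
    and meas: "(\<lambda>p. Determinant.det (Matrix.mat (n + k) (n + k) (\<lambda>(i, j). \<kappa> (p i) (p j)))) \<in>
       borel_measurable (Pi\<^sub>M {..<n + k} (\<lambda>_. count_space I \<Otimes>\<^sub>M lborel))"
  shows "moment_density I m c n k \<kappa> \<in> borel_measurable (Pi\<^sub>M {..<n + k} (\<lambda>_. count_space I \<Otimes>\<^sub>M lborel))"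
proof -
  have "(\<lambda>p. indicator (pattern_sets I m c n i) (p i) :: real) \<in> borel_measurable (Pi\<^sub>M {..<n + k} (\<lambda>_. count_space I \<Otimes>\<^sub>M lborel))"
    if "i < n + k" for i
  proof (rule measurable_compose[OF measurable_component_singleton[of i]])
    show "(indicator (pattern_sets I m c n i) :: _ \<Rightarrow> real) \<in> borel_measurable (count_space I \<Otimes>\<^sub>M lborel)"
      unfolding measurable_cong_sets[OF sets_space_time refl]
      by (intro borel_measurable_indicator pattern_sets_properties(1) I c)
  qed (use that in auto)
  moreover have "(\<lambda>p. Re (Determinant.det (Matrix.mat (n + k) (n + k) (\<lambda>(i, j). \<kappa> (p i) (p j))))) \<in>
       borel_measurable (Pi\<^sub>M {..<n + k} (\<lambda>_. count_space I \<Otimes>\<^sub>M lborel))"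
    by (rule measurable_compose[OF meas borel_measurable_Re])
  ultimately show ?thesis
    unfolding moment_density_def by (intro borel_measurable_times borel_measurable_prod borel_measurable_max) auto
qed

text \<open>\<open>determinantal_process_scaled_moments\<close> for the family
  \<open>pattern_sets\<close>. For \<open>i < n\<close> the earlier sets inside the
  \<open>i\<close>-th one are the earlier occurrences of the same cell; from \<open>n\<close> on,
  all earlier sets are inside. The bound on the kernel makes the moments finite, with a bound that
  depends on the process only through \<open>C\<close>.\<close>

lemma cell_count_moments:
  fixes \<theta> :: "real \<Rightarrow> real" and \<sigma> :: real and K :: "real \<times> real \<Rightarrow> real \<times> real \<Rightarrow> complex"
  assumes det: "determinantal_process M J \<Xi> K"
    and I: "finite I" and \<theta>: "inj_on \<theta> I" "\<theta> ` I \<subseteq> J" and \<sigma>: "0 < \<sigma>"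
    and c: "\<And>i. i < n \<Longrightarrow> c i \<in> I \<times> grid_index m"
  defines "\<kappa> \<equiv> \<lambda>x y. complex_of_real \<sigma> * K (\<theta> (fst x), \<sigma> * snd x) (\<theta> (fst y), \<sigma> * snd y)"
  defines "L \<equiv> \<lambda>N. Pi\<^sub>M {..<N::nat} (\<lambda>_. count_space I \<Otimes>\<^sub>M (lborel :: real measure))"
  defines "N \<equiv> \<lambda>\<omega> b. point_count (distr (\<Xi> (\<theta> (fst b)) \<omega>) borel (\<lambda>x. x / \<sigma>)) (grid_cell m (snd b))"
  assumes C: "0 \<le> C" and \<kappa>: "\<And>x y. x \<in> I \<times> {- real m..real m} \<Longrightarrow> y \<in> I \<times> {- real m..real m} \<Longrightarrow> norm (\<kappa> x y) \<le> C"
  shows "moment_density I m c n k \<kappa> \<in> borel_measurable (L (n + k))"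
    and "(\<integral>\<^sup>+\<omega>. of_nat (pattern_product c n (N \<omega>) * (\<Prod>l<k. (\<Sum>b\<in>I \<times> grid_index m. N \<omega> b) - (n + l))) \<partial>M) =
       ennreal (\<integral>p. moment_density I m c n k \<kappa> p \<partial>L (n + k))"
    and "(\<integral>p. moment_density I m c n k \<kappa> p \<partial>L (n + k)) \<le> (C * (real (card I) * (2 * real m)) * sqrt (real (n + k))) ^ (n + k)"
    and "0 \<le> (\<integral>p. moment_density I m c n k \<kappa> p \<partial>L (n + k))"
proof -
  let ?A = "pattern_sets I m c n"
  have pm: "\<Xi> t \<omega> \<in> point_measures" if "t \<in> J" "\<omega> \<in> space M" for t \<omega>
    using det that by (auto simp: determinantal_process_def configuration_process_def)
  have pm': "distr (\<Xi> (\<theta> t) \<omega>) borel (\<lambda>x. x / \<sigma>) \<in> point_measures" if t: "t \<in> I" and \<omega>: "\<omega> \<in> space M" for t \<omega>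
    by (rule point_measures_distr_scale[OF _ \<sigma>]) (use pm \<theta>(2) t \<omega> in blast)
  note props = pattern_sets_properties[where c = c and n = n and m = m, OF I c]
  have mom: "(\<lambda>p. Determinant.det (Matrix.mat (n + k) (n + k) (\<lambda>(i, j). \<kappa> (p i) (p j)))) \<in> borel_measurable (L (n + k))"
    "(\<integral>\<^sup>+\<omega>. of_nat (\<Prod>i<n + k. space_time_count I (\<lambda>t. distr (\<Xi> (\<theta> t) \<omega>) borel (\<lambda>x. x / \<sigma>)) (?A i) -
              card {j. j < i \<and> ?A j \<subseteq> ?A i}) \<partial>M) =
     (\<integral>\<^sup>+p. (\<Prod>i<n + k. indicator (?A i) (p i)) * ennreal (Re (Determinant.det (Matrix.mat (n + k) (n + k) (\<lambda>(i, j). \<kappa> (p i) (p j))))) \<partial>L (n + k))"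
    unfolding \<kappa>_def L_def
    using determinantal_process_scaled_moments[OF det I \<theta> \<sigma>, where n = "n + k" and A = ?A] props(1-3)
    by simp_all
  show meas: "moment_density I m c n k \<kappa> \<in> borel_measurable (L (n + k))"
    unfolding L_def by (rule moment_density_measurable[OF I c mom(1)[unfolded L_def]])
  let ?D = "(C * sqrt (real (n + k))) ^ (n + k)"
  let ?w = "\<lambda>p. \<Prod>i<n + k. indicator (I \<times> {- real m..real m}) (p i) :: real"
  have intw: "integrable (L (n + k)) ?w" "(\<integral>p. ?w p \<partial>L (n + k)) = (real (card I) * (2 * real m)) ^ (n + k)"
    unfolding L_def using window_indicator_integral[OF I] by blast+
  have nonneg: "0 \<le> moment_density I m c n k \<kappa> p" for p by (rule moment_density_bound(1)[OF I c \<kappa>])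
  have upper: "moment_density I m c n k \<kappa> p \<le> ?D * ?w p" for p by (rule moment_density_bound(2)[OF I c \<kappa> C])
  have int: "integrable (L (n + k)) (moment_density I m c n k \<kappa>)"
  proof (rule Bochner_Integration.integrable_bound[OF integrable_mult_right[OF intw(1), of ?D] meas])
    show "AE p in L (n + k). norm (moment_density I m c n k \<kappa> p) \<le> norm (?D * ?w p)"
    proof (rule AE_I2)
      fix p
      have "norm (moment_density I m c n k \<kappa> p) = moment_density I m c n k \<kappa> p" using nonneg by simp
      also have "\<dots> \<le> ?D * ?w p" by (rule upper)
      also have "\<dots> \<le> norm (?D * ?w p)" by simp
      finally show "norm (moment_density I m c n k \<kappa> p) \<le> norm (?D * ?w p)" .
    qed
  qed
  show "0 \<le> (\<integral>p. moment_density I m c n k \<kappa> p \<partial>L (n + k))" by (rule Bochner_Integration.integral_nonneg[OF nonneg])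
  have "(\<integral>p. moment_density I m c n k \<kappa> p \<partial>L (n + k)) \<le> (\<integral>p. ?D * ?w p \<partial>L (n + k))"
    by (rule integral_mono[OF int integrable_mult_right[OF intw(1)] upper])
  also have "\<dots> = (C * (real (card I) * (2 * real m)) * sqrt (real (n + k))) ^ (n + k)"
    using intw(2) by (simp add: power_mult_distrib mult_ac)
  finally show "(\<integral>p. moment_density I m c n k \<kappa> p \<partial>L (n + k)) \<le> (C * (real (card I) * (2 * real m)) * sqrt (real (n + k))) ^ (n + k)" .
  have "(\<integral>\<^sup>+\<omega>. of_nat (pattern_product c n (N \<omega>) * (\<Prod>l<k. (\<Sum>b\<in>I \<times> grid_index m. N \<omega> b) - (n + l))) \<partial>M) =
    (\<integral>\<^sup>+\<omega>. of_nat (\<Prod>i<n + k. space_time_count I (\<lambda>t. distr (\<Xi> (\<theta> t) \<omega>) borel (\<lambda>x. x / \<sigma>)) (?A i) -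
              card {j. j < i \<and> ?A j \<subseteq> ?A i}) \<partial>M)"
  proof (intro nn_integral_cong arg_cong[where f = of_nat])
    fix \<omega> assume \<omega>: "\<omega> \<in> space M"
    let ?\<eta> = "\<lambda>t. distr (\<Xi> (\<theta> t) \<omega>) borel (\<lambda>x. x / \<sigma>)"
    have 1: "space_time_count I ?\<eta> (?A i) - card {j. j < i \<and> ?A j \<subseteq> ?A i} = N \<omega> (c i) - card {j. j < i \<and> c j = c i}" if i: "i < n" for i
    proof -
      have "{j. j < i \<and> ?A j \<subseteq> ?A i} = {j. j < i \<and> c j = c i}" using props(4) i by blast
      moreover have "space_time_count I ?\<eta> (?A i) = N \<omega> (c i)"
        using i c[OF i] space_time_count_cell[OF I, of "fst (c i)"] by (auto simp: pattern_sets_def N_def)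
      ultimately show ?thesis by simp
    qed
    have 2: "space_time_count I ?\<eta> (?A (n + l)) - card {j. j < n + l \<and> ?A j \<subseteq> ?A (n + l)} = (\<Sum>b\<in>I \<times> grid_index m. N \<omega> b) - (n + l)" for l
    proof -
      have "{j. j < n + l \<and> ?A j \<subseteq> ?A (n + l)} = {..<n + l}" using props(5) by auto
      moreover have "space_time_count I ?\<eta> (?A (n + l)) = (\<Sum>b\<in>I \<times> grid_index m. N \<omega> b)"
        unfolding N_def using space_time_count_window[OF I, where \<eta> = ?\<eta>] pm' \<omega> by (simp add: pattern_sets_def)
      ultimately show ?thesis by simp
    qed
    show "pattern_product c n (N \<omega>) * (\<Prod>l<k. (\<Sum>b\<in>I \<times> grid_index m. N \<omega> b) - (n + l)) =
       (\<Prod>i<n + k. space_time_count I ?\<eta> (?A i) - card {j. j < i \<and> ?A j \<subseteq> ?A i})"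
      unfolding prod_lessThan_add pattern_product_def 2 by (simp add: 1)
  qed
  also have "\<dots> = (\<integral>\<^sup>+p. ennreal (moment_density I m c n k \<kappa> p) \<partial>L (n + k))"
    unfolding mom(2)
  proof (rule nn_integral_cong)
    fix p
    have "(\<Prod>i<n + k. indicator (?A i) (p i) :: ennreal) = ennreal (\<Prod>i<n + k. indicator (?A i) (p i))"
      by (simp add: prod_ennreal[symmetric] ennreal_indicator)
    then show "(\<Prod>i<n + k. indicator (?A i) (p i)) * ennreal (Re (Determinant.det (Matrix.mat (n + k) (n + k) (\<lambda>(i, j). \<kappa> (p i) (p j)))))
       = ennreal (moment_density I m c n k \<kappa> p)"
      unfolding moment_density_def by (simp add: ennreal_mult'' ennreal_max_0 prod_nonneg)
  qed
  also have "\<dots> = ennreal (\<integral>p. moment_density I m c n k \<kappa> p \<partial>L (n + k))"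
    by (rule nn_integral_eq_integral[OF int]) (use nonneg in simp)
  finally show "(\<integral>\<^sup>+\<omega>. of_nat (pattern_product c n (N \<omega>) * (\<Prod>l<k. (\<Sum>b\<in>I \<times> grid_index m. N \<omega> b) - (n + l))) \<partial>M) =
       ennreal (\<integral>p. moment_density I m c n k \<kappa> p \<partial>L (n + k))" .
qed

lemma tendsto_det:
  fixes f :: "'i \<Rightarrow> nat \<Rightarrow> nat \<Rightarrow> complex"
  assumes "\<And>i j. i < n \<Longrightarrow> j < n \<Longrightarrow> ((\<lambda>T. f T i j) \<longlongrightarrow> g i j) F"
  shows "((\<lambda>T. Determinant.det (Matrix.mat n n (\<lambda>(i, j). f T i j))) \<longlongrightarrow> Determinant.det (Matrix.mat n n (\<lambda>(i, j). g i j))) F"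
proof -
  have det: "Determinant.det (Matrix.mat n n (\<lambda>(i, j). h i j)) = (\<Sum>p | p permutes {0..<n}. of_int (sign p) * (\<Prod>i = 0..<n. h i (p i)))"
    for h :: "nat \<Rightarrow> nat \<Rightarrow> complex"
    by (subst det_def'[of _ n]) (auto intro!: sum.cong prod.cong dest: permutes_in_image)
  show ?thesis unfolding det
    by (intro tendsto_sum tendsto_mult tendsto_const tendsto_prod assms) (auto dest: permutes_in_image)
qed

text \<open>The factorial moments converge by dominated convergence, with Hadamard's bound as
  majorant. The Bonferroni error has the same bound for all \<open>i\<close> and tends to 0 by
  \<open>Hadamard_moment_decay\<close>, so the probabilities of the counts converge.\<close>

lemma determinantal_counts_converge:
  fixes \<theta> :: "nat \<Rightarrow> real \<Rightarrow> real" and \<sigma> :: "nat \<Rightarrow> real" and K K' :: "real \<times> real \<Rightarrow> real \<times> real \<Rightarrow> complex"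
  assumes det: "determinantal_process M J \<Xi> K" and det': "determinantal_process M' UNIV Z K'"
    and I: "finite I" and \<theta>: "\<And>i. inj_on (\<theta> i) I" "\<And>i. \<theta> i ` I \<subseteq> J" and \<sigma>: "\<And>i. 0 < \<sigma> i"
  defines "\<kappa> \<equiv> \<lambda>i x y. complex_of_real (\<sigma> i) * K (\<theta> i (fst x), \<sigma> i * snd x) (\<theta> i (fst y), \<sigma> i * snd y)"
  assumes lim: "\<And>x y. x \<in> I \<times> {- real m..real m} \<Longrightarrow> y \<in> I \<times> {- real m..real m} \<Longrightarrow> (\<lambda>i. \<kappa> i x y) \<longlonglongrightarrow> K' x y"
    and bound: "\<And>i x y. x \<in> I \<times> {- real m..real m} \<Longrightarrow> y \<in> I \<times> {- real m..real m} \<Longrightarrow> norm (\<kappa> i x y) \<le> C"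
  shows "(\<lambda>i. measure M {\<omega>\<in>space M. \<forall>b\<in>I \<times> grid_index m.
            point_count (distr (\<Xi> (\<theta> i (fst b)) \<omega>) borel (\<lambda>x. x / \<sigma> i)) (grid_cell m (snd b)) = v b})
      \<longlonglongrightarrow> measure M' {\<omega>\<in>space M'. \<forall>b\<in>I \<times> grid_index m. point_count (Z (fst b) \<omega>) (grid_cell m (snd b)) = v b}"
proof -
  let ?B = "I \<times> grid_index m" and ?W = "I \<times> {- real m..real m}"
  define C' where "C' = max C 0"
  have C': "0 \<le> C'" "\<And>i x y. x \<in> ?W \<Longrightarrow> y \<in> ?W \<Longrightarrow> norm (\<kappa> i x y) \<le> C'"
    using bound by (auto simp: C'_def le_max_iff_disj)
  have bK': "norm (K' x y) \<le> C'" if "x \<in> ?W" "y \<in> ?W" for x y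
    by (rule Lim_bounded[OF tendsto_norm[OF lim[OF that]]]) (use C'(2) that in auto)
  have "finite ?B" using I by simp
  then obtain c :: "nat \<Rightarrow> real \<times> int" and n where cn: "\<forall>i<n. c i \<in> ?B" "\<forall>b\<in>?B. card {i. i < n \<and> c i = b} = v b"
    using pattern_exists[of ?B v] by blast
  have cB: "c i \<in> ?B" if "i < n" for i using cn(1) that by blast
  have c: "card {i. i < n \<and> c i = b} = v b" if "b \<in> ?B" for b using cn(2) that by blast
  define L where "L N = Pi\<^sub>M {..<N::nat} (\<lambda>_. count_space I \<Otimes>\<^sub>M (lborel :: real measure))" for N
  define mu where "mu i k = (\<integral>p. moment_density I m c n k (\<kappa> i) p \<partial>L (n + k))" for i k
  define mu' where "mu' k = (\<integral>p. moment_density I m c n k K' p \<partial>L (n + k))" for k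
  define D where "D = C' * (real (card I) * (2 * real m))"
  have D: "0 \<le> D" using C' by (simp add: D_def)
  define N where "N i \<omega> b = point_count (distr (\<Xi> (\<theta> i (fst b)) \<omega>) borel (\<lambda>x. x / \<sigma> i)) (grid_cell m (snd b))" for i \<omega> b
  define N' where "N' \<omega> b = point_count (Z (fst b) \<omega>) (grid_cell m (snd b))" for \<omega> b
  have conf: "configuration_process M J \<Xi>" "configuration_process M' UNIV Z"
    using det det' by (simp_all add: determinantal_process_def)
  then have probs: "prob_space M" "prob_space M'" by (simp_all add: configuration_process_def)
  have K2: "(\<lambda>x y. complex_of_real (\<sigma> i) * K (\<theta> i (fst x), \<sigma> i * snd x) (\<theta> i (fst y), \<sigma> i * snd y)) = \<kappa> i" for i
    by (simp add: \<kappa>_def)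
  have Nf: "N i \<omega> = (\<lambda>b. point_count (distr (\<Xi> (\<theta> i (fst b)) \<omega>) borel (\<lambda>x. x / \<sigma> i)) (grid_cell m (snd b)))" for i \<omega>
    by (simp add: N_def fun_eq_iff)
  have momX: "moment_density I m c n k (\<kappa> i) \<in> borel_measurable (L (n + k))"
    "(\<integral>\<^sup>+\<omega>. of_nat (pattern_product c n (N i \<omega>) * (\<Prod>l<k. (\<Sum>b\<in>?B. N i \<omega> b) - (n + l))) \<partial>M) = ennreal (mu i k)"
    "mu i k \<le> (D * sqrt (real (n + k))) ^ (n + k)" "0 \<le> mu i k" for i k
  proof -
    have b: "norm (complex_of_real (\<sigma> i) * K (\<theta> i (fst x), \<sigma> i * snd x) (\<theta> i (fst y), \<sigma> i * snd y)) \<le> C'"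
      if "x \<in> ?W" "y \<in> ?W" for x y
      using C'(2)[OF that, of i] by (simp add: \<kappa>_def)
    note m = cell_count_moments[where \<theta> = "\<theta> i" and \<sigma> = "\<sigma> i" and c = c and n = n and m = m and k = k,
        OF det I \<theta>(1) \<theta>(2) \<sigma> cB C'(1) b, unfolded K2, folded L_def]
    show "moment_density I m c n k (\<kappa> i) \<in> borel_measurable (L (n + k))" by (rule m(1))
    show "(\<integral>\<^sup>+\<omega>. of_nat (pattern_product c n (N i \<omega>) * (\<Prod>l<k. (\<Sum>b\<in>?B. N i \<omega> b) - (n + l))) \<partial>M) = ennreal (mu i k)"
      unfolding Nf mu_def by (rule m(2))
    show "mu i k \<le> (D * sqrt (real (n + k))) ^ (n + k)" unfolding mu_def D_def by (rule m(3))
    show "0 \<le> mu i k" unfolding mu_def by (rule m(4))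
  qed
  \<comment> \<open>The limit process is treated as a rescaled one, with the identity as time change
    and scale 1, so that the same moment formula covers it.\<close>
  have K1: "(\<lambda>x y. complex_of_real 1 * K' (fst x, 1 * snd x) (fst y, 1 * snd y)) = K'"
    by (simp add: fun_eq_iff)
  have momZ: "moment_density I m c n k K' \<in> borel_measurable (L (n + k))"
    "(\<integral>\<^sup>+\<omega>. of_nat (pattern_product c n (N' \<omega>) * (\<Prod>l<k. (\<Sum>b\<in>?B. N' \<omega> b) - (n + l))) \<partial>M') = ennreal (mu' k)"
    "mu' k \<le> (D * sqrt (real (n + k))) ^ (n + k)" "0 \<le> mu' k" for k
  proof -
    have Neq: "point_count (distr (Z (fst b) \<omega>) borel (\<lambda>x. x / 1)) (grid_cell m (snd b)) = N' \<omega> b" if "\<omega> \<in> space M'" for \<omega> b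
    proof -
      have "sets borel = sets (Z (fst b) \<omega>)" using conf(2) that by (auto simp: configuration_process_def point_measures_def)
      then show ?thesis by (simp add: N'_def distr_id2)
    qed
    have inj: "inj_on (\<lambda>t. t) I" "(\<lambda>t. t) ` I \<subseteq> UNIV" by simp_all
    have bK1: "norm (complex_of_real 1 * K' (fst x, 1 * snd x) (fst y, 1 * snd y)) \<le> C'" if "x \<in> ?W" "y \<in> ?W" for x y
      using bK'[OF that] by simp
    have one: "0 < (1 :: real)" by simp
    note m = cell_count_moments[where \<theta> = "\<lambda>t. t" and \<sigma> = 1 and c = c and n = n and m = m and k = k,
        OF det' I inj one cB C'(1) bK1, unfolded K1, folded L_def]
    show "moment_density I m c n k K' \<in> borel_measurable (L (n + k))"
      by (rule m(1))
    show "mu' k \<le> (D * sqrt (real (n + k))) ^ (n + k)" unfolding mu'_def D_def by (rule m(3))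
    show "0 \<le> mu' k" unfolding mu'_def by (rule m(4))
    have "(\<integral>\<^sup>+\<omega>. of_nat (pattern_product c n (N' \<omega>) * (\<Prod>l<k. (\<Sum>b\<in>?B. N' \<omega> b) - (n + l))) \<partial>M') =
      (\<integral>\<^sup>+\<omega>. of_nat (pattern_product c n (\<lambda>b. point_count (distr (Z (fst b) \<omega>) borel (\<lambda>x. x / 1)) (grid_cell m (snd b))) *
         (\<Prod>l<k. (\<Sum>b\<in>?B. point_count (distr (Z (fst b) \<omega>) borel (\<lambda>x. x / 1)) (grid_cell m (snd b))) - (n + l))) \<partial>M')"
      by (rule nn_integral_cong) (simp only: Neq)
    also have "\<dots> = ennreal (mu' k)" unfolding mu'_def
      by (rule m(2))
    finally show "(\<integral>\<^sup>+\<omega>. of_nat (pattern_product c n (N' \<omega>) * (\<Prod>l<k. (\<Sum>b\<in>?B. N' \<omega> b) - (n + l))) \<partial>M') = ennreal (mu' k)" .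
  qed
  have mconv: "(\<lambda>i. mu i k) \<longlonglongrightarrow> mu' k" for k
    unfolding mu_def mu'_def
  proof (rule integral_dominated_convergence)
    show "moment_density I m c n k K' \<in> borel_measurable (L (n + k))" by (rule momZ)
    show "moment_density I m c n k (\<kappa> i) \<in> borel_measurable (L (n + k))" for i by (rule momX(1))
    let ?w = "\<lambda>p. (C' * sqrt (real (n + k))) ^ (n + k) * (\<Prod>i<n + k. indicator ?W (p i))"
    show "integrable (L (n + k)) ?w"
      unfolding L_def by (rule integrable_mult_right[OF window_indicator_integral(1)[OF I]])
    show "AE p in L (n + k). norm (moment_density I m c n k (\<kappa> i) p) \<le> ?w p" for i
    proof (rule AE_I2)
      fix p
      have "0 \<le> moment_density I m c n k (\<kappa> i) p" using I cB C'(2) by (rule moment_density_bound(1))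
      moreover have "moment_density I m c n k (\<kappa> i) p \<le> ?w p" using I cB C'(2,1) by (rule moment_density_bound(2))
      ultimately show "norm (moment_density I m c n k (\<kappa> i) p) \<le> ?w p" by simp
    qed
    show "AE p in L (n + k). (\<lambda>i. moment_density I m c n k (\<kappa> i) p) \<longlonglongrightarrow> moment_density I m c n k K' p"
    proof (rule AE_I2)
      fix p
      show "(\<lambda>i. moment_density I m c n k (\<kappa> i) p) \<longlonglongrightarrow> moment_density I m c n k K' p"
      proof (cases "\<forall>i<n + k. p i \<in> pattern_sets I m c n i")
        case True
        have pW: "p i \<in> ?W" if "i < n + k" for i
        proof -
          have "pattern_sets I m c n i \<subseteq> ?W" using I cB by (rule pattern_sets_properties(6))
          then show ?thesis using True that by blast
        qed
        show ?thesis unfolding moment_density_def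
          by (intro tendsto_mult tendsto_const tendsto_max tendsto_Re tendsto_det lim pW)
      next
        case False
        then obtain i where i: "i < n + k" "p i \<notin> pattern_sets I m c n i" by auto
        then have z: "(\<Prod>i<n + k. indicator (pattern_sets I m c n i) (p i)) = (0 :: real)"
          by (intro prod_zero bexI[of _ i]) auto
        show ?thesis by (simp add: moment_density_def z)
      qed
    qed
  qed
  have Nm: "(\<lambda>\<omega>. N i \<omega> b) \<in> measurable M (count_space UNIV)" if "b \<in> ?B" for i b
    unfolding N_def
  proof (rule measurable_point_count)
    have t: "\<theta> i (fst b) \<in> J" using that by (intro subsetD[OF \<theta>(2)[of i]] imageI) auto
    have "(\<lambda>\<omega>. emeasure (\<Xi> (\<theta> i (fst b)) \<omega>) ((\<lambda>x. x / \<sigma> i) -` grid_cell m (snd b))) \<in> borel_measurable M"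
      using conf(1) t measurable_sets_borel[of "\<lambda>x. x / \<sigma> i" borel "grid_cell m (snd b)"]
      by (auto simp: configuration_process_def)
    moreover have "emeasure (distr (\<Xi> (\<theta> i (fst b)) \<omega>) borel (\<lambda>x. x / \<sigma> i)) (grid_cell m (snd b)) =
        emeasure (\<Xi> (\<theta> i (fst b)) \<omega>) ((\<lambda>x. x / \<sigma> i) -` grid_cell m (snd b))" if "\<omega> \<in> space M" for \<omega>
      by (rule emeasure_distr_scale) (use conf(1) t that in \<open>auto simp: configuration_process_def\<close>)
    ultimately show "(\<lambda>\<omega>. emeasure (distr (\<Xi> (\<theta> i (fst b)) \<omega>) borel (\<lambda>x. x / \<sigma> i)) (grid_cell m (snd b))) \<in> borel_measurable M"
      by (subst measurable_cong) auto
  qed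
  have N'm: "(\<lambda>\<omega>. N' \<omega> b) \<in> measurable M' (count_space UNIV)" for b
    unfolding N'_def by (rule measurable_point_count) (use conf(2) in \<open>auto simp: configuration_process_def\<close>)
  have finB: "finite ?B" using I by simp
  let ?c = "real (pattern_product c n v)"
  have "(\<lambda>i. ?c * measure M {\<omega>\<in>space M. \<forall>b\<in>?B. N i \<omega> b = v b}) \<longlonglongrightarrow> ?c * measure M' {\<omega>\<in>space M'. \<forall>b\<in>?B. N' \<omega> b = v b}"
  proof (rule tendsto_of_uniform_partial_sums)
    show "(\<lambda>i. \<Sum>k<r. (- 1) ^ k / fact k * mu i k) \<longlonglongrightarrow> (\<Sum>k<r. (- 1) ^ k / fact k * mu' k)" for r
      by (intro tendsto_sum tendsto_mult tendsto_const mconv)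
    show "(\<lambda>r. (D * sqrt (real (n + r))) ^ (n + r) / fact r) \<longlonglongrightarrow> 0" by (rule Hadamard_moment_decay[OF D])
    show "\<forall>\<^sub>F i in sequentially. \<bar>?c * measure M {\<omega>\<in>space M. \<forall>b\<in>?B. N i \<omega> b = v b} - (\<Sum>k<r. (- 1) ^ k / fact k * mu i k)\<bar>
       \<le> (D * sqrt (real (n + r))) ^ (n + r) / fact r" for r
    proof (rule always_eventually, rule allI)
      fix i
      have "\<bar>?c * measure M {\<omega>\<in>space M. \<forall>b\<in>?B. N i \<omega> b = v b} - (\<Sum>k<r. (- 1) ^ k / fact k * mu i k)\<bar> \<le> mu i r / fact r"
        by (rule prob_counts_Bonferroni[OF probs(1) finB cB c Nm momX(2) momX(4)])
      also have "\<dots> \<le> (D * sqrt (real (n + r))) ^ (n + r) / fact r"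
        by (intro divide_right_mono momX(3)) simp
      finally show "\<bar>?c * measure M {\<omega>\<in>space M. \<forall>b\<in>?B. N i \<omega> b = v b} - (\<Sum>k<r. (- 1) ^ k / fact k * mu i k)\<bar>
         \<le> (D * sqrt (real (n + r))) ^ (n + r) / fact r" .
    qed
    show "\<bar>?c * measure M' {\<omega>\<in>space M'. \<forall>b\<in>?B. N' \<omega> b = v b} - (\<Sum>k<r. (- 1) ^ k / fact k * mu' k)\<bar>
       \<le> (D * sqrt (real (n + r))) ^ (n + r) / fact r" for r
    proof -
      have "\<bar>?c * measure M' {\<omega>\<in>space M'. \<forall>b\<in>?B. N' \<omega> b = v b} - (\<Sum>k<r. (- 1) ^ k / fact k * mu' k)\<bar> \<le> mu' r / fact r"
        by (rule prob_counts_Bonferroni[OF probs(2) finB cB c N'm momZ(2) momZ(4)])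
      also have "\<dots> \<le> (D * sqrt (real (n + r))) ^ (n + r) / fact r"
        by (intro divide_right_mono momZ(3)) simp
      finally show ?thesis .
    qed
  qed
  \<comment> \<open>At the prescribed counts the pattern product is a product of factorials, and can
    be divided out.\<close>
  moreover have "?c \<noteq> 0" using pattern_product_self[OF c cB] by simp
  ultimately show ?thesis
    unfolding N_def N'_def using tendsto_mult_left_iff[of ?c] by blast
qed

text \<open>The bound on the rescaled kernel may depend on the window and on the finite set of times.\<close>

lemma determinantal_process_fdd_converges:
  fixes \<theta> :: "real \<Rightarrow> real \<Rightarrow> real" and \<sigma> :: "real \<Rightarrow> real" and K K' :: "real \<times> real \<Rightarrow> real \<times> real \<Rightarrow> complex"
  assumes det: "determinantal_process M J \<Xi> K" and det': "determinantal_process M' UNIV Z K'"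
    and \<theta>: "\<And>T. 0 < \<sigma> T \<Longrightarrow> inj (\<theta> T)" "\<And>t. \<forall>\<^sub>F T in at_top. \<theta> T t \<in> J" and \<sigma>: "\<forall>\<^sub>F T in at_top. 0 < \<sigma> T"
  defines "\<kappa> \<equiv> \<lambda>T x y. complex_of_real (\<sigma> T) * K (\<theta> T (fst x), \<sigma> T * snd x) (\<theta> T (fst y), \<sigma> T * snd y)"
  assumes lim: "\<And>x y. ((\<lambda>T. \<kappa> T x y) \<longlongrightarrow> K' x y) at_top"
    and bound: "\<And>I m. finite I \<Longrightarrow> \<exists>C. \<forall>\<^sub>F T in at_top. \<forall>x\<in>I \<times> {- real m..real m}. \<forall>y\<in>I \<times> {- real m..real m}. norm (\<kappa> T x y) \<le> C"
  shows "fdd_converges at_top M (\<lambda>T t \<omega>. distr (\<Xi> (\<theta> T t) \<omega>) borel (\<lambda>x. x / \<sigma> T)) M' Z"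
proof (rule fdd_converges_of_counts)
  have conf: "configuration_process M J \<Xi>" "configuration_process M' UNIV Z"
    using det det' by (simp_all add: determinantal_process_def)
  then show "prob_space M" "prob_space M'" by (simp_all add: configuration_process_def)
  show "(\<forall>\<omega>\<in>space M'. Z t \<omega> \<in> point_measures) \<and> (\<forall>B\<in>sets borel. (\<lambda>\<omega>. emeasure (Z t \<omega>) B) \<in> borel_measurable M')" for t
    using conf(2) by (simp add: configuration_process_def)
  show "\<forall>\<^sub>F T in at_top. (\<forall>\<omega>\<in>space M. distr (\<Xi> (\<theta> T t) \<omega>) borel (\<lambda>x. x / \<sigma> T) \<in> point_measures) \<and>
     (\<forall>B\<in>sets borel. (\<lambda>\<omega>. emeasure (distr (\<Xi> (\<theta> T t) \<omega>) borel (\<lambda>x. x / \<sigma> T)) B) \<in> borel_measurable M)" for t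
    using \<theta>(2)[of t] \<sigma>
  proof eventually_elim
    case (elim T)
    have pm: "\<Xi> (\<theta> T t) \<omega> \<in> point_measures" if "\<omega> \<in> space M" for \<omega>
      using conf(1) elim that by (simp add: configuration_process_def)
    have "(\<lambda>\<omega>. emeasure (distr (\<Xi> (\<theta> T t) \<omega>) borel (\<lambda>x. x / \<sigma> T)) B) \<in> borel_measurable M" if B: "B \<in> sets borel" for B
    proof -
      have "(\<lambda>\<omega>. emeasure (\<Xi> (\<theta> T t) \<omega>) ((\<lambda>x. x / \<sigma> T) -` B)) \<in> borel_measurable M"
        using conf(1) elim measurable_sets_borel[of "\<lambda>x. x / \<sigma> T" borel B] B
        by (simp add: configuration_process_def)
      then show ?thesis
        by (subst measurable_cong[OF emeasure_distr_scale[OF pm B]]) auto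
    qed
    then show ?case using point_measures_distr_scale[OF pm elim(2)] by blast
  qed
  fix I :: "real set" and m :: nat and v :: "real \<times> int \<Rightarrow> nat"
  assume I: "finite I"
  show "((\<lambda>T. measure M {\<omega>\<in>space M. \<forall>b\<in>I \<times> grid_index m.
        point_count (distr (\<Xi> (\<theta> T (fst b)) \<omega>) borel (\<lambda>x. x / \<sigma> T)) (grid_cell m (snd b)) = v b})
     \<longlongrightarrow> measure M' {\<omega>\<in>space M'. \<forall>b\<in>I \<times> grid_index m. point_count (Z (fst b) \<omega>) (grid_cell m (snd b)) = v b}) at_top"
  \<comment> \<open>Dominated convergence is applied along sequences. Discarding the first
    \<open>i0\<close> terms turns the eventual hypotheses into ones that hold for all
    indices.\<close>
  proof (rule tendsto_at_topI_sequentially)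
    fix S :: "nat \<Rightarrow> real" assume S: "filterlim S at_top sequentially"
    obtain C where C: "\<forall>\<^sub>F T in at_top. \<forall>x\<in>I \<times> {- real m..real m}. \<forall>y\<in>I \<times> {- real m..real m}. norm (\<kappa> T x y) \<le> C"
      using bound[OF I] by blast
    have "\<forall>\<^sub>F T in at_top. \<forall>t\<in>I. \<theta> T t \<in> J" by (rule eventually_ball_finite[OF I]) (use \<theta>(2) in blast)
    with C \<sigma> have "\<forall>\<^sub>F T in at_top. 0 < \<sigma> T \<and> (\<forall>t\<in>I. \<theta> T t \<in> J) \<and>
        (\<forall>x\<in>I \<times> {- real m..real m}. \<forall>y\<in>I \<times> {- real m..real m}. norm (\<kappa> T x y) \<le> C)"
      by eventually_elim blast
    then have "\<forall>\<^sub>F i in sequentially. 0 < \<sigma> (S i) \<and> (\<forall>t\<in>I. \<theta> (S i) t \<in> J) \<and>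
        (\<forall>x\<in>I \<times> {- real m..real m}. \<forall>y\<in>I \<times> {- real m..real m}. norm (\<kappa> (S i) x y) \<le> C)"
      using S by (rule eventually_compose_filterlim)
    then obtain i0 where i0: "\<And>i. i0 \<le> i \<Longrightarrow> 0 < \<sigma> (S i) \<and> (\<forall>t\<in>I. \<theta> (S i) t \<in> J) \<and>
        (\<forall>x\<in>I \<times> {- real m..real m}. \<forall>y\<in>I \<times> {- real m..real m}. norm (\<kappa> (S i) x y) \<le> C)"
      unfolding eventually_sequentially by blast
    have S': "filterlim (\<lambda>i. S (i + i0)) at_top sequentially"
      using S by (rule filterlim_compose) (rule filterlim_add_const_nat_at_top)
    show "(\<lambda>i. measure M {\<omega>\<in>space M. \<forall>b\<in>I \<times> grid_index m.
        point_count (distr (\<Xi> (\<theta> (S i) (fst b)) \<omega>) borel (\<lambda>x. x / \<sigma> (S i))) (grid_cell m (snd b)) = v b})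
     \<longlonglongrightarrow> measure M' {\<omega>\<in>space M'. \<forall>b\<in>I \<times> grid_index m. point_count (Z (fst b) \<omega>) (grid_cell m (snd b)) = v b}"
    proof (rule LIMSEQ_offset[of _ i0], rule determinantal_counts_converge[OF det det' I])
      fix i
      note i = i0[of "i + i0", OF le_add2]
      show "inj_on (\<theta> (S (i + i0))) I" using \<theta>(1) i inj_on_subset by blast
      show "\<theta> (S (i + i0)) ` I \<subseteq> J" "0 < \<sigma> (S (i + i0))" using i by auto
    next
      fix x y assume xy: "x \<in> I \<times> {- real m..real m}" "y \<in> I \<times> {- real m..real m}"
      show "(\<lambda>i. complex_of_real (\<sigma> (S (i + i0))) * K (\<theta> (S (i + i0)) (fst x), \<sigma> (S (i + i0)) * snd x)
           (\<theta> (S (i + i0)) (fst y), \<sigma> (S (i + i0)) * snd y)) \<longlonglongrightarrow> K' x y"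
        using filterlim_compose[OF lim[of x y] S'] by (simp add: \<kappa>_def)
    next
      fix i x y assume xy: "x \<in> I \<times> {- real m..real m}" "y \<in> I \<times> {- real m..real m}"
      show "norm (complex_of_real (\<sigma> (S (i + i0))) * K (\<theta> (S (i + i0)) (fst x), \<sigma> (S (i + i0)) * snd x)
           (\<theta> (S (i + i0)) (fst y), \<sigma> (S (i + i0)) * snd y)) \<le> C"
        using i0[of "i + i0", OF le_add2, THEN conjunct2, THEN conjunct2, THEN bspec, OF xy(1), THEN bspec, OF xy(2)]
        unfolding \<kappa>_def .
    qed
  qed
qed

section \<open>Bounds on ratios of the canonical product\<close>

lemma exp_minus_le_quadratic: "0 \<le> x \<Longrightarrow> exp (- x) \<le> 1 - x + x\<^sup>2 / 2" for x :: real
proof -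
  assume x: "0 \<le> x"
  define f where "f t = 1 - t + t\<^sup>2 / 2 - exp (- t)" for t :: real
  have "f 0 \<le> f x"
  proof (rule DERIV_nonneg_imp_nondecreasing[OF x])
    fix t :: real assume "0 \<le> t"
    have "(f has_real_derivative (- 1 + t + exp (- t))) (at t)"
      unfolding f_def by (auto intro!: derivative_eq_intros)
    moreover have "0 \<le> - 1 + t + exp (- t)" using exp_ge_add_one_self[of "- t"] by simp
    ultimately show "\<exists>y. (f has_real_derivative y) (at t) \<and> 0 \<le> y" by blast
  qed
  then show ?thesis by (simp add: f_def)
qed

text \<open>A quantitative form of \<open>1 + d \<le> exp d\<close>: the gap in the exponent is
  quadratic for small \<open>d\<close> and linear for large \<open>d\<close>. This gap is the source
  of the decay in \<open>w\<close> away from the saddle points.\<close>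

lemma one_plus_times_exp_le:
  fixes d :: real
  assumes "- 1 \<le> d"
  shows "(1 + d) * exp (- d) \<le> exp (- (d\<^sup>2 / (2 * (1 + \<bar>d\<bar>))))"
proof (cases "d = - 1")
  case False
  then have d: "- 1 < d" using assms by simp
  have "ln (1 + d) \<le> d - d\<^sup>2 / (2 * (1 + \<bar>d\<bar>))"
  proof (cases "0 \<le> d")
    case True
    define f where "f t = t - t\<^sup>2 / (2 * (1 + t)) - ln (1 + t)" for t :: real
    have "f 0 \<le> f d"
    proof (rule DERIV_nonneg_imp_nondecreasing[OF True])
      fix t :: real assume t: "0 \<le> t"
      have "(f has_real_derivative (1 - (2 * t * (2 * (1 + t)) - t\<^sup>2 * 2) / (2 * (1 + t))\<^sup>2 - 1 / (1 + t))) (at t)"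
        unfolding f_def using t by (auto intro!: derivative_eq_intros simp: power2_eq_square)
      moreover have "1 - (2 * t * (2 * (1 + t)) - t\<^sup>2 * 2) / (2 * (1 + t))\<^sup>2 - 1 / (1 + t) = t\<^sup>2 / (2 * (1 + t)\<^sup>2)"
        using t by (simp add: power2_eq_square divide_simps) (simp add: algebra_simps)
      ultimately show "\<exists>y. (f has_real_derivative y) (at t) \<and> 0 \<le> y" by force
    qed
    then show ?thesis using True by (simp add: f_def)
  next
    case False
    define f where "f t = t - t\<^sup>2 / 2 - ln (1 + t)" for t :: real
    have "f 0 \<le> f d"
    proof (rule DERIV_nonpos_imp_nonincreasing[of d 0 f])
      show "d \<le> 0" using False by simp
      fix t :: real assume t: "d \<le> t" "t \<le> 0"
      have "(f has_real_derivative (1 - t - 1 / (1 + t))) (at t)"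
        unfolding f_def using t d by (auto intro!: derivative_eq_intros)
      moreover have "1 - t - 1 / (1 + t) = - (t\<^sup>2 / (1 + t))"
        using t d by (simp add: power2_eq_square divide_simps) (simp add: algebra_simps)
      moreover have "0 \<le> t\<^sup>2 / (1 + t)" using t d by simp
      ultimately show "\<exists>y. (f has_real_derivative y) (at t) \<and> y \<le> 0" by force
    qed
    moreover have "d\<^sup>2 / (2 * (1 + \<bar>d\<bar>)) \<le> d\<^sup>2 / 2" by (intro divide_left_mono) auto
    ultimately show ?thesis by (simp add: f_def)
  qed
  then have "exp (ln (1 + d)) * exp (- d) \<le> exp (d - d\<^sup>2 / (2 * (1 + \<bar>d\<bar>))) * exp (- d)"
    by (intro mult_right_mono) auto
  then show ?thesis using d by (simp flip: exp_add)
qed simp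

text \<open>One term of the exponential series: polynomial growth is absorbed by an exponential of
  arbitrarily small rate.\<close>

lemma Bernoulli_power_bound: "0 \<le> x \<Longrightarrow> 0 < \<delta> \<Longrightarrow> (1 + x) ^ J \<le> fact J / \<delta> ^ J * exp (\<delta> * (1 + x))" for x \<delta> :: real
proof -
  assume x: "0 \<le> x" "0 < \<delta>"
  have "(\<lambda>k. (\<delta> * (1 + x)) ^ k /\<^sub>R fact k) sums exp (\<delta> * (1 + x))" by (rule exp_converges)
  then have s: "(\<lambda>k. (\<delta> * (1 + x)) ^ k / fact k) sums exp (\<delta> * (1 + x))" by (simp add: divide_real_def mult.commute)
  have "(\<Sum>k\<in>{J}. (\<delta> * (1 + x)) ^ k / fact k) \<le> (\<Sum>k. (\<delta> * (1 + x)) ^ k / fact k)"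
    by (rule sum_le_suminf) (use s x in \<open>auto simp: sums_iff\<close>)
  then have "(\<delta> * (1 + x)) ^ J / fact J \<le> exp (\<delta> * (1 + x))" using s by (simp add: sums_iff)
  then have "\<delta> ^ J * (1 + x) ^ J \<le> fact J * exp (\<delta> * (1 + x))"
    by (simp add: power_mult_distrib divide_le_eq mult.commute)
  then show ?thesis using x by (simp add: pos_le_divide_eq mult.commute)
qed

text \<open>The estimate behind the choice of the slope of the contour: with \<open>(1 - m)\<^sup>2 + 4 m\<^sup>2 / 3\<close> in place of
  \<open>(1 - m)\<^sup>2 + \<kappa> m\<^sup>2\<close>, the factor is controlled for all \<open>m \<ge> 0\<close> because \<open>4 / 3 > 1\<close>.\<close>

lemma contour_factor_bound:
  fixes m y :: real
  assumes m: "0 \<le> m" and y: "4 / 3 * m\<^sup>2 \<le> y\<^sup>2"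
  shows "exp (- m) * sqrt (1 + m\<^sup>2 * exp (2 * m) / 3) \<le> sqrt ((1 - m)\<^sup>2 + y\<^sup>2)"
proof (rule real_le_rsqrt)
  have "exp (- (2 * m)) \<le> 1 - 2 * m + (2 * m)\<^sup>2 / 2" using m by (intro exp_minus_le_quadratic) simp
  then have 1: "exp (- (2 * m)) + m\<^sup>2 / 3 \<le> (1 - m)\<^sup>2 + y\<^sup>2" using y by (simp add: power2_eq_square algebra_simps)
  have "(exp (- m) * sqrt (1 + m\<^sup>2 * exp (2 * m) / 3))\<^sup>2 = (exp (- m))\<^sup>2 * (1 + m\<^sup>2 * exp (2 * m) / 3)"
    by (simp add: power_mult_distrib)
  also have "(exp (- m))\<^sup>2 = exp (- (2 * m))" by (simp add: power2_eq_square flip: exp_add)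
  also have "exp (- (2 * m)) * (1 + m\<^sup>2 * exp (2 * m) / 3) = exp (- (2 * m)) + m\<^sup>2 / 3"
    by (simp add: algebra_simps flip: exp_add)
  finally show "(exp (- m) * sqrt (1 + m\<^sup>2 * exp (2 * m) / 3))\<^sup>2 \<le> (1 - m)\<^sup>2 + y\<^sup>2" using 1 by simp
qed

locale canonical_zeros =
  fixes \<epsilon> :: nat and a :: "nat \<Rightarrow> real"
  assumes a_pos: "\<And>j. 0 < a (Suc j)" and summable_inverse_squares: "summable (\<lambda>j. 1 / (a (Suc j))\<^sup>2)"
    and \<epsilon>_le: "\<epsilon> \<le> 1"
begin

abbreviation "E \<equiv> canonical_product \<epsilon> a"

lemma convergent_factors: "convergent_prod (\<lambda>j. 1 - z\<^sup>2 / (complex_of_real (a (Suc j)))\<^sup>2)"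
proof (rule abs_convergent_prod_imp_convergent_prod, rule summable_imp_abs_convergent_prod)
  have "summable (\<lambda>j. (cmod z)\<^sup>2 * (1 / (a (Suc j))\<^sup>2))" using summable_inverse_squares by (rule summable_mult)
  then show "summable (\<lambda>j. norm (1 - z\<^sup>2 / (complex_of_real (a (Suc j)))\<^sup>2 - 1))"
    by (simp add: norm_divide norm_power)
qed

lemma partial_products_tendsto:
  "(\<lambda>N. z ^ \<epsilon> * (\<Prod>j<N. 1 - z\<^sup>2 / (complex_of_real (a (Suc j)))\<^sup>2)) \<longlonglongrightarrow> E z"
  unfolding canonical_product_def
  by (intro tendsto_mult tendsto_const has_prod_imp_tendsto' convergent_prod_has_prod convergent_factors)

lemma factor_nonzero:
  assumes "Im z \<noteq> 0" shows "1 - z\<^sup>2 / (complex_of_real (a (Suc j)))\<^sup>2 \<noteq> 0"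
proof
  assume "1 - z\<^sup>2 / (complex_of_real (a (Suc j)))\<^sup>2 = 0"
  then have "z\<^sup>2 = (complex_of_real (a (Suc j)))\<^sup>2" using a_pos[of j] by simp
  then have "z = complex_of_real (a (Suc j)) \<or> z = - complex_of_real (a (Suc j))" by (simp add: power2_eq_iff)
  then show False using assms by auto
qed

lemma E_nonzero: "Im z \<noteq> 0 \<Longrightarrow> E z \<noteq> 0"
  unfolding canonical_product_def
  using prodinf_nonzero[OF convergent_factors factor_nonzero] by auto

lemma E_minus: "E (- z) = (- 1) ^ \<epsilon> * E z"
  unfolding canonical_product_def by (simp add: power_minus[of z])

lemma E_holomorphic: "E holomorphic_on UNIV"
proof -
  have "(\<lambda>z. \<Prod>j. 1 - z\<^sup>2 / (complex_of_real (a (Suc j)))\<^sup>2) holomorphic_on UNIV"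
  proof (rule holomorphic_uniform_sequence[of _ "\<lambda>N z. \<Prod>j<N. 1 - z\<^sup>2 / (complex_of_real (a (Suc j)))\<^sup>2"])
    show "(\<lambda>z. \<Prod>j<N. 1 - z\<^sup>2 / (complex_of_real (a (Suc j)))\<^sup>2) holomorphic_on UNIV" for N
      by (intro holomorphic_intros) (use a_pos in \<open>simp add: less_imp_neq[symmetric]\<close>)
    fix x :: complex assume "x \<in> UNIV"
    have "uniformly_convergent_on (cball x 1) (\<lambda>N z. \<Prod>j<N. 1 - z\<^sup>2 / (complex_of_real (a (Suc j)))\<^sup>2)"
    proof (rule Infinite_Products.uniformly_convergent_on_prod')
      show "continuous_on (cball x 1) (\<lambda>z. 1 - z\<^sup>2 / (complex_of_real (a (Suc n)))\<^sup>2)" for n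
        by (intro continuous_intros) (use a_pos[of n] in auto)
      show "uniformly_convergent_on (cball x 1) (\<lambda>N z. \<Sum>n<N. norm (1 - z\<^sup>2 / (complex_of_real (a (Suc n)))\<^sup>2 - 1))"
      proof (rule Weierstrass_m_test'[where M = "\<lambda>n. (cmod x + 1)\<^sup>2 * (1 / (a (Suc n))\<^sup>2)"])
        show "summable (\<lambda>n. (cmod x + 1)\<^sup>2 * (1 / (a (Suc n))\<^sup>2))" using summable_inverse_squares by (rule summable_mult)
        fix n z assume "z \<in> cball x 1"
        then have "cmod z \<le> cmod x + 1" using norm_triangle_ineq2[of z x] by (simp add: dist_norm norm_minus_commute)
        then have "(cmod z)\<^sup>2 \<le> (cmod x + 1)\<^sup>2" by (intro power_mono) auto
        then show "norm (norm (1 - z\<^sup>2 / (complex_of_real (a (Suc n)))\<^sup>2 - 1)) \<le> (cmod x + 1)\<^sup>2 * (1 / (a (Suc n))\<^sup>2)"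
          by (simp add: norm_divide norm_power divide_right_mono)
      qed
    qed simp
    then have ul: "uniform_limit (cball x 1) (\<lambda>N z. \<Prod>j<N. 1 - z\<^sup>2 / (complex_of_real (a (Suc j)))\<^sup>2)
        (\<lambda>z. lim (\<lambda>N. \<Prod>j<N. 1 - z\<^sup>2 / (complex_of_real (a (Suc j)))\<^sup>2)) sequentially"
      using uniformly_convergent_uniform_limit_iff by blast
    have "lim (\<lambda>N. \<Prod>j<N. 1 - z\<^sup>2 / (complex_of_real (a (Suc j)))\<^sup>2) = (\<Prod>j. 1 - z\<^sup>2 / (complex_of_real (a (Suc j)))\<^sup>2)" for z
      by (intro limI has_prod_imp_tendsto' convergent_prod_has_prod convergent_factors)
    with ul have "uniform_limit (cball x 1) (\<lambda>N z. \<Prod>j<N. 1 - z\<^sup>2 / (complex_of_real (a (Suc j)))\<^sup>2)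
        (\<lambda>z. \<Prod>j. 1 - z\<^sup>2 / (complex_of_real (a (Suc j)))\<^sup>2) sequentially" by simp
    then show "\<exists>d>0. cball x d \<subseteq> UNIV \<and> uniform_limit (cball x d) (\<lambda>N z. \<Prod>j<N. 1 - z\<^sup>2 / (complex_of_real (a (Suc j)))\<^sup>2)
        (\<lambda>z. \<Prod>j. 1 - z\<^sup>2 / (complex_of_real (a (Suc j)))\<^sup>2) sequentially"
      by (intro exI[of _ 1]) simp
  qed simp
  then show ?thesis unfolding canonical_product_def by (intro holomorphic_intros)
qed

lemma continuous_on_E: "continuous_on S E"
  using holomorphic_on_imp_continuous_on[OF E_holomorphic] continuous_on_subset by blast

text \<open>The real part of \<open>z^2 - (i V)^2\<close>, the displacement from the saddle point
  \<open>i V\<close> measured in \<open>z^2\<close>. In that variable the factors of the product are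
  linear.\<close>

definition square_shift :: "real \<Rightarrow> complex \<Rightarrow> real" where
  "square_shift V z = V\<^sup>2 + Re (z\<^sup>2)"

text \<open>The region where \<open>contour_factor_bound\<close> applies to every factor. On a ray
  \<open>|Im z| = |Re z| / sqrt 3\<close> one has \<open>(Im (z^2))^2 = 4/3 * (Re z)^4\<close>,
  which is where the constant comes from.\<close>

definition admissible :: "real \<Rightarrow> complex \<Rightarrow> bool" where
  "admissible V z \<longleftrightarrow> 0 < V \<and> Im z \<noteq> 0 \<and> 0 \<le> square_shift V z \<and> 4 / 3 * (square_shift V z)\<^sup>2 \<le> (Im (z\<^sup>2))\<^sup>2"

text \<open>Centring at the saddle: with \<open>B = a_j^2 + V^2\<close> the numerator is
  \<open>B\<close> times \<open>1 + (v^2 - V^2) / B\<close>, and the denominator is \<open>B\<close>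
  times the modulus of a number with real part \<open>1 - M / B\<close>, to which
  \<open>contour_factor_bound\<close> gives a lower bound.\<close>

lemma factor_ratio_bound:
  fixes v :: real
  assumes adm: "admissible V z"
  defines "B \<equiv> \<lambda>j. (a (Suc j))\<^sup>2 + V\<^sup>2" and "M \<equiv> square_shift V z"
  shows "norm ((1 - (\<i> * of_real v)\<^sup>2 / (complex_of_real (a (Suc j)))\<^sup>2) / (1 - z\<^sup>2 / (complex_of_real (a (Suc j)))\<^sup>2))
     \<le> (1 + (v\<^sup>2 - V\<^sup>2) / B j) * (exp (M / B j) / sqrt (1 + (M / B j)\<^sup>2 * exp (2 * (M / B j)) / 3))"
proof -
  define b where "b = (a (Suc j))\<^sup>2"
  define m where "m = M / B j"
  have b: "0 < b" using a_pos[of j] by (simp add: b_def)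
  have V: "0 < V" using adm by (simp add: admissible_def)
  have B: "0 < B j" "B j = b + V\<^sup>2" using b by (auto simp: B_def b_def add_pos_nonneg)
  have M: "0 \<le> M" "4 / 3 * M\<^sup>2 \<le> (Im (z\<^sup>2))\<^sup>2" using adm by (auto simp: admissible_def M_def)
  have m: "0 \<le> m" using M B by (simp add: m_def)
  have "norm (complex_of_real b - z\<^sup>2) = sqrt ((b - Re (z\<^sup>2))\<^sup>2 + (Im (z\<^sup>2))\<^sup>2)"
    by (simp add: cmod_def)
  also have "b - Re (z\<^sup>2) = B j * (1 - m)" using B by (simp add: m_def M_def square_shift_def right_diff_distrib)
  also have "(B j * (1 - m))\<^sup>2 + (Im (z\<^sup>2))\<^sup>2 = (B j)\<^sup>2 * ((1 - m)\<^sup>2 + (Im (z\<^sup>2) / B j)\<^sup>2)"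
    using B by (simp add: power_mult_distrib power_divide distrib_left)
  also have "sqrt \<dots> = B j * sqrt ((1 - m)\<^sup>2 + (Im (z\<^sup>2) / B j)\<^sup>2)"
    using B by (simp add: real_sqrt_mult)
  finally have nz: "norm (complex_of_real b - z\<^sup>2) = B j * sqrt ((1 - m)\<^sup>2 + (Im (z\<^sup>2) / B j)\<^sup>2)" .
  have "exp (- m) * sqrt (1 + m\<^sup>2 * exp (2 * m) / 3) \<le> sqrt ((1 - m)\<^sup>2 + (Im (z\<^sup>2) / B j)\<^sup>2)"
  proof (rule contour_factor_bound[OF m])
    have "4 / 3 * M\<^sup>2 / (B j)\<^sup>2 \<le> (Im (z\<^sup>2))\<^sup>2 / (B j)\<^sup>2" using M by (intro divide_right_mono) auto
    then show "4 / 3 * m\<^sup>2 \<le> (Im (z\<^sup>2) / B j)\<^sup>2" by (simp add: m_def power_divide)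
  qed
  then have low: "B j * (exp (- m) * sqrt (1 + m\<^sup>2 * exp (2 * m) / 3)) \<le> norm (complex_of_real b - z\<^sup>2)"
    unfolding nz using B by (intro mult_left_mono) auto
  have pos: "0 < B j * (exp (- m) * sqrt (1 + m\<^sup>2 * exp (2 * m) / 3))"
    using B by (intro mult_pos_pos) (auto intro: add_pos_nonneg)
  have "(1 - (\<i> * of_real v)\<^sup>2 / (complex_of_real (a (Suc j)))\<^sup>2) = complex_of_real ((b + v\<^sup>2) / b)"
    using b by (simp add: b_def power_mult_distrib add_divide_distrib)
  moreover have "1 - z\<^sup>2 / (complex_of_real (a (Suc j)))\<^sup>2 = (complex_of_real b - z\<^sup>2) / complex_of_real b"
    using b by (simp add: b_def diff_divide_distrib)
  ultimately have "norm ((1 - (\<i> * of_real v)\<^sup>2 / (complex_of_real (a (Suc j)))\<^sup>2) / (1 - z\<^sup>2 / (complex_of_real (a (Suc j)))\<^sup>2))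
     = (b + v\<^sup>2) / norm (complex_of_real b - z\<^sup>2)"
    using b by (simp add: norm_divide norm_mult del: of_real_divide of_real_add)
  also have "\<dots> \<le> (b + v\<^sup>2) / (B j * (exp (- m) * sqrt (1 + m\<^sup>2 * exp (2 * m) / 3)))"
    using low pos b by (intro divide_left_mono mult_pos_pos[OF less_le_trans[OF pos low] pos]) auto
  also have "\<dots> = (1 + (v\<^sup>2 - V\<^sup>2) / B j) * (exp m / sqrt (1 + m\<^sup>2 * exp (2 * m) / 3))"
    using B by (simp add: exp_minus field_simps)
  finally show ?thesis by (simp add: m_def)
qed

lemma ratio_tendsto:
  assumes "Im z \<noteq> 0"
  shows "(\<lambda>N. norm ((w / z) ^ \<epsilon>) * (\<Prod>j<N. norm ((1 - w\<^sup>2 / (complex_of_real (a (Suc j)))\<^sup>2) / (1 - z\<^sup>2 / (complex_of_real (a (Suc j)))\<^sup>2))))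
    \<longlonglongrightarrow> norm (E w / E z)"
proof -
  have "(\<lambda>N. norm ((w ^ \<epsilon> * (\<Prod>j<N. 1 - w\<^sup>2 / (complex_of_real (a (Suc j)))\<^sup>2)) /
      (z ^ \<epsilon> * (\<Prod>j<N. 1 - z\<^sup>2 / (complex_of_real (a (Suc j)))\<^sup>2)))) \<longlonglongrightarrow> norm (E w / E z)"
    by (intro tendsto_norm tendsto_divide partial_products_tendsto E_nonzero assms)
  then show ?thesis
    by (simp add: norm_mult norm_divide norm_power prod_norm prod_dividef power_divide)
qed

lemma power_\<epsilon>_le: "0 \<le> x \<Longrightarrow> x ^ \<epsilon> \<le> 1 + x" for x :: real
  using \<epsilon>_le by (cases "\<epsilon> = 0") (auto simp: le_Suc_eq)

lemma summable_shifted: "summable (\<lambda>j. 1 / ((a (Suc j))\<^sup>2 + V\<^sup>2))"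
proof (rule summable_comparison_test'[OF summable_inverse_squares, of 0])
  fix j
  have "0 < (a (Suc j))\<^sup>2" using a_pos[of j] by simp
  then show "norm (1 / ((a (Suc j))\<^sup>2 + V\<^sup>2)) \<le> 1 / (a (Suc j))\<^sup>2"
    by (simp add: frac_le)
qed

text \<open>Each factor is at most the exponential of \<open>(v^2 - V^2 + M) / b j\<close> times a
  weight \<open>G\<close> not exceeding 1. The saddle equation sums the exponents to
  \<open>(v^2 - V^2 + M) / (2 T)\<close>. For the first \<open>n\<close> zeros \<open>b j\<close> is
  at most \<open>B\<close>, so their weights are at most the common value
  \<open>G d m\<close>.\<close>

lemma ratio_bound_saddle:
  fixes v :: real
  assumes adm: "admissible V z" and T: "0 < T"
    and saddle: "(\<lambda>j. 1 / ((a (Suc j))\<^sup>2 + V\<^sup>2)) sums (1 / (2 * T))"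
    and n: "\<And>j. j < n \<Longrightarrow> (a (Suc j))\<^sup>2 \<le> L\<^sup>2"
  defines "M \<equiv> square_shift V z" and "B \<equiv> L\<^sup>2 + V\<^sup>2"
  defines "d \<equiv> (v\<^sup>2 - V\<^sup>2) / B" and "m \<equiv> M / B"
  shows "norm (E (\<i> * of_real v) / E z) \<le> (1 + \<bar>v\<bar> / norm z) * exp ((v\<^sup>2 - V\<^sup>2 + M) / (2 * T)) *
     (exp (- (d\<^sup>2 / (2 * (1 + \<bar>d\<bar>)))) / sqrt (1 + m\<^sup>2 * exp (2 * m) / 3)) ^ n"
proof -
  define b where "b j = (a (Suc j))\<^sup>2 + V\<^sup>2" for j
  have V: "0 < V" and z: "Im z \<noteq> 0" and M: "0 \<le> M" using adm by (auto simp: admissible_def M_def)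
  have b: "0 < b j" for j using V by (simp add: b_def add_nonneg_pos)
  have bB: "b j \<le> B" if "j < n" for j using n[OF that] by (simp add: b_def B_def)
  have bV: "V\<^sup>2 \<le> b j" for j by (simp add: b_def)
  \<comment> \<open>What a factor loses against its exponential. The weights of the zeros beyond the
    first \<open>n\<close> are simply bounded by 1.\<close>
  define G where "G x y = exp (- (x\<^sup>2 / (2 * (1 + \<bar>x\<bar>)))) / sqrt (1 + y\<^sup>2 * exp (2 * y) / 3)" for x y :: real
  have G: "0 \<le> G x y" "G x y \<le> 1" for x y
  proof -
    have s: "1 \<le> sqrt (1 + y\<^sup>2 * exp (2 * y) / 3)" by simp
    show "0 \<le> G x y" unfolding G_def by (intro divide_nonneg_nonneg) (use s in auto)
    have "exp (- (x\<^sup>2 / (2 * (1 + \<bar>x\<bar>)))) \<le> 1" by simp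
    with s have "exp (- (x\<^sup>2 / (2 * (1 + \<bar>x\<bar>)))) \<le> sqrt (1 + y\<^sup>2 * exp (2 * y) / 3)" by linarith
    then show "G x y \<le> 1" unfolding G_def using s by (subst divide_le_eq_1_pos) linarith+
  qed
  define r where "r j = norm ((1 - (\<i> * of_real v)\<^sup>2 / (complex_of_real (a (Suc j)))\<^sup>2) / (1 - z\<^sup>2 / (complex_of_real (a (Suc j)))\<^sup>2))" for j
  have r: "r j \<le> exp ((v\<^sup>2 - V\<^sup>2 + M) * (1 / b j)) * G ((v\<^sup>2 - V\<^sup>2) / b j) (M / b j)" for j
  proof -
    let ?d = "(v\<^sup>2 - V\<^sup>2) / b j" and ?m = "M / b j"
    have "- 1 * b j \<le> v\<^sup>2 - V\<^sup>2" using bV[of j] zero_le_power2[of v] by linarith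
    then have "- 1 \<le> ?d" using b[of j] by (simp only: pos_le_divide_eq)
    then have "(1 + ?d) * exp (- ?d) \<le> exp (- (?d\<^sup>2 / (2 * (1 + \<bar>?d\<bar>))))" by (rule one_plus_times_exp_le)
    then have "((1 + ?d) * exp (- ?d)) * exp ?d \<le> exp (- (?d\<^sup>2 / (2 * (1 + \<bar>?d\<bar>)))) * exp ?d" by (intro mult_right_mono) auto
    then have 1: "1 + ?d \<le> exp (- (?d\<^sup>2 / (2 * (1 + \<bar>?d\<bar>)))) * exp ?d" by (simp add: mult.assoc flip: exp_add)
    have "r j \<le> (1 + ?d) * (exp ?m / sqrt (1 + ?m\<^sup>2 * exp (2 * ?m) / 3))"
      unfolding r_def M_def b_def by (rule factor_ratio_bound[OF adm])
    also have "\<dots> \<le> (exp (- (?d\<^sup>2 / (2 * (1 + \<bar>?d\<bar>)))) * exp ?d) * (exp ?m / sqrt (1 + ?m\<^sup>2 * exp (2 * ?m) / 3))"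
      by (intro mult_right_mono 1) (auto intro!: divide_nonneg_nonneg add_nonneg_nonneg)
    also have "\<dots> = exp (?d + ?m) * G ?d ?m" by (simp add: G_def exp_add)
    also have "?d + ?m = (v\<^sup>2 - V\<^sup>2 + M) * (1 / b j)" by (simp add: add_divide_distrib)
    finally show ?thesis .
  qed
  \<comment> \<open>\<open>G\<close> decreases in the modulus of its first argument and in its
    second, and both moduli grow when the denominator \<open>B\<close> is replaced by the smaller
    \<open>b j\<close>.\<close>
  have Gmono: "G ((v\<^sup>2 - V\<^sup>2) / b j) (M / b j) \<le> G d m" if "j < n" for j
  proof -
    let ?d = "(v\<^sup>2 - V\<^sup>2) / b j" and ?m = "M / b j"
    have B: "0 < B" using bB[OF that] b[of j] by linarith
    have "\<bar>d\<bar> \<le> \<bar>?d\<bar>" unfolding d_def abs_divide using bB[OF that] b[of j] B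
      by (simp add: divide_left_mono)
    then have "\<bar>d\<bar>\<^sup>2 / (2 * (1 + \<bar>d\<bar>)) \<le> \<bar>?d\<bar>\<^sup>2 / (2 * (1 + \<bar>?d\<bar>))"
    proof -
      assume le: "\<bar>d\<bar> \<le> \<bar>?d\<bar>"
      have "x\<^sup>2 / (2 * (1 + x)) \<le> y\<^sup>2 / (2 * (1 + y))" if xy: "0 \<le> x" "x \<le> y" for x y :: real
      proof -
        have "x\<^sup>2 * (1 + y) \<le> y\<^sup>2 * (1 + x)"
        proof -
          have "x * x * y \<le> y * y * x" using mult_mono[of "x * y" "x * y" x y] xy by (simp add: mult_ac mult_left_mono)
          moreover have "x * x \<le> y * y" using xy by (intro mult_mono) auto
          ultimately show ?thesis by (simp add: power2_eq_square algebra_simps)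
        qed
        then show ?thesis using xy by (simp add: divide_simps) (simp add: algebra_simps)
      qed
      from this[OF abs_ge_zero le] show ?thesis .
    qed
    then have 1: "exp (- (?d\<^sup>2 / (2 * (1 + \<bar>?d\<bar>)))) \<le> exp (- (d\<^sup>2 / (2 * (1 + \<bar>d\<bar>))))"
      unfolding power2_abs by simp
    have m: "0 \<le> m" "m \<le> ?m" unfolding m_def using M B bB[OF that] b[of j] by (auto intro!: divide_left_mono)
    then have "m\<^sup>2 * exp (2 * m) \<le> ?m\<^sup>2 * exp (2 * ?m)" by (intro mult_mono power_mono) auto
    then have 2: "sqrt (1 + m\<^sup>2 * exp (2 * m) / 3) \<le> sqrt (1 + ?m\<^sup>2 * exp (2 * ?m) / 3)" by simp
    show ?thesis unfolding G_def
      by (rule frac_le[OF _ 1 _ 2]) (auto intro!: add_pos_nonneg)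
  qed
  have partial: "norm ((\<i> * of_real v / z) ^ \<epsilon>) * (\<Prod>j<N. r j) \<le>
     (1 + \<bar>v\<bar> / norm z) * exp ((v\<^sup>2 - V\<^sup>2 + M) * (\<Sum>j<N. 1 / b j)) * G d m ^ n" if N: "n \<le> N" for N
  proof -
    have "(\<Prod>j<N. r j) \<le> (\<Prod>j<N. exp ((v\<^sup>2 - V\<^sup>2 + M) * (1 / b j)) * G ((v\<^sup>2 - V\<^sup>2) / b j) (M / b j))"
      by (intro prod_mono) (use r in \<open>auto simp: r_def\<close>)
    also have "\<dots> = exp ((v\<^sup>2 - V\<^sup>2 + M) * (\<Sum>j<N. 1 / b j)) * (\<Prod>j<N. G ((v\<^sup>2 - V\<^sup>2) / b j) (M / b j))"
      by (simp only: prod.distrib exp_sum[symmetric] finite_lessThan sum_distrib_left)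
    also have "(\<Prod>j<N. G ((v\<^sup>2 - V\<^sup>2) / b j) (M / b j)) = (\<Prod>j<n. G ((v\<^sup>2 - V\<^sup>2) / b j) (M / b j)) * (\<Prod>j\<in>{n..<N}. G ((v\<^sup>2 - V\<^sup>2) / b j) (M / b j))"
      using N by (subst prod.union_disjoint[symmetric]) (auto intro!: prod.cong)
    also have "\<dots> \<le> G d m ^ n * 1"
    proof (intro mult_mono)
      have "(\<Prod>j<n. G ((v\<^sup>2 - V\<^sup>2) / b j) (M / b j)) \<le> (\<Prod>j<n. G d m)" by (intro prod_mono) (use G Gmono in auto)
      then show "(\<Prod>j<n. G ((v\<^sup>2 - V\<^sup>2) / b j) (M / b j)) \<le> G d m ^ n" by simp
      show "(\<Prod>j\<in>{n..<N}. G ((v\<^sup>2 - V\<^sup>2) / b j) (M / b j)) \<le> 1" by (intro prod_le_1) (use G in auto)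
    qed (use G in \<open>auto intro!: prod_nonneg\<close>)
    finally have 1: "(\<Prod>j<N. r j) \<le> exp ((v\<^sup>2 - V\<^sup>2 + M) * (\<Sum>j<N. 1 / b j)) * G d m ^ n" by simp
    have "norm ((\<i> * of_real v / z) ^ \<epsilon>) = (\<bar>v\<bar> / norm z) ^ \<epsilon>" by (simp add: norm_power norm_divide norm_mult)
    also have "\<dots> \<le> 1 + \<bar>v\<bar> / norm z" by (rule power_\<epsilon>_le) simp
    finally have 2: "norm ((\<i> * of_real v / z) ^ \<epsilon>) \<le> 1 + \<bar>v\<bar> / norm z" .
    have "norm ((\<i> * of_real v / z) ^ \<epsilon>) * (\<Prod>j<N. r j) \<le> (1 + \<bar>v\<bar> / norm z) * (exp ((v\<^sup>2 - V\<^sup>2 + M) * (\<Sum>j<N. 1 / b j)) * G d m ^ n)"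
      by (rule mult_mono[OF 2 1]) (auto intro!: prod_nonneg simp: r_def)
    then show ?thesis by (simp add: mult.assoc)
  qed
  have lim: "(\<lambda>N. (1 + \<bar>v\<bar> / norm z) * exp ((v\<^sup>2 - V\<^sup>2 + M) * (\<Sum>j<N. 1 / b j)) * G d m ^ n) \<longlonglongrightarrow>
     (1 + \<bar>v\<bar> / norm z) * exp ((v\<^sup>2 - V\<^sup>2 + M) * (1 / (2 * T))) * G d m ^ n"
    using saddle unfolding sums_def b_def by (intro tendsto_intros)
  have "norm (E (\<i> * of_real v) / E z) \<le> (1 + \<bar>v\<bar> / norm z) * exp ((v\<^sup>2 - V\<^sup>2 + M) * (1 / (2 * T))) * G d m ^ n"
    by (rule LIMSEQ_le[OF ratio_tendsto[OF z] lim]) (use partial in \<open>auto simp: r_def intro!: exI[of _ n]\<close>)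
  then show ?thesis by (simp add: G_def)
qed

text \<open>Growth of order 2 with arbitrarily small type, at a fixed \<open>V\<close>: the tail of
  the convergent sum of \<open>1 / b j\<close> can be made smaller than any \<open>\<delta>\<close>,
  and the finitely many remaining factors grow at most polynomially in \<open>v\<close> and are
  bounded in \<open>z\<close>. It serves for integrability only, where \<open>V\<close> need not be
  a saddle.\<close>

lemma ratio_bound_general:
  assumes \<delta>: "0 < \<delta>" and V: "0 < V"
  shows "\<exists>C>0. \<forall>z v. admissible V z \<longrightarrow> norm (E (\<i> * of_real v) / E z) \<le> C * (1 + \<bar>v\<bar> / norm z) * exp (\<delta> * (v\<^sup>2 + square_shift V z))"
proof -
  define b where "b j = (a (Suc j))\<^sup>2 + V\<^sup>2" for j
  have b: "0 < b j" "V\<^sup>2 \<le> b j" for j using V by (auto simp: b_def add_nonneg_pos)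
  have sm: "summable (\<lambda>j. 1 / b j)" unfolding b_def by (rule summable_shifted)
  define S where "S = (\<Sum>j. 1 / b j)"
  have "(\<lambda>J. \<Sum>j<J. 1 / b j) \<longlonglongrightarrow> S" unfolding S_def by (rule summable_LIMSEQ[OF sm])
  then have "\<forall>\<^sub>F J in sequentially. S - \<delta> / 2 < (\<Sum>j<J. 1 / b j)" by (rule order_tendstoD) (use \<delta> in simp)
  then obtain J where J: "S - \<delta> / 2 < (\<Sum>j<J. 1 / b j)" by (auto simp: eventually_sequentially)
  have le_S: "(\<Sum>j<N. 1 / b j) \<le> S" for N unfolding S_def
    by (rule sum_le_suminf[OF sm]) (use b in \<open>auto simp: less_imp_le\<close>)
  \<comment> \<open>With this rate the bound for \<open>(1 + v^2 / V^2)^J\<close> contributes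
    \<open>\<delta> / 2 * v^2\<close> to the exponent, the half left over by the tail.\<close>
  define \<delta>' where "\<delta>' = \<delta> / 2 * V\<^sup>2"
  have \<delta>': "0 < \<delta>'" using \<delta> V by (simp add: \<delta>'_def)
  define C where "C = exp 2 ^ J * (fact J / \<delta>' ^ J * exp \<delta>')"
  have C: "0 < C" using \<delta>' by (simp add: C_def)
  have main: "norm (E (\<i> * of_real v) / E z) \<le> C * (1 + \<bar>v\<bar> / norm z) * exp (\<delta> * (v\<^sup>2 + square_shift V z))"
    if adm: "admissible V z" for z and v :: real
  proof -
    define M where "M = square_shift V z"
    have z: "Im z \<noteq> 0" and M: "0 \<le> M" "4 / 3 * M\<^sup>2 \<le> (Im (z\<^sup>2))\<^sup>2" using adm by (auto simp: admissible_def M_def)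
    define r where "r j = norm ((1 - (\<i> * of_real v)\<^sup>2 / (complex_of_real (a (Suc j)))\<^sup>2) / (1 - z\<^sup>2 / (complex_of_real (a (Suc j)))\<^sup>2))" for j
    have r0: "0 \<le> r j" for j by (simp add: r_def)
    have rb: "r j \<le> (1 + v\<^sup>2 / b j) * (exp (M / b j) / sqrt (1 + (M / b j)\<^sup>2 * exp (2 * (M / b j)) / 3))" for j
    proof -
      have "r j \<le> (1 + (v\<^sup>2 - V\<^sup>2) / b j) * (exp (M / b j) / sqrt (1 + (M / b j)\<^sup>2 * exp (2 * (M / b j)) / 3))"
        unfolding r_def M_def b_def by (rule factor_ratio_bound[OF adm])
      also have "\<dots> \<le> (1 + v\<^sup>2 / b j) * (exp (M / b j) / sqrt (1 + (M / b j)\<^sup>2 * exp (2 * (M / b j)) / 3))"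
        using b[of j] by (intro mult_right_mono add_left_mono divide_right_mono divide_nonneg_nonneg) auto
      finally show ?thesis .
    qed
    have r1: "r j \<le> exp ((v\<^sup>2 + M) * (1 / b j))" for j
    proof -
      have "exp (M / b j) / sqrt (1 + (M / b j)\<^sup>2 * exp (2 * (M / b j)) / 3) \<le> exp (M / b j) / 1"
        by (intro divide_left_mono) (auto intro: add_pos_nonneg)
      moreover have "1 + v\<^sup>2 / b j \<le> exp (v\<^sup>2 / b j)" by (rule exp_ge_add_one_self)
      ultimately have "(1 + v\<^sup>2 / b j) * (exp (M / b j) / sqrt (1 + (M / b j)\<^sup>2 * exp (2 * (M / b j)) / 3)) \<le> exp (v\<^sup>2 / b j) * exp (M / b j)"
        using b[of j] by (intro mult_mono) (auto intro!: divide_nonneg_nonneg add_nonneg_nonneg)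
      then show ?thesis using rb[of j] by (simp add: add_divide_distrib exp_add)
    qed
    have r2: "r j \<le> exp 2 * (1 + v\<^sup>2 / V\<^sup>2)" for j
    proof -
      \<comment> \<open>With \<open>m = M / b j\<close>: if \<open>m \<le> 2\<close> the exponential
        is at most \<open>exp 4\<close>; if \<open>m > 2\<close> then \<open>m^2 / 3 > 1\<close> and
        the second summand alone suffices.\<close>
      have "exp (2 * (M / b j)) \<le> exp 4 * (1 + (M / b j)\<^sup>2 * exp (2 * (M / b j)) / 3)"
      proof (cases "M / b j \<le> 2")
        case True
        then have "exp (2 * (M / b j)) * 1 \<le> exp 4 * (1 + (M / b j)\<^sup>2 * exp (2 * (M / b j)) / 3)"
          by (intro mult_mono) auto
        then show ?thesis by simp
      next
        case False
        then have "2\<^sup>2 \<le> (M / b j)\<^sup>2" by (intro power_mono) auto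
        then have "1 * exp (2 * (M / b j)) \<le> (M / b j)\<^sup>2 / 3 * exp (2 * (M / b j))" by (intro mult_right_mono) auto
        then have "1 * exp (2 * (M / b j)) \<le> exp 4 * (1 + (M / b j)\<^sup>2 * exp (2 * (M / b j)) / 3)"
          by (intro order_trans[OF _ mult_mono[of 1 "exp 4" "(M / b j)\<^sup>2 * exp (2 * (M / b j)) / 3"]]) auto
        then show ?thesis by simp
      qed
      then have "sqrt (exp (2 * (M / b j))) \<le> sqrt (exp 4 * (1 + (M / b j)\<^sup>2 * exp (2 * (M / b j)) / 3))"
        by (rule real_sqrt_le_mono)
      moreover have "sqrt (exp (2 * (M / b j))) = exp (M / b j)" "sqrt (exp 4) = exp (2 :: real)"
        by (simp_all add: real_sqrt_unique power2_eq_square flip: exp_add)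
      ultimately have "exp (M / b j) \<le> exp 2 * sqrt (1 + (M / b j)\<^sup>2 * exp (2 * (M / b j)) / 3)"
        by (simp add: real_sqrt_mult)
      then have 1: "exp (M / b j) / sqrt (1 + (M / b j)\<^sup>2 * exp (2 * (M / b j)) / 3) \<le> exp 2"
        by (subst pos_divide_le_eq) (auto intro: add_pos_nonneg)
      have "v\<^sup>2 / b j \<le> v\<^sup>2 / V\<^sup>2" using b[of j] V by (intro divide_left_mono) auto
      then have "(1 + v\<^sup>2 / b j) * (exp (M / b j) / sqrt (1 + (M / b j)\<^sup>2 * exp (2 * (M / b j)) / 3)) \<le> (1 + v\<^sup>2 / V\<^sup>2) * exp 2"
        using 1 b[of j] by (intro mult_mono) (auto intro!: divide_nonneg_nonneg add_nonneg_nonneg)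
      then show ?thesis using rb[of j] by (simp add: mult.commute)
    qed
    have partial: "norm ((\<i> * of_real v / z) ^ \<epsilon>) * (\<Prod>j<N. r j) \<le> C * (1 + \<bar>v\<bar> / norm z) * exp (\<delta> * (v\<^sup>2 + M))" if N: "J \<le> N" for N
    proof -
      have "(\<Prod>j<N. r j) = (\<Prod>j<J. r j) * (\<Prod>j\<in>{J..<N}. r j)"
        using N by (subst prod.union_disjoint[symmetric]) (auto intro!: prod.cong)
      also have "\<dots> \<le> (exp 2 * (1 + v\<^sup>2 / V\<^sup>2)) ^ J * exp (\<delta> / 2 * (v\<^sup>2 + M))"
      proof (intro mult_mono)
        have "(\<Prod>j<J. r j) \<le> (\<Prod>j<J. exp 2 * (1 + v\<^sup>2 / V\<^sup>2))" by (intro prod_mono) (use r0 r2 in auto)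
        then show "(\<Prod>j<J. r j) \<le> (exp 2 * (1 + v\<^sup>2 / V\<^sup>2)) ^ J" by simp
        have "(\<Prod>j\<in>{J..<N}. r j) \<le> (\<Prod>j\<in>{J..<N}. exp ((v\<^sup>2 + M) * (1 / b j)))" by (intro prod_mono) (use r0 r1 in auto)
        also have "\<dots> = exp ((v\<^sup>2 + M) * (\<Sum>j\<in>{J..<N}. 1 / b j))" by (simp only: exp_sum[symmetric] finite_atLeastLessThan sum_distrib_left)
        also have "\<dots> \<le> exp ((v\<^sup>2 + M) * (\<delta> / 2))"
        proof -
          have "(\<Sum>j<N. 1 / b j) = (\<Sum>j<J. 1 / b j) + (\<Sum>j\<in>{J..<N}. 1 / b j)"
            using N by (subst sum.union_disjoint[symmetric]) (auto intro!: sum.cong)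
          then have "(\<Sum>j\<in>{J..<N}. 1 / b j) \<le> \<delta> / 2" using J le_S[of N] by linarith
          then have "(v\<^sup>2 + M) * (\<Sum>j\<in>{J..<N}. 1 / b j) \<le> (v\<^sup>2 + M) * (\<delta> / 2)" using M by (intro mult_left_mono) auto
          then show ?thesis by simp
        qed
        finally show "(\<Prod>j\<in>{J..<N}. r j) \<le> exp (\<delta> / 2 * (v\<^sup>2 + M))" by (simp add: mult.commute)
      qed (use r0 in \<open>auto intro!: prod_nonneg mult_nonneg_nonneg add_nonneg_nonneg\<close>)
      also have "(exp 2 * (1 + v\<^sup>2 / V\<^sup>2)) ^ J * exp (\<delta> / 2 * (v\<^sup>2 + M)) \<le> C * exp (\<delta> * (v\<^sup>2 + M))"
      proof -
        have "(1 + v\<^sup>2 / V\<^sup>2) ^ J \<le> fact J / \<delta>' ^ J * exp (\<delta>' * (1 + v\<^sup>2 / V\<^sup>2))"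
          by (rule Bernoulli_power_bound) (use \<delta>' in auto)
        also have "\<delta>' * (1 + v\<^sup>2 / V\<^sup>2) = \<delta>' + \<delta> / 2 * v\<^sup>2" using V by (simp add: \<delta>'_def distrib_left)
        also have "fact J / \<delta>' ^ J * exp (\<delta>' + \<delta> / 2 * v\<^sup>2) \<le> fact J / \<delta>' ^ J * exp (\<delta>' + \<delta> / 2 * (v\<^sup>2 + M))"
          using M \<delta> \<delta>' by (intro mult_left_mono) auto
        finally have "exp 2 ^ J * (1 + v\<^sup>2 / V\<^sup>2) ^ J * exp (\<delta> / 2 * (v\<^sup>2 + M)) \<le>
            exp 2 ^ J * (fact J / \<delta>' ^ J * exp (\<delta>' + \<delta> / 2 * (v\<^sup>2 + M))) * exp (\<delta> / 2 * (v\<^sup>2 + M))"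
          by (intro mult_right_mono mult_left_mono) auto
        also have "\<dots> = C * (exp (\<delta> / 2 * (v\<^sup>2 + M)) * exp (\<delta> / 2 * (v\<^sup>2 + M)))" by (simp add: C_def exp_add)
        also have "exp (\<delta> / 2 * (v\<^sup>2 + M)) * exp (\<delta> / 2 * (v\<^sup>2 + M)) = exp (\<delta> * (v\<^sup>2 + M))" by (simp flip: exp_add)
        finally show ?thesis by (simp add: power_mult_distrib)
      qed
      finally have 1: "(\<Prod>j<N. r j) \<le> C * exp (\<delta> * (v\<^sup>2 + M))" .
      have "norm ((\<i> * of_real v / z) ^ \<epsilon>) = (\<bar>v\<bar> / norm z) ^ \<epsilon>" by (simp add: norm_power norm_divide norm_mult)
      also have "\<dots> \<le> 1 + \<bar>v\<bar> / norm z" by (rule power_\<epsilon>_le) simp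
      finally have 2: "norm ((\<i> * of_real v / z) ^ \<epsilon>) \<le> 1 + \<bar>v\<bar> / norm z" .
      have "norm ((\<i> * of_real v / z) ^ \<epsilon>) * (\<Prod>j<N. r j) \<le> (1 + \<bar>v\<bar> / norm z) * (C * exp (\<delta> * (v\<^sup>2 + M)))"
        by (rule mult_mono[OF 2 1]) (auto intro!: prod_nonneg simp: r_def)
      then show ?thesis by (simp add: mult_ac)
    qed
    show ?thesis
      unfolding M_def[symmetric]
      by (rule LIMSEQ_le_const2[OF ratio_tendsto[OF z]]) (use partial in \<open>auto simp: r_def intro!: exI[of _ J]\<close>)
  qed
  show ?thesis using C main by blast
qed

end

section \<open>Gaussian integrals against the Cauchy singularity\<close>

text \<open>The function \<open>|u|^(-1/2)\<close>, valued in \<open>ennreal\<close> so that it is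
  infinite at 0, where real division would give 0 and spoil the pointwise domination of the Cauchy
  kernel.\<close>

definition root_weight :: "real \<Rightarrow> ennreal" where
  "root_weight u = inverse (ennreal (sqrt \<bar>u\<bar>))"

lemma root_weight_measurable [measurable]: "root_weight \<in> borel_measurable borel"
  unfolding root_weight_def by measurable

lemma inverse_distance_le_root_weight:
  "ennreal (1 / sqrt (r\<^sup>2 + u\<^sup>2)) \<le> root_weight r * root_weight u"
proof (cases "r = 0 \<or> u = 0")
  case True
  have pos: "root_weight x \<noteq> 0" for x by (simp add: root_weight_def)
  show ?thesis
  proof (cases "r = 0 \<and> u = 0")
    case False
    with True have "root_weight r * root_weight u = \<top>"
      using pos[of r] pos[of u] by (auto simp: root_weight_def ennreal_top_mult ennreal_mult_top)
    then show ?thesis by simp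
  qed simp
next
  case False
  then have p: "0 < \<bar>r\<bar>" "0 < \<bar>u\<bar>" by auto
  have "\<bar>r\<bar> * \<bar>u\<bar> \<le> r\<^sup>2 + u\<^sup>2"
  proof -
    have "2 * \<bar>r\<bar> * \<bar>u\<bar> \<le> r\<^sup>2 + u\<^sup>2" using sum_squares_bound[of "\<bar>r\<bar>" "\<bar>u\<bar>"] by simp
    moreover have "0 \<le> \<bar>r\<bar> * \<bar>u\<bar>" by simp
    ultimately show ?thesis unfolding mult.assoc by linarith
  qed
  then have "sqrt \<bar>r\<bar> * sqrt \<bar>u\<bar> \<le> sqrt (r\<^sup>2 + u\<^sup>2)" by (simp flip: real_sqrt_mult)
  then have "1 / sqrt (r\<^sup>2 + u\<^sup>2) \<le> 1 / (sqrt \<bar>r\<bar> * sqrt \<bar>u\<bar>)"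
    using p by (intro divide_left_mono mult_pos_pos real_sqrt_gt_zero) (auto simp: sum_power2_gt_zero_iff)
  also have "\<dots> = inverse (sqrt \<bar>r\<bar>) * inverse (sqrt \<bar>u\<bar>)" by (simp add: field_simps)
  finally have "ennreal (1 / sqrt (r\<^sup>2 + u\<^sup>2)) \<le> ennreal (inverse (sqrt \<bar>r\<bar>)) * ennreal (inverse (sqrt \<bar>u\<bar>))"
    by (simp add: ennreal_mult[symmetric] ennreal_leI)
  then show ?thesis using p by (simp add: root_weight_def inverse_ennreal)
qed

lemma nn_integral_root_weight:
  assumes "0 \<le> \<delta>"
  shows "(\<integral>\<^sup>+u. root_weight (u - h) * indicator {h - \<delta>..h + \<delta>} u \<partial>lborel) \<le> ennreal (4 * sqrt \<delta>)"
proof -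
  have half: "(\<integral>\<^sup>+u. ennreal (u powr (- 1 / 2)) * indicator {0..\<delta>} u \<partial>lborel) = ennreal (2 * sqrt \<delta>)"
  proof -
    have "((\<lambda>u. u powr (- 1 / 2)) has_integral 2 * sqrt \<delta>) {0..\<delta>}"
      using has_integral_powr_from_0[of "- 1 / 2" \<delta>] assms by (simp add: powr_half_sqrt mult.commute)
    then have "(\<integral>\<^sup>+u. ennreal (indicator {0..\<delta>} u * u powr (- 1 / 2)) \<partial>lborel) = ennreal (2 * sqrt \<delta>)"
      by (intro nn_integral_has_integral_lebesgue) auto
    then show ?thesis by (simp add: ennreal_mult' ennreal_indicator mult.commute)
  qed
  have "(\<integral>\<^sup>+u. root_weight (u - h) * indicator {h - \<delta>..h + \<delta>} u \<partial>lborel) = (\<integral>\<^sup>+u. root_weight u * indicator {- \<delta>..\<delta>} u \<partial>lborel)"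
  proof -
    have "(\<integral>\<^sup>+u. root_weight (u - h) * indicator {h - \<delta>..h + \<delta>} u \<partial>lborel) =
        (\<integral>\<^sup>+u. root_weight (h + u - h) * indicator {h - \<delta>..h + \<delta>} (h + u) \<partial>lborel)"
      using nn_integral_real_affine[of "\<lambda>u. root_weight (u - h) * indicator {h - \<delta>..h + \<delta>} u" 1 h] by simp
    also have "\<dots> = (\<integral>\<^sup>+u. root_weight u * indicator {- \<delta>..\<delta>} u \<partial>lborel)"
      by (rule nn_integral_cong) (auto simp: indicator_def)
    finally show ?thesis .
  qed
  also have "\<dots> \<le> (\<integral>\<^sup>+u. ennreal (u powr (- 1 / 2)) * indicator {0..\<delta>} u + ennreal ((- u) powr (- 1 / 2)) * indicator {0..\<delta>} (- u) \<partial>lborel)"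
  proof (rule nn_integral_mono_AE)
    have "AE u in lborel. u \<noteq> (0::real)" by (rule AE_lborel_singleton)
    then show "AE u in lborel. root_weight u * indicator {- \<delta>..\<delta>} u \<le>
        ennreal (u powr (- 1 / 2)) * indicator {0..\<delta>} u + ennreal ((- u) powr (- 1 / 2)) * indicator {0..\<delta>} (- u)"
    proof eventually_elim
      case (elim u)
      have w: "root_weight u = ennreal (\<bar>u\<bar> powr (- 1 / 2))"
      proof -
        have "\<bar>u\<bar> powr (- 1 / 2) = inverse (sqrt \<bar>u\<bar>)"
          using powr_minus[of "\<bar>u\<bar>" "1 / 2"] by (simp add: powr_half_sqrt)
        then show ?thesis using elim by (simp add: root_weight_def inverse_ennreal)
      qed
      show ?case
      proof (cases "0 < u")
        case True
        then show ?thesis unfolding w by (auto simp: indicator_def)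
      next
        case False
        then have "u < 0" using elim by simp
        then show ?thesis unfolding w by (auto simp: indicator_def)
      qed
    qed
  qed
  also have "\<dots> = (\<integral>\<^sup>+u. ennreal (u powr (- 1 / 2)) * indicator {0..\<delta>} u \<partial>lborel) + (\<integral>\<^sup>+u. ennreal ((- u) powr (- 1 / 2)) * indicator {0..\<delta>} (- u) \<partial>lborel)"
    by (rule nn_integral_add) auto
  also have "(\<integral>\<^sup>+u. ennreal ((- u) powr (- 1 / 2)) * indicator {0..\<delta>} (- u) \<partial>lborel) = (\<integral>\<^sup>+u. ennreal (u powr (- 1 / 2)) * indicator {0..\<delta>} u \<partial>lborel)"
    using nn_integral_real_affine[of "\<lambda>u. ennreal ((- u) powr (- 1 / 2)) * indicator {0..\<delta>} (- u)" "- 1" 0] by simp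
  also have "(\<integral>\<^sup>+u. ennreal (u powr (- 1 / 2)) * indicator {0..\<delta>} u \<partial>lborel) + (\<integral>\<^sup>+u. ennreal (u powr (- 1 / 2)) * indicator {0..\<delta>} u \<partial>lborel) = ennreal (4 * sqrt \<delta>)"
    unfolding half using assms by (simp flip: ennreal_plus)
  finally show ?thesis .
qed

lemma nn_integral_Gaussian:
  assumes "0 < \<kappa>"
  shows "(\<integral>\<^sup>+v. ennreal (exp (- (\<kappa> * (v - c)\<^sup>2))) \<partial>lborel) = ennreal (sqrt (pi / \<kappa>))"
proof -
  define s where "s = sqrt (1 / (2 * \<kappa>))"
  have s: "0 < s" "s\<^sup>2 = 1 / (2 * \<kappa>)" using assms by (auto simp: s_def)
  interpret prob_space "density lborel (normal_density c s)" by (rule prob_space_normal_density[OF s(1)])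
  have 1: "(\<integral>\<^sup>+v. ennreal (normal_density c s v) \<partial>lborel) = 1"
    using emeasure_space_1 by (simp add: emeasure_density)
  have "exp (- (\<kappa> * (v - c)\<^sup>2)) = sqrt (pi / \<kappa>) * normal_density c s v" for v
    unfolding normal_density_def s(2) using assms by (simp add: field_simps real_sqrt_divide)
  then have "(\<integral>\<^sup>+v. ennreal (exp (- (\<kappa> * (v - c)\<^sup>2))) \<partial>lborel) = (\<integral>\<^sup>+v. ennreal (sqrt (pi / \<kappa>)) * ennreal (normal_density c s v) \<partial>lborel)"
    using assms by (simp add: ennreal_mult)
  also have "\<dots> = ennreal (sqrt (pi / \<kappa>))" by (subst nn_integral_cmult) (auto simp: 1)
  finally show ?thesis .
qed

text \<open>Split at distance \<open>\<kappa>^(-1/2)\<close> from the singularity, the width of the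
  Gaussian. Near it the weight integrates to order \<open>\<kappa>^(-1/4)\<close>; away from it the
  weight is at most \<open>\<kappa>^(1/4)\<close> and the Gaussians, one at \<open>c\<close> and one
  at \<open>- c\<close>, have integrals of order \<open>\<kappa>^(-1/2)\<close>. The bound is
  uniform in \<open>h\<close> and \<open>c\<close>.\<close>

lemma nn_integral_root_weight_Gaussian:
  assumes \<kappa>: "0 < \<kappa>"
  shows "(\<integral>\<^sup>+v. root_weight (v - h) * ennreal (exp (- (\<kappa> * (\<bar>v\<bar> - c)\<^sup>2))) \<partial>lborel) \<le> ennreal ((4 + 2 * sqrt pi) * \<kappa> powr (- 1 / 4))"
proof -
  define p where "p = \<kappa> powr (- 1 / 4)"
  have p: "0 < p" using \<kappa> by (simp add: p_def)
  define \<delta> where "\<delta> = p * p"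
  have \<delta>: "0 < \<delta>" "sqrt \<delta> = p" using p by (auto simp: \<delta>_def)
  have pp: "sqrt (pi / \<kappa>) = sqrt pi * (p * p)"
  proof -
    have "p * p = \<kappa> powr (- 1 / 2)" unfolding p_def by (simp flip: powr_add)
    also have "\<dots> = inverse (sqrt \<kappa>)" using powr_minus[of \<kappa> "1 / 2"] \<kappa> by (simp add: powr_half_sqrt)
    finally show ?thesis by (simp add: real_sqrt_mult real_sqrt_inverse divide_inverse)
  qed
  let ?g = "\<lambda>v. ennreal (exp (- (\<kappa> * (\<bar>v\<bar> - c)\<^sup>2)))"
  have pt: "root_weight (v - h) * ?g v \<le> root_weight (v - h) * indicator {h - \<delta>..h + \<delta>} v +
      ennreal (1 / sqrt \<delta>) * (ennreal (exp (- (\<kappa> * (v - c)\<^sup>2))) + ennreal (exp (- (\<kappa> * (v - (- c))\<^sup>2))))" for v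
  proof (cases "v \<in> {h - \<delta>..h + \<delta>}")
    case True
    have "?g v \<le> 1" using \<kappa> by simp
    then have "root_weight (v - h) * ?g v \<le> root_weight (v - h) * 1" by (intro mult_left_mono) auto
    with True show ?thesis by (simp add: add_increasing2)
  next
    case False
    then have d: "\<delta> < \<bar>v - h\<bar>" by auto
    then have "sqrt \<delta> \<le> sqrt \<bar>v - h\<bar>" by simp
    then have "inverse (sqrt \<bar>v - h\<bar>) \<le> inverse (sqrt \<delta>)" using \<delta> by (intro le_imp_inverse_le) auto
    moreover have "root_weight (v - h) = ennreal (inverse (sqrt \<bar>v - h\<bar>))"
      unfolding root_weight_def using d \<delta> by (subst inverse_ennreal) auto
    ultimately have 1: "root_weight (v - h) \<le> ennreal (1 / sqrt \<delta>)" by (simp add: inverse_eq_divide ennreal_leI)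
    have 2: "?g v \<le> ennreal (exp (- (\<kappa> * (v - c)\<^sup>2))) + ennreal (exp (- (\<kappa> * (v - (- c))\<^sup>2)))"
    proof (cases "0 \<le> v")
      case False
      then have "(\<bar>v\<bar> - c)\<^sup>2 = (v - (- c))\<^sup>2" by (simp add: power2_eq_square algebra_simps)
      then show ?thesis by (simp add: add_increasing)
    qed (simp add: add_increasing2)
    from mult_mono[OF 1 2] False show ?thesis by simp
  qed
  have "(\<integral>\<^sup>+v. root_weight (v - h) * ?g v \<partial>lborel) \<le> (\<integral>\<^sup>+v. root_weight (v - h) * indicator {h - \<delta>..h + \<delta>} v +
      ennreal (1 / sqrt \<delta>) * (ennreal (exp (- (\<kappa> * (v - c)\<^sup>2))) + ennreal (exp (- (\<kappa> * (v - (- c))\<^sup>2)))) \<partial>lborel)"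
    by (rule nn_integral_mono) (rule pt)
  also have "\<dots> = (\<integral>\<^sup>+v. root_weight (v - h) * indicator {h - \<delta>..h + \<delta>} v \<partial>lborel) +
      ennreal (1 / sqrt \<delta>) * ((\<integral>\<^sup>+v. ennreal (exp (- (\<kappa> * (v - c)\<^sup>2))) \<partial>lborel) + (\<integral>\<^sup>+v. ennreal (exp (- (\<kappa> * (v - (- c))\<^sup>2))) \<partial>lborel))"
    by (simp add: nn_integral_add nn_integral_cmult)
  also have "\<dots> \<le> ennreal (4 * sqrt \<delta>) + ennreal (1 / sqrt \<delta>) * (ennreal (sqrt (pi / \<kappa>)) + ennreal (sqrt (pi / \<kappa>)))"
    unfolding nn_integral_Gaussian[OF \<kappa>]
    by (intro add_mono nn_integral_root_weight order_refl) (use \<delta> in simp)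
  also have "\<dots> = ennreal (4 * sqrt \<delta> + 1 / sqrt \<delta> * (sqrt (pi / \<kappa>) + sqrt (pi / \<kappa>)))"
  proof -
    have "ennreal x + ennreal b * (ennreal c + ennreal c) = ennreal (x + b * (c + c))" if "0 \<le> x" "0 \<le> b" "0 \<le> c" for x b c
      by (simp only: ennreal_plus ennreal_mult mult_nonneg_nonneg add_nonneg_nonneg that)
    then show ?thesis by this (use \<delta> p \<kappa> in auto)
  qed
  also have "4 * sqrt \<delta> + 1 / sqrt \<delta> * (sqrt (pi / \<kappa>) + sqrt (pi / \<kappa>)) = (4 + 2 * sqrt pi) * \<kappa> powr (- 1 / 4)"
    unfolding \<delta>(2) pp p_def[symmetric] using p by (simp add: field_simps)
  finally show ?thesis .
qed

text \<open>\<open>(|r| |u|)\<^sup>-\<^sup>1\<^sup>/\<^sup>2\<close> dominates the Cauchy kernel, so that the two variables separate.\<close>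

lemma nn_integral_Cauchy_Gaussian:
  assumes \<kappa>1: "0 < \<kappa>1" and \<kappa>2: "0 < \<kappa>2" and C: "0 \<le> C" and h: "h \<in> borel_measurable borel"
    and F: "\<And>r v. norm (F (r, v)) \<le> C * (1 / sqrt (r\<^sup>2 + (v - h r)\<^sup>2)) * exp (- (\<kappa>1 * r\<^sup>2)) * exp (- (\<kappa>2 * (\<bar>v\<bar> - c)\<^sup>2))"
  shows "(\<integral>\<^sup>+p. ennreal (norm (F p)) \<partial>(lborel \<Otimes>\<^sub>M lborel)) \<le>
     ennreal (C * (4 + 2 * sqrt pi)\<^sup>2 * (\<kappa>1 * \<kappa>2) powr (- 1 / 4))"
proof -
  note h [measurable]
  let ?g = "\<lambda>r. ennreal (exp (- (\<kappa>1 * r\<^sup>2)))" and ?k = "\<lambda>v. ennreal (exp (- (\<kappa>2 * (\<bar>v\<bar> - c)\<^sup>2)))"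
  let ?C0 = "4 + 2 * sqrt pi"
  have pt: "ennreal (norm (F p)) \<le> ennreal C * ((root_weight (fst p) * ?g (fst p)) * (root_weight (snd p - h (fst p)) * ?k (snd p)))" for p
  proof -
    obtain r v where p: "p = (r, v)" by (cases p)
    have "ennreal (norm (F p)) \<le> ennreal (C * (1 / sqrt (r\<^sup>2 + (v - h r)\<^sup>2)) * exp (- (\<kappa>1 * r\<^sup>2)) * exp (- (\<kappa>2 * (\<bar>v\<bar> - c)\<^sup>2)))"
      unfolding p by (intro ennreal_leI F)
    also have "\<dots> = ennreal C * ennreal (1 / sqrt (r\<^sup>2 + (v - h r)\<^sup>2)) * ?g r * ?k v"
      using C by (subst ennreal_mult'', simp)+ simp
    also have "\<dots> \<le> ennreal C * (root_weight r * root_weight (v - h r)) * ?g r * ?k v"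
      by (intro mult_right_mono mult_left_mono inverse_distance_le_root_weight) auto
    finally show ?thesis unfolding p by (simp add: mult_ac)
  qed
  have "(\<integral>\<^sup>+p. ennreal (norm (F p)) \<partial>(lborel \<Otimes>\<^sub>M lborel)) \<le>
     (\<integral>\<^sup>+p. ennreal C * ((root_weight (fst p) * ?g (fst p)) * (root_weight (snd p - h (fst p)) * ?k (snd p))) \<partial>(lborel \<Otimes>\<^sub>M lborel))"
    by (rule nn_integral_mono) (rule pt)
  also have "\<dots> = (\<integral>\<^sup>+r. \<integral>\<^sup>+v. ennreal C * ((root_weight r * ?g r) * (root_weight (v - h r) * ?k v)) \<partial>lborel \<partial>lborel)"
    by (subst lborel.nn_integral_fst[symmetric]) auto
  also have "\<dots> = (\<integral>\<^sup>+r. ennreal C * ((root_weight r * ?g r) * (\<integral>\<^sup>+v. root_weight (v - h r) * ?k v \<partial>lborel)) \<partial>lborel)"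
    by (simp add: nn_integral_cmult)
  also have "\<dots> \<le> (\<integral>\<^sup>+r. ennreal C * ((root_weight r * ?g r) * ennreal (?C0 * \<kappa>2 powr (- 1 / 4))) \<partial>lborel)"
    by (intro nn_integral_mono mult_left_mono nn_integral_root_weight_Gaussian \<kappa>2) auto
  also have "\<dots> = ennreal C * ((\<integral>\<^sup>+r. root_weight r * ?g r \<partial>lborel) * ennreal (?C0 * \<kappa>2 powr (- 1 / 4)))"
    by (simp add: nn_integral_cmult nn_integral_multc)
  also have "(\<integral>\<^sup>+r. root_weight r * ?g r \<partial>lborel) \<le> ennreal (?C0 * \<kappa>1 powr (- 1 / 4))"
    using nn_integral_root_weight_Gaussian[OF \<kappa>1, of 0 0] by simp
  also have "ennreal C * (ennreal (?C0 * \<kappa>1 powr (- 1 / 4)) * ennreal (?C0 * \<kappa>2 powr (- 1 / 4))) =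
      ennreal (C * ?C0\<^sup>2 * (\<kappa>1 * \<kappa>2) powr (- 1 / 4))"
    using C \<kappa>1 \<kappa>2 by (simp add: powr_mult power2_eq_square mult_ac flip: ennreal_mult)
  finally show ?thesis by (simp add: mult_left_mono mult_right_mono)
qed

section \<open>The family of contours and the integrand on them\<close>

text \<open>The upper component of the contour with its flat part at height \<open>V\<close> instead
  of 1. All members of the family share the outer parts of the two rays.\<close>

definition contour :: "real \<Rightarrow> real \<Rightarrow> complex" where
  "contour V r = Complex (- r) (max V (\<bar>r\<bar> / sqrt 3))"

text \<open>A Borel function defined everywhere that represents the derivative of the contour off
  its two corners \<open>|r| = sqrt 3 * V\<close>.\<close>

definition contour_deriv :: "real \<Rightarrow> real \<Rightarrow> complex" where
  "contour_deriv V r = Complex (- 1) (if \<bar>r\<bar> < sqrt 3 * V then 0 else sgn r / sqrt 3)"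

lemma contour_simps [simp]: "Re (contour V r) = - r" "Im (contour V r) = max V (\<bar>r\<bar> / sqrt 3)"
  by (simp_all add: contour_def)

lemma contour_eq_upper: "contour 1 = contour_upper"
  by (simp add: contour_def contour_upper_def fun_eq_iff)

lemma contour_lower_eq: "contour_lower r = - contour_upper r"
  by (simp add: contour_lower_def contour_upper_def complex_eq_iff)

lemma continuous_contour: "continuous_on S (contour V)"
  unfolding contour_def complex_eq_iff[symmetric] Complex_eq by (intro continuous_intros) auto

lemma norm_contour_deriv: "norm (contour_deriv V r) \<le> 2"
proof -
  have "norm (contour_deriv V r) \<le> \<bar>Re (contour_deriv V r)\<bar> + \<bar>Im (contour_deriv V r)\<bar>" by (rule cmod_le)
  also have "\<dots> \<le> 1 + 1" by (auto simp: contour_deriv_def sgn_real_def divide_le_eq abs_divide)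
  finally show ?thesis by simp
qed

lemma contour_has_vector_derivative:
  assumes V: "0 < V" and r: "\<bar>r\<bar> \<noteq> sqrt 3 * V"
  shows "(contour V has_vector_derivative contour_deriv V r) (at r)"
proof -
  have "((\<lambda>r. max V (\<bar>r\<bar> / sqrt 3)) has_real_derivative Im (contour_deriv V r)) (at r)"
  proof (cases "\<bar>r\<bar> < sqrt 3 * V")
    case True
    have "((\<lambda>r. V) has_real_derivative 0) (at r)" by simp
    then have "((\<lambda>r. max V (\<bar>r\<bar> / sqrt 3)) has_real_derivative 0) (at r)"
    proof (rule DERIV_cong_ev[THEN iffD1, rotated -1, OF _ refl _ refl])
      have "open {x. \<bar>x\<bar> < sqrt 3 * V}" by (intro open_Collect_less continuous_intros)
      then have "\<forall>\<^sub>F x in nhds r. x \<in> {x. \<bar>x\<bar> < sqrt 3 * V}" using True by (intro eventually_nhds_in_open) auto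
      then show "\<forall>\<^sub>F x in nhds r. V = max V (\<bar>x\<bar> / sqrt 3)"
        by eventually_elim (auto simp: max_def field_simps)
    qed
    then show ?thesis using True by (simp add: contour_deriv_def)
  next
    case False
    then have gt: "sqrt 3 * V < \<bar>r\<bar>" using r by simp
    have "0 < sqrt 3 * V" using V by simp
    with gt have r0: "r \<noteq> 0" by auto
    have pos: "sqrt 3 * V < sgn r * r" using gt by (simp add: sgn_real_def abs_if split: if_splits)
    have "((\<lambda>x. sgn r * x / sqrt 3) has_real_derivative sgn r / sqrt 3) (at r)"
      using DERIV_cdivide[OF DERIV_cmult_Id[of "sgn r" r], of "sqrt 3"] by simp
    then have "((\<lambda>r. max V (\<bar>r\<bar> / sqrt 3)) has_real_derivative sgn r / sqrt 3) (at r)"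
    proof (rule DERIV_cong_ev[THEN iffD1, rotated -1, OF _ refl _ refl])
      have "open {x. sqrt 3 * V < sgn r * x}" by (intro open_Collect_less continuous_intros)
      then have "\<forall>\<^sub>F x in nhds r. x \<in> {x. sqrt 3 * V < sgn r * x}" using pos by (intro eventually_nhds_in_open) auto
      then show "\<forall>\<^sub>F x in nhds r. sgn r * x / sqrt 3 = max V (\<bar>x\<bar> / sqrt 3)"
      proof eventually_elim
        case (elim x)
        then have x: "sqrt 3 * V < sgn r * x" by simp
        have "0 < sqrt 3 * V" using V by simp
        then have "0 < sgn r * x" using x by linarith
        then have "sgn r * x = \<bar>x\<bar>" using r0 by (auto simp: sgn_real_def abs_if split: if_splits)
        moreover have "V < sgn r * x / sqrt 3" using x by (simp add: pos_less_divide_eq mult.commute)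
        ultimately show ?case by (simp add: max_def)
      qed
    qed
    then show ?thesis using False by (simp add: contour_deriv_def)
  qed
  then have "((\<lambda>r. of_real (- r) + \<i> * of_real (max V (\<bar>r\<bar> / sqrt 3))) has_vector_derivative
      of_real (- 1) + \<i> * of_real (Im (contour_deriv V r))) (at r)"
    by (intro has_vector_derivative_add has_vector_derivative_mult_right has_vector_derivative_of_real) (auto intro!: derivative_eq_intros)
  then show ?thesis
    by (simp add: contour_def[abs_def] Complex_eq contour_deriv_def)
qed

lemma contour_deriv_measurable [measurable]: "contour_deriv V \<in> borel_measurable borel"
proof -
  have "contour_deriv V = (\<lambda>r. of_real (- 1) + \<i> * of_real (if \<bar>r\<bar> < sqrt 3 * V then 0 else sgn r / sqrt 3))"
    by (simp add: contour_deriv_def fun_eq_iff complex_eq_iff)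
  then show ?thesis by simp
qed

lemma contour_measurable [measurable]: "contour V \<in> borel_measurable borel"
  by (rule borel_measurable_continuous_onI) (rule continuous_contour)

lemma norm_contour_ge: "0 < V \<Longrightarrow> V \<le> norm (contour V r)"
  using abs_Im_le_cmod[of "contour V r"] by simp

lemma norm_axis_minus_contour: "norm (\<i> * of_real v - contour V r) = sqrt (r\<^sup>2 + (v - max V (\<bar>r\<bar> / sqrt 3))\<^sup>2)"
  by (simp add: cmod_def)

context canonical_zeros
begin

text \<open>On the flat part the shift is \<open>r^2\<close> and
  \<open>(Im (z^2))^2 = 4 r^2 V^2\<close>, which is at least \<open>4/3 r^4\<close> since
  \<open>r^2 \<le> 3 V^2\<close>. On the rays the shift is \<open>V^2 + 2/3 r^2\<close>, at most
  \<open>r^2\<close>, and \<open>(Im (z^2))^2 = 4/3 r^4\<close>.\<close>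

lemma contour_shift:
  assumes V: "0 < V"
  shows "admissible V (contour V r)"
    and "2 / 3 * r\<^sup>2 \<le> square_shift V (contour V r)" and "square_shift V (contour V r) \<le> r\<^sup>2"
proof -
  define h where "h = max V (\<bar>r\<bar> / sqrt 3)"
  have sh: "square_shift V (contour V r) = V\<^sup>2 + r\<^sup>2 - h\<^sup>2"
    by (simp add: square_shift_def h_def power2_eq_square)
  have im: "Im ((contour V r)\<^sup>2) = - (2 * r * h)" by (simp add: h_def power2_eq_square)
  have h: "V \<le> h" "0 < h" using V by (auto simp: h_def)
  have *: "2 / 3 * r\<^sup>2 \<le> square_shift V (contour V r) \<and> square_shift V (contour V r) \<le> r\<^sup>2 \<and>
     4 / 3 * (square_shift V (contour V r))\<^sup>2 \<le> (Im ((contour V r)\<^sup>2))\<^sup>2"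
  proof (cases "\<bar>r\<bar> / sqrt 3 \<le> V")
    case True
    then have hV: "h = V" by (simp add: h_def)
    have "(\<bar>r\<bar> / sqrt 3)\<^sup>2 \<le> V\<^sup>2" using True by (intro power_mono) auto
    then have r3: "r\<^sup>2 \<le> 3 * V\<^sup>2" by (simp add: power_divide)
    have "4 / 3 * (r\<^sup>2)\<^sup>2 \<le> 4 * (r\<^sup>2 * V\<^sup>2)"
    proof -
      have "r\<^sup>2 * r\<^sup>2 \<le> 3 * (r\<^sup>2 * V\<^sup>2)"
        using mult_left_mono[OF r3, of "r\<^sup>2"] by (simp only: mult.left_commute zero_le_power2)
      then show ?thesis unfolding power2_eq_square[of "r\<^sup>2"] by linarith
    qed
    then show ?thesis unfolding sh im hV by (simp add: power_mult_distrib)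
  next
    case False
    then have hr: "h = \<bar>r\<bar> / sqrt 3" by (simp add: h_def)
    then have h2: "h\<^sup>2 = r\<^sup>2 / 3" by (simp add: power_divide)
    have V2: "V\<^sup>2 \<le> r\<^sup>2 / 3" using h V unfolding h2[symmetric] by (intro power_mono) auto
    have 1: "square_shift V (contour V r) \<le> r\<^sup>2" "2 / 3 * r\<^sup>2 \<le> square_shift V (contour V r)" unfolding sh h2 using V2 by auto
    then have "(square_shift V (contour V r))\<^sup>2 \<le> (r\<^sup>2)\<^sup>2"
      by (intro power_mono) (auto intro: order_trans[rotated])
    then have "4 / 3 * (square_shift V (contour V r))\<^sup>2 \<le> 4 * r\<^sup>2 * (r\<^sup>2 / 3)" by (simp add: power2_eq_square)
    then show ?thesis unfolding im using 1 by (simp add: power_mult_distrib h2)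
  qed
  then show "2 / 3 * r\<^sup>2 \<le> square_shift V (contour V r)" "square_shift V (contour V r) \<le> r\<^sup>2" by auto
  have "0 \<le> 2 / 3 * r\<^sup>2" by simp
  also have "\<dots> \<le> square_shift V (contour V r)" using * by simp
  finally show "admissible V (contour V r)" using * V h by (simp add: admissible_def h_def[symmetric])
qed

definition kernel_integrand :: "real \<Rightarrow> real \<Rightarrow> real \<Rightarrow> real \<Rightarrow> complex \<Rightarrow> complex \<Rightarrow> complex" where
  "kernel_integrand S U x y z w = 1 / (w - z) *
     exp ((w - complex_of_real y)\<^sup>2 / complex_of_real (2 * U) - (z - complex_of_real x)\<^sup>2 / complex_of_real (2 * S)) *
     (E w / E z)"

definition contour_integrand :: "real \<Rightarrow> real \<Rightarrow> real \<Rightarrow> real \<Rightarrow> real \<Rightarrow> real \<times> real \<Rightarrow> complex" where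
  "contour_integrand V S U x y p =
     kernel_integrand S U x y (contour V (fst p)) (\<i> * of_real (snd p)) * contour_deriv V (fst p) * \<i>"

lemma norm_kernel_exponential:
  assumes "0 < S" "0 < U"
  shows "norm (exp ((\<i> * of_real v - complex_of_real y)\<^sup>2 / complex_of_real (2 * U) - (contour V r - complex_of_real x)\<^sup>2 / complex_of_real (2 * S)))
    = exp ((y\<^sup>2 - v\<^sup>2) / (2 * U) + (V\<^sup>2 - square_shift V (contour V r)) / (2 * S) - x * r / S - x\<^sup>2 / (2 * S))"
proof -
  let ?z = "contour V r"
  have "Re ((\<i> * of_real v - complex_of_real y)\<^sup>2 / complex_of_real (2 * U)) = (y\<^sup>2 - v\<^sup>2) / (2 * U)"
    unfolding Re_divide_of_real by (simp add: power2_eq_square)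
  moreover have "Re ((?z - complex_of_real x)\<^sup>2 / complex_of_real (2 * S)) = (square_shift V ?z - V\<^sup>2 + 2 * x * r + x\<^sup>2) / (2 * S)"
    unfolding Re_divide_of_real by (simp add: square_shift_def power2_eq_square algebra_simps)
  ultimately show ?thesis using assms
    by (simp add: add_divide_distrib diff_divide_distrib algebra_simps)
qed

lemma norm_contour_integrand:
  assumes "0 < S" "0 < U" "0 < V"
  shows "norm (contour_integrand V S U x y (r, v)) \<le> 2 * (1 / sqrt (r\<^sup>2 + (v - max V (\<bar>r\<bar> / sqrt 3))\<^sup>2)) *
     exp ((y\<^sup>2 - v\<^sup>2) / (2 * U) + (V\<^sup>2 - square_shift V (contour V r)) / (2 * S) - x * r / S - x\<^sup>2 / (2 * S)) *
     norm (E (\<i> * of_real v) / E (contour V r))"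
proof -
  have "norm (contour_integrand V S U x y (r, v)) = norm (contour_deriv V r) * ((1 / sqrt (r\<^sup>2 + (v - max V (\<bar>r\<bar> / sqrt 3))\<^sup>2)) *
     exp ((y\<^sup>2 - v\<^sup>2) / (2 * U) + (V\<^sup>2 - square_shift V (contour V r)) / (2 * S) - x * r / S - x\<^sup>2 / (2 * S)) *
     norm (E (\<i> * of_real v) / E (contour V r)))"
    unfolding contour_integrand_def kernel_integrand_def
    using norm_kernel_exponential[OF assms(1,2), of v y V r x] norm_axis_minus_contour[of v V r]
    by (simp only: norm_mult fst_conv snd_conv norm_divide norm_one norm_ii mult_1_right mult_ac)
  also have "\<dots> \<le> 2 * ((1 / sqrt (r\<^sup>2 + (v - max V (\<bar>r\<bar> / sqrt 3))\<^sup>2)) *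
     exp ((y\<^sup>2 - v\<^sup>2) / (2 * U) + (V\<^sup>2 - square_shift V (contour V r)) / (2 * S) - x * r / S - x\<^sup>2 / (2 * S)) *
     norm (E (\<i> * of_real v) / E (contour V r)))"
    by (intro mult_right_mono norm_contour_deriv) auto
  finally show ?thesis by (simp add: mult.assoc)
qed

lemma contour_integrand_measurable [measurable]:
  "contour_integrand V S U x y \<in> borel_measurable (borel \<Otimes>\<^sub>M borel)"
proof -
  have E: "E \<in> borel_measurable borel" by (rule borel_measurable_continuous_onI) (rule continuous_on_E)
  note E [measurable]
  show ?thesis unfolding contour_integrand_def[abs_def] kernel_integrand_def by measurable
qed

text \<open>The Gaussians in \<open>v\<close> and \<open>r\<close> beat the growth of the ratio,
  which by \<open>ratio_bound_general\<close> has rate as small as desired; the singularity on the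
  diagonal is handled by \<open>nn_integral_Cauchy_Gaussian\<close>.\<close>

lemma contour_integrand_integrable:
  assumes S: "0 < S" and U: "0 < U" and V: "0 < V"
  shows "integrable (lborel \<Otimes>\<^sub>M lborel) (contour_integrand V S U x y)"
proof -
  \<comment> \<open>Budget in eighths: the Gaussian in \<open>v\<close> has rate
    \<open>4/(8 U)\<close>, the ratio and the linear prefactor take one eighth each, and
    \<open>2/(8 U) = \<kappa>2\<close> remains. In \<open>r\<close>, after the ratio,
    \<open>3/(8 S)\<close> of the shift is left, at least \<open>r^2 / (4 S)\<close>, enough for the
    cross term in \<open>x r\<close> and for \<open>\<kappa>1\<close>.\<close>
  define \<delta> where "\<delta> = min (1 / (8 * S)) (1 / (8 * U))"
  have \<delta>: "0 < \<delta>" "\<delta> \<le> 1 / (8 * S)" "\<delta> \<le> 1 / (8 * U)" using S U by (auto simp: \<delta>_def)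
  obtain C where C: "0 < C" "\<And>z v. admissible V z \<Longrightarrow> norm (E (\<i> * of_real v) / E z) \<le> C * (1 + \<bar>v\<bar> / norm z) * exp (\<delta> * (v\<^sup>2 + square_shift V z))"
    using ratio_bound_general[OF \<delta>(1) V] by blast
  define \<kappa>1 where "\<kappa>1 = 1 / (12 * S)"
  define \<kappa>2 where "\<kappa>2 = 1 / (4 * U)"
  have \<kappa>: "0 < \<kappa>1" "0 < \<kappa>2" using S U by (auto simp: \<kappa>1_def \<kappa>2_def)
  define C1 where "C1 = exp (y\<^sup>2 / (2 * U) + V\<^sup>2 / (2 * S) + 12 * x\<^sup>2 / S)"
  define C2 where "C2 = exp (U / V\<^sup>2 * 2)"
  have linear: "1 + \<bar>v\<bar> / V \<le> 2 * C2 * exp (v\<^sup>2 / (8 * U))" for v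
  proof -
    have "\<bar>v\<bar> / V = 2 * (\<bar>v\<bar> / sqrt (8 * U)) * (sqrt (8 * U) / (2 * V))" using U V by simp
    also have "\<dots> \<le> (\<bar>v\<bar> / sqrt (8 * U))\<^sup>2 + (sqrt (8 * U) / (2 * V))\<^sup>2" by (rule sum_squares_bound)
    also have "\<dots> = v\<^sup>2 / (8 * U) + U / V\<^sup>2 * 2" using U by (simp add: power_divide power_mult_distrib)
    also have "\<dots> \<le> exp (v\<^sup>2 / (8 * U) + U / V\<^sup>2 * 2)" using exp_ge_add_one_self[of "v\<^sup>2 / (8 * U) + U / V\<^sup>2 * 2"] by linarith
    also have "\<dots> = C2 * exp (v\<^sup>2 / (8 * U))" by (simp add: C2_def exp_add)
    finally have 1: "\<bar>v\<bar> / V \<le> C2 * exp (v\<^sup>2 / (8 * U))" .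
    have "1 * 1 \<le> C2 * exp (v\<^sup>2 / (8 * U))" unfolding C2_def using U by (intro mult_mono) auto
    with 1 show ?thesis by simp
  qed
  have bound: "norm (contour_integrand V S U x y (r, v)) \<le> (4 * C * C1 * C2) * (1 / sqrt (r\<^sup>2 + (v - max V (\<bar>r\<bar> / sqrt 3))\<^sup>2)) *
     exp (- (\<kappa>1 * r\<^sup>2)) * exp (- (\<kappa>2 * (\<bar>v\<bar> - 0)\<^sup>2))" for r v
  proof -
    let ?z = "contour V r" and ?M = "square_shift V (contour V r)"
    note M = contour_shift[OF V, of r]
    have "norm (E (\<i> * of_real v) / E ?z) \<le> C * (1 + \<bar>v\<bar> / norm ?z) * exp (\<delta> * (v\<^sup>2 + ?M))" by (rule C(2)[OF M(1)])
    also have "\<dots> \<le> C * (2 * C2 * exp (v\<^sup>2 / (8 * U))) * exp (\<delta> * (v\<^sup>2 + ?M))"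
    proof (intro mult_right_mono mult_left_mono)
      have "\<bar>v\<bar> / norm ?z \<le> \<bar>v\<bar> / V" using norm_contour_ge[OF V, of r] V
        by (intro divide_left_mono mult_pos_pos) auto
      then show "1 + \<bar>v\<bar> / norm ?z \<le> 2 * C2 * exp (v\<^sup>2 / (8 * U))" using linear[of v] by linarith
    qed (use C in auto)
    also have "\<dots> = (2 * C * C2) * exp (v\<^sup>2 / (8 * U) + \<delta> * (v\<^sup>2 + ?M))" by (simp add: exp_add mult_ac)
    finally have R: "norm (E (\<i> * of_real v) / E ?z) \<le> (2 * C * C2) * exp (v\<^sup>2 / (8 * U) + \<delta> * (v\<^sup>2 + ?M))" .
    have expo: "((y\<^sup>2 - v\<^sup>2) / (2 * U) + (V\<^sup>2 - ?M) / (2 * S) - x * r / S - x\<^sup>2 / (2 * S)) + (v\<^sup>2 / (8 * U) + \<delta> * (v\<^sup>2 + ?M))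
       \<le> (y\<^sup>2 / (2 * U) + V\<^sup>2 / (2 * S) + 12 * x\<^sup>2 / S) - \<kappa>1 * r\<^sup>2 - \<kappa>2 * (\<bar>v\<bar> - 0)\<^sup>2"
    proof -
      have a1: "\<delta> * v\<^sup>2 \<le> 1 / (8 * U) * v\<^sup>2" "\<delta> * ?M \<le> 1 / (8 * S) * ?M"
        using \<delta> order_trans[OF _ M(2), of 0] by (intro mult_right_mono; simp)+
      have a2: "- (x * r) \<le> 12 * x\<^sup>2 + r\<^sup>2 / 12"
      proof -
        have "0 \<le> (6 * x + r / 2)\<^sup>2 + 36 * x\<^sup>2 + r\<^sup>2 / 4" by simp
        then show ?thesis by (simp add: power2_eq_square algebra_simps)
      qed
      have a2': "- (x * r / S) \<le> (12 * x\<^sup>2 + r\<^sup>2 / 12) / S" using divide_right_mono[OF a2, of S] S by simp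
      have a3: "3 / (8 * S) * (2 / 3 * r\<^sup>2) \<le> 3 / (8 * S) * ?M" using S M(2) by (intro mult_left_mono) auto
      have a4: "- x\<^sup>2 / (2 * S) \<le> 0" using S by simp
      have e1: "(y\<^sup>2 - v\<^sup>2) / (2 * U) = y\<^sup>2 / (2 * U) - 4 * (1 / (8 * U) * v\<^sup>2)" using U by (simp add: field_simps)
      have e2: "(V\<^sup>2 - ?M) / (2 * S) = V\<^sup>2 / (2 * S) - (3 / (8 * S) * ?M + 1 / (8 * S) * ?M)" using S by (simp add: field_simps)
      have e3: "v\<^sup>2 / (8 * U) = 1 / (8 * U) * v\<^sup>2" by simp
      have e4: "\<kappa>2 * (\<bar>v\<bar> - 0)\<^sup>2 = 2 * (1 / (8 * U) * v\<^sup>2)" by (simp add: \<kappa>2_def)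
      have e5: "3 / (8 * S) * (2 / 3 * r\<^sup>2) = r\<^sup>2 / (4 * S)" by simp
      have e6: "(12 * x\<^sup>2 + r\<^sup>2 / 12) / S = 12 * x\<^sup>2 / S + r\<^sup>2 / (12 * S)" by (simp add: add_divide_distrib)
      have e7: "\<kappa>1 * r\<^sup>2 = r\<^sup>2 / (12 * S)" by (simp add: \<kappa>1_def)
      have e8: "r\<^sup>2 / (4 * S) = 3 * (r\<^sup>2 / (12 * S))" by simp
      have e9: "0 \<le> r\<^sup>2 / (12 * S)" using S by simp
      have e10: "\<delta> * (v\<^sup>2 + ?M) = \<delta> * v\<^sup>2 + \<delta> * ?M" by (simp add: distrib_left)
      have e11: "0 \<le> 1 / (8 * U) * v\<^sup>2" using U by simp
      show ?thesis unfolding e1 e2 e3 e4 e7 e10 using a1 a2'[unfolded e6] a3[unfolded e5 e8] a4 e9 e11 by linarith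
    qed
    have "norm (contour_integrand V S U x y (r, v)) \<le> 2 * (1 / sqrt (r\<^sup>2 + (v - max V (\<bar>r\<bar> / sqrt 3))\<^sup>2)) *
     exp ((y\<^sup>2 - v\<^sup>2) / (2 * U) + (V\<^sup>2 - ?M) / (2 * S) - x * r / S - x\<^sup>2 / (2 * S)) * norm (E (\<i> * of_real v) / E ?z)"
      by (rule norm_contour_integrand[OF S U V])
    also have "\<dots> \<le> 2 * (1 / sqrt (r\<^sup>2 + (v - max V (\<bar>r\<bar> / sqrt 3))\<^sup>2)) *
     exp ((y\<^sup>2 - v\<^sup>2) / (2 * U) + (V\<^sup>2 - ?M) / (2 * S) - x * r / S - x\<^sup>2 / (2 * S)) * ((2 * C * C2) * exp (v\<^sup>2 / (8 * U) + \<delta> * (v\<^sup>2 + ?M)))"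
      by (intro mult_left_mono R) auto
    also have "\<dots> = (4 * C * C2) * (1 / sqrt (r\<^sup>2 + (v - max V (\<bar>r\<bar> / sqrt 3))\<^sup>2)) *
       exp (((y\<^sup>2 - v\<^sup>2) / (2 * U) + (V\<^sup>2 - ?M) / (2 * S) - x * r / S - x\<^sup>2 / (2 * S)) + (v\<^sup>2 / (8 * U) + \<delta> * (v\<^sup>2 + ?M)))"
      by (simp only: exp_add mult_ac)
    also have "\<dots> \<le> (4 * C * C2) * (1 / sqrt (r\<^sup>2 + (v - max V (\<bar>r\<bar> / sqrt 3))\<^sup>2)) *
       exp ((y\<^sup>2 / (2 * U) + V\<^sup>2 / (2 * S) + 12 * x\<^sup>2 / S) - \<kappa>1 * r\<^sup>2 - \<kappa>2 * (\<bar>v\<bar> - 0)\<^sup>2)"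
      using expo C by (intro mult_left_mono) (auto simp: C2_def)
    also have "\<dots> = (4 * C * C1 * C2) * (1 / sqrt (r\<^sup>2 + (v - max V (\<bar>r\<bar> / sqrt 3))\<^sup>2)) *
     exp (- (\<kappa>1 * r\<^sup>2)) * exp (- (\<kappa>2 * (\<bar>v\<bar> - 0)\<^sup>2))"
      by (simp only: C1_def exp_add diff_conv_add_uminus mult_ac)
    finally show ?thesis .
  qed
  have "(\<integral>\<^sup>+p. ennreal (norm (contour_integrand V S U x y p)) \<partial>(lborel \<Otimes>\<^sub>M lborel)) \<le>
     ennreal (4 * C * C1 * C2 * (4 + 2 * sqrt pi)\<^sup>2 * (\<kappa>1 * \<kappa>2) powr (- 1 / 4))"
    by (rule nn_integral_Cauchy_Gaussian[OF \<kappa> _ _ bound]) (use C in \<open>auto simp: C1_def C2_def\<close>)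
  then have fin: "(\<integral>\<^sup>+p. ennreal (norm (contour_integrand V S U x y p)) \<partial>(lborel \<Otimes>\<^sub>M lborel)) < \<infinity>"
    by (rule le_less_trans) simp
  have "contour_integrand V S U x y \<in> borel_measurable (lborel \<Otimes>\<^sub>M lborel)"
    using contour_integrand_measurable by (simp cong: measurable_cong_sets)
  then show ?thesis using fin by (rule integrableI_bounded)
qed

end

section \<open>Moving the contour through the poles\<close>

lemma contour_fundamental_theorem:
  assumes V: "0 < V" and R: "0 \<le> R" and S: "open S" "\<And>r. contour V r \<in> S"
    and H: "\<And>z. z \<in> S \<Longrightarrow> (H has_field_derivative h z) (at z)"
  shows "((\<lambda>r. h (contour V r) * contour_deriv V r) has_integral (H (contour V R) - H (contour V (- R)))) {- R..R}"
proof (rule fundamental_theorem_of_calculus_interior_strong[of "{sqrt 3 * V, - (sqrt 3 * V)}"])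
  fix r assume "r \<in> {- R<..<R} - {sqrt 3 * V, - (sqrt 3 * V)}"
  then have "\<bar>r\<bar> \<noteq> sqrt 3 * V" by auto
  then have "(contour V has_vector_derivative contour_deriv V r) (at r)" by (rule contour_has_vector_derivative[OF V])
  from field_vector_diff_chain_at[OF this H[OF S(2)]]
  show "((\<lambda>r. H (contour V r)) has_vector_derivative h (contour V r) * contour_deriv V r) (at r)"
    by (simp add: o_def mult.commute)
next
  have "continuous_on S H" using H S(1) by (meson DERIV_isCont continuous_at_imp_continuous_on)
  then show "continuous_on {- R..R} (\<lambda>r. H (contour V r))"
    by (rule continuous_on_compose2[OF _ continuous_contour]) (use S(2) in auto)
qed (use R in auto)

text \<open>The branch of the logarithm whose cut runs straight down from \<open>i v\<close>; since
  \<open>v < V\<close> the contour passes above that ray.\<close>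

lemma contour_log_above:
  assumes V: "0 < V" and R: "0 \<le> R" and v: "v < V"
  shows "((\<lambda>r. contour_deriv V r / (contour V r - \<i> * of_real v)) has_integral
     (Ln (- \<i> * (contour V R - \<i> * of_real v)) - Ln (- \<i> * (contour V (- R) - \<i> * of_real v)))) {- R..R}"
proof -
  let ?S = "{z. - \<i> * (z - \<i> * of_real v) \<notin> \<real>\<^sub>\<le>\<^sub>0}"
  have "?S = (\<lambda>z. - \<i> * (z - \<i> * of_real v)) -` (- \<real>\<^sub>\<le>\<^sub>0)" by auto
  moreover have "open \<dots>" by (intro open_vimage continuous_intros) (simp add: closed_nonpos_Reals_complex open_Compl)
  ultimately have S: "open ?S" by simp
  have "- \<i> * (contour V r - \<i> * of_real v) \<notin> \<real>\<^sub>\<le>\<^sub>0" for r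
  proof -
    have "- \<i> * (contour V r - \<i> * of_real v) = Complex (max V (\<bar>r\<bar> / sqrt 3) - v) r" by (simp add: complex_eq_iff)
    moreover have "0 < max V (\<bar>r\<bar> / sqrt 3) - v" using v by simp
    ultimately show ?thesis by (simp add: complex_nonpos_Reals_iff)
  qed
  then have "((\<lambda>r. (- \<i> / (- \<i> * (contour V r - \<i> * of_real v))) * contour_deriv V r) has_integral
     (Ln (- \<i> * (contour V R - \<i> * of_real v)) - Ln (- \<i> * (contour V (- R) - \<i> * of_real v)))) {- R..R}"
    by (intro contour_fundamental_theorem[OF V R S, where h = "\<lambda>z. - \<i> / (- \<i> * (z - \<i> * of_real v))"])
      (auto intro!: derivative_eq_intros simp: divide_inverse mult_ac)
  then show ?thesis by simp
qed

text \<open>The branch whose cut runs straight up from \<open>i v\<close>; the contour meets the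
  imaginary axis only at \<open>i V\<close>, which lies below.\<close>

lemma contour_log_below:
  assumes V: "0 < V" and R: "0 \<le> R" and v: "V < v"
  shows "((\<lambda>r. contour_deriv V r / (contour V r - \<i> * of_real v)) has_integral
     (Ln (\<i> * (contour V R - \<i> * of_real v)) - Ln (\<i> * (contour V (- R) - \<i> * of_real v)))) {- R..R}"
proof -
  let ?S = "{z. \<i> * (z - \<i> * of_real v) \<notin> \<real>\<^sub>\<le>\<^sub>0}"
  have "?S = (\<lambda>z. \<i> * (z - \<i> * of_real v)) -` (- \<real>\<^sub>\<le>\<^sub>0)" by auto
  moreover have "open \<dots>" by (intro open_vimage continuous_intros) (simp add: closed_nonpos_Reals_complex open_Compl)
  ultimately have S: "open ?S" by simp
  have "\<i> * (contour V r - \<i> * of_real v) \<notin> \<real>\<^sub>\<le>\<^sub>0" for r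
  proof -
    have "\<i> * (contour V r - \<i> * of_real v) = Complex (v - max V (\<bar>r\<bar> / sqrt 3)) (- r)" by (simp add: complex_eq_iff)
    moreover have "r \<noteq> 0 \<or> 0 < v - max V (\<bar>r\<bar> / sqrt 3)" using v V by auto
    ultimately show ?thesis by (auto simp: complex_nonpos_Reals_iff)
  qed
  then have "((\<lambda>r. (\<i> / (\<i> * (contour V r - \<i> * of_real v))) * contour_deriv V r) has_integral
     (Ln (\<i> * (contour V R - \<i> * of_real v)) - Ln (\<i> * (contour V (- R) - \<i> * of_real v)))) {- R..R}"
    by (intro contour_fundamental_theorem[OF V R S, where h = "\<lambda>z. \<i> / (\<i> * (z - \<i> * of_real v))"])
      (auto intro!: derivative_eq_intros simp: divide_inverse mult_ac)
  then show ?thesis by simp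
qed

lemma contours_meet: "0 < V' \<Longrightarrow> V' \<le> V \<Longrightarrow> sqrt 3 * V \<le> \<bar>r\<bar> \<Longrightarrow> contour V' r = contour V r \<and> contour_deriv V' r = contour_deriv V r"
proof -
  assume V: "0 < V'" "V' \<le> V" "sqrt 3 * V \<le> \<bar>r\<bar>"
  have "V \<le> \<bar>r\<bar> / sqrt 3" using V by (simp add: le_divide_eq mult.commute)
  moreover have "sqrt 3 * V' \<le> sqrt 3 * V" using V by simp
  then have "\<not> \<bar>r\<bar> < sqrt 3 * V'" "\<not> \<bar>r\<bar> < sqrt 3 * V" using V(3) by linarith+
  ultimately show ?thesis using V by (auto simp: contour_def contour_deriv_def max_def)
qed

text \<open>Subtracting \<open>G w / (w - z)\<close> leaves an integrand with a primitive, which cannot distinguish the two contours;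
  the subtracted term is integrated with the two branches of the logarithm.\<close>

lemma contour_deformation:
  assumes V: "0 < V'" "V' < V" and R: "R = sqrt 3 * V" and v: "v \<noteq> V'" "v \<noteq> V"
    and G: "G holomorphic_on {z. 0 < Im z}"
  shows "((\<lambda>r. G (contour V' r) / (\<i> * of_real v - contour V' r) * contour_deriv V' r -
       G (contour V r) / (\<i> * of_real v - contour V r) * contour_deriv V r) has_integral
     (if V' < v \<and> v < V then 2 * of_real pi * \<i> * G (\<i> * of_real v) else 0)) {- R..R}"
proof -
  define w where "w = \<i> * complex_of_real v"
  let ?H = "{z. 0 < Im z}"
  have H: "open ?H" "convex ?H" by (simp_all add: open_halfspace_Im_gt convex_halfspace_Im_gt)
  have V0: "0 < V" and R0: "0 \<le> R" "0 < R" using V R by auto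
  have in_H: "contour V' r \<in> ?H" "contour V r \<in> ?H" for r using V V0 by (auto simp: less_max_iff_disj)
  have meet: "contour V' R = contour V R" "contour V' (- R) = contour V (- R)"
    using contours_meet[of V' V R] contours_meet[of V' V "- R"] V R by auto
  show ?thesis
  proof (cases "0 < v")
    case False
    \<comment> \<open>The pole is outside the open upper half-plane, so the integrand itself has a
      primitive there and both contours, having the same end points, give the same value.\<close>
    have "(\<lambda>z. G z / (w - z)) holomorphic_on ?H"
      by (intro holomorphic_intros G) (use False in \<open>auto simp: w_def\<close>)
    then obtain P where P: "\<And>z. z \<in> ?H \<Longrightarrow> (P has_field_derivative G z / (w - z)) (at z within ?H)"
      using holomorphic_convex_primitive'[OF H(2,1)] by blast
    then have P': "\<And>z. z \<in> ?H \<Longrightarrow> (P has_field_derivative G z / (w - z)) (at z)"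
      using H(1) by (metis at_within_open)
    have "((\<lambda>r. G (contour V' r) / (w - contour V' r) * contour_deriv V' r - G (contour V r) / (w - contour V r) * contour_deriv V r)
       has_integral ((P (contour V' R) - P (contour V' (- R))) - (P (contour V R) - P (contour V (- R))))) {- R..R}"
      by (intro has_integral_diff contour_fundamental_theorem[OF _ R0(1) H(1) _ P'] in_H V V0)
    then show ?thesis using False V unfolding meet w_def by simp
  next
    case True
    define \<phi> where "\<phi> z = (if z = w then deriv G w else (G z - G w) / (z - w))" for z
    have "\<phi> holomorphic_on ?H" unfolding \<phi>_def by (rule pole_lemma_open[OF G H(1)])
    then obtain P where P: "\<And>z. z \<in> ?H \<Longrightarrow> (P has_field_derivative \<phi> z) (at z within ?H)"
      using holomorphic_convex_primitive'[OF H(2,1)] by blast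
    then have P': "\<And>z. z \<in> ?H \<Longrightarrow> (P has_field_derivative \<phi> z) (at z)"
      using H(1) by (metis at_within_open)
    have split: "G (contour U r) / (w - contour U r) * contour_deriv U r =
        - (\<phi> (contour U r) * contour_deriv U r) - G w * (contour_deriv U r / (contour U r - w))" if "0 < U" "v \<noteq> U" for U r
    proof -
      have ne: "contour U r \<noteq> w"
      proof
        assume "contour U r = w"
        then have "Re (contour U r) = 0" "Im (contour U r) = v" by (auto simp: w_def)
        then show False using that by (simp add: max_def split: if_splits)
      qed
      have "G z / (w - z) * d = - ((G z - G w) / (z - w) * d) - G w * (d / (z - w))" if "z \<noteq> w" for z d
        using that by (simp add: divide_simps) (simp add: algebra_simps)
      then show ?thesis using ne by (simp add: \<phi>_def)
    qed
    define \<zeta> where "\<zeta> = contour V R - w"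
    define \<zeta>' where "\<zeta>' = contour V (- R) - w"
    define I1 where "I1 = (if v < V' then Ln (- \<i> * \<zeta>) - Ln (- \<i> * \<zeta>') else Ln (\<i> * \<zeta>) - Ln (\<i> * \<zeta>'))"
    define I2 where "I2 = (if v < V then Ln (- \<i> * \<zeta>) - Ln (- \<i> * \<zeta>') else Ln (\<i> * \<zeta>) - Ln (\<i> * \<zeta>'))"
    have 1: "((\<lambda>r. contour_deriv V' r / (contour V' r - w)) has_integral I1) {- R..R}"
      using contour_log_above[OF V(1) R0(1), of v] contour_log_below[OF V(1) R0(1), of v] v(1)
      unfolding I1_def \<zeta>_def \<zeta>'_def w_def meet by (cases "v < V'") auto
    have 2: "((\<lambda>r. contour_deriv V r / (contour V r - w)) has_integral I2) {- R..R}"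
      using contour_log_above[OF V0 R0(1), of v] contour_log_below[OF V0 R0(1), of v] v(2)
      unfolding I2_def \<zeta>_def \<zeta>'_def w_def by (cases "v < V") auto
    have sum: "((\<lambda>r. (- (\<phi> (contour V' r) * contour_deriv V' r) - G w * (contour_deriv V' r / (contour V' r - w))) -
        (- (\<phi> (contour V r) * contour_deriv V r) - G w * (contour_deriv V r / (contour V r - w)))) has_integral
        ((- (P (contour V' R) - P (contour V' (- R))) - G w * I1) - (- (P (contour V R) - P (contour V (- R))) - G w * I2))) {- R..R}"
      by (intro has_integral_diff has_integral_neg has_integral_mult_right 1 2 contour_fundamental_theorem[OF _ R0(1) H(1) _ P'] in_H V V0)
    have val: "(- (P (contour V' R) - P (contour V' (- R))) - G w * I1) - (- (P (contour V R) - P (contour V (- R))) - G w * I2) = G w * (I2 - I1)"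
      unfolding meet by (simp add: algebra_simps)
    have main: "((\<lambda>r. G (contour V' r) / (w - contour V' r) * contour_deriv V' r - G (contour V r) / (w - contour V r) * contour_deriv V r)
       has_integral (G w * (I2 - I1))) {- R..R}"
      using sum unfolding val split[OF V(1) v(1)] split[OF V0 v(2)] .
    \<comment> \<open>The two contours use different branches only for \<open>V' < v < V\<close>. At
      the common end points \<open>- i \<zeta>\<close> has imaginary part \<open>R\<close> and
      \<open>- R\<close>, so the branches differ by \<pi> times the imaginary unit with opposite
      signs, which adds up to a full turn.\<close>
    have "I2 - I1 = (if V' < v \<and> v < V then 2 * of_real pi * \<i> else 0)"
    proof (cases "V' < v \<and> v < V")
      case mid: True
      have im: "Im (- \<i> * \<zeta>) = R" "Im (- \<i> * \<zeta>') = - R" by (simp_all add: \<zeta>_def \<zeta>'_def w_def)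
      then have nz: "- \<i> * \<zeta> \<noteq> 0" "- \<i> * \<zeta>' \<noteq> 0" using R0 by (metis less_irrefl neg_0_equal_iff_equal zero_complex.sel(2))+
      have "Ln (\<i> * \<zeta>) = Ln (- \<i> * \<zeta>) - \<i> * pi" "Ln (\<i> * \<zeta>') = Ln (- \<i> * \<zeta>') + \<i> * pi"
        using Ln_minus[OF nz(1)] Ln_minus[OF nz(2)] R0 im by auto
      then show ?thesis using mid by (simp add: I1_def I2_def)
    qed (use v V in \<open>auto simp: I1_def I2_def\<close>)
    moreover have "G w * (if V' < v \<and> v < V then 2 * of_real pi * \<i> else 0) = (if V' < v \<and> v < V then 2 * of_real pi * \<i> * G w else 0)"
      by simp
    ultimately show ?thesis using main unfolding w_def by simp
  qed
qed

lemma lborel_pair_reflect: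
  "distr (lborel \<Otimes>\<^sub>M lborel) (lborel \<Otimes>\<^sub>M lborel) (\<lambda>(r, v). (r, - v)) = (lborel \<Otimes>\<^sub>M lborel :: (real \<times> real) measure)"
proof -
  have 1: "distr lborel lborel (\<lambda>x. x) = (lborel :: real measure)" by (rule distr_id)
  have 2: "distr lborel lborel uminus = (lborel :: real measure)"
    using lborel_distr_uminus by (simp cong: distr_cong)
  have "sigma_finite_measure (distr lborel lborel (uminus :: real \<Rightarrow> real))" unfolding 2 by (rule sigma_finite_lborel)
  then have "distr lborel lborel (\<lambda>x. x) \<Otimes>\<^sub>M distr lborel lborel uminus =
      distr (lborel \<Otimes>\<^sub>M lborel) (lborel \<Otimes>\<^sub>M lborel) (\<lambda>(r, v). (r :: real, - v :: real))"
    by (intro pair_measure_distr) auto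
  then show ?thesis unfolding 1 2 by simp
qed

context canonical_zeros
begin

abbreviation "contour_double V S U x y \<equiv> integral\<^sup>L (lborel \<Otimes>\<^sub>M lborel) (contour_integrand V S U x y)"

text \<open>What the integrand leaves behind on the diagonal \<open>z = w = i v\<close>, where the
  ratio of the products is 1.\<close>

definition saddle_exponential :: "real \<Rightarrow> real \<Rightarrow> real \<Rightarrow> real \<Rightarrow> real \<Rightarrow> complex" where
  "saddle_exponential S U x y v = exp ((\<i> * of_real v - complex_of_real y)\<^sup>2 / complex_of_real (2 * U) -
     (\<i> * of_real v - complex_of_real x)\<^sup>2 / complex_of_real (2 * S))"

text \<open>\<open>vector_derivative\<close> has no known value at the two corners, but these form a
  null set, also in the product with the second variable.\<close>

lemma AE_vector_derivative_eq:
  assumes "\<And>r. \<bar>r\<bar> \<noteq> (c :: real) \<Longrightarrow> (\<gamma> has_vector_derivative d r) (at r)"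
  shows "AE p in lborel \<Otimes>\<^sub>M (lborel :: real measure). vector_derivative \<gamma> (at (fst p)) = d (fst p)"
proof -
  have "AE r in lborel. r \<noteq> c" "AE r in lborel. r \<noteq> - c" by (rule AE_lborel_singleton)+
  then have "AE r in lborel. vector_derivative \<gamma> (at r) = d r"
  proof eventually_elim
    case (elim r)
    then have "\<bar>r\<bar> \<noteq> c" by auto
    then show ?case by (intro vector_derivative_at assms)
  qed
  then obtain N where N: "{r \<in> space lborel. vector_derivative \<gamma> (at r) \<noteq> d r} \<subseteq> N" "emeasure lborel N = 0" "N \<in> sets lborel"
    by (rule AE_E)
  have "emeasure (lborel \<Otimes>\<^sub>M lborel) (N \<times> (UNIV :: real set)) = emeasure lborel N * emeasure lborel (UNIV :: real set)"
    by (rule lborel.emeasure_pair_measure_Times) (use N in auto)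
  then have "N \<times> (UNIV :: real set) \<in> null_sets (lborel \<Otimes>\<^sub>M lborel)"
    using N by (auto simp: null_sets_def intro!: pair_measureI)
  then show ?thesis by (rule AE_I') (use N(1) in \<open>auto simp: space_pair_measure\<close>)
qed

lemma vector_derivative_measurable:
  assumes "\<And>r. \<bar>r\<bar> \<noteq> (c :: real) \<Longrightarrow> (\<gamma> has_vector_derivative d r) (at r)" and "d \<in> borel_measurable borel"
  shows "(\<lambda>r. vector_derivative \<gamma> (at r) :: complex) \<in> borel_measurable borel"
proof (rule measurable_discrete_difference[where X = "{c, - c}", OF assms(2)])
  fix r assume "r \<notin> {c, - c}"
  then have "\<bar>r\<bar> \<noteq> c" by auto
  then show "d r = vector_derivative \<gamma> (at r)" by (intro vector_derivative_at[symmetric] assms)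
qed auto

lemma upper_lower_derivative:
  assumes "\<bar>r\<bar> \<noteq> sqrt 3"
  shows "(contour_upper has_vector_derivative contour_deriv 1 r) (at r)"
    and "(contour_lower has_vector_derivative - contour_deriv 1 r) (at r)"
proof -
  show 1: "(contour_upper has_vector_derivative contour_deriv 1 r) (at r)"
    using contour_has_vector_derivative[of 1 r] assms by (simp add: contour_eq_upper)
  have "contour_lower = (\<lambda>r. - contour_upper r)" by (rule ext) (rule contour_lower_eq)
  then show "(contour_lower has_vector_derivative - contour_deriv 1 r) (at r)"
    using has_vector_derivative_minus[OF 1] by simp
qed

lemma double_contour_integral_upper:
  "double_contour_integral contour_upper (kernel_integrand S U x y) = contour_double 1 S U x y"
proof -
  have E: "E \<in> borel_measurable borel" by (rule borel_measurable_continuous_onI) (rule continuous_on_E)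
  have d: "(\<lambda>r. vector_derivative contour_upper (at r)) \<in> borel_measurable borel"
    by (rule vector_derivative_measurable[OF upper_lower_derivative(1)]) auto
  have c: "contour_upper \<in> borel_measurable borel" unfolding contour_eq_upper[symmetric] by measurable
  note [measurable] = E d c
  show ?thesis unfolding double_contour_integral_def
  proof (rule integral_cong_AE)
    show "(\<lambda>(r, v). kernel_integrand S U x y (contour_upper r) (\<i> * complex_of_real v) * vector_derivative contour_upper (at r) * \<i>)
        \<in> borel_measurable (lborel \<Otimes>\<^sub>M lborel)"
      unfolding kernel_integrand_def by measurable
    show "contour_integrand 1 S U x y \<in> borel_measurable (lborel \<Otimes>\<^sub>M lborel)" by measurable
    have "AE p in lborel \<Otimes>\<^sub>M (lborel :: real measure). vector_derivative contour_upper (at (fst p)) = contour_deriv 1 (fst p)"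
      by (rule AE_vector_derivative_eq[OF upper_lower_derivative(1)])
    then show "AE p in lborel \<Otimes>\<^sub>M lborel. (case p of (r, v) \<Rightarrow> kernel_integrand S U x y (contour_upper r) (\<i> * complex_of_real v) * vector_derivative contour_upper (at r) * \<i>)
        = contour_integrand 1 S U x y p"
      by eventually_elim (auto simp: contour_integrand_def contour_eq_upper)
  qed
qed

lemma kernel_integrand_minus:
  "kernel_integrand S U x y (- z) (- w) = - kernel_integrand S U (- x) (- y) z w"
proof -
  have "1 / (- w - - z) = - (1 / (w - z))" by (simp add: divide_simps)
  moreover have "(- w - complex_of_real y)\<^sup>2 = (w - complex_of_real (- y))\<^sup>2" "(- z - complex_of_real x)\<^sup>2 = (z - complex_of_real (- x))\<^sup>2"
    by (simp_all add: power2_eq_square algebra_simps)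
  moreover have "E (- w) / E (- z) = E w / E z" by (simp add: E_minus)
  ultimately show ?thesis by (simp add: kernel_integrand_def)
qed

text \<open>The point reflection sending \<open>(z, w)\<close> to \<open>(-z, -w)\<close> carries
  the lower component to the upper one with its orientation. The ratio of products is invariant
  because \<open>E\<close> is even or odd, and the reflection changes the signs of \<open>x\<close>
  and \<open>y\<close>.\<close>

lemma double_contour_integral_lower:
  "double_contour_integral contour_lower (kernel_integrand S U x y) = contour_double 1 S U (- x) (- y)"
proof -
  have E: "E \<in> borel_measurable borel" by (rule borel_measurable_continuous_onI) (rule continuous_on_E)
  have d: "(\<lambda>r. vector_derivative contour_lower (at r)) \<in> borel_measurable borel"
    by (rule vector_derivative_measurable[OF upper_lower_derivative(2)]) auto
  have c: "contour_lower \<in> borel_measurable borel"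
    unfolding contour_lower_eq[abs_def] contour_eq_upper[symmetric] by measurable
  note [measurable] = E d c
  let ?\<phi> = "\<lambda>(r :: real, v :: real). (r, - v)"
  have eq: "kernel_integrand S U x y (contour_lower r) (\<i> * complex_of_real v) * (- contour_deriv 1 r) * \<i> =
      contour_integrand 1 S U (- x) (- y) (r, - v)" for r v
    using kernel_integrand_minus[of S U x y "contour 1 r" "\<i> * complex_of_real (- v)"]
    by (simp add: contour_integrand_def contour_lower_eq contour_eq_upper)
  have "double_contour_integral contour_lower (kernel_integrand S U x y) =
      (\<integral>p. contour_integrand 1 S U (- x) (- y) (?\<phi> p) \<partial>(lborel \<Otimes>\<^sub>M lborel))"
    unfolding double_contour_integral_def
  proof (rule integral_cong_AE)
    show "(\<lambda>(r, v). kernel_integrand S U x y (contour_lower r) (\<i> * complex_of_real v) * vector_derivative contour_lower (at r) * \<i>)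
        \<in> borel_measurable (lborel \<Otimes>\<^sub>M lborel)"
      unfolding kernel_integrand_def by measurable
    show "(\<lambda>p. contour_integrand 1 S U (- x) (- y) (?\<phi> p)) \<in> borel_measurable (lborel \<Otimes>\<^sub>M lborel)" by measurable
    have "AE p in lborel \<Otimes>\<^sub>M (lborel :: real measure). vector_derivative contour_lower (at (fst p)) = - contour_deriv 1 (fst p)"
      by (rule AE_vector_derivative_eq[OF upper_lower_derivative(2)])
    then show "AE p in lborel \<Otimes>\<^sub>M lborel. (case p of (r, v) \<Rightarrow> kernel_integrand S U x y (contour_lower r) (\<i> * complex_of_real v) * vector_derivative contour_lower (at r) * \<i>)
        = contour_integrand 1 S U (- x) (- y) (?\<phi> p)"
    proof eventually_elim
      case (elim p)
      obtain r v where p: "p = (r, v)" by (cases p)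
      show ?case using elim eq[of r v] unfolding p by simp
    qed
  qed
  also have "\<dots> = integral\<^sup>L (distr (lborel \<Otimes>\<^sub>M lborel) (lborel \<Otimes>\<^sub>M lborel) ?\<phi>) (contour_integrand 1 S U (- x) (- y))"
    by (rule integral_distr[symmetric]) measurable
  also have "\<dots> = contour_double 1 S U (- x) (- y)" unfolding lborel_pair_reflect ..
  finally show ?thesis .
qed

end

context canonical_zeros
begin
text \<open>Both double integrals converge absolutely, so the difference may be integrated over
  \<open>r\<close> first. For fixed \<open>v\<close> the inner integral is the residue computed in
  \<open>contour_deformation\<close>, and it vanishes unless \<open>i v\<close> lies between the two
  contours.\<close>

lemma contour_double_deformation:
  assumes S: "0 < S" and U: "0 < U" and V: "0 < V'" "V' < V"
  shows "contour_double V' S U x y - contour_double V S U x y =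
    (\<integral>v\<in>{V'..V}. 2 * of_real pi * \<i> * \<i> * saddle_exponential S U x y v \<partial>lborel)"
proof -
  let ?F = "\<lambda>V p. contour_integrand V S U x y p"
  define R where "R = sqrt 3 * V"
  have V0: "0 < V" using V by simp
  have int: "integrable (lborel \<Otimes>\<^sub>M lborel) (?F V')" "integrable (lborel \<Otimes>\<^sub>M lborel) (?F V)"
    using contour_integrand_integrable[OF S U] V V0 by auto
  then have intd: "integrable (lborel \<Otimes>\<^sub>M lborel) (\<lambda>(r, v). ?F V' (r, v) - ?F V (r, v))"
    by (simp add: case_prod_unfold)
  define G where "G z = exp (- ((z - complex_of_real x)\<^sup>2 / complex_of_real (2 * S))) / E z" for z
  have G: "G holomorphic_on {z. 0 < Im z}"
    unfolding G_def
    by (intro holomorphic_intros holomorphic_on_subset[OF E_holomorphic]) (use S E_nonzero in auto)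
  \<comment> \<open>The factors that depend on \<open>w\<close> only; they come out of the inner
    integral.\<close>
  define q where "q v = exp ((\<i> * of_real v - complex_of_real y)\<^sup>2 / complex_of_real (2 * U)) * E (\<i> * of_real v) * \<i>" for v :: real
  have Fq: "?F W (r, v) = q v * (G (contour W r) / (\<i> * of_real v - contour W r) * contour_deriv W r)" for W r v
  proof -
    have "1 / z * exp (A - B) * (e / g) * d * \<i> = exp A * e * \<i> * ((exp (- B) / g) / z * d)" for z A B e g d :: complex
    proof -
      have "exp (A - B) = exp A * exp (- B)" by (simp only: mult_exp_exp diff_conv_add_uminus)
      then show ?thesis by (simp only: divide_inverse mult_1 mult_ac)
    qed
    then show ?thesis unfolding contour_integrand_def kernel_integrand_def q_def G_def fst_conv snd_conv .
  qed
  have qG: "q v * (2 * of_real pi * \<i> * G (\<i> * of_real v)) = 2 * of_real pi * \<i> * \<i> * saddle_exponential S U x y v" if "0 < v" for v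
  proof -
    have ne: "E (\<i> * of_real v) \<noteq> 0" using that by (intro E_nonzero) simp
    have "exp A * e * \<i> * (2 * of_real pi * \<i> * (exp (- B) / e)) = 2 * of_real pi * \<i> * \<i> * exp (A - B)" if "e \<noteq> 0" for A B e :: complex
    proof -
      have "exp A * e * \<i> * (2 * of_real pi * \<i> * (exp (- B) / e)) = (e * inverse e) * (2 * of_real pi * \<i> * \<i> * (exp A * exp (- B)))"
        by (simp only: divide_inverse mult_ac)
      also have "e * inverse e = 1" using that by (rule right_inverse)
      also have "exp A * exp (- B) = exp (A - B)" by (simp only: mult_exp_exp diff_conv_add_uminus)
      finally show ?thesis by (simp only: mult_1)
    qed
    from this[OF ne] show ?thesis unfolding q_def G_def saddle_exponential_def .
  qed
  have "contour_double V' S U x y - contour_double V S U x y = (\<integral>p. (case p of (r, v) \<Rightarrow> ?F V' (r, v) - ?F V (r, v)) \<partial>(lborel \<Otimes>\<^sub>M lborel))"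
    using int by (simp add: case_prod_unfold)
  also have "\<dots> = (\<integral>v. \<integral>r. ?F V' (r, v) - ?F V (r, v) \<partial>lborel \<partial>lborel)"
    using lborel_pair.integral_snd[OF intd] by (rule sym)
  also have "\<dots> = (\<integral>v. indicator {V'..V} v *\<^sub>R (2 * of_real pi * \<i> * \<i> * saddle_exponential S U x y v) \<partial>lborel)"
  proof (rule integral_cong_AE)
    show "(\<lambda>v. \<integral>r. ?F V' (r, v) - ?F V (r, v) \<partial>lborel) \<in> borel_measurable lborel"
      by measurable
    show "(\<lambda>v. indicator {V'..V} v *\<^sub>R (2 * of_real pi * \<i> * \<i> * saddle_exponential S U x y v)) \<in> borel_measurable lborel"
      unfolding saddle_exponential_def by measurable
    have a1: "AE v in lborel. integrable lborel (\<lambda>r. ?F V' (r, v) - ?F V (r, v))"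
      using lborel_pair.AE_integrable_snd[OF intd] .
    have a2: "AE v in lborel. v \<noteq> V'" "AE v in lborel. v \<noteq> V" by (rule AE_lborel_singleton)+
    from a1 a2 show "AE v in lborel. (\<integral>r. ?F V' (r, v) - ?F V (r, v) \<partial>lborel) =
        indicator {V'..V} v *\<^sub>R (2 * of_real pi * \<i> * \<i> * saddle_exponential S U x y v)"
    proof eventually_elim
      case (elim v)
      have "((\<lambda>r. ?F V' (r, v) - ?F V (r, v)) has_integral q v * (if V' < v \<and> v < V then 2 * of_real pi * \<i> * G (\<i> * of_real v) else 0)) {- R..R}"
        unfolding Fq right_diff_distrib[symmetric]
        by (intro has_integral_mult_right contour_deformation[OF V R_def _ _ G]) (use elim in auto)
      \<comment> \<open>Beyond \<open>R\<close> the two contours coincide, so the difference has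
        compact support.\<close>
      then have "((\<lambda>r. ?F V' (r, v) - ?F V (r, v)) has_integral q v * (if V' < v \<and> v < V then 2 * of_real pi * \<i> * G (\<i> * of_real v) else 0)) UNIV"
      proof (rule has_integral_on_superset)
        fix r assume "r \<notin> {- R..R}"
        then have "sqrt 3 * V \<le> \<bar>r\<bar>" by (auto simp: R_def)
        then show "?F V' (r, v) - ?F V (r, v) = 0" using contours_meet[of V' V r] V by (simp add: Fq)
      qed simp
      moreover have "((\<lambda>r. ?F V' (r, v) - ?F V (r, v)) has_integral (\<integral>r. ?F V' (r, v) - ?F V (r, v) \<partial>lborel)) UNIV"
        by (rule has_integral_integral_lborel[OF elim(1)])
      ultimately have "(\<integral>r. ?F V' (r, v) - ?F V (r, v) \<partial>lborel) = q v * (if V' < v \<and> v < V then 2 * of_real pi * \<i> * G (\<i> * of_real v) else 0)"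
        by (rule has_integral_unique[symmetric])
      also have "\<dots> = indicator {V'..V} v *\<^sub>R (2 * of_real pi * \<i> * \<i> * saddle_exponential S U x y v)"
        using elim(2,3) V qG[of v] by (auto simp: indicator_def)
      finally show ?case .
    qed
  qed
  finally show ?thesis unfolding set_lebesgue_integral_def .
qed


end

context canonical_zeros
begin
lemma saddle_exponential_continuous: "continuous_on A (saddle_exponential S U x y)"
  unfolding saddle_exponential_def[abs_def] divide_inverse by (intro continuous_intros)

lemma saddle_exponential_integrable: "set_integrable lborel {c..d} (saddle_exponential S U x y)"
  by (rule borel_integrable_atLeastAtMost') (rule saddle_exponential_continuous)

text \<open>This puts the single integral of the kernel and the residues of the deformation on the
  same integrand, so that they can be joined.\<close>

lemma heat_kernel_product:
  assumes "0 < S" "0 < U"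
  shows "heat_kernel S (complex_of_real x) (\<i> * complex_of_real u) * heat_kernel U (- \<i> * complex_of_real y) (complex_of_real u) =
    complex_of_real (1 / (2 * pi * sqrt (S * U))) * saddle_exponential S U x y u"
proof -
  have "(1 / sqrt (2 * pi * S)) * (1 / sqrt (2 * pi * U)) = 1 / (2 * pi * sqrt (S * U))"
  proof -
    have "sqrt (2 * pi * S) * sqrt (2 * pi * U) = sqrt ((2 * pi)\<^sup>2 * (S * U))"
      by (simp add: real_sqrt_mult[symmetric] power2_eq_square mult_ac)
    then show ?thesis by (simp add: real_sqrt_mult)
  qed
  then have c: "complex_of_real (1 / sqrt (2 * pi * S)) * complex_of_real (1 / sqrt (2 * pi * U)) = complex_of_real (1 / (2 * pi * sqrt (S * U)))"
    by (simp only: of_real_mult[symmetric])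
  have "- (complex_of_real x - \<i> * complex_of_real u)\<^sup>2 / complex_of_real (2 * S) + - (- \<i> * complex_of_real y - complex_of_real u)\<^sup>2 / complex_of_real (2 * U)
     = (\<i> * of_real u - complex_of_real y)\<^sup>2 / complex_of_real (2 * U) - (\<i> * of_real u - complex_of_real x)\<^sup>2 / complex_of_real (2 * S)"
  proof -
    have "(complex_of_real x - \<i> * complex_of_real u)\<^sup>2 = (\<i> * of_real u - complex_of_real x)\<^sup>2"
      by (rule power2_commute)
    moreover have "- (- \<i> * complex_of_real y - complex_of_real u)\<^sup>2 = (\<i> * of_real u - complex_of_real y)\<^sup>2"
      by (simp add: power2_eq_square algebra_simps)
    ultimately show ?thesis by simp
  qed
  note e = this
  have "(c1 * exp p) * (c2 * exp q) = (c1 * c2) * exp (p + q)" for c1 c2 p q :: complex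
    by (simp only: exp_add mult_ac)
  then show ?thesis
    unfolding heat_kernel_def saddle_exponential_def c[symmetric] by (simp only: e)
qed

text \<open>Each component of the contour, when moved to height \<open>V\<close>, collects the
  residues with \<open>1 < |v| < V\<close> on its side of the real axis. The constants match, as
  \<open>2 \<pi> i * i / (2 \<pi> i)^2 = 1 / (2 \<pi>)\<close>, so the residues extend the single
  integral from \<open>[-1, 1]\<close> to \<open>[-V, V]\<close>.\<close>

lemma analytic_kernel_deformed:
  assumes S: "0 < S" and U: "0 < U" and V: "1 < V"
  shows "analytic_kernel \<epsilon> a (S, x) (U, y) =
    1 / ((2 * complex_of_real pi * \<i>)\<^sup>2 * complex_of_real (sqrt (S * U))) * (contour_double V S U x y + contour_double V S U (- x) (- y))
    + complex_of_real (1 / (2 * pi * sqrt (S * U))) * (\<integral>u\<in>{- V..V}. saddle_exponential S U x y u \<partial>lborel)"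
proof -
  let ?c = "1 / ((2 * complex_of_real pi * \<i>)\<^sup>2 * complex_of_real (sqrt (S * U)))"
  let ?d = "complex_of_real (1 / (2 * pi * sqrt (S * U)))"
  let ?e = "saddle_exponential S U x y"
  have cd: "?c * (2 * of_real pi * \<i> * \<i>) = ?d" using S U by (simp add: power2_eq_square divide_simps)
  have e: "saddle_exponential S U (- x) (- y) v = ?e (- v)" for v
  proof -
    have "(\<i> * of_real v - complex_of_real (- y))\<^sup>2 = (\<i> * of_real (- v) - complex_of_real y)\<^sup>2" for v y :: real
      by (simp add: power2_eq_square algebra_simps)
    then show ?thesis unfolding saddle_exponential_def by simp
  qed
  have one: "0 < (1 :: real)" by simp
  have up: "contour_double 1 S U x y = contour_double V S U x y + 2 * of_real pi * \<i> * \<i> * (\<integral>v\<in>{1..V}. ?e v \<partial>lborel)"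
    using contour_double_deformation[OF S U one V, of x y] unfolding set_integral_mult_right diff_eq_eq by (simp only: add.commute)
  have down: "contour_double 1 S U (- x) (- y) = contour_double V S U (- x) (- y) + 2 * of_real pi * \<i> * \<i> * (\<integral>v\<in>{- V..- 1}. ?e v \<partial>lborel)"
  proof -
    have "(\<integral>v\<in>{1..V}. saddle_exponential S U (- x) (- y) v \<partial>lborel) = (\<integral>v\<in>{1..V}. ?e (- v) \<partial>lborel)"
      by (simp only: e)
    also have "\<dots> = (\<integral>v\<in>{- V..- 1}. ?e v \<partial>lborel)"
      unfolding set_lebesgue_integral_def
      by (subst lborel_integral_real_affine[where c = "- 1" and t = 0]) (auto intro!: Bochner_Integration.integral_cong simp: indicator_def)
    finally show ?thesis
      using contour_double_deformation[OF S U one V, of "- x" "- y"] unfolding set_integral_mult_right diff_eq_eq by (simp only: add.commute)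
  qed
  have kernel: "(\<lambda>z w. 1 / (w - z) * exp ((w - complex_of_real y)\<^sup>2 / complex_of_real (2 * U) - (z - complex_of_real x)\<^sup>2 / complex_of_real (2 * S)) *
     (E w / E z)) = kernel_integrand S U x y" by (simp add: fun_eq_iff kernel_integrand_def)
  have hh: "(\<integral>u\<in>{-1..1}. heat_kernel S (complex_of_real x) (\<i> * complex_of_real u) * heat_kernel U (- \<i> * complex_of_real y) (complex_of_real u) \<partial>lborel)
     = ?d * (\<integral>u\<in>{-1..1}. ?e u \<partial>lborel)"
    unfolding heat_kernel_product[OF S U] by (rule set_integral_mult_right)
  have 1: "(\<integral>u\<in>{- V..V}. ?e u \<partial>lborel) = (\<integral>u\<in>{- V..-1}. ?e u \<partial>lborel) + (\<integral>u\<in>{-1..1}. ?e u \<partial>lborel) + (\<integral>u\<in>{1..V}. ?e u \<partial>lborel)"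
  proof -
    have split: "(\<integral>u\<in>{p..r}. ?e u \<partial>lborel) = (\<integral>u\<in>{p..q}. ?e u \<partial>lborel) + (\<integral>u\<in>{q..r}. ?e u \<partial>lborel)" if "p \<le> q" "q \<le> r" for p q r :: real
    proof -
      have "(\<integral>u\<in>{p..q} \<union> {q..r}. ?e u \<partial>lborel) = (\<integral>u\<in>{p..q}. ?e u \<partial>lborel) + (\<integral>u\<in>{q..r}. ?e u \<partial>lborel)"
      proof (rule set_integral_Un_AE)
        have "AE u in lborel. u \<noteq> q" by (rule AE_lborel_singleton)
        then show "AE u in lborel. \<not> (u \<in> {p..q} \<and> u \<in> {q..r})" by eventually_elim auto
      qed (auto intro: saddle_exponential_integrable)
      moreover have "{p..q} \<union> {q..r} = {p..r}" using that by auto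
      ultimately show ?thesis by simp
    qed
    show ?thesis using split[of "- V" "- 1" V] split[of "- 1" 1 V] V by simp
  qed
  have "analytic_kernel \<epsilon> a (S, x) (U, y) = ?c * (contour_double 1 S U x y + contour_double 1 S U (- x) (- y)) + ?d * (\<integral>u\<in>{-1..1}. ?e u \<partial>lborel)"
    unfolding analytic_kernel_def prod.case Let_def kernel double_contour_integral_upper double_contour_integral_lower hh ..
  also have "\<dots> = ?c * (contour_double V S U x y + contour_double V S U (- x) (- y)) +
     (?c * (2 * of_real pi * \<i> * \<i>)) * ((\<integral>v\<in>{1..V}. ?e v \<partial>lborel) + (\<integral>v\<in>{- V..- 1}. ?e v \<partial>lborel)) + ?d * (\<integral>u\<in>{-1..1}. ?e u \<partial>lborel)"
    unfolding up down by (simp only: distrib_left mult.assoc add_ac)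
  also have "\<dots> = ?c * (contour_double V S U x y + contour_double V S U (- x) (- y)) + ?d * (\<integral>u\<in>{- V..V}. ?e u \<partial>lborel)"
    unfolding cd 1 by (simp only: distrib_left add_ac)
  finally show ?thesis .
qed

end

section \<open>The saddle point estimate of the double integral\<close>

lemma exp_convex_bound: "0 \<le> k \<Longrightarrow> k \<le> 1 \<Longrightarrow> exp (k * u) \<le> 1 + k * exp u" for k u :: real
proof -
  assume k: "0 \<le> k" "k \<le> 1"
  have "exp ((1 - k) *\<^sub>R 0 + k *\<^sub>R u) \<le> (1 - k) * exp 0 + k * exp u"
    by (rule convex_onD[OF exp_convex]) (use k in auto)
  then show ?thesis using k by simp
qed

text \<open>Here \<open>\<nu>\<close>, \<open>\<rho>\<close>, \<open>v0\<close> stand for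
  \<open>v\<close>, \<open>r\<close>, \<open>V\<close> in units of \<open>L\<close>, and
  \<open>\<mu>\<close> for the shift in units of \<open>L^2\<close>. The times \<open>S\<close> and
  \<open>U\<close> differ from \<open>\<sigma>^2 n\<close> by factors \<open>1 + O (1/n)\<close>.
  Hence the terms of order \<open>n\<close> in the Gaussian exponents cancel against the exponent
  from the saddle bound, and what survives is bounded by multiples of \<open>\<nu>^2\<close>,
  \<open>\<rho>^2\<close> and 1 that do not grow with \<open>n\<close>.\<close>

lemma scaled_exponent_bound:
  fixes \<sigma> n s t X Y \<nu> \<rho> \<mu> v0 R :: real
  assumes \<sigma>: "0 < \<sigma>" and n: "1 \<le> n" "2 * R \<le> n" and R: "\<bar>s\<bar> \<le> R" "\<bar>t\<bar> \<le> R" "\<bar>X\<bar> \<le> R" "\<bar>Y\<bar> \<le> R"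
    and \<mu>: "0 \<le> \<mu>" "\<mu> \<le> \<rho>\<^sup>2"
  defines "L \<equiv> \<sigma> * n" and "S \<equiv> \<sigma>\<^sup>2 * (n + s)" and "U \<equiv> \<sigma>\<^sup>2 * (n + t)"
  shows "((\<sigma> * Y)\<^sup>2 - (L * \<nu>)\<^sup>2) / (2 * U) + ((L * v0)\<^sup>2 - L\<^sup>2 * \<mu>) / (2 * S) - (\<sigma> * X) * (L * \<rho>) / S - (\<sigma> * X)\<^sup>2 / (2 * S)
     + ((L * \<nu>)\<^sup>2 - (L * v0)\<^sup>2 + L\<^sup>2 * \<mu>) / (2 * (\<sigma>\<^sup>2 * n)) \<le> R * \<nu>\<^sup>2 + 2 * R * \<rho>\<^sup>2 + (R * v0\<^sup>2 + R\<^sup>2 + R)"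
proof -
  \<comment> \<open>The linear bookkeeping, isolated in abstract variables; the facts gathered by
    \<open>moreover\<close> below are its premises in order.\<close>
  have collect: "A + B - C - D + F \<le> b1 + b2' + (b3 + b4 + R)" if "A = y - e1" "B = e2" "C = x" "F = f" "0 \<le> D"
    "g1 - e1 = h1 / 2" "e2 - g2 = - (h2 / 2)" "P" "Q" "h1 \<le> k1" "- h2 \<le> k2" "- x \<le> k3" "y \<le> b4"
    "f = g1 - g2" "k2 = 2 * b3 + 2 * b2" "k3 = R + b2" "k1 = 2 * b1" "b2' = 2 * b2"
    for A B C D F b1 b2 b2' b3 b4 y e1 e2 x f g1 g2 h1 h2 k1 k2 k3 :: real and P Q
    using that by linarith
  have R0: "0 \<le> R" using R(1) by linarith
  have ns: "0 < n + s" "0 < n + t" "n / 2 \<le> n + s" "n / 2 \<le> n + t" using n R by linarith+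
  have ratio: "0 \<le> n / (n + s)" "n / (n + s) \<le> 2" "0 \<le> n / (n + t)" "n / (n + t) \<le> 2"
    using ns n by (auto simp: divide_le_eq)
  have reduce: "\<sigma>\<^sup>2 * P / (2 * (\<sigma>\<^sup>2 * Q)) = P / (2 * Q)" for P Q
    using \<sigma> by (simp only: mult.left_commute[of 2] mult_divide_mult_cancel_left_if) simp
  have "((\<sigma> * Y)\<^sup>2 - (L * \<nu>)\<^sup>2) / (2 * U) = Y\<^sup>2 / (2 * (n + t)) - \<nu>\<^sup>2 * (n * (n / (n + t))) / 2"
  proof -
    have "(\<sigma> * Y)\<^sup>2 - (L * \<nu>)\<^sup>2 = \<sigma>\<^sup>2 * (Y\<^sup>2 - n\<^sup>2 * \<nu>\<^sup>2)" by (simp add: L_def power_mult_distrib algebra_simps)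
    then have "((\<sigma> * Y)\<^sup>2 - (L * \<nu>)\<^sup>2) / (2 * U) = (Y\<^sup>2 - n\<^sup>2 * \<nu>\<^sup>2) / (2 * (n + t))" by (simp only: U_def reduce)
    also have "\<dots> = Y\<^sup>2 / (2 * (n + t)) - \<nu>\<^sup>2 * (n * (n / (n + t))) / 2" by (simp add: diff_divide_distrib power2_eq_square mult_ac)
    finally show ?thesis .
  qed
  moreover have "((L * v0)\<^sup>2 - L\<^sup>2 * \<mu>) / (2 * S) = (v0\<^sup>2 - \<mu>) * (n * (n / (n + s))) / 2"
  proof -
    have "(L * v0)\<^sup>2 - L\<^sup>2 * \<mu> = \<sigma>\<^sup>2 * (n\<^sup>2 * (v0\<^sup>2 - \<mu>))" by (simp add: L_def power_mult_distrib algebra_simps)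
    then have "((L * v0)\<^sup>2 - L\<^sup>2 * \<mu>) / (2 * S) = n\<^sup>2 * (v0\<^sup>2 - \<mu>) / (2 * (n + s))" by (simp only: S_def reduce)
    then show ?thesis by (simp add: power2_eq_square mult_ac)
  qed
  moreover have "(\<sigma> * X) * (L * \<rho>) / S = X * \<rho> * (n / (n + s))"
  proof -
    have "(\<sigma> * X) * (L * \<rho>) = \<sigma>\<^sup>2 * (X * \<rho> * n)" by (simp add: L_def power2_eq_square)
    then have "(\<sigma> * X) * (L * \<rho>) / S = \<sigma>\<^sup>2 * (X * \<rho> * n) / (\<sigma>\<^sup>2 * (n + s))" by (simp only: S_def)
    then show ?thesis using \<sigma> by simp
  qed
  moreover have "((L * \<nu>)\<^sup>2 - (L * v0)\<^sup>2 + L\<^sup>2 * \<mu>) / (2 * (\<sigma>\<^sup>2 * n)) = (\<nu>\<^sup>2 - v0\<^sup>2 + \<mu>) * n / 2"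
  proof -
    have "(L * \<nu>)\<^sup>2 - (L * v0)\<^sup>2 + L\<^sup>2 * \<mu> = \<sigma>\<^sup>2 * (n\<^sup>2 * (\<nu>\<^sup>2 - v0\<^sup>2 + \<mu>))" by (simp add: L_def power_mult_distrib algebra_simps)
    then have "((L * \<nu>)\<^sup>2 - (L * v0)\<^sup>2 + L\<^sup>2 * \<mu>) / (2 * (\<sigma>\<^sup>2 * n)) = n\<^sup>2 * (\<nu>\<^sup>2 - v0\<^sup>2 + \<mu>) / (2 * n)" by (simp only: reduce)
    then show ?thesis using n by (simp add: power2_eq_square mult_ac)
  qed
  moreover have "0 \<le> (\<sigma> * X)\<^sup>2 / (2 * S)" unfolding S_def using \<sigma> ns by simp
  moreover have "\<nu>\<^sup>2 * n / 2 - \<nu>\<^sup>2 * (n * (n / (n + t))) / 2 = \<nu>\<^sup>2 * (t * (n / (n + t))) / 2"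
    using ns by (simp add: field_simps)
  moreover have "(v0\<^sup>2 - \<mu>) * (n * (n / (n + s))) / 2 - (v0\<^sup>2 - \<mu>) * n / 2 = - ((v0\<^sup>2 - \<mu>) * (s * (n / (n + s))) / 2)"
    using ns by (simp add: field_simps)
  moreover have st: "\<bar>t * (n / (n + t))\<bar> \<le> R * 2" "\<bar>s * (n / (n + s))\<bar> \<le> R * 2"
    unfolding abs_mult abs_of_nonneg[OF ratio(1)] abs_of_nonneg[OF ratio(3)]
    using mult_mono[OF R(2) ratio(4) R0 ratio(3)] mult_mono[OF R(1) ratio(2) R0 ratio(1)] .
  moreover have "\<nu>\<^sup>2 * (t * (n / (n + t))) \<le> \<nu>\<^sup>2 * (R * 2)" by (rule mult_left_mono[OF abs_le_D1[OF st(1)]]) simp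
  moreover have "- ((v0\<^sup>2 - \<mu>) * (s * (n / (n + s)))) \<le> (v0\<^sup>2 + \<rho>\<^sup>2) * (R * 2)"
  proof -
    have "- ((v0\<^sup>2 - \<mu>) * (s * (n / (n + s)))) \<le> \<bar>v0\<^sup>2 - \<mu>\<bar> * \<bar>s * (n / (n + s))\<bar>" by (metis abs_ge_minus_self abs_mult)
    also have "\<dots> \<le> (v0\<^sup>2 + \<rho>\<^sup>2) * (R * 2)" 
    proof (rule mult_mono[OF _ st(2)])
      show "\<bar>v0\<^sup>2 - \<mu>\<bar> \<le> v0\<^sup>2 + \<rho>\<^sup>2" unfolding abs_le_iff using \<mu> zero_le_power2[of v0] zero_le_power2[of \<rho>] by linarith
    qed auto
    finally show ?thesis .
  qed
  moreover have "- (X * \<rho> * (n / (n + s))) \<le> R * (1 + \<rho>\<^sup>2)"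
  proof -
    have "- (X * \<rho> * (n / (n + s))) \<le> \<bar>X\<bar> * \<bar>\<rho>\<bar> * \<bar>n / (n + s)\<bar>" by (metis abs_ge_minus_self abs_mult)
    also have "\<dots> = \<bar>X\<bar> * \<bar>\<rho>\<bar> * (n / (n + s))" by (simp only: abs_of_nonneg[OF ratio(1)])
    also have "\<dots> \<le> (R * \<bar>\<rho>\<bar>) * 2"
      by (rule mult_mono[OF mult_right_mono[OF R(3)] ratio(2)]) (use R0 ratio(1) in simp_all)
    also have "\<dots> = R * (2 * \<bar>\<rho>\<bar>)" by simp
    also have "\<dots> \<le> R * (1 + \<rho>\<^sup>2)" using R0 zero_le_power2[of "\<bar>\<rho>\<bar> - 1"] by (intro mult_left_mono) (auto simp: power2_eq_square algebra_simps)
    finally show ?thesis .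
  qed
  moreover have "Y\<^sup>2 / (2 * (n + t)) \<le> R\<^sup>2"
  proof -
    have "Y\<^sup>2 \<le> R\<^sup>2" using R(4) R0 by (simp add: abs_le_square_iff[symmetric])
    moreover have "R\<^sup>2 * 1 \<le> R\<^sup>2 * (2 * (n + t))" using ns n by (intro mult_left_mono) auto
    ultimately show ?thesis using ns by (simp add: divide_le_eq)
  qed
  moreover have "(\<nu>\<^sup>2 - v0\<^sup>2 + \<mu>) * n / 2 = \<nu>\<^sup>2 * n / 2 - (v0\<^sup>2 - \<mu>) * n / 2"
    "(v0\<^sup>2 + \<rho>\<^sup>2) * (R * 2) = 2 * (R * v0\<^sup>2) + 2 * (R * \<rho>\<^sup>2)" "R * (1 + \<rho>\<^sup>2) = R + R * \<rho>\<^sup>2"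
    "\<nu>\<^sup>2 * (R * 2) = 2 * (R * \<nu>\<^sup>2)" "2 * R * \<rho>\<^sup>2 = 2 * (R * \<rho>\<^sup>2)"
    by (simp_all add: field_simps)
  ultimately show ?thesis by (rule collect)
qed

text \<open>The decay of the weight in terms of the distance of \<open>|\<nu>|\<close> from
  \<open>v0\<close>: near the saddle \<open>d\<close> vanishes to first order in that distance, and
  far away \<open>d\<close> itself grows quadratically, so a multiple of the square is a lower bound
  throughout. The bounds \<open>l\<close> and \<open>h\<close> on \<open>v0\<close> make the
  constant uniform.\<close>

lemma displacement_bound:
  fixes \<nu> v0 :: real
  assumes l: "0 < l" "l \<le> v0" "v0 \<le> h"
  defines "d \<equiv> (\<nu>\<^sup>2 - v0\<^sup>2) / (1 + v0\<^sup>2)"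
  shows "l\<^sup>2 / (2 * (1 + h\<^sup>2) * (1 + 2 * h\<^sup>2)) * (\<bar>\<nu>\<bar> - v0)\<^sup>2 \<le> d\<^sup>2 / (2 * (1 + \<bar>d\<bar>))"
proof -
  have v0: "0 < v0" using l by simp
  define p where "p = (\<bar>\<nu>\<bar> - v0)\<^sup>2" 
  define A where "A = 1 + v0\<^sup>2"
  define W where "W = \<nu>\<^sup>2 + v0\<^sup>2"
  have A: "1 \<le> A" and p: "0 \<le> p" and W: "0 \<le> W" by (simp_all add: A_def p_def W_def)
  have vl: "l\<^sup>2 \<le> v0\<^sup>2" "v0\<^sup>2 \<le> h\<^sup>2" using l by (auto intro!: power_mono)
  have d1: "1 + \<bar>d\<bar> \<le> (A + W) / A"
  proof -
    have "\<bar>\<nu>\<^sup>2 - v0\<^sup>2\<bar> \<le> W" unfolding W_def abs_le_iff using zero_le_power2[of v0] zero_le_power2[of \<nu>] by linarith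
    then have "\<bar>d\<bar> \<le> W / A" unfolding d_def A_def using A by (auto simp: A_def abs_divide intro!: divide_right_mono)
    then show ?thesis using A by (simp add: add_divide_distrib)
  qed
  have d2: "p * W \<le> (A * d)\<^sup>2"
  proof -
    have "A * d = \<nu>\<^sup>2 - v0\<^sup>2" using A by (simp add: d_def A_def[symmetric])
    also have "\<dots> = (\<bar>\<nu>\<bar> - v0) * (\<bar>\<nu>\<bar> + v0)" by (simp add: algebra_simps power2_eq_square)
    finally have "A * d = (\<bar>\<nu>\<bar> - v0) * (\<bar>\<nu>\<bar> + v0)" .
    then have "(A * d)\<^sup>2 = p * (\<bar>\<nu>\<bar> + v0)\<^sup>2" by (simp add: p_def power_mult_distrib)
    moreover have "W \<le> (\<bar>\<nu>\<bar> + v0)\<^sup>2" using v0 by (simp add: W_def power2_sum)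
    ultimately show ?thesis using p by (simp add: mult_left_mono)
  qed
  have main: "l\<^sup>2 * (A + W) \<le> W * (1 + 2 * h\<^sup>2)"
  proof -
    have "l\<^sup>2 * (A + W) \<le> v0\<^sup>2 * (A + W)" using vl A W by (intro mult_right_mono) auto
    also have "\<dots> \<le> W * (1 + 2 * v0\<^sup>2)" by (simp add: A_def W_def algebra_simps)
    also have "\<dots> \<le> W * (1 + 2 * h\<^sup>2)" using vl W by (intro mult_left_mono) auto
    finally show ?thesis .
  qed
  have "l\<^sup>2 / (2 * (1 + h\<^sup>2) * (1 + 2 * h\<^sup>2)) * p = p * l\<^sup>2 / (2 * (1 + h\<^sup>2) * (1 + 2 * h\<^sup>2))" by simp
  also have "\<dots> \<le> p * W / (2 * A * (A + W))"
  proof -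
    have pos: "0 < 2 * (1 + h\<^sup>2) * (1 + 2 * h\<^sup>2)" "0 < 2 * A * (A + W)"
      using A W by (auto intro!: mult_pos_pos add_pos_nonneg)
    have "p * l\<^sup>2 * (2 * A * (A + W)) = 2 * p * A * (l\<^sup>2 * (A + W))" by (simp add: mult_ac)
    also have "\<dots> \<le> 2 * p * A * (W * (1 + 2 * h\<^sup>2))" using p A by (intro mult_left_mono[OF main]) auto
    also have "\<dots> = 2 * p * W * (1 + 2 * h\<^sup>2) * A" by (simp add: mult_ac)
    also have "\<dots> \<le> 2 * p * W * (1 + 2 * h\<^sup>2) * (1 + h\<^sup>2)" using p W vl by (intro mult_left_mono) (auto simp: A_def)
    also have "\<dots> = p * W * (2 * (1 + h\<^sup>2) * (1 + 2 * h\<^sup>2))" by (simp only: mult_ac)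
    finally show ?thesis using pos by (simp only: frac_le_eq diff_le_0_iff_le divide_le_0_iff pos_divide_le_eq pos_le_divide_eq times_divide_eq_left)
  qed
  also have "\<dots> \<le> (A * d)\<^sup>2 / (2 * A * (A + W))" using A W by (intro divide_right_mono d2) auto
  also have "\<dots> = (A * (A * d\<^sup>2)) / (A * (2 * (A + W)))" by (simp only: power2_eq_square mult_ac)
  also have "\<dots> = A * d\<^sup>2 / (2 * (A + W))" using A by (subst mult_divide_mult_cancel_left) auto
  also have "\<dots> = d\<^sup>2 / (2 * ((A + W) / A))" by (simp add: mult.commute)
  also have "\<dots> \<le> d\<^sup>2 / (2 * (1 + \<bar>d\<bar>))"
  proof (rule divide_left_mono)
    show "2 * (1 + \<bar>d\<bar>) \<le> 2 * ((A + W) / A)" by (rule mult_left_mono[OF d1]) simp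
  qed (use A W in \<open>auto intro!: mult_pos_pos divide_pos_pos add_pos_nonneg\<close>)
  finally show ?thesis unfolding p_def .
qed

text \<open>For \<open>\<rho>^2 \<le> 1\<close> the exponential is bounded. For larger
  \<open>\<rho>\<close> one has \<open>m \<ge> g\<close>, so convexity with
  \<open>k = g^2 / 3\<close> bounds the root below by \<open>exp (k m)\<close>; its
  \<open>n\<close>-th power is at least \<open>exp (n k g \<rho>^2)\<close> and outweighs the growth
  once \<open>n\<close> is large.\<close>

lemma shift_weight_bound:
  fixes m \<rho> g R :: real
  assumes g: "0 < g" "g \<le> 1" "g * \<rho>\<^sup>2 \<le> m" and n: "2 * R + 1 \<le> real n * (g\<^sup>2 / 3 * g)" and R: "0 \<le> R"
  shows "exp (2 * R * \<rho>\<^sup>2) * (1 / sqrt (1 + m\<^sup>2 * exp (2 * m) / 3)) ^ n \<le> exp (2 * R + 1) * exp (- \<rho>\<^sup>2)"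
proof -
  define w where "w = sqrt (1 + m\<^sup>2 * exp (2 * m) / 3)"
  have w1: "1 \<le> w" by (simp add: w_def)
  show ?thesis
  proof (cases "\<rho>\<^sup>2 \<le> 1")
    case True
    have "(1 / w) ^ n \<le> 1" using w1 by (intro power_le_one) auto
    moreover have "2 * R * \<rho>\<^sup>2 \<le> 2 * R + 1 + - \<rho>\<^sup>2" using mult_left_mono[OF True, of "2 * R"] R True by simp
    then have "exp (2 * R * \<rho>\<^sup>2) \<le> exp (2 * R + 1) * exp (- \<rho>\<^sup>2)" by (simp only: mult_exp_exp exp_le_cancel_iff)
    ultimately show ?thesis unfolding w_def[symmetric]
      using mult_mono[of "exp (2 * R * \<rho>\<^sup>2)" "exp (2 * R + 1) * exp (- \<rho>\<^sup>2)" "(1 / w) ^ n" 1] w1 by simp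
  next
    case False
    have "g * 1 \<le> g * \<rho>\<^sup>2" using g(1) False by (intro mult_left_mono) auto
    then have gm: "g \<le> m" using g(3) by simp
    define k where "k = g\<^sup>2 / 3"
    have k: "0 \<le> k" "k \<le> 1" using power_le_one[of g 2] g by (auto simp: k_def)
    have "exp (k * (2 * m)) \<le> 1 + k * exp (2 * m)" by (rule exp_convex_bound[OF k])
    also have "\<dots> \<le> 1 + m\<^sup>2 * exp (2 * m) / 3" using power_mono[OF gm, of 2] g by (simp add: k_def)
    finally have "sqrt ((exp (k * m))\<^sup>2) \<le> w" unfolding w_def by (intro real_sqrt_le_mono) (simp add: exp_double[symmetric] mult_ac)
    then have w: "exp (k * m) \<le> w" by simp
    have "exp (2 * R * \<rho>\<^sup>2 + \<rho>\<^sup>2) \<le> exp (real n * (k * m))"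
    proof (subst exp_le_cancel_iff)
      have "2 * R * \<rho>\<^sup>2 + \<rho>\<^sup>2 = (2 * R + 1) * \<rho>\<^sup>2" by (simp add: algebra_simps)
      also have "\<dots> \<le> (real n * (k * g)) * \<rho>\<^sup>2" using n by (intro mult_right_mono) (auto simp: k_def)
      also have "\<dots> = real n * k * (g * \<rho>\<^sup>2)" by simp
      also have "\<dots> \<le> real n * k * m" using g(3) k by (intro mult_left_mono) auto
      finally show "2 * R * \<rho>\<^sup>2 + \<rho>\<^sup>2 \<le> real n * (k * m)" by (simp add: mult_ac)
    qed
    also have "\<dots> = exp (k * m) ^ n" by (simp add: exp_of_nat_mult)
    also have "\<dots> \<le> w ^ n" using w by (intro power_mono) auto
    finally have "exp (2 * R * \<rho>\<^sup>2 + \<rho>\<^sup>2) \<le> w ^ n" .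
    then have "exp (2 * R * \<rho>\<^sup>2) * (1 / w) ^ n \<le> exp (- \<rho>\<^sup>2)"
      using w1 by (simp add: power_one_over divide_le_eq exp_add exp_minus field_simps)
    also have "\<dots> \<le> exp (2 * R + 1) * exp (- \<rho>\<^sup>2)" using R by simp
    finally show ?thesis unfolding w_def[symmetric] .
  qed
qed

text \<open>Half of the rate \<open>N * c\<close> pays for the linear prefactor and for
  \<open>exp (R * \<nu>^2)\<close>, since \<open>\<nu>^2\<close> is at most twice the squared
  distance of \<open>|\<nu>|\<close> from \<open>v0\<close> plus \<open>2 * h^2\<close>.\<close>

lemma displacement_weight_bound:
  fixes \<nu> v0 l h R N c :: real
  assumes l: "0 < l" "0 \<le> v0" "v0 \<le> h" and N: "4 * R + 4 \<le> N * c" and R: "0 \<le> R"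
  shows "(1 + \<bar>\<nu>\<bar> / l) * exp (R * \<nu>\<^sup>2) * exp (- (N * c * (\<bar>\<nu>\<bar> - v0)\<^sup>2)) \<le>
    exp (1 / l\<^sup>2 + (R + 1) * (2 * h\<^sup>2)) * exp (- (N * c / 2 * (\<bar>\<nu>\<bar> - v0)\<^sup>2))"
proof -
  define p where "p = (\<bar>\<nu>\<bar> - v0)\<^sup>2"
  have p: "0 \<le> p" by (simp add: p_def)
  have "\<nu>\<^sup>2 = (p + 2 * v0 * (\<bar>\<nu>\<bar> - v0)) + v0\<^sup>2" by (simp add: p_def power2_eq_square algebra_simps)
  also have "2 * v0 * (\<bar>\<nu>\<bar> - v0) \<le> p + v0\<^sup>2"
    using zero_le_power2[of "\<bar>\<nu>\<bar> - v0 - v0"] by (simp add: p_def power2_eq_square algebra_simps)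
  also have "v0\<^sup>2 \<le> h\<^sup>2" using l by (intro power_mono) auto
  finally have \<nu>: "\<nu>\<^sup>2 \<le> 2 * p + 2 * h\<^sup>2" using \<open>v0\<^sup>2 \<le> h\<^sup>2\<close> by simp
  have "1 + \<bar>\<nu>\<bar> / l \<le> exp (\<bar>\<nu>\<bar> / l)" by (rule exp_ge_add_one_self)
  also have "\<dots> \<le> exp (1 / l\<^sup>2 + \<nu>\<^sup>2)"
  proof (subst exp_le_cancel_iff)
    have "0 \<le> (\<bar>\<nu>\<bar> - 1 / l)\<^sup>2 + \<nu>\<^sup>2 + (1 / l)\<^sup>2" by simp
    then show "\<bar>\<nu>\<bar> / l \<le> 1 / l\<^sup>2 + \<nu>\<^sup>2" using l by (simp add: power2_diff power_divide)
  qed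
  finally have "(1 + \<bar>\<nu>\<bar> / l) * exp (R * \<nu>\<^sup>2) * exp (- (N * c * p)) \<le> exp (1 / l\<^sup>2 + \<nu>\<^sup>2) * exp (R * \<nu>\<^sup>2) * exp (- (N * c * p))"
    by (intro mult_right_mono) auto
  also have "\<dots> = exp (1 / l\<^sup>2 + (R + 1) * \<nu>\<^sup>2 - N * c * p)" by (simp add: mult_exp_exp algebra_simps)
  also have "\<dots> \<le> exp (1 / l\<^sup>2 + (R + 1) * (2 * h\<^sup>2) + - (N * c / 2 * p))"
  proof (subst exp_le_cancel_iff)
    have "(R + 1) * \<nu>\<^sup>2 \<le> (R + 1) * (2 * p + 2 * h\<^sup>2)" using R \<nu> by (intro mult_left_mono) auto
    moreover have "(4 * R + 4) * p \<le> N * c * p" using p N by (intro mult_right_mono) auto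
    ultimately show "1 / l\<^sup>2 + (R + 1) * \<nu>\<^sup>2 - N * c * p \<le> 1 / l\<^sup>2 + (R + 1) * (2 * h\<^sup>2) + - (N * c / 2 * p)"
      by (simp add: algebra_simps)
  qed
  finally show ?thesis unfolding p_def exp_add .
qed

context canonical_zeros
begin

text \<open>In units of \<open>L\<close> the exponents cancel up to bounded multiples of
  \<open>\<nu>^2\<close> and \<open>\<rho>^2\<close> (\<open>scaled_exponent_bound\<close>), and the
  \<open>n\<close>-th power of the weight from \<open>ratio_bound_saddle\<close> outweighs these.
  The outcome is a Gaussian in \<open>r\<close> of width about \<open>L\<close> and one in
  \<open>v\<close> of width about \<open>L / sqrt n\<close> around \<open>L * v0\<close> and its
  negative.\<close>

lemma contour_integrand_scaled_bound:
  fixes \<sigma> s t X Y v0 l h R :: real and n :: nat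
  assumes \<sigma>: "0 < \<sigma>" and l: "0 < l" "l \<le> v0" "v0 \<le> h" and R: "\<bar>s\<bar> \<le> R" "\<bar>t\<bar> \<le> R" "\<bar>X\<bar> \<le> R" "\<bar>Y\<bar> \<le> R"
    and zeros: "\<And>j. j < n \<Longrightarrow> (a (Suc j))\<^sup>2 \<le> (\<sigma> * real n)\<^sup>2"
    and saddle: "(\<lambda>j. 1 / ((a (Suc j))\<^sup>2 + (\<sigma> * real n * v0)\<^sup>2)) sums (1 / (2 * (\<sigma>\<^sup>2 * real n)))"
    and n: "1 \<le> n" "2 * R \<le> real n"
  defines "c \<equiv> l\<^sup>2 / (2 * (1 + h\<^sup>2) * (1 + 2 * h\<^sup>2))" and "g \<equiv> (2 / 3) / (1 + h\<^sup>2)"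
  assumes n': "4 * R + 4 \<le> real n * c" "2 * R + 1 \<le> real n * (g\<^sup>2 / 3 * g)"
  defines "L \<equiv> \<sigma> * real n"
  shows "norm (contour_integrand (L * v0) (\<sigma>\<^sup>2 * (real n + s)) (\<sigma>\<^sup>2 * (real n + t)) (\<sigma> * X) (\<sigma> * Y) (r, v)) \<le>
    2 * exp ((R * h\<^sup>2 + R\<^sup>2 + R) + (2 * R + 1) + (1 / l\<^sup>2 + (R + 1) * (2 * h\<^sup>2))) *
    (1 / sqrt (r\<^sup>2 + (v - max (L * v0) (\<bar>r\<bar> / sqrt 3))\<^sup>2)) * exp (- (1 / L\<^sup>2 * r\<^sup>2)) *
    exp (- (real n * c / 2 / L\<^sup>2 * (\<bar>v\<bar> - L * v0)\<^sup>2))"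
proof -
  define S where "S = \<sigma>\<^sup>2 * (real n + s)"
  define U where "U = \<sigma>\<^sup>2 * (real n + t)"
  define \<nu> where "\<nu> = v / L"
  define \<rho> where "\<rho> = r / L"
  define z where "z = contour (L * v0) r"
  define M where "M = square_shift (L * v0) z"
  define \<mu> where "\<mu> = M / L\<^sup>2"
  define d where "d = (\<nu>\<^sup>2 - v0\<^sup>2) / (1 + v0\<^sup>2)"
  define m where "m = \<mu> / (1 + v0\<^sup>2)"
  define W where "W = 1 / sqrt (r\<^sup>2 + (v - max (L * v0) (\<bar>r\<bar> / sqrt 3))\<^sup>2)"
  have L: "0 < L" using \<sigma> n by (simp add: L_def)
  have v0: "0 < v0" and R0: "0 \<le> R" using l R by linarith+
  then have V: "0 < L * v0" using L by simp
  have "0 < real n + s" "0 < real n + t" using n R by linarith+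
  then have SU: "0 < S" "0 < U" using \<sigma> by (simp_all add: S_def U_def)
  have v: "v = L * \<nu>" and r: "r = L * \<rho>" and M: "M = L\<^sup>2 * \<mu>" using L by (simp_all add: \<nu>_def \<rho>_def \<mu>_def)
  have W: "0 \<le> W" by (simp add: W_def)
  have shift: "2 / 3 * r\<^sup>2 \<le> M" "M \<le> r\<^sup>2" unfolding M_def z_def by (rule contour_shift[OF V])+
  have \<mu>: "2 / 3 * \<rho>\<^sup>2 \<le> \<mu>" "\<mu> \<le> \<rho>\<^sup>2"
    using shift L unfolding r M by (simp_all add: power_mult_distrib)
  have \<mu>0: "0 \<le> \<mu>" using \<mu>(1) zero_le_power2[of \<rho>] by linarith
  have T: "0 < \<sigma>\<^sup>2 * real n" using \<sigma> n by simp
  have E: "norm (E (\<i> * of_real v) / E z) \<le> (1 + \<bar>v\<bar> / norm z) * exp ((v\<^sup>2 - (L * v0)\<^sup>2 + M) / (2 * (\<sigma>\<^sup>2 * real n))) *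
      (exp (- (d\<^sup>2 / (2 * (1 + \<bar>d\<bar>)))) / sqrt (1 + m\<^sup>2 * exp (2 * m) / 3)) ^ n"
  proof -
    have "(v\<^sup>2 - (L * v0)\<^sup>2) / (L\<^sup>2 + (L * v0)\<^sup>2) = (L\<^sup>2 * (\<nu>\<^sup>2 - v0\<^sup>2)) / (L\<^sup>2 * (1 + v0\<^sup>2))"
      by (simp add: v power_mult_distrib algebra_simps)
    then have d: "(v\<^sup>2 - (L * v0)\<^sup>2) / (L\<^sup>2 + (L * v0)\<^sup>2) = d" using L by (simp add: d_def)
    have "M / (L\<^sup>2 + (L * v0)\<^sup>2) = (L\<^sup>2 * \<mu>) / (L\<^sup>2 * (1 + v0\<^sup>2))"
      by (simp add: M power_mult_distrib algebra_simps)
    then have m: "M / (L\<^sup>2 + (L * v0)\<^sup>2) = m" using L by (simp add: m_def)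
    have zeros': "\<And>j. j < n \<Longrightarrow> (a (Suc j))\<^sup>2 \<le> L\<^sup>2" unfolding L_def by (rule zeros)
    have adm: "admissible (L * v0) z" unfolding z_def by (rule contour_shift(1)[OF V])
    show ?thesis
      using ratio_bound_saddle[where V = "L * v0" and z = z and T = "\<sigma>\<^sup>2 * real n" and n = n and L = L and v = v, OF adm T saddle[folded L_def] zeros']
      unfolding M_def[symmetric] d m .
  qed
  have "1 + \<bar>v\<bar> / norm z \<le> 1 + \<bar>v\<bar> / (L * l)"
  proof -
    have "L * l \<le> L * v0" using L l by simp
    also have "\<dots> \<le> norm z" unfolding z_def by (rule norm_contour_ge[OF V])
    finally show ?thesis using L l by (simp add: frac_le)
  qed
  also have "\<dots> = 1 + \<bar>\<nu>\<bar> / l" using L by (simp add: \<nu>_def)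
  finally have q0: "1 + \<bar>v\<bar> / norm z \<le> 1 + \<bar>\<nu>\<bar> / l" .
  have q1: "exp (- (d\<^sup>2 / (2 * (1 + \<bar>d\<bar>)))) ^ n \<le> exp (- (real n * c * (\<bar>\<nu>\<bar> - v0)\<^sup>2))"
  proof -
    have "c * (\<bar>\<nu>\<bar> - v0)\<^sup>2 \<le> d\<^sup>2 / (2 * (1 + \<bar>d\<bar>))" unfolding c_def d_def by (rule displacement_bound[OF l])
    then have "exp (- (d\<^sup>2 / (2 * (1 + \<bar>d\<bar>)))) ^ n \<le> exp (- (c * (\<bar>\<nu>\<bar> - v0)\<^sup>2)) ^ n" by (intro power_mono) auto
    also have "\<dots> = exp (- (real n * c * (\<bar>\<nu>\<bar> - v0)\<^sup>2))" by (simp add: exp_of_nat_mult[symmetric] mult_ac)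
    finally show ?thesis .
  qed
  have h1: "1 + v0\<^sup>2 \<le> 1 + h\<^sup>2" using l v0 by (simp add: power_mono)
  have "g * \<rho>\<^sup>2 = (2 / 3 * \<rho>\<^sup>2) / (1 + h\<^sup>2)" by (simp add: g_def)
  also have "\<dots> \<le> \<mu> / (1 + v0\<^sup>2)" using \<mu> \<mu>0 h1 by (intro frac_le) (auto intro: add_pos_nonneg)
  finally have gm: "g * \<rho>\<^sup>2 \<le> m" by (simp add: m_def)
  have g: "0 < g" "g \<le> 1" unfolding g_def by (auto simp: add_pos_nonneg divide_le_eq intro!: divide_pos_pos)
  have q2: "exp (2 * R * \<rho>\<^sup>2) * (1 / sqrt (1 + m\<^sup>2 * exp (2 * m) / 3)) ^ n \<le> exp (2 * R + 1) * exp (- \<rho>\<^sup>2)"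
    by (rule shift_weight_bound[OF g gm n'(2) R0])
  have q3: "(1 + \<bar>\<nu>\<bar> / l) * exp (R * \<nu>\<^sup>2) * exp (- (real n * c * (\<bar>\<nu>\<bar> - v0)\<^sup>2)) \<le>
    exp (1 / l\<^sup>2 + (R + 1) * (2 * h\<^sup>2)) * exp (- (real n * c / 2 * (\<bar>\<nu>\<bar> - v0)\<^sup>2))"
    by (rule displacement_weight_bound[OF l(1) _ l(3) n'(1) R0]) (use v0 in simp)
  let ?A = "((\<sigma> * Y)\<^sup>2 - v\<^sup>2) / (2 * U) + ((L * v0)\<^sup>2 - M) / (2 * S) - (\<sigma> * X) * r / S - (\<sigma> * X)\<^sup>2 / (2 * S)"
  let ?B = "(v\<^sup>2 - (L * v0)\<^sup>2 + M) / (2 * (\<sigma>\<^sup>2 * real n))"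
  let ?D = "exp (- (d\<^sup>2 / (2 * (1 + \<bar>d\<bar>))))" and ?w = "1 / sqrt (1 + m\<^sup>2 * exp (2 * m) / 3)"
  let ?K = "R * h\<^sup>2 + R\<^sup>2 + R"
  have expo: "?A + ?B \<le> R * \<nu>\<^sup>2 + 2 * R * \<rho>\<^sup>2 + ?K"
  proof -
    have "?A + ?B \<le> R * \<nu>\<^sup>2 + 2 * R * \<rho>\<^sup>2 + (R * v0\<^sup>2 + R\<^sup>2 + R)"
      using scaled_exponent_bound[where \<sigma> = \<sigma> and n = "real n" and R = R and s = s and t = t and X = X and Y = Y and \<mu> = \<mu> and \<rho> = \<rho> and \<nu> = \<nu> and ?v0.0 = v0] \<sigma> n R \<mu> \<mu>0
      unfolding v r M S_def U_def L_def by simp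
    moreover have "R * v0\<^sup>2 \<le> R * h\<^sup>2" using h1 R0 by (intro mult_left_mono) auto
    ultimately show ?thesis by linarith
  qed
  have "norm (contour_integrand (L * v0) S U (\<sigma> * X) (\<sigma> * Y) (r, v)) \<le> 2 * W * exp ?A * norm (E (\<i> * of_real v) / E z)"
    using norm_contour_integrand[OF SU V, of "\<sigma> * X" "\<sigma> * Y" r v] unfolding W_def M_def z_def .
  also have "\<dots> \<le> 2 * W * exp ?A * ((1 + \<bar>\<nu>\<bar> / l) * exp ?B * (?D / sqrt (1 + m\<^sup>2 * exp (2 * m) / 3)) ^ n)"
  proof (rule mult_left_mono)
    show "norm (E (\<i> * of_real v) / E z) \<le> (1 + \<bar>\<nu>\<bar> / l) * exp ?B * (?D / sqrt (1 + m\<^sup>2 * exp (2 * m) / 3)) ^ n"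
      by (rule order_trans[OF E]) (intro mult_right_mono q0, auto)
  qed (use W in simp)
  also have "\<dots> = 2 * W * (1 + \<bar>\<nu>\<bar> / l) * exp (?A + ?B) * (?D ^ n * ?w ^ n)"
  proof -
    have "(?D / w) ^ n = ?D ^ n * (1 / w) ^ n" for w by (simp add: power_divide)
    then show ?thesis by (simp only: exp_add mult_ac)
  qed
  also have "\<dots> \<le> 2 * W * (1 + \<bar>\<nu>\<bar> / l) * exp (R * \<nu>\<^sup>2 + 2 * R * \<rho>\<^sup>2 + ?K) * (exp (- (real n * c * (\<bar>\<nu>\<bar> - v0)\<^sup>2)) * ?w ^ n)"
  proof (rule mult_mono)
    show "2 * W * (1 + \<bar>\<nu>\<bar> / l) * exp (?A + ?B) \<le> 2 * W * (1 + \<bar>\<nu>\<bar> / l) * exp (R * \<nu>\<^sup>2 + 2 * R * \<rho>\<^sup>2 + ?K)"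
      using W l expo by (intro mult_left_mono) auto
    show "?D ^ n * ?w ^ n \<le> exp (- (real n * c * (\<bar>\<nu>\<bar> - v0)\<^sup>2)) * ?w ^ n"
      by (rule mult_right_mono[OF q1]) simp
  qed (use W l in auto)
  also have "\<dots> = 2 * W * exp ?K * (((1 + \<bar>\<nu>\<bar> / l) * exp (R * \<nu>\<^sup>2) * exp (- (real n * c * (\<bar>\<nu>\<bar> - v0)\<^sup>2))) * (exp (2 * R * \<rho>\<^sup>2) * ?w ^ n))"
    by (simp only: exp_add mult_ac)
  also have "\<dots> \<le> 2 * W * exp ?K * ((exp (1 / l\<^sup>2 + (R + 1) * (2 * h\<^sup>2)) * exp (- (real n * c / 2 * (\<bar>\<nu>\<bar> - v0)\<^sup>2))) * (exp (2 * R + 1) * exp (- \<rho>\<^sup>2)))"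
    using W by (intro mult_left_mono mult_mono[OF q3 q2]) (auto intro!: mult_nonneg_nonneg simp: l(1)[THEN less_imp_le])
  also have "\<dots> = 2 * exp (?K + (2 * R + 1) + (1 / l\<^sup>2 + (R + 1) * (2 * h\<^sup>2))) * W * exp (- \<rho>\<^sup>2) * exp (- (real n * c / 2 * (\<bar>\<nu>\<bar> - v0)\<^sup>2))"
    by (simp only: exp_add mult_ac)
  also have "\<rho>\<^sup>2 = 1 / L\<^sup>2 * r\<^sup>2" by (simp add: \<rho>_def power_divide)
  also have "real n * c / 2 * (\<bar>\<nu>\<bar> - v0)\<^sup>2 = real n * c / 2 / L\<^sup>2 * (\<bar>v\<bar> - L * v0)\<^sup>2"
  proof -
    have "\<bar>v\<bar> - L * v0 = L * (\<bar>\<nu>\<bar> - v0)" using L by (simp add: v abs_mult algebra_simps)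
    then show ?thesis using L by (simp add: power_mult_distrib)
  qed
  finally show ?thesis unfolding S_def U_def W_def .
qed


end

context canonical_zeros
begin
text \<open>Integrating the pointwise bound with rates \<open>1 / L^2\<close> and
  \<open>n c / (2 L^2)\<close>, the estimate \<open>nn_integral_Cauchy_Gaussian\<close> gives the
  fourth root of their inverse product, that is a constant times \<open>L n^(-1/4)\<close>. The
  constants depend only on \<open>l\<close>, \<open>h\<close> and \<open>R\<close>.\<close>

lemma contour_double_scaled_bound:
  fixes l h R :: real
  assumes "0 < l" "l \<le> h" "0 \<le> R"
  obtains C N where "\<And>\<sigma> s t X Y v0 n. \<lbrakk>0 < \<sigma>; l \<le> v0; v0 \<le> h; \<bar>s\<bar> \<le> R; \<bar>t\<bar> \<le> R; \<bar>X\<bar> \<le> R; \<bar>Y\<bar> \<le> R;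
    \<And>j. j < n \<Longrightarrow> (a (Suc j))\<^sup>2 \<le> (\<sigma> * real n)\<^sup>2;
    (\<lambda>j. 1 / ((a (Suc j))\<^sup>2 + (\<sigma> * real n * v0)\<^sup>2)) sums (1 / (2 * (\<sigma>\<^sup>2 * real n))); N \<le> n\<rbrakk> \<Longrightarrow>
    norm (contour_double (\<sigma> * real n * v0) (\<sigma>\<^sup>2 * (real n + s)) (\<sigma>\<^sup>2 * (real n + t)) (\<sigma> * X) (\<sigma> * Y)) \<le>
      C * (\<sigma> * real n) * real n powr (- 1 / 4)"
proof -
  define c where "c = l\<^sup>2 / (2 * (1 + h\<^sup>2) * (1 + 2 * h\<^sup>2))"
  define g where "g = (2 / 3) / (1 + h\<^sup>2)"
  define K where "K = 2 * exp ((R * h\<^sup>2 + R\<^sup>2 + R) + (2 * R + 1) + (1 / l\<^sup>2 + (R + 1) * (2 * h\<^sup>2)))"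
  have c: "0 < c" and g: "0 < g" using assms by (auto simp: c_def g_def intro!: divide_pos_pos mult_pos_pos add_pos_nonneg)
  \<comment> \<open>Large enough for every lower bound on \<open>n\<close> required by the pointwise
    estimate; the added 1 guarantees \<open>n \<ge> 1\<close>.\<close>
  define N where "N = nat \<lceil>max (2 * R) (max ((4 * R + 4) / c) ((2 * R + 1) / (g\<^sup>2 / 3 * g)))\<rceil> + 1"
  have N: "1 \<le> n" "2 * R \<le> real n" "4 * R + 4 \<le> real n * c" "2 * R + 1 \<le> real n * (g\<^sup>2 / 3 * g)" if "N \<le> n" for n
  proof -
    have "max (2 * R) (max ((4 * R + 4) / c) ((2 * R + 1) / (g\<^sup>2 / 3 * g))) \<le> real n"
      using that unfolding N_def by linarith
    then have 1: "2 * R \<le> real n" "(4 * R + 4) / c \<le> real n" "(2 * R + 1) / (g\<^sup>2 / 3 * g) \<le> real n" by (simp_all only: max.bounded_iff)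
    then show "2 * R \<le> real n" "4 * R + 4 \<le> real n * c" "2 * R + 1 \<le> real n * (g\<^sup>2 / 3 * g)" "1 \<le> n"
      using c g that by (simp_all only: pos_divide_le_eq mult_pos_pos zero_less_power divide_pos_pos zero_less_numeral) (simp add: N_def)
  qed
  define C where "C = K * (4 + 2 * sqrt pi)\<^sup>2 * (c / 2) powr (- 1 / 4)"
  show ?thesis
  proof (rule that[of N C])
    fix \<sigma> s t X Y v0 :: real and n :: nat
    assume \<sigma>: "0 < \<sigma>" and v0: "l \<le> v0" "v0 \<le> h" and R: "\<bar>s\<bar> \<le> R" "\<bar>t\<bar> \<le> R" "\<bar>X\<bar> \<le> R" "\<bar>Y\<bar> \<le> R"
      and zeros: "\<And>j. j < n \<Longrightarrow> (a (Suc j))\<^sup>2 \<le> (\<sigma> * real n)\<^sup>2"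
      and saddle: "(\<lambda>j. 1 / ((a (Suc j))\<^sup>2 + (\<sigma> * real n * v0)\<^sup>2)) sums (1 / (2 * (\<sigma>\<^sup>2 * real n)))" and n: "N \<le> n"
    define L where "L = \<sigma> * real n"
    have L: "0 < L" and n0: "0 < real n" using \<sigma> N(1)[OF n] by (simp_all add: L_def)
    let ?F = "contour_integrand (L * v0) (\<sigma>\<^sup>2 * (real n + s)) (\<sigma>\<^sup>2 * (real n + t)) (\<sigma> * X) (\<sigma> * Y)"
    have "ennreal (norm (integral\<^sup>L (lborel \<Otimes>\<^sub>M lborel) ?F)) \<le> (\<integral>\<^sup>+p. ennreal (norm (?F p)) \<partial>(lborel \<Otimes>\<^sub>M lborel))"
    proof (rule integral_norm_bound_ennreal, rule contour_integrand_integrable)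
      have "0 < real n + s" "0 < real n + t" using N(1,2)[OF n] R by linarith+
      then show "0 < \<sigma>\<^sup>2 * (real n + s)" "0 < \<sigma>\<^sup>2 * (real n + t)" using \<sigma> by simp_all
      show "0 < L * v0" using L v0(1) assms(1) by simp
    qed
    also have "\<dots> \<le> ennreal (K * (4 + 2 * sqrt pi)\<^sup>2 * (1 / L\<^sup>2 * (real n * c / 2 / L\<^sup>2)) powr (- 1 / 4))"
    proof (rule nn_integral_Cauchy_Gaussian[where h = "\<lambda>r. max (L * v0) (\<bar>r\<bar> / sqrt 3)" and c = "L * v0"])
      fix r v
      show "norm (?F (r, v)) \<le> K * (1 / sqrt (r\<^sup>2 + (v - max (L * v0) (\<bar>r\<bar> / sqrt 3))\<^sup>2)) * exp (- (1 / L\<^sup>2 * r\<^sup>2)) *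
          exp (- (real n * c / 2 / L\<^sup>2 * (\<bar>v\<bar> - L * v0)\<^sup>2))"
        unfolding K_def c_def L_def
        by (rule contour_integrand_scaled_bound[OF \<sigma> assms(1) v0 R zeros saddle N(1,2)[OF n] N(3,4)[OF n, unfolded c_def g_def]])
    next
      show "0 < 1 / L\<^sup>2" "0 < real n * c / 2 / L\<^sup>2" "0 \<le> K" using L n0 c by (simp_all add: K_def)
    qed measurable
    finally have "norm (integral\<^sup>L (lborel \<Otimes>\<^sub>M lborel) ?F) \<le> K * (4 + 2 * sqrt pi)\<^sup>2 * (1 / L\<^sup>2 * (real n * c / 2 / L\<^sup>2)) powr (- 1 / 4)"
      by (rule iffD1[OF ennreal_le_iff, rotated]) (simp add: K_def)
    also have "(1 / L\<^sup>2 * (real n * c / 2 / L\<^sup>2)) powr (- 1 / 4) = (c / 2) powr (- 1 / 4) * (L * real n powr (- 1 / 4))"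
    proof -
      have "1 / L\<^sup>2 * (real n * c / 2 / L\<^sup>2) = (c / 2) * (L powr (- 4) * real n)"
      proof -
        have "L powr (- 4) = 1 / (L\<^sup>2 * L\<^sup>2)" using L by (simp add: powr_minus powr_numeral divide_inverse power_add[symmetric])
        moreover have "1 / q * (real n * c / 2 / q) = (c / 2) * (1 / (q * q) * real n)" for q :: real by (simp add: mult_ac)
        ultimately show ?thesis by (simp only:)
      qed
      moreover have "(c / 2 * (L powr (- 4) * real n)) powr (- 1 / 4) = (c / 2) powr (- 1 / 4) * ((L powr (- 4)) powr (- 1 / 4) * real n powr (- 1 / 4))"
        using L n0 c by (simp only: powr_mult)
      moreover have "(L powr (- 4)) powr (- 1 / 4) = L" using L by (simp add: powr_powr)
      ultimately show ?thesis by (simp only:)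
    qed
    finally show "norm (contour_double (\<sigma> * real n * v0) (\<sigma>\<^sup>2 * (real n + s)) (\<sigma>\<^sup>2 * (real n + t)) (\<sigma> * X) (\<sigma> * Y)) \<le>
      C * (\<sigma> * real n) * real n powr (- 1 / 4)" unfolding C_def L_def[symmetric] by (simp only: mult_ac)
  qed
qed

end

section \<open>The saddle integral and its Riemann sums\<close>

lemma Gamma_reflection_real: "Gamma s * Gamma (1 - s) = pi / sin (pi * s)" for s :: real
proof -
  have "complex_of_real (Gamma s * Gamma (1 - s)) = Gamma (complex_of_real s) * Gamma (1 - complex_of_real s)"
    by (simp add: Gamma_complex_of_real[symmetric])
  also have "\<dots> = complex_of_real (pi / sin (pi * s))"
    by (simp add: Gamma_reflection_complex sin_of_real[symmetric])
  finally show ?thesis by (simp only: of_real_eq_iff)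
qed


text \<open>With \<open>u = l^q r^(q/2)\<close> and \<open>r = y / (1 - y)\<close> one has
  \<open>u^(2/q) = l^2 r\<close>, and \<open>1 + r = 1 / (1 - y)\<close>, so the integrand times the
  Jacobian is a pure product of powers of \<open>y\<close> and \<open>1 - y\<close>.\<close>

lemma saddle_substitution:
  fixes q l y :: real
  assumes q: "0 < q" and l: "0 < l" and y: "0 < y" "y < 1"
  defines "r \<equiv> y / (1 - y)"
  shows "1 / ((l powr q * r powr (q / 2)) powr (2 / q) + l\<^sup>2) * (l powr q * (q / 2) * r powr (q / 2 - 1) * (1 / (1 - y)\<^sup>2)) =
    l powr (q - 2) * (q / 2) * (y powr (q / 2 - 1) * (1 - y) powr ((1 - q / 2) - 1))"
proof -
  have r: "0 < r" using y by (simp add: r_def)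
  have pw: "(l powr q * r powr (q / 2)) powr (2 / q) = l\<^sup>2 * r"
  proof -
    have "(l powr q) powr (2 / q) = l\<^sup>2" "(r powr (q / 2)) powr (2 / q) = r"
      using l r q by (simp_all add: powr_powr powr_numeral)
    then show ?thesis using l r by (simp only: powr_mult)
  qed
  have "l\<^sup>2 * r + l\<^sup>2 = l\<^sup>2 * (1 / (1 - y))" using y by (simp add: r_def divide_simps) (simp add: algebra_simps)
  then have f: "1 / ((l powr q * r powr (q / 2)) powr (2 / q) + l\<^sup>2) = (1 - y) / l\<^sup>2" unfolding pw by simp
  have r': "r powr (q / 2 - 1) = y powr (q / 2 - 1) * (1 - y) powr (1 - q / 2)"
  proof -
    have "r powr (q / 2 - 1) = y powr (q / 2 - 1) / (1 - y) powr (q / 2 - 1)" using y by (simp only: r_def powr_divide)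
    moreover have "(1 - y) powr (1 - q / 2) = 1 / (1 - y) powr (q / 2 - 1)" using powr_minus_divide[of "1 - y" "q / 2 - 1"] by simp
    ultimately show ?thesis by simp
  qed
  have e: "(1 - y) powr ((1 - q / 2) - 1) = (1 - y) powr (1 - q / 2) / (1 - y)" using y by (subst powr_diff) simp
  have e': "l powr (q - 2) = l powr q / l\<^sup>2" using l by (simp add: powr_diff powr_numeral)
  have ne: "1 - y \<noteq> 0" using y by simp
  have alg: "p / k * (lq * h * (A * P) * (1 / p\<^sup>2)) = lq / k * h * (A * (P / p))" if "p \<noteq> 0" for p k lq h A P :: real
    using that by (simp add: power2_eq_square mult_ac)
  show ?thesis unfolding f r' e e' by (rule alg[OF ne])
qed

lemma odds_limits:
  fixes q l :: real
  assumes q: "0 < q" and l: "0 < l"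
  shows "((\<lambda>y. l powr q * (y / (1 - y)) powr (q / 2)) \<longlongrightarrow> 0) (at_right 0)"
    and "filterlim (\<lambda>y. l powr q * (y / (1 - y)) powr (q / 2)) at_top (at_left 1)"
proof -
  have "((\<lambda>y::real. y / (1 - y)) \<longlongrightarrow> 0) (at_right 0)" by real_asymp
  then have "((\<lambda>y. (y / (1 - y)) powr (q / 2)) \<longlongrightarrow> 0) (at_right 0)"
  proof (rule tendsto_zero_powrI[OF _ tendsto_const])
    show "0 < q / 2" using q by simp
    show "\<forall>\<^sub>F y in at_right 0. 0 \<le> y / (1 - y :: real)"
      by (rule eventually_at_rightI[of 0 1]) auto
  qed
  from tendsto_mult_left[OF this, of "l powr q"] show "((\<lambda>y. l powr q * (y / (1 - y)) powr (q / 2)) \<longlongrightarrow> 0) (at_right 0)" by simp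
  have "filterlim (\<lambda>y::real. y / (1 - y)) at_top (at_left 1)" by real_asymp
  moreover have "filterlim (\<lambda>x. l powr q * x powr (q / 2)) at_top at_top"
  proof (rule filterlim_tendsto_pos_mult_at_top[OF tendsto_const])
    show "0 < l powr q" using l by simp
    have "0 < q / 2" using q by simp
    then show "filterlim (\<lambda>x::real. x powr (q / 2)) at_top at_top" by real_asymp
  qed
  ultimately show "filterlim (\<lambda>y. l powr q * (y / (1 - y)) powr (q / 2)) at_top (at_left 1)" by (rule filterlim_compose[rotated])
qed

lemma odds_derivative:
  fixes q l y :: real
  assumes y: "0 < y" "y < 1"
  shows "((\<lambda>y. l powr q * (y / (1 - y)) powr (q / 2)) has_real_derivative
     l powr q * (q / 2) * (y / (1 - y)) powr (q / 2 - 1) * (1 / (1 - y)\<^sup>2)) (at y)"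
proof -
  define r where "r = y / (1 - y)"
  have r: "0 < r" using y by (simp add: r_def)
  have "((\<lambda>y. y / (1 - y)) has_real_derivative 1 / (1 - y)\<^sup>2) (at y)"
    by (rule derivative_eq_intros refl | use y in \<open>simp add: power2_eq_square\<close>)+
  from DERIV_powr[OF this _ DERIV_const, of "q / 2"] r
  have "((\<lambda>y. (y / (1 - y)) powr (q / 2)) has_real_derivative r powr (q / 2) * (0 * ln r + 1 / (1 - y)\<^sup>2 * (q / 2) / r)) (at y)"
    unfolding r_def[symmetric] by simp
  from DERIV_cmult[OF this, of "l powr q"]
  show ?thesis unfolding r_def[symmetric] using r by (simp add: powr_diff mult_ac)
qed

text \<open>The substitution \<open>u = \<lambda>\<^sup>q (y / (1 - y))\<^bsup>q/2\<^esup>\<close> turns the integrand into that of a Beta integral.\<close>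

lemma saddle_integral:
  fixes q l :: real
  assumes q: "0 < q" "q < 2" and l: "0 < l"
  shows "set_integrable lborel {0<..} (\<lambda>u. 1 / (u powr (2 / q) + l\<^sup>2))"
    and "(LBINT u:{0<..}. 1 / (u powr (2 / q) + l\<^sup>2)) = l powr (q - 2) * (q / 2) * (pi / sin (pi * (q / 2)))"
proof -
  define \<beta> where "\<beta> y = y powr (q / 2 - 1) * (1 - y) powr ((1 - q / 2) - 1)" for y :: real
  define f where "f u = 1 / (u powr (2 / q) + l\<^sup>2)" for u
  define g where "g y = l powr q * (y / (1 - y)) powr (q / 2)" for y
  define g' where "g' y = l powr q * (q / 2) * (y / (1 - y)) powr (q / 2 - 1) * (1 / (1 - y)\<^sup>2)" for y
  have B: "(\<beta> has_integral Beta (q / 2) (1 - q / 2)) {0<..<1}"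
    unfolding \<beta>_def has_integral_Icc_iff_Ioo[symmetric] by (rule has_integral_Beta_real) (use q in auto)
  have [measurable]: "\<beta> \<in> borel_measurable borel" unfolding \<beta>_def by measurable
  have "\<beta> absolutely_integrable_on {0<..<1}"
    by (rule nonnegative_absolutely_integrable_1) (use B in \<open>auto simp: \<beta>_def integrable_on_def\<close>)
  then have \<beta>_int: "set_integrable lborel {0<..<1} \<beta>"
    unfolding set_integrable_def by (subst (asm) integrable_completion) measurable
  have \<beta>_val: "(LBINT y:{0<..<1}. \<beta> y) = Beta (q / 2) (1 - q / 2)"
    using set_borel_integral_eq_integral(2)[OF \<beta>_int] B by (simp add: integral_unique)
  have fg: "f (g y) * g' y = (l powr (q - 2) * (q / 2)) * \<beta> y" if "0 < y" "y < 1" for y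
    unfolding f_def g_def g'_def \<beta>_def by (rule saddle_substitution[OF q(1) l that])
  have mono01: "einterval 0 1 = {0<..<1 :: real}" by (auto simp: einterval_def zero_ereal_def one_ereal_def)
  have lim: "((ereal \<circ> g \<circ> real_of_ereal) \<longlongrightarrow> 0) (at_right 0)"
    using odds_limits(1)[OF q(1) l] unfolding g_def[symmetric, abs_def] by (simp add: ereal_tendsto_simps zero_ereal_def)
  have lim': "((ereal \<circ> g \<circ> real_of_ereal) \<longlongrightarrow> \<infinity>) (at_left 1)"
    using odds_limits(2)[OF q(1) l] unfolding g_def[symmetric, abs_def] by (simp add: ereal_tendsto_simps one_ereal_def)
  have int_fg: "set_integrable lborel (einterval 0 1) (\<lambda>y. f (g y) * g' y)"
  proof -
    have "set_integrable lborel {0<..<1} (\<lambda>y. (l powr (q - 2) * (q / 2)) * \<beta> y)" using \<beta>_int by simp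
    then show ?thesis unfolding mono01 by (rule set_integrable_cong[THEN iffD1, rotated -1]) (simp_all add: fg)
  qed
  have y01: "0 < y" "y < 1" if "0 < ereal y" "ereal y < 1" for y
    using that by (simp_all add: zero_ereal_def one_ereal_def)
  have deriv: "DERIV g y :> g' y" if "0 < ereal y" "ereal y < 1" for y
    unfolding g_def g'_def by (rule odds_derivative[OF y01[OF that]])
  have contf: "isCont f (g y)" if "0 < ereal y" "ereal y < 1" for y
  proof -
    have "0 < g y" using y01[OF that] l by (simp add: g_def)
    moreover have "isCont f u" if "0 < u" for u
      unfolding f_def using that l by (intro continuous_intros) (auto simp: add_nonneg_eq_0_iff)
    ultimately show ?thesis by blast
  qed
  have contg': "isCont g' y" if "0 < ereal y" "ereal y < 1" for y
    unfolding g'_def using y01[OF that] by (intro continuous_intros) auto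
  have nonneg: "0 \<le> f (g y)" "0 \<le> g' y" for y using q by (auto simp: f_def g'_def)
  have z1: "(0 :: ereal) < 1" by simp
  note sub = interval_integral_substitution_nonneg[where f = f and g = g and g' = g' and a = 0 and b = 1 and A = 0 and B = \<infinity>,
      OF z1 deriv contf contg' nonneg lim lim' int_fg]
  have set: "einterval 0 \<infinity> = {0<..}" by (auto simp: einterval_def zero_ereal_def)
  show "set_integrable lborel {0<..} (\<lambda>u. 1 / (u powr (2 / q) + l\<^sup>2))" using sub(1) unfolding set f_def .
  have "(LBINT u:{0<..}. f u) = (LBINT y:{0<..<1}. f (g y) * g' y)"
    using sub(2) by (simp add: interval_lebesgue_integral_def set mono01)
  also have "\<dots> = (LBINT y:{0<..<1}. (l powr (q - 2) * (q / 2)) * \<beta> y)"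
    by (rule set_lebesgue_integral_cong) (simp_all add: fg)
  also have "\<dots> = l powr (q - 2) * (q / 2) * Beta (q / 2) (1 - q / 2)" by (simp add: \<beta>_val)
  also have "Beta (q / 2) (1 - q / 2) = pi / sin (pi * (q / 2))"
    using Gamma_reflection_real[of "q / 2"] by (simp add: Beta_def)
  finally show "(LBINT u:{0<..}. 1 / (u powr (2 / q) + l\<^sup>2)) = l powr (q - 2) * (q / 2) * (pi / sin (pi * (q / 2)))"
    unfolding f_def .
qed

text \<open>The function of \<open>u\<close> is constant on the cells from \<open>j / n\<close> to
  \<open>(j + 1) / n\<close>, so the normalised series is exactly an integral. This makes dominated
  convergence available for Riemann sums over an infinite range.\<close>

lemma step_function_integral:
  fixes G :: "nat \<Rightarrow> real"
  assumes n: "0 < n" and G: "\<And>j. 0 \<le> G j" "summable (\<lambda>j. G (Suc j))"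
  shows "(LBINT u:{0<..}. G (nat \<lceil>n * u\<rceil>)) = (\<Sum>j. G (Suc j)) / n"
proof -
  have cell: "nat \<lceil>n * u\<rceil> = Suc j \<longleftrightarrow> u \<in> {real j / n<..(real j + 1) / n}" for u j
  proof -
    have "nat \<lceil>n * u\<rceil> = Suc j \<longleftrightarrow> \<lceil>n * u\<rceil> = int j + 1" by linarith
    also have "\<dots> \<longleftrightarrow> real j < n * u \<and> n * u \<le> real j + 1" by (simp add: ceiling_eq_iff)
    finally show ?thesis using n by (simp add: divide_less_eq le_divide_eq mult.commute)
  qed
  have "ennreal (indicator {0<..} u *\<^sub>R G (nat \<lceil>n * u\<rceil>)) = (\<Sum>j. ennreal (G (Suc j)) * indicator {real j / n<..(real j + 1) / n} u)" for u
  proof (cases "0 < u")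
    case True
    then have "0 < nat \<lceil>n * u\<rceil>" using n by simp
    then obtain i where i: "nat \<lceil>n * u\<rceil> = Suc i" by (cases "nat \<lceil>n * u\<rceil>") auto
    have "(\<Sum>j. ennreal (G (Suc j)) * indicator {real j / n<..(real j + 1) / n} u) =
        (\<Sum>j\<in>{i}. ennreal (G (Suc j)) * indicator {real j / n<..(real j + 1) / n} u)"
    proof (rule suminf_finite)
      fix j assume "j \<notin> {i}"
      then have "u \<notin> {real j / n<..(real j + 1) / n}" unfolding cell[symmetric] i by simp
      then show "ennreal (G (Suc j)) * indicator {real j / n<..(real j + 1) / n} u = 0" by simp
    qed simp
    also have "\<dots> = ennreal (G (Suc i))" using i cell[of u i] by (simp only: sum.insert sum.empty finite.emptyI empty_iff simp_thms) simp
    finally show ?thesis using True i by simp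
  next
    case False
    have "u \<notin> {real j / n<..(real j + 1) / n}" for j
      using False n by (auto simp: not_less intro: order_trans[of _ 0])
    then show ?thesis using False by simp
  qed
  then have "(\<integral>\<^sup>+u. ennreal (indicator {0<..} u *\<^sub>R G (nat \<lceil>n * u\<rceil>)) \<partial>lborel) =
      (\<Sum>j. \<integral>\<^sup>+u. ennreal (G (Suc j)) * indicator {real j / n<..(real j + 1) / n} u \<partial>lborel)"
    by (simp add: nn_integral_suminf)
  also have "\<dots> = (\<Sum>j. ennreal (G (Suc j) / n))"
  proof (rule suminf_cong)
    fix j
    have "real j / n \<le> (real j + 1) / n" using n by (simp add: divide_right_mono)
    then have "(\<integral>\<^sup>+u. ennreal (G (Suc j)) * indicator {real j / n<..(real j + 1) / n} u \<partial>lborel) = ennreal (G (Suc j)) * ennreal ((real j + 1) / n - real j / n)"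
      by (subst nn_integral_cmult_indicator) auto
    also have "(real j + 1) / n - real j / n = 1 / n" by (simp add: diff_divide_distrib[symmetric])
    finally show "(\<integral>\<^sup>+u. ennreal (G (Suc j)) * indicator {real j / n<..(real j + 1) / n} u \<partial>lborel) = ennreal (G (Suc j) / n)"
      using G(1) n by (simp add: ennreal_mult[symmetric])
  qed
  also have "\<dots> = ennreal (\<Sum>j. G (Suc j) / n)"
    by (rule suminf_ennreal2) (use G n in \<open>auto intro: summable_divide\<close>)
  also have "(\<Sum>j. G (Suc j) / n) = (\<Sum>j. G (Suc j)) / n" by (rule suminf_divide[OF G(2)])
  finally have nn: "(\<integral>\<^sup>+u. ennreal (indicator {0<..} u *\<^sub>R G (nat \<lceil>n * u\<rceil>)) \<partial>lborel) = ennreal ((\<Sum>j. G (Suc j)) / n)" .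
  have pos: "0 \<le> (\<Sum>j. G (Suc j)) / n" using G n by (simp add: suminf_nonneg)
  show ?thesis unfolding set_lebesgue_integral_def
    by (subst integral_eq_nn_integral) (use G pos nn in \<open>auto simp: nn\<close>)
qed

text \<open>Dominated convergence for the step functions: regular growth of the zeros gives the
  pointwise limit, and the lower bound on all zeros gives a majorant of the same shape as the
  limit.\<close>

lemma Riemann_sum_limit:
  fixes a :: "nat \<Rightarrow> real" and n L :: "real \<Rightarrow> real" and q l \<kappa> :: real
  assumes q: "0 < q" "q < 2" and l: "0 < l" and \<kappa>: "0 < \<kappa>"
    and a: "\<And>j. 0 < a (Suc j)" "summable (\<lambda>j. 1 / (a (Suc j))\<^sup>2)"
    and pos: "\<forall>\<^sub>F T in at_top. 0 < n T \<and> 0 < L T"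
    and lim: "\<And>u. 0 < u \<Longrightarrow> ((\<lambda>T. a (nat \<lceil>n T * u\<rceil>) / L T) \<longlongrightarrow> u powr (1 / q)) at_top"
    and low: "\<forall>\<^sub>F T in at_top. \<forall>j\<ge>1. \<kappa> * (real j / n T) powr (1 / q) \<le> a j / L T"
  shows "((\<lambda>T. (\<Sum>j. 1 / ((a (Suc j) / L T)\<^sup>2 + l\<^sup>2)) / n T) \<longlongrightarrow>
     l powr (q - 2) * (q / 2) * (pi / sin (pi * (q / 2)))) at_top"
proof -
  define G where "G T j = 1 / ((a j / L T)\<^sup>2 + l\<^sup>2)" for T and j :: nat
  define f where "f u = 1 / (u powr (2 / q) + l\<^sup>2)" for u
  \<comment> \<open>The majorant is a multiple of the limit function with
    \<open>l / \<kappa>\<close> in place of \<open>l\<close>, so \<open>saddle_integral\<close>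
    already gives its integrability.\<close>
  define w where "w u = 1 / \<kappa>\<^sup>2 * (1 / (u powr (2 / q) + (l / \<kappa>)\<^sup>2))" for u
  have sq: "(u powr (1 / q))\<^sup>2 = u powr (2 / q)" for u
    by (simp add: power2_eq_square powr_add[symmetric] add_divide_distrib[symmetric])
  have G0: "0 \<le> G T j" for T j by (simp add: G_def)
  have sum: "summable (\<lambda>j. G T (Suc j))" if "0 < L T" for T
  proof (rule summable_comparison_test')
    show "summable (\<lambda>j. (L T)\<^sup>2 * (1 / (a (Suc j))\<^sup>2))" by (rule summable_mult[OF a(2)])
    fix j show "norm (G T (Suc j)) \<le> (L T)\<^sup>2 * (1 / (a (Suc j))\<^sup>2)"
    proof -
      have p: "0 < (a (Suc j) / L T)\<^sup>2" using a(1)[of j] that by simp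
      have "G T (Suc j) \<le> 1 / (a (Suc j) / L T)\<^sup>2"
        unfolding G_def by (rule divide_left_mono) (use p l in \<open>auto intro!: mult_pos_pos add_pos_nonneg\<close>)
      then show ?thesis using G0[of T "Suc j"] by (simp add: power_divide)
    qed
  qed
  have "((\<lambda>T. \<integral>u. indicator {0<..} u *\<^sub>R G T (nat \<lceil>n T * u\<rceil>) \<partial>lborel) \<longlongrightarrow> (\<integral>u. indicator {0<..} u *\<^sub>R f u \<partial>lborel)) at_top"
  proof (rule integral_dominated_convergence_at_top[where w = "\<lambda>u. indicator {0<..} u *\<^sub>R w u"])
    show "(\<lambda>u. indicator {0<..} u *\<^sub>R f u) \<in> borel_measurable lborel" unfolding f_def by measurable
    have "(\<lambda>u. G T (nat \<lceil>n T * u\<rceil>)) \<in> borel_measurable lborel" for T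
      by (rule measurable_compose[where N = "count_space UNIV" and g = "G T"]) measurable
    then show "(\<lambda>u. indicator {0<..} u *\<^sub>R G T (nat \<lceil>n T * u\<rceil>)) \<in> borel_measurable lborel" for T by measurable
    have "0 < l / \<kappa>" using l \<kappa> by simp
    from set_integrable_mult_right[OF saddle_integral(1)[OF q this], of "1 / \<kappa>\<^sup>2"]
    show "integrable lborel (\<lambda>u. indicator {0<..} u *\<^sub>R w u)" unfolding w_def set_integrable_def by blast
    show "AE u in lborel. ((\<lambda>T. indicator {0<..} u *\<^sub>R G T (nat \<lceil>n T * u\<rceil>)) \<longlongrightarrow> indicator {0<..} u *\<^sub>R f u) at_top"
    proof (rule AE_I2)
      fix u :: real
      show "((\<lambda>T. indicator {0<..} u *\<^sub>R G T (nat \<lceil>n T * u\<rceil>)) \<longlongrightarrow> indicator {0<..} u *\<^sub>R f u) at_top"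
      proof (cases "0 < u")
        case True
        have "((\<lambda>T. 1 / ((a (nat \<lceil>n T * u\<rceil>) / L T)\<^sup>2 + l\<^sup>2)) \<longlongrightarrow> 1 / ((u powr (1 / q))\<^sup>2 + l\<^sup>2)) at_top"
          by (intro tendsto_intros lim[OF True]) (use l in \<open>simp add: add_nonneg_eq_0_iff\<close>)
        then have "((\<lambda>T. G T (nat \<lceil>n T * u\<rceil>)) \<longlongrightarrow> f u) at_top" unfolding G_def f_def sq .
        then show ?thesis using True by simp
      qed simp
    qed
    show "\<forall>\<^sub>F T in at_top. AE u in lborel. norm (indicator {0<..} u *\<^sub>R G T (nat \<lceil>n T * u\<rceil>)) \<le> indicator {0<..} u *\<^sub>R w u"
      using pos low
    proof eventually_elim
      case (elim T)
      show ?case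
      proof (rule AE_I2)
        fix u :: real
        show "norm (indicator {0<..} u *\<^sub>R G T (nat \<lceil>n T * u\<rceil>)) \<le> indicator {0<..} u *\<^sub>R w u"
        proof (cases "0 < u")
          case True
          define j where "j = nat \<lceil>n T * u\<rceil>"
          have nu: "0 < n T * u" using elim(1) True by simp
          then have j: "1 \<le> j" "n T * u \<le> real j" unfolding j_def by linarith+
          have "u \<le> real j / n T" using j(2) elim(1) by (simp add: le_divide_eq mult.commute)
          then have "\<kappa> * u powr (1 / q) \<le> \<kappa> * (real j / n T) powr (1 / q)"
            using \<kappa> True q by (intro mult_left_mono powr_mono2) auto
          also have "\<dots> \<le> a j / L T" using elim(2) j(1) by blast
          finally have "(\<kappa> * u powr (1 / q))\<^sup>2 \<le> (a j / L T)\<^sup>2" using \<kappa> by (intro power_mono) auto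
          then have b: "\<kappa>\<^sup>2 * u powr (2 / q) \<le> (a j / L T)\<^sup>2" by (simp only: power_mult_distrib sq)
          have p: "0 < \<kappa>\<^sup>2 * u powr (2 / q) + l\<^sup>2" using l by (simp add: add_nonneg_pos)
          have "G T j \<le> 1 / (\<kappa>\<^sup>2 * u powr (2 / q) + l\<^sup>2)"
            unfolding G_def by (rule divide_left_mono) (use b p in \<open>auto intro!: mult_pos_pos\<close>)
          also have "\<kappa>\<^sup>2 * u powr (2 / q) + l\<^sup>2 = \<kappa>\<^sup>2 * (u powr (2 / q) + (l / \<kappa>)\<^sup>2)" using \<kappa> by (simp add: power_divide distrib_left)
          finally have "G T j \<le> w u" by (simp add: w_def)
          then show ?thesis using True G0[of T j] by (simp add: j_def)
        qed simp
      qed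
    qed
  qed
  moreover have "(\<integral>u. indicator {0<..} u *\<^sub>R f u \<partial>lborel) = l powr (q - 2) * (q / 2) * (pi / sin (pi * (q / 2)))"
    using saddle_integral(2)[OF q l] unfolding set_lebesgue_integral_def f_def .
  moreover have "\<forall>\<^sub>F T in at_top. (\<integral>u. indicator {0<..} u *\<^sub>R G T (nat \<lceil>n T * u\<rceil>) \<partial>lborel) = (\<Sum>j. G T (Suc j)) / n T"
    using pos
  proof eventually_elim
    case (elim T)
    then show ?case using step_function_integral[of "n T" "G T"] G0 sum[of T] unfolding set_lebesgue_integral_def by blast
  qed
  ultimately have "((\<lambda>T. (\<Sum>j. G T (Suc j)) / n T) \<longlongrightarrow> l powr (q - 2) * (q / 2) * (pi / sin (pi * (q / 2)))) at_top"
    using Lim_transform_eventually by fastforce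
  then show ?thesis unfolding G_def .
qed

lemma shifted_sum_continuous:
  fixes b :: "nat \<Rightarrow> real"
  assumes b: "\<And>j. 0 < b j" "summable (\<lambda>j. 1 / b j)"
  shows "continuous_on A (\<lambda>l. \<Sum>j. 1 / (b j + l\<^sup>2))"
proof (rule uniform_limit_theorem)
  show "uniform_limit A (\<lambda>m l. \<Sum>j<m. 1 / (b j + l\<^sup>2)) (\<lambda>l. \<Sum>j. 1 / (b j + l\<^sup>2)) sequentially"
  proof (rule Weierstrass_m_test[OF _ b(2)])
    fix j l have "1 / (b j + l\<^sup>2) \<le> 1 / b j" using b(1)[of j] by (intro divide_left_mono) (auto intro!: mult_pos_pos add_pos_nonneg)
    then show "norm (1 / (b j + l\<^sup>2)) \<le> 1 / b j" using b(1)[of j] by simp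
  qed
  have "b j + l\<^sup>2 \<noteq> 0" for j l using b(1)[of j] by (simp add: add_pos_nonneg less_imp_neq[symmetric])
  then show "\<forall>\<^sub>F m in sequentially. continuous_on A (\<lambda>l. \<Sum>j<m. 1 / (b j + l\<^sup>2))"
    by (intro always_eventually allI continuous_intros) auto
qed simp

section \<open>Scales of regularly growing zeros, and the saddle point\<close>

locale power_growth =
  fixes a :: "nat \<Rightarrow> real" and c q :: real
  assumes first_pos: "0 < a 1" and increasing: "\<And>j. 1 \<le> j \<Longrightarrow> a j < a (Suc j)"
    and c: "0 < c" and q: "0 < q" "q < 2"
    and growth: "a \<sim>[sequentially] (\<lambda>j. (real j / c) powr (1 / q))"
begin

lemma zeros_mono:
  assumes "1 \<le> i" "i \<le> j"
  shows "a i \<le> a j"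
  using assms(2)
proof (induction rule: dec_induct)
  case (step k)
  then show ?case using increasing[of k] assms(1) by simp
qed simp

lemma zeros_pos: "1 \<le> j \<Longrightarrow> 0 < a j"
  using zeros_mono[of 1 j] first_pos by simp

lemma growth_ratio: "(\<lambda>j. a j / (real j / c) powr (1 / q)) \<longlonglongrightarrow> 1"
proof (rule Lim_transform_eventually[OF asymp_equivD[OF growth]])
  show "\<forall>\<^sub>F j in sequentially. (if a j = 0 \<and> (real j / c) powr (1 / q) = 0 then 1 else a j / (real j / c) powr (1 / q)) =
      a j / (real j / c) powr (1 / q)"
    using eventually_gt_at_top[of 0]
  proof eventually_elim
    case (elim j)
    then show ?case using zeros_pos[of j] by simp
  qed
qed

text \<open>The inverse of a sequence tending to 1 is bounded, and all zeros of index at least 1 are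
  positive; this turns the asymptotics into a bound valid for every index.\<close>

lemma growth_lower_bound:
  obtains B where "0 < B" "\<And>j. 1 \<le> j \<Longrightarrow> real j powr (1 / q) \<le> B * a j"
proof -
  have "(\<lambda>j. inverse (a j / (real j / c) powr (1 / q))) \<longlonglongrightarrow> inverse 1"
    by (rule tendsto_inverse[OF growth_ratio]) simp
  then have "Bseq (\<lambda>j. inverse (a j / (real j / c) powr (1 / q)))"
    by (rule convergent_imp_Bseq[OF convergentI])
  then obtain K where K: "0 < K" "\<And>j. norm (inverse (a j / (real j / c) powr (1 / q))) \<le> K" unfolding Bseq_def by blast
  have "real j powr (1 / q) \<le> (K * c powr (1 / q)) * a j" if "1 \<le> j" for j
  proof -
    have "(real j / c) powr (1 / q) / a j \<le> K" using K(2)[of j] zeros_pos[OF that] by simp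
    then have "(real j / c) powr (1 / q) \<le> K * a j" using zeros_pos[OF that] by (simp add: divide_le_eq)
    moreover have "(real j / c) powr (1 / q) = real j powr (1 / q) / c powr (1 / q)" using c by (simp add: powr_divide)
    ultimately have "real j powr (1 / q) / c powr (1 / q) \<le> K * a j" by (simp only:)
    moreover have "0 < c powr (1 / q)" using c by simp
    ultimately show ?thesis by (simp only: pos_divide_le_eq mult_ac)
  qed
  then show ?thesis using K(1) c by (intro that[of "K * c powr (1 / q)"]) auto
qed

lemma summable_inverse_square_zeros: "summable (\<lambda>j. 1 / (a (Suc j))\<^sup>2)"
proof -
  obtain B where B: "0 < B" "\<And>j. 1 \<le> j \<Longrightarrow> real j powr (1 / q) \<le> B * a j" using growth_lower_bound by blast
  have "summable (\<lambda>j. real j powr (- (2 / q)))" using q by (subst summable_real_powr_iff) simp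
  then have "summable (\<lambda>j. real (Suc j) powr (- (2 / q)))" by (subst summable_Suc_iff)
  then have s: "summable (\<lambda>j. B\<^sup>2 * real (Suc j) powr (- (2 / q)))" by (rule summable_mult)
  show ?thesis
  proof (rule summable_comparison_test'[OF s])
    fix j
    have p: "0 < real (Suc j) powr (1 / q)" by simp
    have "(real (Suc j) powr (1 / q))\<^sup>2 \<le> (B * a (Suc j))\<^sup>2" using B(2)[of "Suc j"] by (intro power_mono) auto
    moreover have "(real (Suc j) powr (1 / q))\<^sup>2 = real (Suc j) powr (2 / q)"
      by (simp add: power2_eq_square powr_add[symmetric] add_divide_distrib[symmetric])
    ultimately have le: "real (Suc j) powr (2 / q) \<le> B\<^sup>2 * (a (Suc j))\<^sup>2" by (simp add: power_mult_distrib)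
    have "1 / (a (Suc j))\<^sup>2 \<le> B\<^sup>2 / real (Suc j) powr (2 / q)"
      using le zeros_pos[of "Suc j"] by (simp add: divide_le_eq le_divide_eq)
    then show "norm (1 / (a (Suc j))\<^sup>2) \<le> B\<^sup>2 * real (Suc j) powr (- (2 / q))" by (simp add: powr_minus divide_inverse)
  qed
qed

text \<open>Since \<open>q < 2\<close>, the squares of the zeros grow like a power greater than 1 of
  the index, so they exceed any linear function eventually.\<close>

lemma finite_scale_set: "finite {n. 1 \<le> n \<and> (a n)\<^sup>2 \<le> T * real n}"
proof -
  obtain B where B: "0 < B" "\<And>j. 1 \<le> j \<Longrightarrow> real j powr (1 / q) \<le> B * a j" using growth_lower_bound by blast
  have "filterlim (\<lambda>x::real. x powr p) at_top at_top" if "0 < p" for p :: real using that by real_asymp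
  note powr_at_top = this
  have "0 < 2 / q - 1" using q by simp
  from powr_at_top[OF this]
  have "filterlim (\<lambda>n. real n powr (2 / q - 1)) at_top sequentially" by (rule filterlim_compose) (rule filterlim_real_sequentially)
  then have "\<forall>\<^sub>F n in sequentially. B\<^sup>2 * T < real n powr (2 / q - 1)" by (simp add: filterlim_at_top_dense)
  then obtain N where N: "\<And>n. N \<le> n \<Longrightarrow> B\<^sup>2 * T < real n powr (2 / q - 1)" by (auto simp: eventually_sequentially)
  have "n \<le> N" if n: "1 \<le> n" "(a n)\<^sup>2 \<le> T * real n" for n
  proof (rule ccontr)
    assume "\<not> n \<le> N"
    have "(real n powr (1 / q))\<^sup>2 \<le> (B * a n)\<^sup>2" using B(2)[OF n(1)] by (intro power_mono) auto
    moreover have "(real n powr (1 / q))\<^sup>2 = real n powr (2 / q - 1) * real n"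
    proof -
      have "(real n powr (1 / q))\<^sup>2 = real n powr (1 / q + 1 / q)" unfolding power2_eq_square powr_add ..
      also have "1 / q + 1 / q = (2 / q - 1) + 1" by simp
      also have "real n powr ((2 / q - 1) + 1) = real n powr (2 / q - 1) * real n" unfolding powr_add by simp
      finally show ?thesis .
    qed
    moreover have "(B * a n)\<^sup>2 \<le> B\<^sup>2 * T * real n" using mult_left_mono[OF n(2), of "B\<^sup>2"] by (simp add: power_mult_distrib mult.assoc)
    ultimately have "real n powr (2 / q - 1) * real n \<le> B\<^sup>2 * T * real n" by linarith
    moreover have "0 < real n" using n(1) by simp
    ultimately have "real n powr (2 / q - 1) \<le> B\<^sup>2 * T" by (rule mult_right_le_imp_le)
    then show False using N[of n] \<open>\<not> n \<le> N\<close> by simp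
  qed
  then have "{n. 1 \<le> n \<and> (a n)\<^sup>2 \<le> T * real n} \<subseteq> {..N}" by blast
  then show ?thesis by (rule finite_subset) simp
qed

end

context power_growth
begin

lemma scale_index_ge: "1 \<le> N \<Longrightarrow> (a N)\<^sup>2 \<le> T * real N \<Longrightarrow> N \<le> scale_index a T"
  unfolding scale_index_def by (rule Max_ge[OF finite_scale_set]) auto

lemma scale_index_bounds:
  assumes "(a 1)\<^sup>2 \<le> T"
  shows "1 \<le> scale_index a T" and "(a (scale_index a T))\<^sup>2 \<le> T * real (scale_index a T)"
    and "T * real (Suc (scale_index a T)) < (a (Suc (scale_index a T)))\<^sup>2"
proof -
  let ?A = "{n. 1 \<le> n \<and> (a n)\<^sup>2 \<le> T * real n}"
  have "1 \<in> ?A" using assms by simp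
  then have "?A \<noteq> {}" by blast
  from Max_in[OF finite_scale_set this] show 1: "1 \<le> scale_index a T" "(a (scale_index a T))\<^sup>2 \<le> T * real (scale_index a T)"
    unfolding scale_index_def by auto
  show "T * real (Suc (scale_index a T)) < (a (Suc (scale_index a T)))\<^sup>2"
    using scale_index_ge[of "Suc (scale_index a T)" T] by (cases "(a (Suc (scale_index a T)))\<^sup>2 \<le> T * real (Suc (scale_index a T))") auto
qed

lemma filterlim_scale_index: "filterlim (scale_index a) at_top at_top"
  unfolding filterlim_at_top
proof
  fix N :: nat
  show "\<forall>\<^sub>F T in at_top. N \<le> scale_index a T"
    using eventually_ge_at_top[of "(a (max 1 N))\<^sup>2 / real (max 1 N)"]
  proof eventually_elim
    case (elim T)
    have m: "0 < real (max 1 N)" by simp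
    have "(a (max 1 N))\<^sup>2 \<le> T * real (max 1 N)" using elim unfolding pos_divide_le_eq[OF m] .
    then have "max 1 N \<le> scale_index a T" by (intro scale_index_ge) auto
    then show ?case by simp
  qed
qed

text \<open>The length \<open>L\<close>, equal to \<open>sqrt (T n)\<close> for large
  \<open>T\<close>. By maximality of \<open>n\<close> it lies between the consecutive zeros
  \<open>a n\<close> and \<open>a (n + 1)\<close>, and it is the unit in which the height of the
  saddle converges.\<close>

definition edge_scale :: "real \<Rightarrow> real" where
  "edge_scale T = space_scale a T * real (scale_index a T)"

lemma scale_facts:
  assumes "(a 1)\<^sup>2 \<le> T"
  shows "0 < space_scale a T" and "(space_scale a T)\<^sup>2 * real (scale_index a T) = T"
    and "(edge_scale T)\<^sup>2 = T * real (scale_index a T)" and "0 < edge_scale T"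
    and "a (scale_index a T) \<le> edge_scale T" and "edge_scale T < a (Suc (scale_index a T))"
proof -
  let ?n = "scale_index a T"
  have T: "0 < T" using assms zero_less_power[OF first_pos, of 2] by linarith
  have n: "0 < real ?n" using scale_index_bounds(1)[OF assms] by simp
  show \<sigma>: "0 < space_scale a T" using T n by (simp add: space_scale_def)
  show s: "(space_scale a T)\<^sup>2 * real ?n = T" using T n by (simp add: space_scale_def)
  show L2: "(edge_scale T)\<^sup>2 = T * real ?n"
  proof -
    have "(edge_scale T)\<^sup>2 = ((space_scale a T)\<^sup>2 * real ?n) * real ?n" unfolding edge_scale_def power2_eq_square by (simp only: mult_ac)
    then show ?thesis unfolding s .
  qed
  show L: "0 < edge_scale T" using \<sigma> n by (simp add: edge_scale_def)
  show "a ?n \<le> edge_scale T"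
    by (rule power2_le_imp_le) (use scale_index_bounds(2)[OF assms] L2 L in simp_all)
  have "(edge_scale T)\<^sup>2 < (a (Suc ?n))\<^sup>2" using scale_index_bounds(3)[OF assms] T unfolding L2 by (simp add: algebra_simps)
  then show "edge_scale T < a (Suc ?n)" by (rule power2_less_imp_less) (use zeros_pos[of "Suc ?n"] in simp)
qed

lemma eventually_scale: "\<forall>\<^sub>F T in at_top. (a 1)\<^sup>2 \<le> T"
  by (rule eventually_ge_at_top)

end

context power_growth
begin

text \<open>\<open>L\<close> is squeezed between two consecutive zeros, which are asymptotic to each
  other and to the power law.\<close>

lemma edge_scale_growth: "((\<lambda>T. edge_scale T / (real (scale_index a T) / c) powr (1 / q)) \<longlongrightarrow> 1) at_top"
proof (rule tendsto_sandwich)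
  let ?r = "\<lambda>j. a j / (real j / c) powr (1 / q)"
  show "((\<lambda>T. ?r (scale_index a T)) \<longlongrightarrow> 1) at_top"
    by (rule filterlim_compose[OF growth_ratio filterlim_scale_index])
  have "(\<lambda>n. ?r (Suc n)) \<longlonglongrightarrow> 1" by (rule LIMSEQ_Suc[OF growth_ratio])
  moreover have "(\<lambda>n. (real (Suc n) / real n) powr (1 / q)) \<longlonglongrightarrow> 1 powr (1 / q)"
    by (intro tendsto_powr tendsto_const LIMSEQ_Suc_n_over_n) auto
  ultimately have "(\<lambda>n. ?r (Suc n) * (real (Suc n) / real n) powr (1 / q)) \<longlonglongrightarrow> 1 * 1 powr (1 / q)" by (rule tendsto_mult)
  then have "(\<lambda>n. ?r (Suc n) * (real (Suc n) / real n) powr (1 / q)) \<longlonglongrightarrow> 1" by simp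
  then show "((\<lambda>T. ?r (Suc (scale_index a T)) * (real (Suc (scale_index a T)) / real (scale_index a T)) powr (1 / q)) \<longlongrightarrow> 1) at_top"
    by (rule filterlim_compose[OF _ filterlim_scale_index])
  show "\<forall>\<^sub>F T in at_top. ?r (scale_index a T) \<le> edge_scale T / (real (scale_index a T) / c) powr (1 / q)"
    using eventually_scale
  proof eventually_elim
    case (elim T)
    then show ?case by (intro divide_right_mono scale_facts) auto
  qed
  show "\<forall>\<^sub>F T in at_top. edge_scale T / (real (scale_index a T) / c) powr (1 / q) \<le>
      ?r (Suc (scale_index a T)) * (real (Suc (scale_index a T)) / real (scale_index a T)) powr (1 / q)"
    using eventually_scale
  proof eventually_elim
    case (elim T)
    define n where "n = scale_index a T"
    have n: "0 < real n" using scale_index_bounds(1)[OF elim] by (simp add: n_def)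
    have "edge_scale T / (real n / c) powr (1 / q) \<le> a (Suc n) / (real n / c) powr (1 / q)"
      using scale_facts(6)[OF elim] by (intro divide_right_mono) (auto simp: n_def)
    also have "\<dots> = a (Suc n) / (real (Suc n) / c) powr (1 / q) * (real (Suc n) / real n) powr (1 / q)"
    proof -
      have "(real (Suc n) / c) powr (1 / q) = real (Suc n) powr (1 / q) / c powr (1 / q)"
        "(real (Suc n) / real n) powr (1 / q) = real (Suc n) powr (1 / q) / real n powr (1 / q)"
        "(real n / c) powr (1 / q) = real n powr (1 / q) / c powr (1 / q)"
        using n c by (simp_all only: powr_divide of_nat_0_le_iff less_imp_le)
      note pw = this
      have cancel: "x / (N / C) = x / (M / C) * (M / N)" if "M \<noteq> 0" for x N C M :: real using that by simp
      show ?thesis unfolding pw by (rule cancel) simp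
    qed
    finally show ?case unfolding n_def .
  qed
qed

text \<open>Numerator and denominator follow the same power law, at indices whose quotient tends to
  \<open>u\<close>.\<close>

lemma scaled_zeros_limit:
  assumes u: "0 < u"
  shows "((\<lambda>T. a (nat \<lceil>real (scale_index a T) * u\<rceil>) / edge_scale T) \<longlongrightarrow> u powr (1 / q)) at_top"
proof -
  define m where "m n = nat \<lceil>real n * u\<rceil>" for n :: nat
  have m: "real n * u \<le> real (m n)" "real (m n) \<le> real n * u + 1" for n
  proof -
    have "0 \<le> real n * u" using u by simp
    then show "real n * u \<le> real (m n)" "real (m n) \<le> real n * u + 1" unfolding m_def by linarith+
  qed
  have "(\<lambda>n. real (m n) / real n) \<longlonglongrightarrow> u"
  proof (rule tendsto_sandwich)
    show "(\<lambda>n. u) \<longlonglongrightarrow> u" by simp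
    have "(\<lambda>n. u + 1 / real n) \<longlonglongrightarrow> u + 0" by (intro tendsto_intros lim_1_over_n)
    then show "(\<lambda>n. u + 1 / real n) \<longlonglongrightarrow> u" by simp
    show "\<forall>\<^sub>F n in sequentially. u \<le> real (m n) / real n" "\<forall>\<^sub>F n in sequentially. real (m n) / real n \<le> u + 1 / real n"
      using eventually_gt_at_top[of 0] by (eventually_elim, use m in \<open>simp add: field_simps\<close>)+
  qed
  then have ratio: "(\<lambda>n. (real (m n) / real n) powr (1 / q)) \<longlonglongrightarrow> u powr (1 / q)"
    by (intro tendsto_powr tendsto_const) (use u in auto)
  have "filterlim (\<lambda>n. real n * u) at_top sequentially"
    by (rule filterlim_at_top_mult_tendsto_pos[OF tendsto_const u filterlim_real_sequentially])
  then have "filterlim (\<lambda>n. real (m n)) at_top sequentially" by (rule filterlim_at_top_mono) (use m in simp)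
  then have "filterlim m at_top sequentially" by (simp add: filterlim_sequentially_iff_filterlim_real)
  then have "(\<lambda>n. a (m n) / (real (m n) / c) powr (1 / q)) \<longlonglongrightarrow> 1" by (rule filterlim_compose[OF growth_ratio])
  from tendsto_mult[OF this ratio]
  have "(\<lambda>n. a (m n) / (real (m n) / c) powr (1 / q) * (real (m n) / real n) powr (1 / q)) \<longlonglongrightarrow> u powr (1 / q)" by simp
  from tendsto_mult[OF filterlim_compose[OF this filterlim_scale_index] tendsto_inverse[OF edge_scale_growth]]
  have lim: "((\<lambda>T. a (m (scale_index a T)) / (real (m (scale_index a T)) / c) powr (1 / q) * (real (m (scale_index a T)) / real (scale_index a T)) powr (1 / q) *
     inverse (edge_scale T / (real (scale_index a T) / c) powr (1 / q))) \<longlongrightarrow> u powr (1 / q)) at_top" by simp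
  show ?thesis
  proof (rule Lim_transform_eventually[OF lim])
    show "\<forall>\<^sub>F T in at_top. a (m (scale_index a T)) / (real (m (scale_index a T)) / c) powr (1 / q) * (real (m (scale_index a T)) / real (scale_index a T)) powr (1 / q) *
     inverse (edge_scale T / (real (scale_index a T) / c) powr (1 / q)) = a (nat \<lceil>real (scale_index a T) * u\<rceil>) / edge_scale T"
      using eventually_scale
    proof eventually_elim
      case (elim T)
      define n where "n = scale_index a T"
      have n: "0 < real n" using scale_index_bounds(1)[OF elim] by (simp add: n_def)
      have mn: "0 < real (m n)" using m(1)[of n] mult_pos_pos[OF n u] by linarith
      have pw: "(real (m n) / c) powr (1 / q) = real (m n) powr (1 / q) / c powr (1 / q)"
        "(real (m n) / real n) powr (1 / q) = real (m n) powr (1 / q) / real n powr (1 / q)"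
        "(real n / c) powr (1 / q) = real n powr (1 / q) / c powr (1 / q)"
        using c n mn by (simp_all add: powr_divide)
      have cancel: "x / (M / C) * (M / N) * inverse (K / (N / C)) = x / K" if "M \<noteq> 0" "C \<noteq> 0" "N \<noteq> 0" for x M C N K :: real
        using that by simp
      have "a (m n) / (real (m n) powr (1 / q) / c powr (1 / q)) * (real (m n) powr (1 / q) / real n powr (1 / q)) *
          inverse (edge_scale T / (real n powr (1 / q) / c powr (1 / q))) = a (m n) / edge_scale T"
        by (rule cancel) (use n mn c in simp_all)
      then show ?case unfolding n_def[symmetric] m_def[symmetric] pw .
    qed
  qed
qed

end

context power_growth
begin

lemma scaled_zeros_lower:
  obtains \<kappa> where "0 < \<kappa>" "\<forall>\<^sub>F T in at_top. \<forall>j\<ge>1. \<kappa> * (real j / real (scale_index a T)) powr (1 / q) \<le> a j / edge_scale T"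
proof -
  obtain B where B: "0 < B" "\<And>j. 1 \<le> j \<Longrightarrow> real j powr (1 / q) \<le> B * a j" using growth_lower_bound by blast
  have "\<forall>\<^sub>F T in at_top. edge_scale T / (real (scale_index a T) / c) powr (1 / q) < 2"
    using order_tendstoD(2)[OF edge_scale_growth, of 2] by simp
  then have "\<forall>\<^sub>F T in at_top. \<forall>j\<ge>1. c powr (1 / q) / (2 * B) * (real j / real (scale_index a T)) powr (1 / q) \<le> a j / edge_scale T"
    using eventually_scale
  proof eventually_elim
    case (elim T)
    define n where "n = scale_index a T"
    have n: "0 < real n" using scale_index_bounds(1)[OF elim(2)] by (simp add: n_def)
    have L: "0 < edge_scale T" by (rule scale_facts(4)[OF elim(2)])
    have cn: "0 < (real n / c) powr (1 / q)" using n c by simp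
    have "edge_scale T \<le> 2 * (real n / c) powr (1 / q)" using elim(1) cn unfolding n_def by (simp add: divide_less_eq)
    also have "\<dots> = 2 * real n powr (1 / q) / c powr (1 / q)" using n c by (simp add: powr_divide)
    finally have Lc: "c powr (1 / q) * edge_scale T \<le> 2 * real n powr (1 / q)" using c by (simp add: le_divide_eq mult.commute)
    show ?case
    proof (intro allI impI)
      fix j :: nat assume j: "1 \<le> j"
      have "c powr (1 / q) / (2 * B) * (real j / real n) powr (1 / q) = c powr (1 / q) * real j powr (1 / q) / (2 * B * real n powr (1 / q))"
        using n by (simp add: powr_divide)
      also have "\<dots> \<le> a j / edge_scale T"
      proof -
        have "c powr (1 / q) * real j powr (1 / q) * edge_scale T = (c powr (1 / q) * edge_scale T) * real j powr (1 / q)" by simp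
        also have "\<dots> \<le> (2 * real n powr (1 / q)) * (B * a j)"
          by (rule mult_mono[OF Lc B(2)[OF j]]) auto
        finally have "c powr (1 / q) * real j powr (1 / q) * edge_scale T \<le> a j * (2 * B * real n powr (1 / q))" by (simp only: mult_ac)
        moreover have "0 < 2 * B * real n powr (1 / q)" using n B(1) by simp
        ultimately show ?thesis using L by (simp only: pos_divide_le_eq pos_le_divide_eq times_divide_eq_left)
      qed
      finally show "c powr (1 / q) / (2 * B) * (real j / real (scale_index a T)) powr (1 / q) \<le> a j / edge_scale T" unfolding n_def .
    qed
  qed
  then show ?thesis by (rule that[rotated]) (use B(1) c in simp)
qed

lemma edge_pos: "0 < edge q"
proof -
  have "pi * q / 2 < pi" using q by simp
  then have "0 < sin (pi * q / 2)" using q by (intro sin_gt_zero) auto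
  then have "0 < q * pi / sin (pi * q / 2)" using q by simp
  then show ?thesis unfolding edge_def powr_gt_zero by (rule less_imp_neq[symmetric])
qed

text \<open>This is what \<open>edge q\<close> is: the root of the limiting saddle equation.\<close>

lemma edge_equation: "edge q powr (q - 2) * (q / 2) * (pi / sin (pi * (q / 2))) = 1 / 2"
proof -
  define s where "s = sin (pi * q / 2)"
  have "pi * q / 2 < pi" using q by simp
  then have s: "0 < s" unfolding s_def using q by (intro sin_gt_zero) auto
  then have b: "0 < q * pi / s" using q by simp
  have e: "1 / (2 - q) * (q - 2) = - 1" using q by (simp add: field_simps)
  have "edge q powr (q - 2) = (q * pi / s) powr (- 1)" unfolding edge_def s_def[symmetric] powr_powr e ..
  also have "\<dots> = inverse (q * pi / s)" using b by (simp only: powr_minus powr_one less_imp_le)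
  also have "\<dots> = s / (q * pi)" by simp
  finally show ?thesis using s q by (simp add: s_def[symmetric])
qed

end

context power_growth
begin

text \<open>The normalised saddle sum \<open>F T\<close> is continuous in \<open>l\<close> and
  converges pointwise to the strictly decreasing \<open>H\<close>, which takes the value
  \<open>1 / 2\<close> at \<open>edge q\<close>. For large \<open>T\<close> it is therefore above
  \<open>1 / 2\<close> at the left end and below at the right end, and the intermediate value
  theorem applies.\<close>

lemma saddle_point_exists:
  assumes \<delta>: "0 < \<delta>" "\<delta> < edge q"
  shows "\<forall>\<^sub>F T in at_top. \<exists>l\<in>{edge q - \<delta>..edge q + \<delta>}. (\<lambda>j. 1 / ((a (Suc j))\<^sup>2 + (edge_scale T * l)\<^sup>2)) sums (1 / (2 * T))"
proof -
  define F where "F T l = (\<Sum>j. 1 / ((a (Suc j) / edge_scale T)\<^sup>2 + l\<^sup>2)) / real (scale_index a T)" for T l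
  define H where "H l = l powr (q - 2) * (q / 2) * (pi / sin (pi * (q / 2)))" for l
  obtain \<kappa> where \<kappa>: "0 < \<kappa>" "\<forall>\<^sub>F T in at_top. \<forall>j\<ge>1. \<kappa> * (real j / real (scale_index a T)) powr (1 / q) \<le> a j / edge_scale T"
    using scaled_zeros_lower by blast
  have pos: "\<forall>\<^sub>F T in at_top. 0 < real (scale_index a T) \<and> 0 < edge_scale T"
    using eventually_scale
  proof eventually_elim
    case (elim T) then show ?case using scale_index_bounds(1)[OF elim] scale_facts(4)[OF elim] by simp
  qed
  have ap: "0 < a (Suc j)" for j by (rule zeros_pos) simp
  have lim: "((\<lambda>T. F T l) \<longlongrightarrow> H l) at_top" if "0 < l" for l
    unfolding F_def H_def
    by (rule Riemann_sum_limit[OF q that \<kappa>(1) ap summable_inverse_square_zeros pos scaled_zeros_limit \<kappa>(2)])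
  have Hpos: "0 < (q / 2) * (pi / sin (pi * (q / 2)))"
  proof -
    have "pi * (q / 2) < pi" using q by simp
    then have "0 < sin (pi * (q / 2))" using q by (intro sin_gt_zero) auto
    then show ?thesis using q by simp
  qed
  have Hmono: "H y < H x" if "0 < x" "x < y" for x y
  proof -
    have "y powr (q - 2) < x powr (q - 2)" using that q by (intro powr_less_mono2_neg) auto
    then show ?thesis unfolding H_def mult.assoc using Hpos by (simp only: mult_strict_right_mono)
  qed
  have H: "H (edge q) = 1 / 2" unfolding H_def by (rule edge_equation)
  have l1: "0 < edge q - \<delta>" and l2: "0 < edge q + \<delta>" using \<delta> by auto
  have "1 / 2 < H (edge q - \<delta>)" "H (edge q + \<delta>) < 1 / 2"
    using Hmono[OF l1, of "edge q"] Hmono[OF edge_pos, of "edge q + \<delta>"] \<delta> H by simp_all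
  then have "\<forall>\<^sub>F T in at_top. 1 / 2 < F T (edge q - \<delta>)" "\<forall>\<^sub>F T in at_top. F T (edge q + \<delta>) < 1 / 2"
    using order_tendstoD(1)[OF lim[OF l1]] order_tendstoD(2)[OF lim[OF l2]] by blast+
  then show ?thesis using eventually_scale
  proof eventually_elim
    case (elim T)
    let ?L = "edge_scale T" and ?n = "scale_index a T"
    note L = scale_facts[OF elim(3)]
    have n: "0 < real ?n" using scale_index_bounds(1)[OF elim(3)] by simp
    have b: "0 < (a (Suc j) / ?L)\<^sup>2" for j using ap[of j] L(4) by simp
    have "summable (\<lambda>j. ?L\<^sup>2 * (1 / (a (Suc j))\<^sup>2))" by (rule summable_mult[OF summable_inverse_square_zeros])
    then have sm: "summable (\<lambda>j. 1 / (a (Suc j) / ?L)\<^sup>2)" by (simp add: power_divide)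
    have cont: "continuous_on {edge q - \<delta>..edge q + \<delta>} (F T)"
      unfolding F_def by (intro continuous_on_divide shifted_sum_continuous[OF b sm] continuous_on_const) (use n in auto)
    obtain l where l: "edge q - \<delta> \<le> l" "l \<le> edge q + \<delta>" "F T l = 1 / 2"
      using IVT2'[of "F T" "edge q + \<delta>" "1 / 2" "edge q - \<delta>", OF _ _ _ cont] elim(1,2) \<delta> by auto
    have l0: "0 < l" using l(1) l1 by simp
    let ?f = "\<lambda>j. 1 / ((a (Suc j) / ?L)\<^sup>2 + l\<^sup>2)"
    have "summable ?f"
    proof (rule summable_comparison_test'[OF sm])
      fix j have "?f j \<le> 1 / (a (Suc j) / ?L)\<^sup>2" using b[of j] by (intro divide_left_mono) (auto intro!: mult_pos_pos add_pos_nonneg)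
      then show "norm (?f j) \<le> 1 / (a (Suc j) / ?L)\<^sup>2" by simp
    qed
    \<comment> \<open>Dividing by \<open>L^2 = T n\<close> turns this normalisation into the saddle
      equation with right side \<open>1 / (2 T)\<close>.\<close>
    then have "?f sums (real ?n / 2)" using l(3) n unfolding F_def sums_iff by (simp add: divide_eq_eq)
    from sums_mult[OF this, of "1 / ?L\<^sup>2"]
    have s: "(\<lambda>j. 1 / ?L\<^sup>2 * ?f j) sums (1 / ?L\<^sup>2 * (real ?n / 2))" .
    have "1 / ?L\<^sup>2 * (real ?n / 2) = 1 / (2 * T)" unfolding L(3) using n by simp
    moreover have "1 / ?L\<^sup>2 * ?f j = 1 / ((a (Suc j))\<^sup>2 + (?L * l)\<^sup>2)" for j
    proof -
      have "?L\<^sup>2 * ((a (Suc j) / ?L)\<^sup>2 + l\<^sup>2) = (a (Suc j))\<^sup>2 + (?L * l)\<^sup>2"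
        using L(4) by (simp add: power_divide power_mult_distrib distrib_left)
      then show ?thesis by (metis mult_1 times_divide_times_eq)
    qed
    ultimately have "(\<lambda>j. 1 / ((a (Suc j))\<^sup>2 + (?L * l)\<^sup>2)) sums (1 / (2 * T))" using s by simp
    then show ?case using l by auto
  qed
qed

end

section \<open>The segment between the saddle points\<close>

text \<open>Moves the dependence on the end points into the integrand, so that continuity in all
  parameters can be read off. Taking \<open>c = - V\<close> adds a reflection, which is used to fix
  the sign of the oscillating term.\<close>

lemma symmetric_set_integral_affine:
  fixes f :: "real \<Rightarrow> complex"
  assumes V: "0 < V" "\<bar>c\<bar> = V" and f: "continuous_on UNIV f"
  shows "(\<integral>u\<in>{- V..V}. f u \<partial>lborel) = of_real V * integral {- 1..1} (\<lambda>x. f (c * x))"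
proof -
  have c0: "c \<noteq> 0" using V by auto
  have mem: "c * x \<in> {- V..V} \<longleftrightarrow> x \<in> {- 1..1}" for x
  proof -
    have "c * x \<in> {- V..V} \<longleftrightarrow> \<bar>c * x\<bar> \<le> V" by auto
    also have "\<dots> \<longleftrightarrow> V * \<bar>x\<bar> \<le> V * 1" using V by (simp add: abs_mult)
    also have "\<dots> \<longleftrightarrow> x \<in> {- 1..1}" using V by (subst mult_le_cancel_left_pos) auto
    finally show ?thesis .
  qed
  have g: "continuous_on {- 1..1} (\<lambda>x. f (c * x))"
    by (rule continuous_on_compose2[OF f]) (auto intro!: continuous_intros)
  have "(\<integral>u\<in>{- V..V}. f u \<partial>lborel) = \<bar>c\<bar> *\<^sub>R (\<integral>x. indicator {- V..V} (0 + c * x) *\<^sub>R f (0 + c * x) \<partial>lborel)"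
    unfolding set_lebesgue_integral_def by (rule lborel_integral_real_affine[OF c0])
  also have "(\<lambda>x. indicator {- V..V} (0 + c * x) *\<^sub>R f (0 + c * x)) = (\<lambda>x. indicator {- 1..1} x *\<^sub>R f (c * x))"
    using mem by (auto simp: indicator_def fun_eq_iff)
  also have "(\<integral>x. indicator {- 1..1} x *\<^sub>R f (c * x) \<partial>lborel) = (\<integral>x\<in>{- 1..1}. f (c * x) \<partial>lborel)"
    unfolding set_lebesgue_integral_def ..
  also have "\<dots> = integral {- 1..1} (\<lambda>x. f (c * x))"
    by (rule set_borel_integral_eq_integral(2)[OF borel_integrable_atLeastAtMost'[OF g]])
  finally show ?thesis unfolding V(2) scaleR_conv_of_real .
qed

text \<open>The contribution of the segment between the saddle points in units of \<open>L\<close>, with \<open>\<eta> = 1/n\<close>; the formula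
  extends continuously to \<open>\<eta> = 0\<close>.\<close>

definition segment_integrand :: "real \<Rightarrow> real \<Rightarrow> real \<Rightarrow> real \<Rightarrow> real \<Rightarrow> real \<Rightarrow> real \<Rightarrow> complex" where
  "segment_integrand \<eta> l s t X Y x = of_real (l / sqrt ((1 + \<eta> * s) * (1 + \<eta> * t))) *
     exp (of_real ((l * x)\<^sup>2 * (t - s) / (2 * ((1 + \<eta> * s) * (1 + \<eta> * t))) + \<eta> * (Y\<^sup>2 / (1 + \<eta> * t) - X\<^sup>2 / (1 + \<eta> * s)) / 2) +
       \<i> * of_real (l * x * (Y / (1 + \<eta> * t) - X / (1 + \<eta> * s))))"

definition segment_integral :: "real \<times> real \<times> real \<times> real \<times> real \<times> real \<Rightarrow> complex" where
  "segment_integral = (\<lambda>(\<eta>, l, s, t, X, Y). 1 / (2 * of_real pi) * integral {- 1..1} (segment_integrand \<eta> l s t X Y))"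

lemma segment_integral_edge:
  assumes u: "0 < u"
  shows "segment_integral (0, u, s, t, X, Y) = 1 / (2 * complex_of_real pi) *
    (\<integral>k\<in>{- u..u}. exp (complex_of_real (k\<^sup>2 * (t - s) / 2) + \<i> * complex_of_real (k * (Y - X))) \<partial>lborel)"
proof -
  let ?f = "\<lambda>k. exp (complex_of_real (k\<^sup>2 * (t - s) / 2) + \<i> * complex_of_real (k * (Y - X)))"
  have "(\<integral>k\<in>{- u..u}. ?f k \<partial>lborel) = of_real u * integral {- 1..1} (\<lambda>x. ?f (u * x))"
    using u by (intro symmetric_set_integral_affine continuous_intros) auto
  also have "\<dots> = integral {- 1..1} (\<lambda>x. of_real u * ?f (u * x))" by (rule integral_mult_right[symmetric])
  also have "(\<lambda>x. of_real u * ?f (u * x)) = segment_integrand 0 u s t X Y"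
    by (simp add: fun_eq_iff segment_integrand_def)
  finally show ?thesis by (simp only: segment_integral_def prod.case)
qed

text \<open>The point \<open>u = - \<sigma> n k\<close> carries the minus sign so that the cross
  terms become \<open>k (Y - X)\<close> at \<open>\<eta> = 0\<close>. All powers of
  \<open>\<sigma>\<close> cancel, and the two quadratic terms in \<open>k\<close>, each of order
  \<open>n\<close>, combine to one proportional to \<open>t - s\<close>.\<close>

lemma segment_exponent:
  fixes \<sigma> n s t X Y k :: real
  assumes \<sigma>: "0 < \<sigma>" and n: "0 < n" "0 < n + s" "0 < n + t"
  defines "\<eta> \<equiv> 1 / n"
  shows "(\<i> * of_real (- (\<sigma> * n * k)) - complex_of_real (\<sigma> * Y))\<^sup>2 / complex_of_real (2 * (\<sigma>\<^sup>2 * (n + t))) -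
      (\<i> * of_real (- (\<sigma> * n * k)) - complex_of_real (\<sigma> * X))\<^sup>2 / complex_of_real (2 * (\<sigma>\<^sup>2 * (n + s))) =
    of_real (k\<^sup>2 * (t - s) / (2 * ((1 + \<eta> * s) * (1 + \<eta> * t))) + \<eta> * (Y\<^sup>2 / (1 + \<eta> * t) - X\<^sup>2 / (1 + \<eta> * s)) / 2) +
       \<i> * of_real (k * (Y / (1 + \<eta> * t) - X / (1 + \<eta> * s)))"
proof -
  have one: "1 + \<eta> * s = (n + s) / n" "1 + \<eta> * t = (n + t) / n" using n by (simp_all add: \<eta>_def add_divide_distrib)
  have part: "(\<i> * of_real (- (\<sigma> * n * k)) - complex_of_real (\<sigma> * y))\<^sup>2 / complex_of_real (2 * (\<sigma>\<^sup>2 * m)) =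
      of_real ((y\<^sup>2 - (n * k)\<^sup>2) / (2 * m)) + \<i> * of_real (n * k * y / m)" if "0 < m" for y m
  proof -
    have "(\<i> * of_real (- (\<sigma> * n * k)) - complex_of_real (\<sigma> * y))\<^sup>2 =
        complex_of_real (\<sigma>\<^sup>2) * (of_real (y\<^sup>2 - (n * k)\<^sup>2) + \<i> * of_real (2 * (n * k * y)))"
      by (simp add: complex_eq_iff power2_eq_square algebra_simps)
    moreover have "complex_of_real (\<sigma>\<^sup>2) \<noteq> 0" using \<sigma> by simp
    moreover have "complex_of_real (2 * (\<sigma>\<^sup>2 * m)) = complex_of_real (\<sigma>\<^sup>2) * complex_of_real (2 * m)" by simp
    ultimately have "(\<i> * of_real (- (\<sigma> * n * k)) - complex_of_real (\<sigma> * y))\<^sup>2 / complex_of_real (2 * (\<sigma>\<^sup>2 * m)) =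
        (of_real (y\<^sup>2 - (n * k)\<^sup>2) + \<i> * of_real (2 * (n * k * y))) / complex_of_real (2 * m)"
      by (simp only: mult_divide_mult_cancel_left_if if_False)
    also have "\<dots> = of_real ((y\<^sup>2 - (n * k)\<^sup>2) / (2 * m)) + \<i> * of_real (n * k * y / m)"
      using that by (simp add: add_divide_distrib)
    finally show ?thesis .
  qed
  have re: "(Y\<^sup>2 - (n * k)\<^sup>2) / (2 * (n + t)) - (X\<^sup>2 - (n * k)\<^sup>2) / (2 * (n + s)) =
     k\<^sup>2 * (t - s) / (2 * ((1 + \<eta> * s) * (1 + \<eta> * t))) + \<eta> * (Y\<^sup>2 / (1 + \<eta> * t) - X\<^sup>2 / (1 + \<eta> * s)) / 2"
  proof -
    have "\<eta> * (Y\<^sup>2 / (1 + \<eta> * t) - X\<^sup>2 / (1 + \<eta> * s)) / 2 = Y\<^sup>2 / (2 * (n + t)) - X\<^sup>2 / (2 * (n + s))"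
    proof -
      have "1 / n * (y / (m / n) - x / (k / n)) / 2 = y / (2 * m) - x / (2 * k)" for y m x k
        using n by (simp add: right_diff_distrib diff_divide_distrib mult.commute)
      then show ?thesis unfolding one unfolding \<eta>_def by blast
    qed
    moreover have "k\<^sup>2 * (t - s) / (2 * ((1 + \<eta> * s) * (1 + \<eta> * t))) = (n * k)\<^sup>2 / (2 * (n + s)) - (n * k)\<^sup>2 / (2 * (n + t))"
    proof -
      have "(n * k)\<^sup>2 / (2 * p) - (n * k)\<^sup>2 / (2 * r) = k\<^sup>2 * (r - p) / (2 * ((p / n) * (r / n)))" if "0 < p" "0 < r" for p r
        using that n by (simp add: divide_simps) (simp add: power2_eq_square algebra_simps)
      from this[OF n(2,3)] show ?thesis unfolding one by simp
    qed
    ultimately show ?thesis unfolding diff_divide_distrib by linarith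
  qed
  have im: "n * k * Y / (n + t) - n * k * X / (n + s) = k * (Y / (1 + \<eta> * t) - X / (1 + \<eta> * s))"
    unfolding one using n by (simp add: right_diff_distrib mult_ac)
  show ?thesis unfolding part[OF n(2)] part[OF n(3)] re[symmetric] im[symmetric]
    by (simp add: algebra_simps)
qed

text \<open>The factor \<open>\<sigma> / sqrt (S * U)\<close> is of order \<open>1 / L\<close>, so
  multiplying it by the half-length \<open>L * l\<close> of the segment leaves a quantity of order
  1, and no error term appears at this stage.\<close>

lemma (in canonical_zeros) segment_integral_scaled:
  fixes \<sigma> n s t X Y l :: real
  assumes \<sigma>: "0 < \<sigma>" and n: "0 < n" "0 < n + s" "0 < n + t" and l: "0 < l"
  defines "S \<equiv> \<sigma>\<^sup>2 * (n + s)" and "U \<equiv> \<sigma>\<^sup>2 * (n + t)"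
  shows "of_real \<sigma> * (of_real (1 / (2 * pi * sqrt (S * U))) *
      (\<integral>u\<in>{- (\<sigma> * n * l)..\<sigma> * n * l}. saddle_exponential S U (\<sigma> * X) (\<sigma> * Y) u \<partial>lborel)) = segment_integral (1 / n, l, s, t, X, Y)"
proof -
  have V: "0 < \<sigma> * n * l" "\<bar>- (\<sigma> * n * l)\<bar> = \<sigma> * n * l" using \<sigma> n l by simp_all
  let ?e = "saddle_exponential S U (\<sigma> * X) (\<sigma> * Y)"
  have "sqrt (S * U) = \<sigma>\<^sup>2 * n * sqrt ((1 + 1 / n * s) * (1 + 1 / n * t))"
  proof -
    have "S * U = (\<sigma>\<^sup>2 * n)\<^sup>2 * ((1 + 1 / n * s) * (1 + 1 / n * t))"
      unfolding S_def U_def using n by (simp add: power2_eq_square field_simps)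
    then show ?thesis using \<sigma> n by (simp add: real_sqrt_mult)
  qed
  then have pre: "\<sigma> * (1 / (2 * pi * sqrt (S * U))) * (\<sigma> * n * l) = 1 / (2 * pi) * (l / sqrt ((1 + 1 / n * s) * (1 + 1 / n * t)))"
    using \<sigma> n by (simp add: power2_eq_square)
  have "of_real \<sigma> * (of_real (1 / (2 * pi * sqrt (S * U))) * (\<integral>u\<in>{- (\<sigma> * n * l)..\<sigma> * n * l}. ?e u \<partial>lborel)) =
      of_real \<sigma> * (of_real (1 / (2 * pi * sqrt (S * U))) * (of_real (\<sigma> * n * l) * integral {- 1..1} (\<lambda>x. ?e (- (\<sigma> * n * l) * x))))"
    by (simp only: symmetric_set_integral_affine[OF V saddle_exponential_continuous])
  also have "\<dots> = of_real (\<sigma> * (1 / (2 * pi * sqrt (S * U))) * (\<sigma> * n * l)) * integral {- 1..1} (\<lambda>x. ?e (- (\<sigma> * n * l) * x))"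
    by (simp only: of_real_mult mult.assoc)
  also have "\<dots> = 1 / (2 * of_real pi) * (of_real (l / sqrt ((1 + 1 / n * s) * (1 + 1 / n * t))) * integral {- 1..1} (\<lambda>x. ?e (- (\<sigma> * n * l) * x)))"
    unfolding pre by simp
  also have "of_real (l / sqrt ((1 + 1 / n * s) * (1 + 1 / n * t))) * integral {- 1..1} (\<lambda>x. ?e (- (\<sigma> * n * l) * x)) =
      integral {- 1..1} (\<lambda>x. of_real (l / sqrt ((1 + 1 / n * s) * (1 + 1 / n * t))) * ?e (- (\<sigma> * n * l) * x))"
    by (rule integral_mult_right[symmetric])
  also have "(\<lambda>x. of_real (l / sqrt ((1 + 1 / n * s) * (1 + 1 / n * t))) * ?e (- (\<sigma> * n * l) * x)) = segment_integrand (1 / n) l s t X Y"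
  proof
    fix x
    have "- (\<sigma> * n * l) * x = - (\<sigma> * n * (l * x))" by simp
    then show "of_real (l / sqrt ((1 + 1 / n * s) * (1 + 1 / n * t))) * ?e (- (\<sigma> * n * l) * x) = segment_integrand (1 / n) l s t X Y x"
      unfolding saddle_exponential_def segment_integrand_def S_def U_def by (simp only: segment_exponent[OF \<sigma> n])
  qed
  finally show ?thesis by (simp only: segment_integral_def prod.case)
qed

lemma segment_integral_continuous:
  "continuous_on {(\<eta>, l, s, t, X, Y). 0 < 1 + \<eta> * s \<and> 0 < 1 + \<eta> * t} segment_integral"
proof -
  let ?U = "{(\<eta>, l, s, t, X, Y). 0 < 1 + \<eta> * s \<and> 0 < 1 + \<eta> * t} :: (real \<times> real \<times> real \<times> real \<times> real \<times> real) set"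
  let ?f = "\<lambda>p. segment_integrand (fst p) (fst (snd p)) (fst (snd (snd p))) (fst (snd (snd (snd p)))) (fst (snd (snd (snd (snd p))))) (snd (snd (snd (snd (snd p)))))"
  have "continuous_on (?U \<times> cbox (- 1) 1) (\<lambda>(p, x). ?f p x)"
    unfolding segment_integrand_def case_prod_unfold
    by (intro continuous_intros) auto
  then have "continuous_on ?U (\<lambda>p. integral (cbox (- 1) 1) (?f p))" by (rule integral_continuous_on_param)
  then have "continuous_on ?U (\<lambda>p. 1 / (2 * of_real pi) * integral {- 1..1} (?f p))" by (intro continuous_intros) simp
  then show ?thesis by (simp add: segment_integral_def case_prod_unfold)
qed

lemma bounded_quadruples:
  assumes "bounded C"
  obtains R where "1 \<le> R" "\<And>s t X Y. (s, t, X, Y) \<in> C \<Longrightarrow> \<bar>s\<bar> \<le> R \<and> \<bar>t\<bar> \<le> R \<and> \<bar>X\<bar> \<le> R \<and> \<bar>Y :: real\<bar> \<le> (R :: real)"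
proof -
  obtain B where B: "\<And>x. x \<in> C \<Longrightarrow> norm x \<le> B" using assms by (auto simp: bounded_iff)
  have "\<bar>s\<bar> \<le> max 1 B \<and> \<bar>t\<bar> \<le> max 1 B \<and> \<bar>X\<bar> \<le> max 1 B \<and> \<bar>Y\<bar> \<le> max 1 B" if "(s, t, X, Y) \<in> C" for s t X Y :: real
  proof -
    have p: "\<bar>x\<bar> \<le> norm (x, z)" "norm z \<le> norm (x, z)" for x :: real and z :: "'z :: real_normed_vector"
      using norm_fst_le[of x z] norm_snd_le[of z x] by simp_all
    have b: "norm (s, t, X, Y) \<le> max 1 B" using B[OF that] by simp
    have "\<bar>s\<bar> \<le> norm (s, t, X, Y)" "\<bar>t\<bar> \<le> norm (t, X, Y)" "norm (t, X, Y) \<le> norm (s, t, X, Y)"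
      "\<bar>X\<bar> \<le> norm (X, Y)" "norm (X, Y) \<le> norm (t, X, Y)" "norm Y \<le> norm (X, Y)" by (rule p)+
    then show ?thesis using b by simp
  qed
  then show ?thesis by (intro that[of "max 1 B"]) auto
qed

text \<open>Uniform continuity on a compact set of parameters that includes the limiting value
  \<open>\<eta> = 0\<close>.\<close>

lemma segment_integral_near_edge:
  assumes C: "compact C" and u: "0 < u" and e: "0 < e"
  obtains \<delta> where "0 < \<delta>" "\<And>\<eta> l s t X Y. (s, t, X, Y) \<in> C \<Longrightarrow> 0 \<le> \<eta> \<Longrightarrow> \<eta> < \<delta> \<Longrightarrow> \<bar>l - u\<bar> \<le> \<delta> \<Longrightarrow>
    dist (segment_integral (\<eta>, l, s, t, X, Y)) (segment_integral (0, u, s, t, X, Y)) < e"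
proof -
  obtain R where R: "1 \<le> R" "\<And>s t X Y. (s, t, X, Y) \<in> C \<Longrightarrow> \<bar>s\<bar> \<le> R \<and> \<bar>t\<bar> \<le> R \<and> \<bar>X\<bar> \<le> R \<and> \<bar>Y\<bar> \<le> R"
    using bounded_quadruples[OF compact_imp_bounded[OF C]] by blast
  let ?K = "{0..1 / (2 * R)} \<times> {0..2 * u} \<times> C"
  have pos: "0 < 1 + \<eta> * s" if "0 \<le> \<eta>" "\<eta> \<le> 1 / (2 * R)" "\<bar>s\<bar> \<le> R" for \<eta> s
  proof -
    have "\<bar>\<eta> * s\<bar> \<le> 1 / (2 * R) * R" unfolding abs_mult using that R(1) by (intro mult_mono) auto
    then show ?thesis using R(1) by (simp add: abs_le_iff)
  qed
  have "?K \<subseteq> {(\<eta>, l, s, t, X, Y). 0 < 1 + \<eta> * s \<and> 0 < 1 + \<eta> * t}" using pos R(2) by fastforce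
  then have "continuous_on ?K segment_integral" by (rule continuous_on_subset[OF segment_integral_continuous])
  then have "uniformly_continuous_on ?K segment_integral"
    by (rule compact_uniformly_continuous) (intro compact_Times compact_Icc C)
  then obtain d where d: "0 < d" "\<And>x x'. x \<in> ?K \<Longrightarrow> x' \<in> ?K \<Longrightarrow> dist x' x < d \<Longrightarrow> dist (segment_integral x') (segment_integral x) < e"
    unfolding uniformly_continuous_on_def using e by metis
  \<comment> \<open>The bound \<open>1 / (2 * R)\<close> keeps \<open>1 + \<eta> * s\<close> and
    \<open>1 + \<eta> * t\<close> positive, and \<open>u\<close> keeps \<open>l\<close> in the
    compact interval from 0 to \<open>2 * u\<close>.\<close>
  define \<delta> where "\<delta> = min (d / 4) (min (1 / (2 * R)) u)"
  have \<delta>: "0 < \<delta>" "\<delta> \<le> d / 4" "\<delta> \<le> 1 / (2 * R)" "\<delta> \<le> u" using d(1) R(1) u by (auto simp: \<delta>_def)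
  show ?thesis
  proof (rule that[OF \<delta>(1)])
    fix \<eta> l s t X Y
    assume p: "(s, t, X, Y) \<in> C" "0 \<le> \<eta>" "\<eta> < \<delta>" "\<bar>l - u\<bar> \<le> \<delta>"
    have "dist (\<eta>, l, s, t, X, Y) (0, u, s, t, X, Y) = sqrt (\<eta>\<^sup>2 + (l - u)\<^sup>2)"
      by (simp add: dist_Pair_Pair dist_real_def)
    also have "\<dots> \<le> \<bar>\<eta>\<bar> + \<bar>l - u\<bar>" by (rule sqrt_sum_squares_le_sum_abs)
    also have "\<dots> < d" using p \<delta> d(1) by linarith
    finally show "dist (segment_integral (\<eta>, l, s, t, X, Y)) (segment_integral (0, u, s, t, X, Y)) < e"
      using p \<delta> u R(1) by (intro d(2)) auto
  qed
qed

section \<open>The limit of the analytic kernel\<close>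

locale initial_configuration = power_growth +
  fixes \<epsilon> :: nat
  assumes multiplicity_le: "\<epsilon> \<le> 1"

sublocale initial_configuration \<subseteq> canonical_zeros \<epsilon> a
  by unfold_locales (use zeros_pos summable_inverse_square_zeros multiplicity_le in simp_all)

context initial_configuration
begin

text \<open>Since \<open>S\<close> and \<open>U\<close> are at least
  \<open>\<sigma>^2 n / 2\<close>, the denominator has modulus at least
  \<open>2 \<sigma>^2 n\<close>. Multiplying by \<open>\<sigma>\<close> and by the bound of order
  \<open>\<sigma> n * n^(-1/4)\<close> for the double integrals, all powers of
  \<open>\<sigma>\<close> cancel.\<close>

lemma remainder_bound:
  fixes s t X Y \<sigma> C0 n R :: real and cd1 cd2 :: complex
  assumes \<sigma>: "0 < \<sigma>" and n: "1 \<le> n" "2 * R \<le> n" and R: "\<bar>s\<bar> \<le> R" "\<bar>t\<bar> \<le> R"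
    and cd: "norm cd1 \<le> C0 * (\<sigma> * n) * n powr (- 1 / 4)" "norm cd2 \<le> C0 * (\<sigma> * n) * n powr (- 1 / 4)"
  shows "norm (of_real \<sigma> * (1 / ((2 * complex_of_real pi * \<i>)\<^sup>2 * complex_of_real (sqrt ((\<sigma>\<^sup>2 * (n + s)) * (\<sigma>\<^sup>2 * (n + t))))) * (cd1 + cd2))) \<le> \<bar>C0\<bar> * n powr (- 1 / 4)"
proof -
  define w where "w = n powr (- 1 / 4)"
  have w: "0 \<le> w" by (simp add: w_def)
  have ns: "n / 2 \<le> n + s" "n / 2 \<le> n + t" using n R by linarith+
  have root: "\<sigma>\<^sup>2 * n / 2 \<le> sqrt ((\<sigma>\<^sup>2 * (n + s)) * (\<sigma>\<^sup>2 * (n + t)))"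
  proof (rule real_le_rsqrt)
    have "(n / 2) * (n / 2) \<le> (n + s) * (n + t)" using ns n by (intro mult_mono) auto
    then have "\<sigma> ^ 4 * ((n / 2) * (n / 2)) \<le> \<sigma> ^ 4 * ((n + s) * (n + t))" by (rule mult_left_mono) simp
    moreover have "(\<sigma>\<^sup>2 * n / 2)\<^sup>2 = \<sigma> ^ 4 * ((n / 2) * (n / 2))" "(\<sigma>\<^sup>2 * (n + s)) * (\<sigma>\<^sup>2 * (n + t)) = \<sigma> ^ 4 * ((n + s) * (n + t))"
      by (simp_all add: power2_eq_square power4_eq_xxxx mult_ac)
    ultimately show "(\<sigma>\<^sup>2 * n / 2)\<^sup>2 \<le> (\<sigma>\<^sup>2 * (n + s)) * (\<sigma>\<^sup>2 * (n + t))" by (simp only:)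
  qed
  have q: "0 < \<sigma>\<^sup>2 * n / 2" using \<sigma> n by simp
  have "4 * 1 \<le> 4 * pi\<^sup>2" using pi_gt3 by (intro mult_left_mono one_le_power) auto
  then have "4 * (\<sigma>\<^sup>2 * n / 2) \<le> (4 * pi\<^sup>2) * sqrt ((\<sigma>\<^sup>2 * (n + s)) * (\<sigma>\<^sup>2 * (n + t)))"
    using root q by (intro mult_mono) auto
  then have den: "2 * \<sigma>\<^sup>2 * n \<le> norm ((2 * complex_of_real pi * \<i>)\<^sup>2 * complex_of_real (sqrt ((\<sigma>\<^sup>2 * (n + s)) * (\<sigma>\<^sup>2 * (n + t)))))"
    (is "_ \<le> norm ?D") using q root by (simp add: norm_mult norm_power power_mult_distrib)
  have "norm (cd1 + cd2) \<le> 2 * (\<bar>C0\<bar> * (\<sigma> * n) * w)"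
  proof -
    have "C0 * (\<sigma> * n) * w \<le> \<bar>C0\<bar> * (\<sigma> * n) * w" using \<sigma> n w by (intro mult_right_mono) auto
    then show ?thesis using norm_triangle_ineq[of cd1 cd2] cd unfolding w_def by linarith
  qed
  then have "1 / norm ?D * norm (cd1 + cd2) \<le> 1 / (2 * \<sigma>\<^sup>2 * n) * (2 * (\<bar>C0\<bar> * (\<sigma> * n) * w))"
    using \<sigma> n by (intro mult_mono frac_le den) auto
  then have "\<sigma> * (1 / norm ?D * norm (cd1 + cd2)) \<le> \<sigma> * (1 / (2 * \<sigma>\<^sup>2 * n) * (2 * (\<bar>C0\<bar> * (\<sigma> * n) * w)))"
    using \<sigma> by (intro mult_left_mono) auto
  moreover have nm: "norm (of_real \<sigma> * (1 / D * z)) = \<sigma> * (1 / norm D * norm z)" for D z :: complex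
    using \<sigma> by (simp add: norm_mult norm_divide)
  ultimately have "norm (of_real \<sigma> * (1 / ?D * (cd1 + cd2))) \<le> \<sigma> * (1 / (2 * \<sigma>\<^sup>2 * n) * (2 * (\<bar>C0\<bar> * (\<sigma> * n) * w)))"
    unfolding nm by blast
  also have "\<dots> = \<bar>C0\<bar> * w" using \<sigma> n by (simp add: power2_eq_square)
  finally show ?thesis unfolding w_def .
qed

lemma edge_scale_at_top: "filterlim edge_scale at_top at_top"
proof (rule filterlim_at_top_mono)
  show "filterlim sqrt at_top at_top" by (rule sqrt_at_top)
  show "\<forall>\<^sub>F T in at_top. sqrt T \<le> edge_scale T"
    using eventually_scale eventually_ge_at_top[of 0]
  proof eventually_elim
    case (elim T)
    have "T * 1 \<le> T * real (scale_index a T)" using scale_index_bounds(1)[OF elim(1)] elim(2) by (intro mult_left_mono) auto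
    then show ?case using scale_facts(3,4)[OF elim(1)] by (intro real_le_lsqrt) auto
  qed
qed


end

context initial_configuration
begin
text \<open>The contour is moved to the exact saddle height \<open>L * l\<close> of the given
  \<open>T\<close>, so that the saddle equation holds without error. The double integrals then
  contribute \<open>O (n^(-1/4))\<close>, and the segment integral is close to its value at
  \<open>\<eta> = 0\<close> and \<open>l = edge q\<close>, because \<open>1 / n\<close> is small and
  \<open>l\<close> is close to \<open>edge q\<close>.\<close>

theorem analytic_kernel_limit:
  assumes C: "compact C"
  shows "uniform_limit C
     (\<lambda>T (s, t, X, Y). complex_of_real (space_scale a T) *
       analytic_kernel \<epsilon> a (scaled_time a T s, space_scale a T * X) (scaled_time a T t, space_scale a T * Y))
     (\<lambda>(s, t, X, Y). 1 / (2 * complex_of_real pi) *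
       (\<integral>k\<in>{- edge q..edge q}. exp (complex_of_real (k\<^sup>2 * (t - s) / 2) + \<i> * complex_of_real (k * (Y - X))) \<partial>lborel)) at_top"
proof (rule uniform_limitI)
  fix e :: real assume "0 < e"
  then have e: "0 < e / 2" by simp
  obtain R where R: "1 \<le> R" "\<And>s t X Y. (s, t, X, Y) \<in> C \<Longrightarrow> \<bar>s\<bar> \<le> R \<and> \<bar>t\<bar> \<le> R \<and> \<bar>X\<bar> \<le> R \<and> \<bar>Y\<bar> \<le> R"
    using bounded_quadruples[OF compact_imp_bounded[OF C]] by blast
  obtain \<delta>0 where \<delta>0: "0 < \<delta>0" "\<And>\<eta> l s t X Y. (s, t, X, Y) \<in> C \<Longrightarrow> 0 \<le> \<eta> \<Longrightarrow> \<eta> < \<delta>0 \<Longrightarrow> \<bar>l - edge q\<bar> \<le> \<delta>0 \<Longrightarrow>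
      dist (segment_integral (\<eta>, l, s, t, X, Y)) (segment_integral (0, edge q, s, t, X, Y)) < e / 2"
    by (rule segment_integral_near_edge[OF C edge_pos e]) blast
  \<comment> \<open>The bound \<open>edge q / 2\<close> keeps the lower end \<open>l0\<close> of the
    range of saddle heights positive.\<close>
  define \<delta> where "\<delta> = min \<delta>0 (edge q / 2)"
  have \<delta>: "0 < \<delta>" "\<delta> < edge q" "\<delta> \<le> \<delta>0" using \<delta>0(1) edge_pos by (auto simp: \<delta>_def)
  define l0 where "l0 = edge q - \<delta>"
  define h0 where "h0 = edge q + \<delta>"
  have l0: "0 < l0" "l0 \<le> h0" using \<delta> by (simp_all add: l0_def h0_def)
  have R0: "0 \<le> R" using R(1) by simp
  obtain C0 N where bound: "\<And>\<sigma> s t X Y v0 n. \<lbrakk>0 < \<sigma>; l0 \<le> v0; v0 \<le> h0; \<bar>s\<bar> \<le> R; \<bar>t\<bar> \<le> R; \<bar>X\<bar> \<le> R; \<bar>Y\<bar> \<le> R;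
    \<And>j. j < n \<Longrightarrow> (a (Suc j))\<^sup>2 \<le> (\<sigma> * real n)\<^sup>2;
    (\<lambda>j. 1 / ((a (Suc j))\<^sup>2 + (\<sigma> * real n * v0)\<^sup>2)) sums (1 / (2 * (\<sigma>\<^sup>2 * real n))); N \<le> n\<rbrakk> \<Longrightarrow>
    norm (contour_double (\<sigma> * real n * v0) (\<sigma>\<^sup>2 * (real n + s)) (\<sigma>\<^sup>2 * (real n + t)) (\<sigma> * X) (\<sigma> * Y)) \<le>
      C0 * (\<sigma> * real n) * real n powr (- 1 / 4)"
    by (rule contour_double_scaled_bound[OF l0 R0]) blast
  have small: "(\<lambda>n. \<bar>C0\<bar> * real n powr (- 1 / 4)) \<longlonglongrightarrow> 0"
  proof -
    have "((\<lambda>x::real. x powr (- 1 / 4)) \<longlongrightarrow> 0) at_top" by real_asymp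
    from tendsto_mult_left[OF filterlim_compose[OF this filterlim_real_sequentially], of "\<bar>C0\<bar>"] show ?thesis by simp
  qed
  have inv: "(\<lambda>n. 1 / real n) \<longlonglongrightarrow> 0" by (rule lim_1_over_n)
  have ev_n: "\<forall>\<^sub>F n in sequentially. N \<le> n \<and> 2 * R \<le> real n \<and> 1 / real n < \<delta>0 \<and> \<bar>C0\<bar> * real n powr (- 1 / 4) < e / 2"
    using eventually_ge_at_top[of N] eventually_ge_at_top[of "nat \<lceil>2 * R\<rceil>"] order_tendstoD(2)[OF inv \<delta>0(1)] order_tendstoD(2)[OF small e]
  proof eventually_elim
    case (elim n)
    have "2 * R \<le> real n" using elim(2) by linarith
    then show ?case using elim by blast
  qed
  have ev_L: "\<forall>\<^sub>F T in at_top. 1 / l0 < edge_scale T"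
    using edge_scale_at_top unfolding filterlim_at_top_dense by blast
  show "\<forall>\<^sub>F T in at_top. \<forall>p\<in>C. dist (case p of (s, t, X, Y) \<Rightarrow> complex_of_real (space_scale a T) *
       analytic_kernel \<epsilon> a (scaled_time a T s, space_scale a T * X) (scaled_time a T t, space_scale a T * Y))
     (case p of (s, t, X, Y) \<Rightarrow> 1 / (2 * complex_of_real pi) *
       (\<integral>k\<in>{- edge q..edge q}. exp (complex_of_real (k\<^sup>2 * (t - s) / 2) + \<i> * complex_of_real (k * (Y - X))) \<partial>lborel)) < e"
    using eventually_scale saddle_point_exists[OF \<delta>(1,2)] eventually_compose_filterlim[OF ev_n filterlim_scale_index] ev_L
  proof eventually_elim
    case (elim T)
    define \<sigma> where "\<sigma> = space_scale a T"
    define n where "n = scale_index a T"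
    note facts = scale_facts[OF elim(1)]
    have \<sigma>: "0 < \<sigma>" and T: "\<sigma>\<^sup>2 * real n = T" and L: "edge_scale T = \<sigma> * real n"
      using facts by (simp_all add: \<sigma>_def n_def edge_scale_def)
    have n: "1 \<le> n" "N \<le> n" "2 * R \<le> real n" "1 / real n < \<delta>0" "\<bar>C0\<bar> * real n powr (- 1 / 4) < e / 2"
      using scale_index_bounds(1)[OF elim(1)] elim(3) by (simp_all add: n_def)
    obtain l where l: "l0 \<le> l" "l \<le> h0" and saddle: "(\<lambda>j. 1 / ((a (Suc j))\<^sup>2 + (\<sigma> * real n * l)\<^sup>2)) sums (1 / (2 * (\<sigma>\<^sup>2 * real n)))"
      using elim(2) unfolding L T l0_def h0_def by auto
    have lp: "0 < l" using l0 l by simp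
    have zeros: "(a (Suc j))\<^sup>2 \<le> (\<sigma> * real n)\<^sup>2" if "j < n" for j
    proof (rule power_mono)
      have "a (Suc j) \<le> a n" using that by (intro zeros_mono) auto
      then show "a (Suc j) \<le> \<sigma> * real n" using facts(5) unfolding L[symmetric] n_def[symmetric] by simp
      show "0 \<le> a (Suc j)" using zeros_pos[of "Suc j"] by simp
    qed
    \<comment> \<open>The saddle lies above the original flat part at height 1, since
      \<open>L\<close> tends to infinity; the deformation is upward.\<close>
    have V: "1 < \<sigma> * real n * l"
    proof -
      have "1 = 1 / l0 * l0" using l0 by simp
      also have "\<dots> < edge_scale T * l0" using elim(4) l0 by (intro mult_strict_right_mono) auto
      also have "\<dots> \<le> edge_scale T * l" using l facts(4) by (intro mult_left_mono) auto
      finally show ?thesis unfolding L .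
    qed
    show ?case
    proof
      fix p assume p: "p \<in> C"
      obtain s t X Y where p_eq: "p = (s, t, X, Y)" by (cases p)
      have pR: "\<bar>s\<bar> \<le> R" "\<bar>t\<bar> \<le> R" "\<bar>X\<bar> \<le> R" "\<bar>Y\<bar> \<le> R" using R(2) p unfolding p_eq by blast+
      have pR': "\<bar>- X\<bar> \<le> R" "\<bar>- Y\<bar> \<le> R" using pR by simp_all
      have ns: "0 < real n + s" "0 < real n + t" using n(1,3) pR by linarith+
      define S where "S = \<sigma>\<^sup>2 * (real n + s)"
      define U where "U = \<sigma>\<^sup>2 * (real n + t)"
      have SU: "0 < S" "0 < U" using \<sigma> ns by (simp_all add: S_def U_def)
      have times: "scaled_time a T s = S" "scaled_time a T t = U"
        using T by (simp_all add: scaled_time_def S_def U_def \<sigma>_def[symmetric] distrib_left)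
      let ?A = "analytic_kernel \<epsilon> a (S, \<sigma> * X) (U, \<sigma> * Y)"
      let ?V = "\<sigma> * real n * l"
      let ?rem = "of_real \<sigma> * (1 / ((2 * complex_of_real pi * \<i>)\<^sup>2 * complex_of_real (sqrt (S * U))) *
        (contour_double ?V S U (\<sigma> * X) (\<sigma> * Y) + contour_double ?V S U (\<sigma> * (- X)) (\<sigma> * (- Y))))"
      have "of_real \<sigma> * ?A = ?rem + of_real \<sigma> * (of_real (1 / (2 * pi * sqrt (S * U))) * (\<integral>u\<in>{- ?V..?V}. saddle_exponential S U (\<sigma> * X) (\<sigma> * Y) u \<partial>lborel))"
        unfolding analytic_kernel_deformed[OF SU V] by (simp only: mult_minus_right distrib_left)
      also have "of_real \<sigma> * (of_real (1 / (2 * pi * sqrt (S * U))) * (\<integral>u\<in>{- ?V..?V}. saddle_exponential S U (\<sigma> * X) (\<sigma> * Y) u \<partial>lborel)) =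
          segment_integral (1 / real n, l, s, t, X, Y)"
        unfolding S_def U_def by (rule segment_integral_scaled[OF \<sigma> _ ns lp]) (use n(1) in simp)
      finally have A: "of_real \<sigma> * ?A = ?rem + segment_integral (1 / real n, l, s, t, X, Y)" .
      have "norm ?rem \<le> \<bar>C0\<bar> * real n powr (- 1 / 4)"
        unfolding S_def U_def
      proof (rule remainder_bound[OF \<sigma> _ n(3) pR(1,2)])
        show "1 \<le> real n" using n(1) by simp
        show "norm (contour_double ?V (\<sigma>\<^sup>2 * (real n + s)) (\<sigma>\<^sup>2 * (real n + t)) (\<sigma> * X) (\<sigma> * Y)) \<le> C0 * (\<sigma> * real n) * real n powr (- 1 / 4)"
          by (rule bound[OF \<sigma> l pR zeros saddle n(2)])
        show "norm (contour_double ?V (\<sigma>\<^sup>2 * (real n + s)) (\<sigma>\<^sup>2 * (real n + t)) (\<sigma> * (- X)) (\<sigma> * (- Y))) \<le> C0 * (\<sigma> * real n) * real n powr (- 1 / 4)"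
          by (rule bound[OF \<sigma> l pR(1,2) pR' zeros saddle n(2)])
      qed
      then have r: "norm ?rem < e / 2" using n(5) by simp
      have seg: "dist (segment_integral (1 / real n, l, s, t, X, Y)) (segment_integral (0, edge q, s, t, X, Y)) < e / 2"
        by (rule \<delta>0(2)) (use p p_eq n \<delta> l in \<open>auto simp: l0_def h0_def abs_le_iff\<close>)
      have "dist (of_real \<sigma> * ?A) (segment_integral (0, edge q, s, t, X, Y)) < e"
      proof -
        have "dist (?rem + z) w \<le> norm ?rem + dist z w" for z w
          using norm_triangle_ineq[of ?rem "z - w"] by (simp only: dist_norm add_diff_eq)
        from this[of "segment_integral (1 / real n, l, s, t, X, Y)" "segment_integral (0, edge q, s, t, X, Y)"]
        show ?thesis using r seg unfolding A by linarith
      qed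
      then show "dist (case p of (s, t, X, Y) \<Rightarrow> complex_of_real (space_scale a T) *
         analytic_kernel \<epsilon> a (scaled_time a T s, space_scale a T * X) (scaled_time a T t, space_scale a T * Y))
       (case p of (s, t, X, Y) \<Rightarrow> 1 / (2 * complex_of_real pi) *
         (\<integral>k\<in>{- edge q..edge q}. exp (complex_of_real (k\<^sup>2 * (t - s) / 2) + \<i> * complex_of_real (k * (Y - X))) \<partial>lborel)) < e"
        unfolding p_eq prod.case times \<sigma>_def[symmetric] segment_integral_edge[OF edge_pos] .
    qed
  qed
qed

end

section \<open>Limits of the full kernel and of the processes\<close>

lemma heat_kernel_scaled:
  assumes \<sigma>: "0 < \<sigma>" and \<tau>: "0 < \<tau>"
  shows "complex_of_real \<sigma> * heat_kernel (\<sigma>\<^sup>2 * \<tau>) (complex_of_real (\<sigma> * X)) (complex_of_real (\<sigma> * Y)) =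
    heat_kernel \<tau> (complex_of_real X) (complex_of_real Y)"
proof -
  have "sqrt (2 * pi * (\<sigma>\<^sup>2 * \<tau>)) = \<sigma> * sqrt (2 * pi * \<tau>)"
  proof -
    have "2 * pi * (\<sigma>\<^sup>2 * \<tau>) = \<sigma>\<^sup>2 * (2 * pi * \<tau>)" by simp
    then show ?thesis using \<sigma> by (simp only: real_sqrt_mult real_sqrt_abs abs_of_pos)
  qed
  then have pre: "\<sigma> * (1 / sqrt (2 * pi * (\<sigma>\<^sup>2 * \<tau>))) = 1 / sqrt (2 * pi * \<tau>)" using \<sigma> by simp
  have "- (complex_of_real (\<sigma> * X) - complex_of_real (\<sigma> * Y))\<^sup>2 = complex_of_real (\<sigma>\<^sup>2) * (- (complex_of_real X - complex_of_real Y)\<^sup>2)"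
    by (simp add: power2_eq_square algebra_simps)
  moreover have "complex_of_real (2 * (\<sigma>\<^sup>2 * \<tau>)) = complex_of_real (\<sigma>\<^sup>2) * complex_of_real (2 * \<tau>)" by simp
  moreover have "complex_of_real (\<sigma>\<^sup>2) \<noteq> 0" using \<sigma> by simp
  ultimately have expo: "- (complex_of_real (\<sigma> * X) - complex_of_real (\<sigma> * Y))\<^sup>2 / complex_of_real (2 * (\<sigma>\<^sup>2 * \<tau>)) =
      - (complex_of_real X - complex_of_real Y)\<^sup>2 / complex_of_real (2 * \<tau>)"
    by (simp only: mult_divide_mult_cancel_left_if if_False)
  show ?thesis unfolding heat_kernel_def expo pre[symmetric] of_real_mult[of \<sigma> "1 / sqrt (2 * pi * (\<sigma>\<^sup>2 * \<tau>))"] by (simp only: mult.assoc)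
qed

lemma norm_heat_kernel_le:
  assumes "0 < \<tau>"
  shows "norm (heat_kernel \<tau> (complex_of_real X) (complex_of_real Y)) \<le> 1 / sqrt (2 * pi * \<tau>)"
proof -
  have "norm (heat_kernel \<tau> (complex_of_real X) (complex_of_real Y)) = 1 / sqrt (2 * pi * \<tau>) * exp (- ((X - Y)\<^sup>2 / (2 * \<tau>)))"
  proof -
    have "- (complex_of_real X - complex_of_real Y)\<^sup>2 / complex_of_real (2 * \<tau>) = complex_of_real (- ((X - Y)\<^sup>2 / (2 * \<tau>)))" by simp
    then show ?thesis unfolding heat_kernel_def norm_mult norm_exp_eq_Re norm_of_real using assms by (simp only: Re_complex_of_real) simp
  qed
  also have "\<dots> \<le> 1 / sqrt (2 * pi * \<tau>) * 1" using assms by (intro mult_left_mono) auto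
  finally show ?thesis by simp
qed

context initial_configuration
begin

text \<open>The scaled times are ordered as \<open>s\<close> and \<open>t\<close> are, and Brownian
  scaling (\<open>heat_kernel_scaled\<close>) makes the heat kernel terms of the two kernels
  identical. Their difference is thus exactly the difference of the analytic parts, also near the
  discontinuity at \<open>s = t\<close>.\<close>

lemma xi_kernel_limit:
  assumes C: "compact C"
  shows "uniform_limit C
     (\<lambda>T (s, t, X, Y). complex_of_real (space_scale a T) *
       xi_kernel \<epsilon> a (scaled_time a T s, space_scale a T * X) (scaled_time a T t, space_scale a T * Y)
       - sine_kernel (sine_density q) (s, X) (t, Y)) (\<lambda>_. 0) at_top"
proof (rule uniform_limitI)
  fix e :: real assume e: "0 < e"
  have density: "pi * sine_density q = edge q" by (simp add: sine_density_def)
  show "\<forall>\<^sub>F T in at_top. \<forall>p\<in>C. dist (case p of (s, t, X, Y) \<Rightarrow> complex_of_real (space_scale a T) *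
       xi_kernel \<epsilon> a (scaled_time a T s, space_scale a T * X) (scaled_time a T t, space_scale a T * Y)
       - sine_kernel (sine_density q) (s, X) (t, Y)) 0 < e"
    using uniform_limitD[OF analytic_kernel_limit[OF C] e] eventually_scale
  proof eventually_elim
    case (elim T)
    define \<sigma> where "\<sigma> = space_scale a T"
    have \<sigma>: "0 < \<sigma>" using scale_facts(1)[OF elim(2)] by (simp add: \<sigma>_def)
    show ?case
    proof
      fix p assume p: "p \<in> C"
      obtain s t X Y where p_eq: "p = (s, t, X, Y)" by (cases p)
      have order: "scaled_time a T s > scaled_time a T t \<longleftrightarrow> s > t" using \<sigma> by (simp add: scaled_time_def \<sigma>_def[symmetric])
      have diff: "scaled_time a T s - scaled_time a T t = \<sigma>\<^sup>2 * (s - t)" by (simp add: scaled_time_def \<sigma>_def[symmetric] algebra_simps)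
      have "complex_of_real \<sigma> * (if s > t then heat_kernel (scaled_time a T s - scaled_time a T t) (complex_of_real (\<sigma> * X)) (complex_of_real (\<sigma> * Y)) else 0) =
          (if s > t then heat_kernel (s - t) (complex_of_real X) (complex_of_real Y) else 0)"
        unfolding diff using heat_kernel_scaled[OF \<sigma>, of "s - t" X Y] by simp
      then have "complex_of_real \<sigma> * xi_kernel \<epsilon> a (scaled_time a T s, \<sigma> * X) (scaled_time a T t, \<sigma> * Y) - sine_kernel (sine_density q) (s, X) (t, Y) =
          complex_of_real \<sigma> * analytic_kernel \<epsilon> a (scaled_time a T s, \<sigma> * X) (scaled_time a T t, \<sigma> * Y) - 1 / (2 * complex_of_real pi) *
          (\<integral>k\<in>{- edge q..edge q}. exp (complex_of_real (k\<^sup>2 * (t - s) / 2) + \<i> * complex_of_real (k * (Y - X))) \<partial>lborel)"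
        unfolding xi_kernel_def sine_kernel_def prod.case density order right_diff_distrib by simp
      then show "dist (case p of (s, t, X, Y) \<Rightarrow> complex_of_real (space_scale a T) *
         xi_kernel \<epsilon> a (scaled_time a T s, space_scale a T * X) (scaled_time a T t, space_scale a T * Y)
         - sine_kernel (sine_density q) (s, X) (t, Y)) 0 < e"
        using bspec[OF elim(1) p] unfolding p_eq prod.case \<sigma>_def[symmetric] by (simp only: dist_norm diff_0_right)
    qed
  qed
qed

text \<open>The analytic part is continuous on a compact set. The heat kernel is bounded because a
  finite set of times keeps the positive differences away from 0.\<close>

lemma sine_kernel_bounded:
  assumes I: "finite I" and C: "compact C"
  shows "\<exists>B. \<forall>s\<in>I. \<forall>t\<in>I. \<forall>X\<in>C. \<forall>Y\<in>C. norm (sine_kernel (sine_density q) (s, X) (t, Y)) \<le> B"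
proof -
  have density: "pi * sine_density q = edge q" by (simp add: sine_density_def)
  let ?K = "{0 :: real} \<times> {edge q} \<times> I \<times> I \<times> C \<times> C"
  have "continuous_on ?K segment_integral" by (rule continuous_on_subset[OF segment_integral_continuous]) auto
  then have "bounded (segment_integral ` ?K)"
    by (intro compact_imp_bounded compact_continuous_image compact_Times finite_imp_compact I C) auto
  then obtain B where "\<forall>z\<in>segment_integral ` ?K. norm z \<le> B" unfolding bounded_iff by blast
  then have B: "norm (segment_integral p) \<le> B" if "p \<in> ?K" for p using that by blast
  \<comment> \<open>A sum over all pairs of times dominates each single bound; a pair of equal times
    contributes 0, as division by 0 is 0.\<close>
  define D where "D = (\<Sum>p\<in>I \<times> I. \<bar>1 / sqrt (2 * pi * (fst p - snd p))\<bar>)"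
  have D: "0 \<le> D" by (simp add: D_def sum_nonneg)
  have "norm (sine_kernel (sine_density q) (s, X) (t, Y)) \<le> B + D" if "s \<in> I" "t \<in> I" "X \<in> C" "Y \<in> C" for s t X Y
  proof -
    have "norm (if s > t then heat_kernel (s - t) (complex_of_real X) (complex_of_real Y) else 0) \<le> D"
    proof (cases "s > t")
      case True
      then have "norm (heat_kernel (s - t) (complex_of_real X) (complex_of_real Y)) \<le> 1 / sqrt (2 * pi * (s - t))"
        by (intro norm_heat_kernel_le) simp
      also have "\<dots> \<le> \<bar>1 / sqrt (2 * pi * (fst (s, t) - snd (s, t)))\<bar>" unfolding fst_conv snd_conv by (rule abs_ge_self)
      also have "\<dots> \<le> D" unfolding D_def by (rule member_le_sum) (use that I in auto)
      finally show ?thesis using True by simp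
    qed (use D in simp)
    moreover have "norm (segment_integral (0, edge q, s, t, X, Y)) \<le> B" using that by (intro B) auto
    moreover have "norm (sine_kernel (sine_density q) (s, X) (t, Y)) \<le> norm (segment_integral (0, edge q, s, t, X, Y)) +
        norm (if s > t then heat_kernel (s - t) (complex_of_real X) (complex_of_real Y) else 0)"
      unfolding sine_kernel_def prod.case density segment_integral_edge[OF edge_pos] by (rule norm_triangle_ineq4)
    ultimately show ?thesis by linarith
  qed
  then show ?thesis by blast
qed

text \<open>\<open>xi_kernel_limit\<close> on one-point sets gives pointwise convergence of the
  kernels, and on products of a finite set of times with a window it gives boundedness, by
  comparison with the sine kernel.\<close>

lemma rescaled_process_converges:
  assumes det: "determinantal_process M {0<..} \<Xi> (xi_kernel \<epsilon> a)"
    and det': "determinantal_process M' UNIV Z (sine_kernel (sine_density q))"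
  shows "fdd_converges at_top M (\<lambda>T \<tau> \<omega>. distr (\<Xi> (scaled_time a T \<tau>) \<omega>) borel (\<lambda>x. x / space_scale a T)) M' Z"
proof (rule determinantal_process_fdd_converges[OF det det'])
  fix T assume "0 < space_scale a T"
  then show "inj (scaled_time a T)" by (auto simp: inj_def scaled_time_def)
next
  fix t :: real
  \<comment> \<open>The scaled time equals \<open>\<sigma>^2 * (n + t)\<close>, which is positive
    once \<open>n\<close> exceeds \<open>|t|\<close>.\<close>
  have "\<forall>\<^sub>F n in sequentially. nat \<lceil>\<bar>t\<bar>\<rceil> < n" by (rule eventually_gt_at_top)
  then have "\<forall>\<^sub>F T in at_top. nat \<lceil>\<bar>t\<bar>\<rceil> < scale_index a T" by (rule eventually_compose_filterlim[OF _ filterlim_scale_index])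
  then show "\<forall>\<^sub>F T in at_top. scaled_time a T t \<in> {0<..}" using eventually_scale
  proof eventually_elim
    case (elim T)
    have "0 < real (scale_index a T) + t" using elim(1) by linarith
    then have "0 < (space_scale a T)\<^sup>2 * (real (scale_index a T) + t)" using scale_facts(1)[OF elim(2)] by simp
    then show ?case using scale_facts(2)[OF elim(2)] by (simp add: scaled_time_def distrib_left)
  qed
next
  show "\<forall>\<^sub>F T in at_top. 0 < space_scale a T" using eventually_scale by eventually_elim (rule scale_facts(1))
next
  fix x y :: "real \<times> real"
  have "compact {(fst x, fst y, snd x, snd y)}" by simp
  from tendsto_uniform_limitI[OF xi_kernel_limit[OF this] singletonI]
  have "((\<lambda>T. complex_of_real (space_scale a T) * xi_kernel \<epsilon> a (scaled_time a T (fst x), space_scale a T * snd x) (scaled_time a T (fst y), space_scale a T * snd y) -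
      sine_kernel (sine_density q) x y) \<longlongrightarrow> 0) at_top" by simp
  then show "((\<lambda>T. complex_of_real (space_scale a T) * xi_kernel \<epsilon> a (scaled_time a T (fst x), space_scale a T * snd x) (scaled_time a T (fst y), space_scale a T * snd y))
      \<longlongrightarrow> sine_kernel (sine_density q) x y) at_top" by (rule LIM_zero_cancel)
next
  fix I :: "real set" and m :: nat
  assume I: "finite I"
  have one: "0 < (1 :: real)" by simp
  let ?m = "{- real m..real m}"
  obtain B where B: "\<And>s t X Y. s \<in> I \<Longrightarrow> t \<in> I \<Longrightarrow> X \<in> ?m \<Longrightarrow> Y \<in> ?m \<Longrightarrow> norm (sine_kernel (sine_density q) (s, X) (t, Y)) \<le> B"
    using sine_kernel_bounded[OF I compact_Icc] by meson
  have "compact (I \<times> I \<times> ?m \<times> ?m)" by (intro compact_Times finite_imp_compact I compact_Icc)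
  from uniform_limitD[OF xi_kernel_limit[OF this] one]
  have "\<forall>\<^sub>F T in at_top. \<forall>x\<in>I \<times> ?m. \<forall>y\<in>I \<times> ?m. norm (complex_of_real (space_scale a T) *
      xi_kernel \<epsilon> a (scaled_time a T (fst x), space_scale a T * snd x) (scaled_time a T (fst y), space_scale a T * snd y)) \<le> 1 + B"
  proof eventually_elim
    case (elim T)
    show ?case
    proof (intro ballI)
      fix x y assume x: "x \<in> I \<times> ?m" and y: "y \<in> I \<times> ?m"
      let ?k = "complex_of_real (space_scale a T) * xi_kernel \<epsilon> a (scaled_time a T (fst x), space_scale a T * snd x) (scaled_time a T (fst y), space_scale a T * snd y)"
      let ?s = "sine_kernel (sine_density q) (fst x, snd x) (fst y, snd y)"
      have "(fst x, fst y, snd x, snd y) \<in> I \<times> I \<times> ?m \<times> ?m" using x y by (auto simp: mem_Times_iff)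
      from bspec[OF elim this] have "norm (?k - ?s) < 1" unfolding prod.case dist_norm diff_0_right .
      moreover have "norm ?s \<le> B" by (rule B) (use x y in \<open>auto simp: mem_Times_iff\<close>)
      ultimately show "norm ?k \<le> 1 + B" using norm_triangle_sub[of ?k ?s] by linarith
    qed
  qed
  then show "\<exists>C. \<forall>\<^sub>F T in at_top. \<forall>x\<in>I \<times> ?m. \<forall>y\<in>I \<times> ?m. norm (complex_of_real (space_scale a T) *
      xi_kernel \<epsilon> a (scaled_time a T (fst x), space_scale a T * snd x) (scaled_time a T (fst y), space_scale a T * snd y)) \<le> C"
    by blast
qed

end

theorem theorem7p1:
  fixes \<epsilon> :: nat and a :: "nat \<Rightarrow> real" and c q :: real
  assumes "\<epsilon> \<in> {0, 1}"
    and "0 < a 1"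
    and "\<And>j. 1 \<le> j \<Longrightarrow> a j < a (Suc j)"
    and "0 < c" and "0 < q" and "q < 2"
    and "a \<sim>[sequentially] (\<lambda>j. (real j / c) powr (1 / q))"
  shows
    "(\<forall>C. compact C \<longrightarrow>
        uniform_limit C
          (\<lambda>T (s, t, X, Y). complex_of_real (space_scale a T) *
             analytic_kernel \<epsilon> a (scaled_time a T s, space_scale a T * X) (scaled_time a T t, space_scale a T * Y))
          (\<lambda>(s, t, X, Y). 1 / (2 * complex_of_real pi) *
             (\<integral>k\<in>{- edge q..edge q}.
                exp (complex_of_real (k\<^sup>2 * (t - s) / 2) + \<i> * complex_of_real (k * (Y - X))) \<partial>lborel))
          at_top)
     \<and> (\<forall>C. compact C \<longrightarrow>
        uniform_limit C
          (\<lambda>T (s, t, X, Y). complex_of_real (space_scale a T) *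
             xi_kernel \<epsilon> a (scaled_time a T s, space_scale a T * X) (scaled_time a T t, space_scale a T * Y)
             - sine_kernel (sine_density q) (s, X) (t, Y))
          (\<lambda>_. 0)
          at_top)
     \<and> (\<forall>(M :: 'w measure) \<Xi> (M' :: 'v measure) Z.
        determinantal_process M {0<..} \<Xi> (xi_kernel \<epsilon> a) \<and>
        determinantal_process M' UNIV Z (sine_kernel (sine_density q)) \<longrightarrow>
        fdd_converges at_top M
          (\<lambda>T \<tau> \<omega>. distr (\<Xi> (scaled_time a T \<tau>) \<omega>) borel (\<lambda>x. x / space_scale a T)) M' Z)"
proof -
  interpret initial_configuration a c q \<epsilon>
    using assms by unfold_locales auto
  show ?thesis
    by (intro conjI allI impI; (rule analytic_kernel_limit | rule xi_kernel_limit | rule rescaled_process_converges);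
        (assumption | erule conjunct1 | erule conjunct2))
qed

end
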